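(* Let $n\ge 2$, $1\le k\le n-1$, let $S\subset\mathbb{R}^n$ be a smooth $k$-dimensional surface, and let $\mu$ be a smooth, compactly supported multiple of the induced surface measure on $S$. For $\theta\in SO(n)$ let $\mu_\theta$ be the rotated measure. Then there is a constant $c<\infty$, depending only on $n,k,\mu$, such that for all $f\in L^{\frac{2n-k}{n}}(\mathbb{R}^n)$ $$\Bigl(\int_{SO(n)}\int_{\mathbb{R}^n} |f*\mu_\theta (x)|^{\frac{2n-k}{n-k}}\, dx\, d\theta\Bigr)^{\frac{n-k}{2n-k}}\le c\,\Bigl(\int_{\mathbb{R}^n} |f(y)|^{\frac{2n-k}{n}}\, dy\Bigr)^{\frac{n}{2n-k}}.$$
   Context: For $\theta\in SO(n)$ and a measure $\mu$ on $\mathbb{R}^n$, the measure $\mu_\theta$ is defined by $\langle f,\mu_\theta\rangle=\langle f(\theta^{-1}\,\cdot\,),\mu\rangle$, so that $\widehat{\mu_\theta}(\xi)=\widehat{\mu}(\theta\xi)$. Here $d\theta$ is Haar measure on $SO(n)$ and $f*\mu_\theta$ is convolution on $\mathbb{R}^n$. *)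

theory Defs
  imports "HOL-Analysis.Analysis"
begin

text \<open>Differentiability classes on open sets (\<open>C\<^sup>m\<close> and \<open>C\<^sup>\<infinity>\<close>); a derivative of order \<open>m\<close> is
  an \<open>m\<close>-fold iterated directional derivative.\<close>

primrec Cm_on :: "nat \<Rightarrow> ('a::euclidean_space \<Rightarrow> 'b::real_normed_vector) \<Rightarrow> 'a set \<Rightarrow> bool" where
  "Cm_on 0 f U \<longleftrightarrow> continuous_on U f"
| "Cm_on (Suc m) f U \<longleftrightarrow> (\<forall>x\<in>U. f differentiable at x) \<and>
     (\<forall>v. Cm_on m (\<lambda>x. frechet_derivative f (at x) v) U)"

definition smooth_on :: "('a::euclidean_space \<Rightarrow> 'b::real_normed_vector) \<Rightarrow> 'a set \<Rightarrow> bool" where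
  "smooth_on f U \<longleftrightarrow> (\<forall>m. Cm_on m f U)"

text \<open>Smooth surfaces are embedded \<open>C\<^sup>\<infinity>\<close> submanifolds without boundary, not necessarily closed in
  the ambient space. The dimension is the cardinality of the index type \<open>'k\<close>.\<close>

definition local_param ::
  "(real^'n::finite) set \<Rightarrow> (real^'k::finite) set \<Rightarrow> (real^'k \<Rightarrow> real^'n) \<Rightarrow> bool" where
  "local_param S U \<phi> \<longleftrightarrow>
     open U \<and> smooth_on \<phi> U \<and> (\<forall>u\<in>U. inj (frechet_derivative \<phi> (at u))) \<and>
     openin (top_of_set S) (\<phi> ` U) \<and> (\<exists>g. homeomorphism U (\<phi> ` U) \<phi> g)"

definition smooth_surface :: "'k::finite itself \<Rightarrow> (real^'n::finite) set \<Rightarrow> bool" where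
  "smooth_surface _ S \<longleftrightarrow>
     (\<forall>p\<in>S. \<exists>U (\<phi> :: real^'k \<Rightarrow> real^'n). local_param S U \<phi> \<and> p \<in> \<phi> ` U)"

text \<open>The area element \<open>sqrt (det (D\<phi>\<^sup>T D\<phi>))\<close> of a parametrization, i.e. the Riemannian volume
  density of the metric induced from the Euclidean ambient space.\<close>

definition area_element :: "(real^'k::finite \<Rightarrow> real^'n::finite) \<Rightarrow> real^'k \<Rightarrow> real" where
  "area_element \<phi> u =
     (let D = jacobian \<phi> (at u) in sqrt (det (transpose D ** D)))"

text \<open>Since \<open>S\<close> is covered by countably many parametrized patches, the following conditions
  determine \<open>\<sigma>\<close> uniquely.\<close>

definition induced_surface_measure ::
  "'k::finite itself \<Rightarrow> (real^'n::finite) set \<Rightarrow> (real^'n) measure \<Rightarrow> bool" where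
  "induced_surface_measure _ S \<sigma> \<longleftrightarrow>
     sets \<sigma> = sets borel \<and> emeasure \<sigma> (- S) = 0 \<and>
     (\<forall>U (\<phi> :: real^'k \<Rightarrow> real^'n). local_param S U \<phi> \<longrightarrow>
        (\<forall>A\<in>sets borel. A \<subseteq> \<phi> ` U \<longrightarrow>
           emeasure \<sigma> A = (\<integral>\<^sup>+u\<in>{u\<in>U. \<phi> u \<in> A}. ennreal (area_element \<phi> u) \<partial>lborel)))"

text \<open>\<open>C\<^sup>\<infinity>\<close> functions on \<open>S\<close> whose support is a compact subset of \<open>S\<close>, extended by zero
  to the ambient space. When \<open>S\<close> is not closed it matters that the support does not reach the
  relative boundary of \<open>S\<close>, where the surface measure may be infinite.\<close>

definition smooth_density ::
  "'k::finite itself \<Rightarrow> (real^'n::finite) set \<Rightarrow> (real^'n \<Rightarrow> complex) \<Rightarrow> bool" where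
  "smooth_density _ S \<psi> \<longleftrightarrow>
     (\<forall>U (\<phi> :: real^'k \<Rightarrow> real^'n). local_param S U \<phi> \<longrightarrow> smooth_on (\<psi> \<circ> \<phi>) U) \<and>
     (\<exists>K. compact K \<and> K \<subseteq> S \<and> (\<forall>x. x \<notin> K \<longrightarrow> \<psi> x = 0))"

text \<open>A complex measure \<open>\<mu>\<close> is represented by its pairing \<open>f \<mapsto> \<langle>f, \<mu>\<rangle>\<close>.\<close>

type_synonym 'n cmeasure = "(real^'n \<Rightarrow> complex) \<Rightarrow> complex"

definition weighted_measure ::
  "(real^'n::finite) measure \<Rightarrow> (real^'n \<Rightarrow> complex) \<Rightarrow> 'n cmeasure" where
  "weighted_measure \<sigma> \<psi> = (\<lambda>f. LINT y|\<sigma>. f y * \<psi> y)"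

definition rotated_measure :: "real^'n^'n::finite \<Rightarrow> 'n cmeasure \<Rightarrow> 'n cmeasure" where
  "rotated_measure \<theta> \<mu> = (\<lambda>f. \<mu> (\<lambda>y. f (matrix_inv \<theta> *v y)))"

text \<open>At points \<open>x\<close> where the defining integral diverges the value is 0. For Borel \<open>f\<close> in
  \<open>L\<^sup>p\<close> and a finite \<open>\<mu>\<close> those points form a Lebesgue null set.\<close>

definition convolve :: "(real^'n \<Rightarrow> complex) \<Rightarrow> 'n::finite cmeasure \<Rightarrow> real^'n \<Rightarrow> complex" where
  "convolve f \<mu> x = \<mu> (\<lambda>y. f (x - y))"

definition SO :: "(real^'n^'n::finite) set" where
  "SO = {\<theta>. rotation_matrix \<theta>}"

text \<open>Normalized Haar measure. Right invariance and regularity are automatic for a left invariant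
  Borel probability measure on a compact metrizable group.\<close>

definition haar_SO :: "(real^'n^'n::finite) measure \<Rightarrow> bool" where
  "haar_SO H \<longleftrightarrow>
     sets H = sets (restrict_space borel SO) \<and> emeasure H SO = 1 \<and>
     (\<forall>\<theta>\<in>SO. \<forall>B\<in>sets H. emeasure H ((\<lambda>\<eta>. \<theta> ** \<eta>) ` B) = emeasure H B)"

end

theory Submission
 imports Defs "HOL-Computational_Algebra.Polynomial"
begin

text \<open>Write \<open>n\<close> for the dimension of the space, \<open>k\<close> for that of the surface, \<open>T f (\<theta>, x)\<close> for the
 convolution of \<open>f\<close> with the rotated measure, \<open>p = (2 n - k) / n\<close> and \<open>q\<close> for the dual exponent of \<open>p\<close>.
 The bound \<open>L\<^sup>p \<rightarrow> L\<^sup>q\<close> is an interpolation between two facts about \<open>T\<close>, at each scale \<open>\<surd>t\<close>. The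
 first is size: the heat kernel at time \<open>t\<close>, averaged over a \<open>k\<close>-dimensional measure, is
 \<open>O(t\<^sup>-\<^sup>\<alpha>)\<close> with \<open>\<alpha> = (n - k) / 2\<close>; this maps \<open>L\<^sup>1\<close> to \<open>L\<^sup>\<infinity>\<close>. The second is smoothing in \<open>L\<^sup>2\<close>: a surface may
 be flat, so that its Fourier transform fails to decay in some directions, but the mean
 square over all rotations decays like the power \<open>-k\<close> of the frequency. Hence \<open>T\<close> gains \<open>k / 2\<close>
 derivatives on average, a factor \<open>t\<^sup>\<beta>\<close> with \<open>\<beta> = k / 4\<close>. Interpolation gives
 \<open>p = 1 + \<alpha> / (\<alpha> + 2 \<beta>)\<close>, which is the exponent above.

 The heat semigroup replaces the Fourier transform. With \<open>X = exp (t \<Delta>)\<close>, polynomials in \<open>X\<close>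
 that vanish to high order at \<open>X = 1\<close> serve as frequency cutoffs; they turn into finite
 differences in time (\<open>plin_fdiff\<close>), and two of the zeros are used for square functions that
 telescope along dyadic times because the energy decreases (\<open>square_fun_sum_le\<close>). These
 square functions make the pieces at different scales orthogonal, and \<open>discrete_interpolation\<close>
 uses this to sum the pieces, tested on dyadic level sets, without any loss at the endpoint:
 the result is \<open>level_inequality\<close>, and from it the strong type inequality \<open>strong_type\<close>. Up to
 this point only the two hypotheses of the locale \<open>smoothing_averaging\<close> are used.

 Size is a bi-Lipschitz comparison with a Gaussian integral in \<open>k\<close> variables (\<open>patch_size\<close>). For
 smoothing, \<open>T\<^sup>* T\<close> is convolution with the heat kernel averaged over all differences
 \<open>\<theta>\<^sup>T (\<phi> u' - \<phi> u)\<close> of points of the rotated surface, and its high finite differences in time must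
 have an \<open>L\<^sup>1\<close> norm of order \<open>t\<close> to the power \<open>k / 2\<close>. The average over \<open>\<theta>\<close> is a function of the distance
 \<open>\<rho> = \<parallel>\<phi> u' - \<phi> u\<parallel>\<close> and of time that solves the heat equation in polar coordinates
 (\<open>rotheat_equation\<close>), so a time derivative is \<open>\<rho>\<^sup>-\<^sup>2\<close> times derivatives \<open>\<rho> \<partial>\<^sub>\<rho>\<close>. Along each ray
 \<open>w = u' - u\<close> the distance grows at a rate comparable to its size, so \<open>\<rho> \<partial>\<^sub>\<rho>\<close> can be integrated by parts
 onto the density (\<open>pairing_by_parts\<close>); the coefficients that arise are smooth along rays,
 uniformly, though not at \<open>w = 0\<close>. Repeating this trades each time derivative for a factor
 \<open>\<parallel>w\<parallel>\<^sup>-\<^sup>2\<close> (\<open>cancellation_pointwise\<close>). The region \<open>\<parallel>w\<parallel> < \<surd>t\<close>, where nothing is gained, has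
 measure of order \<open>t\<close> to the power \<open>k / 2\<close>, and this is the required bound (\<open>patch_cancellation\<close>).

 Finally the support of the density is compact, so that finitely many coordinate patches
 cover it, and \<open>convolution_bound\<close> adds their contributions.\<close>

abbreviation (input) mass :: "('a::euclidean_space => real) => ennreal" where
 "mass f \<equiv> \<integral>\<^sup>+x. ennreal \<bar>f x\<bar> \<partial>lborel"

abbreviation (input) Borel :: "('a::topological_space => 'b::topological_space) => bool" where
 "Borel f \<equiv> f \<in> borel_measurable borel"

abbreviation (input) leb :: "'t measure => ('t \<times> 'a::euclidean_space) measure" where
 "leb H \<equiv> H \<Otimes>\<^sub>M lborel"

section \<open>Lebesgue measure under affine maps\<close>

lemma nn_integral_lborel_affine:
 fixes f :: "'a::euclidean_space => ennreal"
 assumes [measurable]: "Borel f" and c: "c \<noteq> 0"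
 shows "(\<integral>\<^sup>+x. f x \<partial>lborel) = ennreal (\<bar>c\<bar> ^ DIM('a)) * (\<integral>\<^sup>+x. f (t + c *\<^sub>R x) \<partial>lborel)"
 by (subst lborel_affine[OF c, of t])
   (simp add: nn_integral_density nn_integral_distr nn_integral_cmult)

lemma nn_integral_lborel_translate:
 fixes f :: "'a::euclidean_space => ennreal"
 assumes [measurable]: "Borel f"
 shows "(\<integral>\<^sup>+x. f (t + x) \<partial>lborel) = (\<integral>\<^sup>+x. f x \<partial>lborel)"
 using nn_integral_lborel_affine[OF assms, of 1 t] by simp

lemma nn_integral_lborel_translate_minus:
 fixes f :: "'a::euclidean_space => ennreal"
 assumes [measurable]: "Borel f"
 shows "(\<integral>\<^sup>+x. f (x - t) \<partial>lborel) = (\<integral>\<^sup>+x. f x \<partial>lborel)"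
 using nn_integral_lborel_translate[OF assms, of "- t"] by simp

lemma nn_integral_lborel_reflect:
 fixes f :: "'a::euclidean_space => ennreal"
 assumes [measurable]: "Borel f"
 shows "(\<integral>\<^sup>+x. f (t - x) \<partial>lborel) = (\<integral>\<^sup>+x. f x \<partial>lborel)"
 using nn_integral_lborel_affine[OF assms, of "-1" t] by simp

lemma integral_lborel_affine:
 fixes f :: "'a::euclidean_space => real"
 assumes [measurable]: "Borel f" and c: "c \<noteq> 0"
 shows "(LBINT x. f x) = \<bar>c\<bar> ^ DIM('a) * (LBINT x. f (t + c *\<^sub>R x))"
 by (subst lborel_affine[OF c, of t])
   (simp add: integral_density integral_distr)

lemma integrable_lborel_affine:
 fixes f :: "'a::euclidean_space => real"
 assumes [measurable]: "integrable lborel f" and c: "c \<noteq> 0"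
 shows "integrable lborel (%x. f (t + c *\<^sub>R x))"
proof -
 have [measurable]: "Borel f" using assms(1) by auto
 have fin: "(\<integral>\<^sup>+x. ennreal (norm (f x)) \<partial>lborel) < \<infinity>"
  using assms(1) by (simp add: integrable_iff_bounded)
 then have "(\<integral>\<^sup>+x. ennreal (norm (f (t + c *\<^sub>R x))) \<partial>lborel) < \<infinity>"
  by (subst (asm) nn_integral_lborel_affine[OF _ c, of _ t])
    (auto simp: ennreal_mult_less_top c)
 then show ?thesis
  by (intro integrableI_bounded) auto
qed

lemma integral_lborel_translate_minus:
 fixes f :: "'a::euclidean_space => real"
 assumes [measurable]: "Borel f"
 shows "(LBINT x. f (x - t)) = (LBINT x. f x)"
 using integral_lborel_affine[OF assms, of 1 "-t"] by simp

lemma integral_lborel_reflect: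
 fixes f :: "'a::euclidean_space => real"
 assumes [measurable]: "Borel f"
 shows "(LBINT x. f (t - x)) = (LBINT x. f x)"
 using integral_lborel_affine[OF assms, of "-1" t] by simp



text \<open>Summation over dyadic shells: the shell of radius \<open>2\<^sup>j\<close> has volume comparable to
 \<open>2\<^sup>j\<close> to the power of the dimension.\<close>

lemma nn_integral_inverse_power_finite:
 assumes q: "q > DIM('a::euclidean_space)"
 shows "(\<integral>\<^sup>+(x::'a). ennreal (1 / (1 + norm x ^ q)) \<partial>lborel) < \<infinity>"
proof -
 let ?n = "DIM('a)"
 let ?g = "%(j::nat) (x::'a). ennreal (2 ^ q * (1 / 2 ^ q) ^ j) * indicator (cball 0 (2 ^ j)) x"
 have le: "ennreal (1 / (1 + norm x ^ q)) \<le> (\<Sum>j. ?g j x)" for x :: 'a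
 proof -
  obtain j0 where j0: "norm x < 2 ^ j0"
   using real_arch_pow[of 2 "norm x"] by auto
  define j where "j = (LEAST j. norm x \<le> 2 ^ j)"
  have j: "norm x \<le> 2 ^ j"
   unfolding j_def by (rule LeastI[of _ j0]) (use j0 in simp)
  have "1 / (1 + norm x ^ q) \<le> 2 ^ q * (1 / 2 ^ q) ^ j"
  proof (cases j)
   case 0
   have "1 / (1 + norm x ^ q) \<le> 1"
    by (subst divide_le_eq_1) (auto intro: add_pos_nonneg)
   also have "... \<le> 2 ^ q" by simp
   finally show ?thesis using 0 by simp
  next
   case (Suc i)
   have "\<not> norm x \<le> 2 ^ i"
    using not_less_Least[of i "%j. norm x \<le> 2 ^ j"] Suc j_def by simp
   then have "(2 ^ i) ^ q \<le> norm x ^ q" by (intro power_mono) auto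
   then have "1 / (1 + norm x ^ q) \<le> 1 / (2 ^ i) ^ q"
    by (intro divide_left_mono) (auto intro!: mult_pos_pos add_pos_nonneg)
   also have "... = 2 ^ q * (1 / 2 ^ q) ^ j"
    using Suc by (simp add: power_divide power_mult[symmetric] mult.commute)
   finally show ?thesis .
  qed
  then have "ennreal (1 / (1 + norm x ^ q)) \<le> ?g j x"
   using j by (simp add: ennreal_leI)
  also have "... = (\<Sum>i\<in>{j}. ?g i x)"
  proof -
   have "sum h {j} = h j" for h :: "nat => ennreal" by simp
   from this[of "%i. ?g i x"] show ?thesis by (rule sym)
  qed
  also have "... \<le> (\<Sum>j. ?g j x)"
   by (intro sum_le_suminf) auto
  finally show ?thesis .
 qed
 have "(\<integral>\<^sup>+(x::'a). ennreal (1 / (1 + norm x ^ q)) \<partial>lborel) \<le> (\<integral>\<^sup>+x. (\<Sum>j. ?g j x) \<partial>lborel)"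
  by (intro nn_integral_mono le)
 also have "... = (\<Sum>j. \<integral>\<^sup>+x. ?g j x \<partial>lborel)"
  by (intro nn_integral_suminf borel_measurable_times_ennreal borel_measurable_const borel_measurable_indicator) auto
 also have "... = (\<Sum>j. ennreal (2 ^ q * unit_ball_vol ?n * (2 ^ ?n / 2 ^ q) ^ j))"
 proof (intro suminf_cong)
  fix j
  have "(\<integral>\<^sup>+x. ?g j x \<partial>lborel) = ennreal (2 ^ q * (1 / 2 ^ q) ^ j) * emeasure lborel (cball (0::'a) (2 ^ j))"
   by (subst nn_integral_cmult_indicator) auto
  also have "... = ennreal (2 ^ q * unit_ball_vol ?n * (2 ^ ?n / 2 ^ q) ^ j)"
   by (subst emeasure_cball)
     (auto simp: ennreal_mult''[symmetric] power_divide power_mult[symmetric] mult.commute mult_ac)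
  finally show "(\<integral>\<^sup>+x. ?g j x \<partial>lborel) = ennreal (2 ^ q * unit_ball_vol ?n * (2 ^ ?n / 2 ^ q) ^ j)" .
 qed
 also have "... < \<infinity>"
 proof -
  have r: "(2::real) ^ ?n / 2 ^ q < 1"
   using q by simp
  have "summable (%j. 2 ^ q * unit_ball_vol ?n * (2 ^ ?n / 2 ^ q) ^ j)"
   using r by (intro summable_mult summable_geometric) auto
  then show ?thesis
   by (subst suminf_ennreal2) auto
 qed
 finally show ?thesis .
qed

lemma nn_integral_scaled_inverse_power:
 fixes M :: nat and t :: real
 assumes M: "2 * M > DIM('a::euclidean_space)" and t: "t > 0"
 shows "(\<integral>\<^sup>+(x::'a). ennreal (t ^ M / (norm x ^ (2 * M) + t ^ M)) \<partial>lborel)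
  = ennreal (t powr (DIM('a) / 2)) * (\<integral>\<^sup>+(x::'a). ennreal (1 / (1 + norm x ^ (2 * M))) \<partial>lborel)"
proof -
 have st: "sqrt t > 0" using t by simp
 have "(\<integral>\<^sup>+(x::'a). ennreal (t ^ M / (norm x ^ (2 * M) + t ^ M)) \<partial>lborel) =
   ennreal (\<bar>sqrt t\<bar> ^ DIM('a)) * (\<integral>\<^sup>+(x::'a). ennreal (t ^ M / (norm (0 + sqrt t *\<^sub>R x) ^ (2 * M) + t ^ M)) \<partial>lborel)"
  using st by (intro nn_integral_lborel_affine) auto
 also have "\<bar>sqrt t\<bar> ^ DIM('a) = t powr (DIM('a) / 2)"
  using t by (simp add: powr_half_sqrt[symmetric] powr_power)
 also have "(%x::'a. t ^ M / (norm (0 + sqrt t *\<^sub>R x) ^ (2 * M) + t ^ M)) = (%x. 1 / (1 + norm x ^ (2 * M)))"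
 proof
  fix x :: 'a
  have "norm (0 + sqrt t *\<^sub>R x) ^ (2 * M) = t ^ M * norm x ^ (2 * M)"
   using t by (simp add: power_mult_distrib power_mult)
  then have eq: "norm (0 + sqrt t *\<^sub>R x) ^ (2 * M) + t ^ M = t ^ M * (1 + norm x ^ (2 * M))"
   by (simp add: algebra_simps)
  show "t ^ M / (norm (0 + sqrt t *\<^sub>R x) ^ (2 * M) + t ^ M) = 1 / (1 + norm x ^ (2 * M))"
   unfolding eq using t by simp
 qed
 finally show ?thesis .
qed

section \<open>Heat kernels\<close>

lemma exp_minus_le_inverse_power:
 fixes x :: real
 assumes "x \<ge> 0"
 shows "exp (- x) \<le> (fact M + 1) / (1 + x ^ M)"
proof -
 have "(\<Sum>i\<in>{M}. x ^ i /\<^sub>R fact i) \<le> exp x"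
  unfolding exp_def using assms
  by (intro sum_le_suminf summable_exp_generic) auto
 then have "x ^ M \<le> fact M * exp x"
  by (simp add: field_simps)
 moreover have "1 \<le> exp x" using assms by simp
 ultimately have "1 + x ^ M \<le> (fact M + 1) * exp x"
  unfolding distrib_right by linarith
 moreover have "1 + x ^ M > 0" using assms by (simp add: add_pos_nonneg)
 ultimately show ?thesis
  by (simp add: exp_minus field_simps)
qed

lemma gaussian_integrable:
 "integrable lborel (%x::'a::euclidean_space. exp (- (norm x)\<^sup>2 / 4))"
proof (rule integrableI_bounded)
 show "(%x::'a. exp (- (norm x)\<^sup>2 / 4)) \<in> borel_measurable lborel" by simp
 let ?M = "DIM('a) + 1"
 have "(\<integral>\<^sup>+(x::'a). ennreal (norm (exp (- (norm x)\<^sup>2 / 4))) \<partial>lborel)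
   \<le> (\<integral>\<^sup>+(x::'a). ennreal ((fact ?M + 1) * 4 ^ ?M) * ennreal (1 / (1 + norm x ^ (2 * ?M))) \<partial>lborel)"
 proof (intro nn_integral_mono)
  fix x :: 'a
  have "exp (- (norm x)\<^sup>2 / 4) \<le> (fact ?M + 1) / (1 + ((norm x)\<^sup>2 / 4) ^ ?M)"
   using exp_minus_le_inverse_power[of "(norm x)\<^sup>2 / 4" ?M] by simp
  also have "... \<le> (fact ?M + 1) / ((1 + norm x ^ (2 * ?M)) / 4 ^ ?M)"
  proof (intro divide_left_mono)
   have "(1 + norm x ^ (2 * ?M)) / 4 ^ ?M = 1 / 4 ^ ?M + ((norm x)\<^sup>2 / 4) ^ ?M"
    by (simp only: power_divide power_mult add_divide_distrib)
   also have "(1::real) / 4 ^ ?M \<le> 1" using one_le_power[of "4::real" ?M] by (subst divide_le_eq_1_pos) auto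
   finally show "(1 + norm x ^ (2 * ?M)) / 4 ^ ?M \<le> 1 + ((norm x)\<^sup>2 / 4) ^ ?M" by simp
  qed (auto intro!: mult_pos_pos divide_pos_pos add_pos_nonneg)
  also have "... = (fact ?M + 1) * 4 ^ ?M * (1 / (1 + norm x ^ (2 * ?M)))"
   by simp
  finally show "ennreal (norm (exp (- (norm x)\<^sup>2 / 4))) \<le>
    ennreal ((fact ?M + 1) * 4 ^ ?M) * ennreal (1 / (1 + norm x ^ (2 * ?M)))"
   by (simp add: ennreal_mult[symmetric] ennreal_leI del: power_Suc fact_Suc)
 qed
 also have "... = ennreal ((fact ?M + 1) * 4 ^ ?M) * (\<integral>\<^sup>+(x::'a). ennreal (1 / (1 + norm x ^ (2 * ?M))) \<partial>lborel)"
  by (intro nn_integral_cmult) auto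
 also have "... < \<infinity>"
  using nn_integral_inverse_power_finite[of "2 * ?M", where ?'a = 'a]
  by (auto simp: ennreal_mult_less_top)
 finally show "(\<integral>\<^sup>+(x::'a). ennreal (norm (exp (- (norm x)\<^sup>2 / 4))) \<partial>lborel) < \<infinity>" .
qed

text \<open>The normalizing constant is defined as an integral instead of \<open>(4 \<pi>)\<close> to the power \<open>n / 2\<close>; in
 this form the heat kernels have integral one by definition.\<close>

definition gauss_const :: "'a::euclidean_space itself => real" where
 "gauss_const _ = (LBINT (x::'a). exp (- (norm x)\<^sup>2 / 4))"

lemma nn_integral_gaussian:
 "(\<integral>\<^sup>+(x::'a::euclidean_space). ennreal (exp (- (norm x)\<^sup>2 / 4)) \<partial>lborel) = ennreal (gauss_const TYPE('a))"
 unfolding gauss_const_def by (intro nn_integral_eq_integral gaussian_integrable) auto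

lemma gauss_const_pos: "gauss_const TYPE('a::euclidean_space) > 0"
proof -
 have "gauss_const TYPE('a) \<noteq> 0"
 proof
  assume "gauss_const TYPE('a) = 0"
  then have "(\<integral>\<^sup>+(x::'a). ennreal (exp (- (norm x)\<^sup>2 / 4)) \<partial>lborel) = 0"
   by (simp only: nn_integral_gaussian) simp
  then have "AE x::'a in lborel. False"
   by (subst (asm) nn_integral_0_iff_AE) auto
  then show False
   by (simp add: AE_iff_null_sets[of "{}"] trivial_limit_def[symmetric] ae_filter_eq_bot_iff)
 qed
 moreover have "gauss_const TYPE('a) \<ge> 0"
  unfolding gauss_const_def by (intro integral_nonneg_AE) auto
 ultimately show ?thesis by simp
qed

definition heat :: "real => 'a::euclidean_space => real" where
 "heat t x = exp (- (norm x)\<^sup>2 / (4 * t)) / (gauss_const TYPE('a) * t powr (DIM('a) / 2))"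

lemma heat_zero_time [simp]: "heat 0 x = 0"
 by (simp add: heat_def)

lemma heat_nonneg [simp]: "heat t x \<ge> 0"
 using gauss_const_pos[where ?'a = 'a] by (simp add: heat_def)

lemma heat_minus [simp]: "heat t (- x) = heat t x"
 by (simp add: heat_def)

lemma heat_measurable [measurable]: "Borel (heat t)"
 unfolding heat_def by measurable

lemma heat_le: "t \<ge> 0 ==> heat t (x::'a::euclidean_space) \<le> 1 / (gauss_const TYPE('a) * t powr (DIM('a) / 2))"
 using gauss_const_pos[where ?'a = 'a]
 unfolding heat_def by (intro divide_right_mono) auto

lemma nn_integral_heat:
 assumes t: "t > 0"
 shows "(\<integral>\<^sup>+(x::'a::euclidean_space). ennreal (heat t x) \<partial>lborel) = 1"
proof -
 let ?c = "gauss_const TYPE('a)"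
 have st: "sqrt t > 0" using t by simp
 have pos: "?c > 0" "t powr (DIM('a) / 2) > 0" using gauss_const_pos t by auto
 have sq: "\<bar>sqrt t\<bar> ^ DIM('a) = t powr (DIM('a) / 2)"
  using t by (simp add: powr_half_sqrt[symmetric] powr_power)
 have "(\<integral>\<^sup>+(x::'a). ennreal (heat t x) \<partial>lborel) =
   ennreal (\<bar>sqrt t\<bar> ^ DIM('a)) * (\<integral>\<^sup>+(x::'a). ennreal (heat t (0 + sqrt t *\<^sub>R x)) \<partial>lborel)"
  using st by (intro nn_integral_lborel_affine) auto
 also have "(\<integral>\<^sup>+(x::'a). ennreal (heat t (0 + sqrt t *\<^sub>R x)) \<partial>lborel) =
   (\<integral>\<^sup>+(x::'a). ennreal (1 / (?c * t powr (DIM('a) / 2))) * ennreal (exp (- (norm x)\<^sup>2 / 4)) \<partial>lborel)"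
 proof (intro nn_integral_cong)
  fix x :: 'a
  have "heat t (0 + sqrt t *\<^sub>R x) = 1 / (?c * t powr (DIM('a) / 2)) * exp (- (norm x)\<^sup>2 / 4)"
   using t by (simp add: heat_def power_mult_distrib)
  then show "ennreal (heat t (0 + sqrt t *\<^sub>R x)) =
    ennreal (1 / (?c * t powr (DIM('a) / 2))) * ennreal (exp (- (norm x)\<^sup>2 / 4))"
   using pos by (simp only: ennreal_mult''[OF less_imp_le[OF exp_gt_zero]])
 qed
 also have "... = ennreal (1 / (?c * t powr (DIM('a) / 2))) * ennreal ?c"
  by (subst nn_integral_cmult) (simp_all only: nn_integral_gaussian, measurable)
 also have "ennreal (\<bar>sqrt t\<bar> ^ DIM('a)) * ... =
   ennreal (t powr (DIM('a) / 2) * (1 / (?c * t powr (DIM('a) / 2)) * ?c))"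
  unfolding sq using pos by (simp add: ennreal_mult'[symmetric])
 also have "t powr (DIM('a) / 2) * (1 / (?c * t powr (DIM('a) / 2)) * ?c) = 1"
  using pos by (simp add: field_simps)
 finally show ?thesis by simp
qed

lemma heat_integrable: "t \<ge> 0 ==> integrable lborel (heat t :: 'a::euclidean_space => real)"
proof (cases "t = 0")
 case False
 assume "t \<ge> 0"
 with False have "t > 0" by simp
 then show ?thesis
  using nn_integral_heat[of t, where ?'a = 'a]
  by (intro integrableI_bounded) auto
next
 case True
 then have "heat t = (%x::'a. 0)" by (simp add: fun_eq_iff)
 then show ?thesis by simp
qed

lemma integral_heat: "t > 0 ==> (LBINT (x::'a::euclidean_space). heat t x) = 1"
 by (subst integral_eq_nn_integral) (auto simp: nn_integral_heat)

text \<open>Completing the square reduces the semigroup law to the normalization of the heat kernel at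
 time \<open>s t / (s + t)\<close>.\<close>

lemma heat_mult_heat:
 fixes x y :: "'a::euclidean_space"
 assumes s: "s > 0" and t: "t > 0"
 shows "heat s (x - y) * heat t y = heat (s + t) x * heat (s * t / (s + t)) (y - (t / (s + t)) *\<^sub>R x)"
proof -
 let ?c = "gauss_const TYPE('a)" and ?d = "DIM('a) / 2 :: real"
 have st: "s + t > 0" using s t by simp
 have n: "(norm (x - y))\<^sup>2 = x \<bullet> x - 2 * (x \<bullet> y) + y \<bullet> y"
  by (simp add: power2_norm_eq_inner inner_simps inner_commute)
 have n2: "(norm (y - (t / (s + t)) *\<^sub>R x))\<^sup>2 = y \<bullet> y - 2 * (t / (s + t)) * (x \<bullet> y) + (t / (s + t))\<^sup>2 * (x \<bullet> x)"
  unfolding power2_norm_eq_inner inner_diff_left inner_diff_right inner_scaleR_left inner_scaleR_right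
  by (simp add: inner_commute[of y x] power2_eq_square right_diff_distrib diff_divide_distrib)
 have e: "- (norm (x - y))\<^sup>2 / (4 * s) + - (norm y)\<^sup>2 / (4 * t) =
   - (norm x)\<^sup>2 / (4 * (s + t)) + - (norm (y - (t / (s + t)) *\<^sub>R x))\<^sup>2 / (4 * (s * t / (s + t)))"
 proof -
  have a: "1 / (4 * (s * t / (s + t))) = 1 / (4 * s) + 1 / (4 * t)"
  proof -
   have "1 / (4 * (s * t / (s + t))) = (s + t) / (4 * (s * t))" by simp
   also have "... = 1 / (4 * s) + 1 / (4 * t)"
    using s t by (simp add: add_divide_distrib)
   finally show ?thesis .
  qed
  have ab: "1 / (4 * s) + 1 / (4 * t) = (s + t) / (4 * s * t)"
   using s t by (simp add: add_divide_distrib)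
  have b: "2 * (t / (s + t)) * (1 / (4 * s) + 1 / (4 * t)) = 1 / (2 * s)"
   unfolding ab using s t st by simp
  have c: "(t / (s + t))\<^sup>2 * (1 / (4 * s) + 1 / (4 * t)) + 1 / (4 * (s + t)) = 1 / (4 * s)"
  proof -
   have "(t / (s + t))\<^sup>2 * (1 / (4 * s) + 1 / (4 * t)) = t / (4 * s * (s + t))"
    unfolding ab using s t st by (simp add: power2_eq_square)
   also have "t / (4 * s * (s + t)) + 1 / (4 * (s + t)) = (s + t) / (4 * s * (s + t))"
    using s by (simp add: add_divide_distrib)
   also have "... = 1 / (4 * s)"
    using st by simp
   finally show ?thesis .
  qed
  have "(norm (y - (t / (s + t)) *\<^sub>R x))\<^sup>2 * (1 / (4 * (s * t / (s + t)))) =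
    (y \<bullet> y) * (1 / (4 * s) + 1 / (4 * t)) - (x \<bullet> y) * (2 * (t / (s + t)) * (1 / (4 * s) + 1 / (4 * t)))
    + (x \<bullet> x) * ((t / (s + t))\<^sup>2 * (1 / (4 * s) + 1 / (4 * t)))"
   unfolding n2 a by (simp add: algebra_simps)
  also have "... = (y \<bullet> y) * (1 / (4 * s) + 1 / (4 * t)) - (x \<bullet> y) * (1 / (2 * s))
    + (x \<bullet> x) * (1 / (4 * s) - 1 / (4 * (s + t)))"
  proof -
   have c': "(t / (s + t))\<^sup>2 * (1 / (4 * s) + 1 / (4 * t)) = 1 / (4 * s) - 1 / (4 * (s + t))"
    using c by linarith
   show ?thesis unfolding b c' ..
  qed
  finally show ?thesis
   unfolding n using s t by (simp add: power2_norm_eq_inner[of x] power2_norm_eq_inner[of y] algebra_simps add_divide_distrib diff_divide_distrib)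
 qed
 have p: "s powr ?d * t powr ?d = (s + t) powr ?d * (s * t / (s + t)) powr ?d"
  using s t st by (simp add: powr_mult[symmetric])
 have "heat s (x - y) * heat t y = exp (- (norm (x - y))\<^sup>2 / (4 * s) + - (norm y)\<^sup>2 / (4 * t)) / (?c * ?c * (s powr ?d * t powr ?d))"
  unfolding heat_def exp_add by simp
 also have "... = heat (s + t) x * heat (s * t / (s + t)) (y - (t / (s + t)) *\<^sub>R x)"
  unfolding e p unfolding heat_def exp_add by simp
 finally show ?thesis .
qed

lemma heat_semigroup:
 fixes x :: "'a::euclidean_space"
 assumes s: "s > 0" and t: "t > 0"
 shows "(LBINT y. heat s (x - y) * heat t y) = heat (s + t) x"
proof -
 have "(LBINT y. heat s (x - y) * heat t y) =
   heat (s + t) x * (LBINT y. heat (s * t / (s + t)) (y - (t / (s + t)) *\<^sub>R x))"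
  by (simp add: heat_mult_heat[OF s t])
 also have "(LBINT y. heat (s * t / (s + t)) (y - (t / (s + t)) *\<^sub>R x)) = 1"
  using s t by (simp add: integral_lborel_translate_minus[where f = "heat _"] integral_heat)
 finally show ?thesis by simp
qed

lemma heat_le_heat:
 fixes x :: "'a::euclidean_space"
 assumes t: "0 < t" "t \<le> s" "s \<le> L * t"
 shows "heat s x \<le> L powr (DIM('a) / 2) * heat (L * t) x"
proof -
 let ?c = "gauss_const TYPE('a)" and ?d = "DIM('a) / 2 :: real"
 have c: "?c > 0" by (rule gauss_const_pos)
 have L: "L > 0" using t by (smt (verit) zero_less_mult_pos2)
 have "heat s x \<le> exp (- (norm x)\<^sup>2 / (4 * (L * t))) / (?c * t powr ?d)"
  unfolding heat_def
 proof (intro frac_le)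
  show "exp (- (norm x)\<^sup>2 / (4 * s)) \<le> exp (- (norm x)\<^sup>2 / (4 * (L * t)))"
   using t L by (auto intro!: divide_left_mono mult_pos_pos)
  show "?c * t powr ?d \<le> ?c * s powr ?d"
   using t c by (intro mult_left_mono powr_mono2) auto
 qed (use c t in auto)
 also have "... = L powr ?d * heat (L * t) x"
  unfolding heat_def using L t by (simp add: powr_mult)
 finally show ?thesis .
qed

section \<open>Convolution of bounded integrable functions\<close>

definition bddint :: "('a::euclidean_space => real) => bool" where
 "bddint f \<longleftrightarrow> f \<in> borel_measurable borel \<and> integrable lborel f \<and> (\<exists>B. \<forall>x. \<bar>f x\<bar> \<le> B)"

definition conv :: "('a::euclidean_space => real) => ('a => real) => 'a => real" where
 "conv a b x = (LBINT y. a (x - y) * b y)"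

lemma bddintD:
 assumes "bddint f"
 shows "Borel f" "integrable lborel f" "\<exists>B\<ge>0. \<forall>x. \<bar>f x\<bar> \<le> B"
proof -
 show "Borel f" "integrable lborel f" using assms by (auto simp: bddint_def)
 obtain B where "\<forall>x. \<bar>f x\<bar> \<le> B" using assms by (auto simp: bddint_def)
 then show "\<exists>B\<ge>0. \<forall>x. \<bar>f x\<bar> \<le> B"
  by (intro exI[of _ B]) (meson abs_ge_zero order_trans)
qed

lemma bddint_zero [simp]: "bddint (%x. 0)"
 by (auto simp: bddint_def)

lemma bddint_add: assumes "bddint f" "bddint g" shows "bddint (%x. f x + g x)"
proof -
 obtain B C where "\<forall>x. \<bar>f x\<bar> \<le> B" "\<forall>x. \<bar>g x\<bar> \<le> C" using assms by (auto simp: bddint_def)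
 then have "\<forall>x. \<bar>f x + g x\<bar> \<le> B + C" by (metis abs_triangle_ineq add_mono order_trans)
 then show ?thesis using assms by (auto simp: bddint_def)
qed

lemma bddint_cmult: assumes "bddint f" shows "bddint (%x. c * f x)"
proof -
 obtain B where "\<forall>x. \<bar>f x\<bar> \<le> B" using assms by (auto simp: bddint_def)
 then have "\<forall>x. \<bar>c * f x\<bar> \<le> \<bar>c\<bar> * B" by (auto simp: abs_mult intro: mult_left_mono)
 then show ?thesis using assms by (auto simp: bddint_def)
qed

lemma bddint_sum: "finite A ==> (\<And>i. i \<in> A ==> bddint (f i)) ==> bddint (%x. \<Sum>i\<in>A. f i x)"
 by (induction A rule: finite_induct) (auto intro: bddint_add)

lemma integrable_bounded_mult:
 fixes f g :: "'b => real"
 assumes "integrable M f" "g \<in> borel_measurable M" "\<And>x. \<bar>g x\<bar> \<le> B"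
 shows "integrable M (%x. g x * f x)"
proof (rule Bochner_Integration.integrable_bound[of M "%x. B * f x"])
 show "AE x in M. norm (g x * f x) \<le> norm (B * f x)"
 proof (rule AE_I2)
  fix x
  have "\<bar>g x\<bar> \<le> \<bar>B\<bar>" using assms(3)[of x] by linarith
  then show "norm (g x * f x) \<le> norm (B * f x)"
   by (simp add: abs_mult mult_right_mono)
 qed
qed (use assms in auto)

lemma bddint_mult_integrable: "bddint f ==> bddint g ==> integrable lborel (%x. f x * g x)"
 using integrable_bounded_mult[of lborel g f] by (auto simp: bddint_def)

lemma conv_integrand_integrable:
 assumes "bddint a" "integrable lborel b"
 shows "integrable lborel (%y. a (x - y) * b y)"
proof -
 obtain B where B: "\<forall>x. \<bar>a x\<bar> \<le> B" using assms by (auto simp: bddint_def)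
 have [measurable]: "Borel a" using assms by (auto simp: bddint_def)
 show ?thesis
  by (rule integrable_bounded_mult[of _ _ _ B]) (use assms B in auto)
qed

lemma integrable_conv_kernel:
 fixes b c :: "'a::euclidean_space => real"
 assumes [measurable]: "integrable lborel b" "integrable lborel c"
 shows "integrable (leb lborel) (%(y, z). b (y - z) * c z)"
proof (rule integrableI_bounded)
 have [measurable]: "Borel b" "Borel c"
  using assms[THEN borel_measurable_integrable] by auto
 show "(%(y, z). b (y - z) * c z) \<in> borel_measurable (leb lborel)" by measurable
 have "(\<integral>\<^sup>+p. ennreal (norm (case p of (y, z) => b (y - z) * c z)) \<partial>(leb lborel)) =
   (\<integral>\<^sup>+z. \<integral>\<^sup>+y. ennreal (norm (b (y - z) * c z)) \<partial>lborel \<partial>lborel)"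
  by (subst lborel_pair.nn_integral_snd[symmetric]) auto
 also have "... = (\<integral>\<^sup>+z. (\<integral>\<^sup>+y. ennreal (norm (b y)) \<partial>lborel) * ennreal (norm (c z)) \<partial>lborel)"
 proof (intro nn_integral_cong)
  fix z
  have "(\<integral>\<^sup>+y. ennreal (norm (b (y - z) * c z)) \<partial>lborel) = (\<integral>\<^sup>+y. ennreal (norm (b (y - z))) * ennreal (norm (c z)) \<partial>lborel)"
   by (simp add: abs_mult ennreal_mult)
  also have "... = (\<integral>\<^sup>+y. ennreal (norm (b (y - z))) \<partial>lborel) * ennreal (norm (c z))"
   by (intro nn_integral_multc) auto
  also have "(\<integral>\<^sup>+y. ennreal (norm (b (y - z))) \<partial>lborel) = (\<integral>\<^sup>+y. ennreal (norm (b y)) \<partial>lborel)"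
   by (intro nn_integral_lborel_translate_minus[of "%y. ennreal (norm (b y))"]) auto
  finally show "(\<integral>\<^sup>+y. ennreal (norm (b (y - z) * c z)) \<partial>lborel) = (\<integral>\<^sup>+y. ennreal (norm (b y)) \<partial>lborel) * ennreal (norm (c z))" .
 qed
 also have "... = (\<integral>\<^sup>+y. ennreal (norm (b y)) \<partial>lborel) * (\<integral>\<^sup>+z. ennreal (norm (c z)) \<partial>lborel)"
  by (intro nn_integral_cmult) auto
 also have "... < \<infinity>"
  using assms by (simp add: integrable_iff_bounded ennreal_mult_less_top)
 finally show "(\<integral>\<^sup>+p. ennreal (norm (case p of (y, z) => b (y - z) * c z)) \<partial>(leb lborel)) < \<infinity>" .
qed

lemma conv_measurable [measurable]:
 assumes [measurable]: "Borel a" "Borel b"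
 shows "Borel (conv a b)"
 unfolding conv_def[abs_def] by measurable

lemma conv_abs_le:
 assumes "bddint a" "integrable lborel b" "\<And>x. \<bar>a x\<bar> \<le> B"
 shows "\<bar>conv a b x\<bar> \<le> B * (LBINT y. \<bar>b y\<bar>)"
proof -
 have "\<bar>conv a b x\<bar> \<le> (LBINT y. \<bar>a (x - y) * b y\<bar>)"
  unfolding conv_def by (rule integral_abs_bound)
 also have "... \<le> (LBINT y. B * \<bar>b y\<bar>)"
  using conv_integrand_integrable[OF assms(1,2), of x] assms(2,3)
  by (intro integral_mono integrable_abs integrable_mult_right)
    (auto simp: abs_mult intro!: mult_right_mono)
 finally show ?thesis by simp
qed

lemma bddint_conv:
 fixes a b :: "'a::euclidean_space => real"
 assumes "bddint a" "bddint b"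
 shows "bddint (conv a b)"
proof -
 obtain B where B: "\<forall>x. \<bar>a x\<bar> \<le> B" using assms by (auto simp: bddint_def)
 have "integrable lborel (%x. LINT y|lborel. (%(y, z). a (y - z) * b z) (x, y))"
  by (intro lborel_pair.integrable_fst' integrable_conv_kernel) (use assms in \<open>auto simp: bddint_def\<close>)
 then have "integrable lborel (conv a b)"
  by (simp add: conv_def[abs_def])
 moreover have "\<forall>x. \<bar>conv a b x\<bar> \<le> B * (LBINT y. \<bar>b y\<bar>)"
  using B by (auto intro!: conv_abs_le bddintD assms)
 moreover have "Borel (conv a b)"
  using assms by (auto simp: bddint_def)
 ultimately show ?thesis unfolding bddint_def by blast
qed

lemma conv_assoc:
 fixes a b c :: "'a::euclidean_space => real"
 assumes a: "bddint a" and b: "bddint b" and c: "bddint c"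
 shows "conv a (conv b c) = conv (conv a b) c"
proof
 fix x
 obtain B where B: "\<forall>x. \<bar>a x\<bar> \<le> B" using a by (auto simp: bddint_def)
 have [measurable]: "Borel a" "Borel b" "Borel c"
  using a b c by (auto simp: bddint_def)
 have "integrable (leb lborel) (%p. a (x - fst p) * (case p of (y, z) => b (y - z) * c z))"
  by (rule integrable_bounded_mult[of _ _ _ B])
    (use B b c in \<open>auto intro!: integrable_conv_kernel simp: bddint_def\<close>)
 then have int: "integrable (leb lborel) (%(y, z). a (x - y) * (b (y - z) * c z))"
  by (simp add: split_beta')
 have "conv a (conv b c) x = (LBINT y. LINT z|lborel. a (x - y) * (b (y - z) * c z))"
  unfolding conv_def by simp
 also have "... = (LBINT z. LINT y|lborel. a (x - y) * (b (y - z) * c z))"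
  using lborel_pair.Fubini_integral[OF int] by simp
 also have "... = (LBINT z. (LBINT y. a (x - z - (y - z)) * b (y - z)) * c z)"
  by (simp add: mult.assoc[symmetric])
 also have "... = (LBINT z. (LBINT y. a (x - z - y) * b y) * c z)"
  by (subst integral_lborel_translate_minus[where f = "%y. a (x - _ - y) * b y"]) auto
 also have "... = conv (conv a b) c x" unfolding conv_def ..
 finally show "conv a (conv b c) x = conv (conv a b) c x" .
qed

text \<open>For an even kernel the convolution is symmetric.\<close>

lemma conv_adjoint:
 fixes a f g :: "'a::euclidean_space => real"
 assumes a: "bddint a" and f: "bddint f" and g: "bddint g" and even: "\<And>x. a (- x) = a x"
 shows "(LBINT x. conv a f x * g x) = (LBINT x. f x * conv a g x)"
proof -
 obtain B where B: "\<forall>x. \<bar>g x\<bar> \<le> B" using g by (auto simp: bddint_def)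
 have [measurable]: "Borel a" "Borel f" "Borel g"
  using a f g by (auto simp: bddint_def)
 have "integrable (leb lborel) (%p. g (fst p) * (case p of (y, z) => a (y - z) * f z))"
  by (rule integrable_bounded_mult[of _ _ _ B])
    (use B a f in \<open>auto intro!: integrable_conv_kernel simp: bddint_def\<close>)
 then have int: "integrable (leb lborel) (%(x, y). g x * (a (x - y) * f y))"
  by (simp add: split_beta')
 have "(LBINT x. conv a f x * g x) = (LBINT x. LINT y|lborel. g x * (a (x - y) * f y))"
  unfolding conv_def by (simp add: mult.commute)
 also have "... = (LBINT y. LINT x|lborel. g x * (a (x - y) * f y))"
  using lborel_pair.Fubini_integral[OF int] by simp
 also have "... = (LBINT y. LINT x|lborel. f y * (a (y - x) * g x))"
 proof -
  have "a (x - y) = a (y - x)" for x y using even[of "y - x"] by simp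
  then show ?thesis by (simp add: mult_ac)
 qed
 also have "... = (LBINT x. f x * conv a g x)"
  unfolding conv_def by simp
 finally show ?thesis .
qed

section \<open>Polynomials in the heat semigroup\<close>

text \<open>The functional that sends \<open>X\<^sup>i\<close> to \<open>f i\<close>. With \<open>f i\<close> a quantity computed from the
 heat kernel at time \<open>i t\<close>, it evaluates polynomials in the operator \<open>X = exp (t \<Delta>)\<close>.\<close>

definition plin :: "real poly => (nat => real) => real" where
 "plin P f = (\<Sum>i\<le>degree P. coeff P i * f i)"

lemma plin_eq: "degree P \<le> N ==> plin P f = (\<Sum>i\<le>N. coeff P i * f i)"
 unfolding plin_def by (rule sum.mono_neutral_left) (auto simp: coeff_eq_0)

lemma plin_pCons: "plin (pCons a P) f = a * f 0 + plin P (%i. f (Suc i))"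
proof -
 have "plin (pCons a P) f = (\<Sum>i\<le>Suc (degree P). coeff (pCons a P) i * f i)"
  by (rule plin_eq) (rule degree_pCons_le)
 also have "... = a * f 0 + (\<Sum>i\<le>degree P. coeff P i * f (Suc i))"
  by (subst sum.atMost_Suc_shift) simp
 finally show ?thesis by (simp add: plin_def)
qed

lemma plin_0 [simp]: "plin 0 f = 0" by (simp add: plin_def)

lemma plin_cong: "(\<And>i. coeff P i \<noteq> 0 ==> f i = g i) ==> plin P f = plin P g"
 unfolding plin_def by (rule sum.cong) auto

lemma plin_add: "plin (P + Q) f = plin P f + plin Q f"
proof -
 let ?N = "max (degree P) (degree Q)"
 show ?thesis
  using plin_eq[of "P + Q" ?N f] plin_eq[of P ?N f] plin_eq[of Q ?N f] degree_add_le_max[of P Q]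
  by (simp add: distrib_right sum.distrib)
qed

lemma plin_smult: "plin (smult c P) f = c * plin P f"
 using plin_eq[of "smult c P" "degree P" f] degree_smult_le[of c P]
 by (simp add: plin_def sum_distrib_left mult_ac)

lemma plin_diff: "plin (P - Q) f = plin P f - plin Q f"
proof -
 have "P - Q = P + smult (-1) Q" by simp
 then show ?thesis by (simp only: plin_add plin_smult)
qed

lemma plin_fun_diff: "plin P (%i. f i - g i) = plin P f - plin P g"
 by (simp add: plin_def right_diff_distrib sum_subtractf)

lemma plin_fun_cmult: "plin P (%i. c * f i) = c * plin P f"
 by (simp add: plin_def sum_distrib_left mult.left_commute)

lemma plin_fun_multc: "plin P (%i. f i * c) = plin P f * c"
 by (simp add: plin_def sum_distrib_right mult.assoc)

lemma plin_mult: "plin (P * Q) f = plin P (%i. plin Q (%j. f (i + j)))"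
proof (induction P arbitrary: f)
 case (pCons a P)
 have "plin (pCons a P * Q) f = a * plin Q f + plin (P * Q) (%i. f (Suc i))"
  by (simp add: mult_pCons_left plin_add plin_smult plin_pCons)
 then show ?case by (simp add: pCons.IH plin_pCons)
qed simp

text \<open>Substituting \<open>X\<^sup>2\<close> for \<open>X = exp (t \<Delta>)\<close> doubles the time.\<close>

lemma plin_pcompose_square: "plin (pcompose P [:0, 0, 1:]) f = plin P (%i. f (2 * i))"
proof (induction P arbitrary: f)
 case (pCons a P)
 have "[:0, 0, 1:] * R = pCons 0 (pCons 0 R)" for R :: "real poly"
  by (simp add: mult_pCons_left)
 then have "pcompose (pCons a P) [:0, 0, 1:] = pCons a (pCons 0 (pcompose P [:0, 0, 1:]))"
  by (simp add: pcompose_pCons)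
 then show ?case by (simp add: plin_pCons pCons.IH)
qed simp

lemma plin_integral: "(\<And>i. integrable M (f i)) ==> (LINT x|M. plin P (%i. f i x)) = plin P (%i. LINT x|M. f i x)"
 unfolding plin_def by (subst Bochner_Integration.integral_sum) auto

lemma plin_measurable [measurable]:
 "(\<And>i. f i \<in> borel_measurable M) ==> (%x. plin P (%i. f i x)) \<in> borel_measurable M"
 unfolding plin_def by measurable

lemma plin_tendsto: "(\<And>i. coeff P i \<noteq> 0 ==> ((%x. f x i) \<longlongrightarrow> L) F) ==> ((%x. plin P (f x)) \<longlongrightarrow> poly P 1 * L) F"
 unfolding plin_def poly_altdef sum_distrib_right
proof (rule tendsto_sum)
 fix i assume *: "\<And>i. coeff P i \<noteq> 0 ==> ((%x. f x i) \<longlongrightarrow> L) F"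
 show "((%x. coeff P i * f x i) \<longlongrightarrow> coeff P i * 1 ^ i * L) F"
  by (cases "coeff P i = 0") (auto intro!: tendsto_mult_left *)
qed

definition coeff_sum :: "real poly => real" where
 "coeff_sum P = (\<Sum>i\<le>degree P. \<bar>coeff P i\<bar>)"

lemma coeff_sum_nonneg: "coeff_sum P \<ge> 0"
 by (auto simp: coeff_sum_def intro: sum_nonneg)

lemma plin_abs_le:
 assumes "\<And>i. coeff P i \<noteq> 0 ==> \<bar>f i\<bar> \<le> B"
 shows "\<bar>plin P f\<bar> \<le> coeff_sum P * B"
proof -
 have "\<bar>plin P f\<bar> \<le> (\<Sum>i\<le>degree P. \<bar>coeff P i * f i\<bar>)"
  unfolding plin_def by (rule sum_abs)
 also have "... \<le> (\<Sum>i\<le>degree P. \<bar>coeff P i\<bar> * B)"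
 proof (rule sum_mono)
  fix i show "\<bar>coeff P i * f i\<bar> \<le> \<bar>coeff P i\<bar> * B"
   by (cases "coeff P i = 0") (auto simp: abs_mult intro!: mult_left_mono assms)
 qed
 finally show ?thesis by (simp add: coeff_sum_def sum_distrib_right)
qed

text \<open>The convolution kernel of the operator \<open>P(exp (t \<Delta>))\<close>. Since \<open>heat 0\<close> is the zero function and
 not a point mass, this reading requires \<open>P\<close> to have no constant term; hence the conditions
 \<open>coeff P 0 = 0\<close> below.\<close>

definition hk :: "real poly => real => 'a::euclidean_space => real" where
 "hk P t x = plin P (%i. heat (real i * t) x)"

lemma bddint_heat: "t \<ge> 0 ==> bddint (heat t)"
 unfolding bddint_def using heat_integrable[of t] heat_le[of t]
 by (auto intro!: exI[of _ "1 / (gauss_const TYPE('a) * t powr (DIM('a) / 2))"])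

lemma bddint_plin: "(\<And>i. bddint (f i)) ==> bddint (%x. plin P (%i. f i x))"
 unfolding plin_def by (intro bddint_sum bddint_cmult) auto

lemma bddint_hk: "t \<ge> 0 ==> bddint (hk P t)"
 unfolding hk_def[abs_def] by (intro bddint_plin bddint_heat) auto

lemma hk_measurable [measurable]: "Borel (hk P t)"
 unfolding hk_def[abs_def] by measurable

lemma hk_minus: "hk P t (- x) = hk P t x"
 by (simp add: hk_def)

lemma conv_heat_heat: "s > 0 ==> t > 0 ==> conv (heat s) (heat t) = heat (s + t)"
 by (simp add: fun_eq_iff conv_def heat_semigroup)

lemma conv_plin_left:
 assumes "\<And>i. bddint (f i)" "integrable lborel g"
 shows "conv (%x. plin P (%i. f i x)) g x = plin P (%i. conv (f i) g x)"
 unfolding conv_def plin_fun_multc[symmetric]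
 by (rule plin_integral) (use assms in \<open>auto intro: conv_integrand_integrable\<close>)

lemma conv_plin_right:
 assumes "bddint f" "\<And>i. integrable lborel (g i)"
 shows "conv f (%x. plin P (%i. g i x)) x = plin P (%i. conv f (g i) x)"
 unfolding conv_def plin_fun_cmult[symmetric]
 by (rule plin_integral) (use assms in \<open>auto intro: conv_integrand_integrable\<close>)

lemma conv_hk_hk:
 assumes t: "t > 0" and P: "coeff P 0 = 0" and Q: "coeff Q 0 = 0"
 shows "conv (hk P t) (hk Q t) = hk (P * Q) t"
proof
 fix x :: 'a
 have hk: "hk R t = (%x::'a. plin R (%i. heat (real i * t) x))" for R
  by (simp add: hk_def fun_eq_iff)
 have "conv (hk P t) (hk Q t) x = plin P (%i. conv (heat (real i * t)) (hk Q t) x)"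
  unfolding hk[of P]
  using t bddint_hk[of t Q] by (intro conv_plin_left bddint_heat) (auto simp: bddint_def)
 also have "... = plin P (%i. plin Q (%j. conv (heat (real i * t)) (heat (real j * t)) x))"
  unfolding hk[of Q]
  using t by (intro plin_cong conv_plin_right bddint_heat heat_integrable) auto
 also have "... = plin P (%i. plin Q (%j. heat (real (i + j) * t) x))"
 proof (intro plin_cong)
  fix i j assume "coeff P i \<noteq> 0" "coeff Q j \<noteq> 0"
  then have "i > 0" "j > 0" using P Q by (auto intro!: Nat.gr0I)
  then show "conv (heat (real i * t)) (heat (real j * t)) x = heat (real (i + j) * t) x"
   using t by (simp add: conv_heat_heat distrib_right)
 qed
 also have "... = hk (P * Q) t x"
  by (simp add: hk_def plin_mult)
 finally show "conv (hk P t) (hk Q t) x = hk (P * Q) t x" .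
qed

subsection \<open>Iterated finite differences\<close>

primrec fdiff :: "nat => (real => real) => real => real => real" where
 "fdiff 0 f t s = f s"
| "fdiff (Suc M) f t s = fdiff M f t s - fdiff M f t (s + t)"

text \<open>A factor \<open>1 - X\<close> is a difference in time, because \<open>X\<close> advances the time by \<open>t\<close>.\<close>

lemma plin_fdiff: "plin ([:1, -1:] ^ M * P) (%i. f (real i * t)) = plin P (%i. fdiff M f t (real i * t))"
proof (induction M arbitrary: P)
 case (Suc M)
 have eq: "[:1, -1:] ^ Suc M * P = [:1, -1:] ^ M * ([:1, -1:] * P)"
  by (simp only: power_Suc2 mult.assoc)
 have "[:1, -1:] * P = P - pCons 0 P"
  by (simp add: mult_pCons_left)
 then have "plin ([:1, -1:] * P) (%i. fdiff M f t (real i * t)) =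
   plin P (%i. fdiff M f t (real i * t)) - plin P (%i. fdiff M f t (real i * t + t))"
  by (simp only: plin_diff plin_pCons) (simp add: distrib_right add.commute)
 then show ?case unfolding eq Suc.IH by (simp add: plin_fun_diff)
qed simp

text \<open>A finite difference is controlled by the derivative of the same order; the derivatives
 enter as a chain of functions \<open>f 0, f 1, ..., f M\<close>, each the derivative of the one before.\<close>

lemma fdiff_abs_le:
 fixes f :: "nat => real => real"
 assumes t: "t > 0"
  and der: "\<And>i s. i < M ==> s > 0 ==> (f i has_real_derivative f (Suc i) s) (at s)"
  and bd: "\<And>s. s0 \<le> s ==> s \<le> s0 + real M * t ==> \<bar>f M s\<bar> \<le> B" and s0: "s0 > 0"
 shows "\<bar>fdiff M (f 0) t s0\<bar> \<le> t ^ M * B"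
proof -
 have der': "(fdiff N (f i) t has_real_derivative fdiff N (f (Suc i)) t s) (at s)"
  if "i < M" "s > 0" for N i s
  using that(2)
 proof (induction N arbitrary: s)
  case 0 then show ?case using der[OF that(1)] by simp
 next
  case (Suc N)
  have "((%s. fdiff N (f i) t (s + t)) has_real_derivative fdiff N (f (Suc i)) t (s + t) * (1 + 0)) (at s)"
   using Suc.prems t by (intro DERIV_chain2[of "fdiff N (f i) t"] Suc.IH) (auto intro!: derivative_eq_intros)
  then show ?case using DERIV_diff[OF Suc.IH[OF Suc.prems]] by simp
 qed
 have "\<bar>fdiff N (f i) t s\<bar> \<le> t ^ N * B" if "N + i = M" "s0 \<le> s" "s + real N * t \<le> s0 + real M * t" for N i s
  using that
 proof (induction N arbitrary: i s)
  case 0 then show ?case using bd[of s] by simp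
 next
  case (Suc N)
  have i: "i < M" using Suc.prems by simp
  have "\<exists>z>s. z < s + t \<and> fdiff N (f i) t (s + t) - fdiff N (f i) t s = (s + t - s) * fdiff N (f (Suc i)) t z"
   using t s0 Suc.prems(2) by (intro MVT2 der' i) auto
  then obtain z where z: "s < z" "z < s + t"
   "fdiff N (f i) t (s + t) - fdiff N (f i) t s = t * fdiff N (f (Suc i)) t z" by auto
  have "\<bar>fdiff (Suc N) (f i) t s\<bar> = \<bar>fdiff N (f i) t (s + t) - fdiff N (f i) t s\<bar>"
   by (simp add: abs_minus_commute)
  also have "... = t * \<bar>fdiff N (f (Suc i)) t z\<bar>"
   unfolding z(3) using t by (simp add: abs_mult)
  also have "... \<le> t * (t ^ N * B)"
   using t z Suc.prems by (intro mult_left_mono Suc.IH) (auto simp: algebra_simps)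
  finally show ?case by (simp add: mult_ac)
 qed
 from this[of M 0 s0] show ?thesis by simp
qed

section \<open>A discrete interpolation inequality\<close>

lemma geometric_sum_le:
 fixes S :: "int set" and z r :: real
 assumes fin: "finite S" and r: "0 < r" "r < 1" and z: "z > 0"
 shows "(\<Sum>i\<in>{i\<in>S. z * r powr (real_of_int i) \<le> 1}. z * r powr (real_of_int i)) \<le> 1 / (1 - r)"
proof -
 let ?S = "{i\<in>S. z * r powr (real_of_int i) \<le> 1}"
 show ?thesis
 proof (cases "?S = {}")
  case True
  then show ?thesis using r by (simp only: True) simp
 next
  case False
  have finS: "finite ?S" using fin by simp
  define i0 where "i0 = Min ?S"
  have i0: "z * r powr (real_of_int i0) \<le> 1" using Min_in[OF finS False] by (simp add: i0_def)
  have le: "i0 \<le> i" if "i \<in> ?S" for i using Min_le[OF finS that] by (simp add: i0_def)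
  have "(\<Sum>i\<in>?S. z * r powr (real_of_int i)) \<le> (\<Sum>i\<in>?S. r ^ nat (i - i0))"
  proof (rule sum_mono)
   fix i assume i: "i \<in> ?S"
   have "z * r powr (real_of_int i) = z * r powr (real_of_int i0) * r powr (real (nat (i - i0)))"
    using le[OF i] r by (simp add: powr_add[symmetric])
   also have "... \<le> 1 * r powr (real (nat (i - i0)))"
    using i0 by (intro mult_right_mono) auto
   also have "... = r ^ nat (i - i0)" using r by (simp add: powr_realpow)
   finally show "z * r powr (real_of_int i) \<le> r ^ nat (i - i0)" .
  qed
  also have "... = (\<Sum>k\<in>(%i. nat (i - i0)) ` ?S. r ^ k)"
  proof -
   have "inj_on (%i. nat (i - i0)) ?S"
   proof (rule inj_onI)
    fix x y assume "x \<in> ?S" "y \<in> ?S" "nat (x - i0) = nat (y - i0)"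
    then show "x = y" using le[of x] le[of y] by linarith
   qed
   then show ?thesis by (simp add: sum.reindex)
  qed
  also have "... \<le> (\<Sum>k. r ^ k)"
   using r finS by (intro sum_le_suminf summable_geometric) auto
  also have "... = 1 / (1 - r)" using r by (simp add: suminf_geometric)
  finally show ?thesis .
 qed
qed

text \<open>Real interpolation for a bilinear form that is a sum of pieces at scales \<open>\<epsilon> 2\<^sup>j\<close>. Testing it
 on level sets of heights \<open>2\<^sup>m\<close> and \<open>2\<^sup>l\<close> gives the numbers \<open>D j m l\<close>, which obey an \<open>L\<^sup>1 \<times> L\<^sup>1\<close>
 bound that improves with the scale and an \<open>L\<^sup>2 \<times> L\<^sup>2\<close> bound that deteriorates with it. The
 factors in the second bound are square summable in \<open>j\<close>, and this orthogonality on both sides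
 is what turns a restricted weak type estimate into a strong one: for each pair \<open>(m, l)\<close>
 the scales are cut where the two bounds agree; the \<open>L\<^sup>1\<close> bound is summed over the large
 scales, and for the small scales the geometric decay away from the cut is summed over \<open>l\<close>
 with \<open>(j, m)\<close> fixed, or over \<open>m\<close> with \<open>(j, l)\<close> fixed.\<close>

lemma discrete_interpolation:
 fixes a b \<epsilon> A :: real and D :: "nat => int => int => real" and F G :: "int => real"
 assumes a: "a > 0" and b: "b > 0" and A: "A \<ge> 0" and eps: "\<epsilon> > 0"
  and fin: "finite I" "finite L"
  and F: "\<And>m. m \<in> I ==> F m \<ge> 0" and G: "\<And>l. l \<in> L ==> G l \<ge> 0"
  and p: "p = 1 + a / (a + 2 * b)"
  and x0: "\<And>j m. x j m \<ge> 0" and y0: "\<And>j l. y j l \<ge> 0"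
  and D1: "\<And>j m l. j < J ==> m \<in> I ==> l \<in> L ==>
    D j m l \<le> A * (\<epsilon> * 2 ^ j) powr (- a) * (2 powr (real_of_int m * (1 - p)) * F m) * (2 powr (real_of_int l * (1 - p)) * G l)"
  and D2: "\<And>j m l \<rho>. j < J ==> m \<in> I ==> l \<in> L ==> \<rho> > 0 ==>
    D j m l \<le> A * (\<epsilon> * 2 ^ j) powr b * (\<rho> * x j m + y j l / \<rho>)"
  and x: "\<And>m. m \<in> I ==> (\<Sum>j<J. x j m) \<le> 2 powr (real_of_int m * (2 - p)) * F m"
  and y: "\<And>l. l \<in> L ==> (\<Sum>j<J. y j l) \<le> 2 powr (real_of_int l * (2 - p)) * G l"
 shows "(\<Sum>m\<in>I. \<Sum>l\<in>L. \<Sum>j<J. D j m l) \<le>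
  A * (1 / (1 - 2 powr (- a)) + 2 / (1 - 2 powr (- (b / (a + 2 * b))))) * (sum F I * sum G L) powr (1 / p)"
proof -
 define \<kappa> where "\<kappa> = 1 / (a + 2 * b)"
 have ab: "a + 2 * b > 0" using a b by simp
 have \<kappa>: "\<kappa> > 0" using ab by (simp add: \<kappa>_def)
 have p1: "1 - p = - (a * \<kappa>)" by (simp add: p \<kappa>_def)
 have p2: "2 - p = 2 * b * \<kappa>" using ab by (simp add: p \<kappa>_def field_simps)
 have kb: "b / (a + 2 * b) = b * \<kappa>" by (simp add: \<kappa>_def)
 define X Y where "X = sum F I" and "Y = sum G L"
 have X0: "X \<ge> 0" and Y0: "Y \<ge> 0" unfolding X_def Y_def using F G by (auto intro: sum_nonneg)
 define C1 C2 where "C1 = 1 / (1 - 2 powr (- a))" and "C2 = 1 / (1 - 2 powr (- (b * \<kappa>)))"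
 have r1: "(0::real) < 2 powr (- a)" "2 powr (- a) < (1::real)" using a by (auto simp: powr_less_one)
 have r2: "(0::real) < 2 powr (- (b * \<kappa>))" "2 powr (- (b * \<kappa>)) < (1::real)" using b \<kappa> by (auto simp: powr_less_one)
 have C: "C1 > 0" "C2 > 0" unfolding C1_def C2_def using r1 r2 by auto
 show ?thesis
 proof (cases "X = 0 \<or> Y = 0")
  case True
  have "D j m l \<le> 0" if "j < J" "m \<in> I" "l \<in> L" for j m l
  proof -
   have "F m = 0 \<or> G l = 0"
    using True that fin F G unfolding X_def Y_def by (auto simp: sum_nonneg_eq_0_iff)
   then show ?thesis using D1[OF that] by auto
  qed
  then have "(\<Sum>m\<in>I. \<Sum>l\<in>L. \<Sum>j<J. D j m l) \<le> 0" by (intro sum_nonpos) auto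
  also have "0 \<le> A * (C1 + 2 * C2) * (X * Y) powr (1 / p)"
   using A C by (intro mult_nonneg_nonneg) auto
  finally show ?thesis unfolding C1_def C2_def X_def Y_def kb by simp
 next
  case False
  then have X: "X > 0" and Y: "Y > 0" using X0 Y0 by auto
  define Z where "Z = sqrt (X * Y)"
  have Z: "Z > 0" using X Y by (simp add: Z_def)
  have ZZ: "Z * Z = X * Y" using X Y by (simp add: Z_def)
  define c where "c = Z powr (1 / (a + b))"
  have c: "c > 0" using Z by (simp add: c_def)
  define \<rho> where "\<rho> = sqrt (Y / X)"
  have lam: "\<rho> > 0" using X Y by (simp add: \<rho>_def)
  have lX: "\<rho> * X = Z" "Y / \<rho> = Z"
  proof -
   have *: "\<rho> * sqrt X = sqrt Y" using X by (simp add: \<rho>_def real_sqrt_divide)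
   have "\<rho> * X = (\<rho> * sqrt X) * sqrt X" using X by simp
   then show "\<rho> * X = Z" unfolding * by (simp add: Z_def real_sqrt_mult)
   have "Y / \<rho> = sqrt X * (Y / (\<rho> * sqrt X))" using X by simp
   also have "... = sqrt X * sqrt Y" unfolding * using Y by (simp only: real_div_sqrt less_imp_le)
   finally show "Y / \<rho> = Z" by (simp add: Z_def real_sqrt_mult)
  qed
  define t where "t j = \<epsilon> * 2 ^ j" for j :: nat
  define T where "T m l = c * 2 powr (- (\<kappa> * real_of_int (m + l)))" for m l :: int
  have t0: "t j > 0" for j using eps by (simp add: t_def)
  have T0: "T m l > 0" for m l using c by (simp add: T_def)
  have T_sym: "T m l = T l m" for m l by (simp add: T_def add.commute)
  \<comment> \<open>Beyond the cut the first bound is a geometric progression in \<open>j\<close>.\<close>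
  have large: "(\<Sum>j\<in>{j\<in>{..<J}. T m l \<le> t j}. D j m l) \<le> A * c powr (- a) * C1 * (F m * G l)"
   if m: "m \<in> I" and l: "l \<in> L" for m l
  proof -
   let ?S = "{j\<in>{..<J}. T m l \<le> t j}"
   define z where "z = (\<epsilon> / T m l) powr (- a)"
   have z: "z > 0" using eps T0[of m l] by (simp add: z_def)
   have zr: "z * (2 powr (- a)) powr (real_of_int (int j)) = (t j / T m l) powr (- a)" for j
   proof -
    have "(2 powr (- a)) powr (real j) = (2 ^ j) powr (- a)"
     by (simp add: powr_powr powr_realpow[symmetric] mult.commute)
    then show ?thesis
     using eps T0[of m l] by (simp add: z_def t_def powr_mult[symmetric])
   qed
   have iff: "z * (2 powr (- a)) powr (real_of_int (int j)) \<le> 1 \<longleftrightarrow> T m l \<le> t j" for j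
   proof -
    have "(t j / T m l) powr (- a) \<le> 1 \<longleftrightarrow> 1 \<le> (t j / T m l) powr a"
     using t0[of j] T0[of m l] by (simp add: powr_minus inverse_le_1_iff)
    also have "... \<longleftrightarrow> 1 \<le> t j / T m l"
     using a t0[of j] T0[of m l] powr_le_cancel_iff[of a]
     by (smt (verit) powr_one_eq_one powr_less_mono2 powr_mono2 divide_pos_pos)
    finally show ?thesis unfolding zr using T0[of m l] by simp
   qed
   have "(\<Sum>j\<in>?S. D j m l) \<le> (\<Sum>j\<in>?S. A * c powr (- a) * (F m * G l) * (t j / T m l) powr (- a))"
   proof (rule sum_mono)
    fix j assume j: "j \<in> ?S"
    have "t j powr (- a) = T m l powr (- a) * (t j / T m l) powr (- a)"
     using t0[of j] T0[of m l] by (simp add: powr_mult[symmetric])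
    moreover have "T m l powr (- a) * 2 powr (real_of_int m * (1 - p)) * 2 powr (real_of_int l * (1 - p)) = c powr (- a)"
     unfolding T_def p1 using c by (simp add: powr_mult powr_powr powr_add[symmetric] algebra_simps)
    ultimately have eq: "A * t j powr (- a) * (2 powr (real_of_int m * (1 - p)) * F m) * (2 powr (real_of_int l * (1 - p)) * G l)
      = A * c powr (- a) * (F m * G l) * (t j / T m l) powr (- a)"
    proof -
     assume t: "t j powr (- a) = T m l powr (- a) * (t j / T m l) powr (- a)"
      and c: "T m l powr (- a) * 2 powr (real_of_int m * (1 - p)) * 2 powr (real_of_int l * (1 - p)) = c powr (- a)"
     show ?thesis unfolding t c[symmetric] by (simp only: mult_ac)
    qed
    have "D j m l \<le> A * t j powr (- a) * (2 powr (real_of_int m * (1 - p)) * F m) * (2 powr (real_of_int l * (1 - p)) * G l)"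
     unfolding t_def using j m l by (intro D1) auto
    then show "D j m l \<le> A * c powr (- a) * (F m * G l) * (t j / T m l) powr (- a)"
     unfolding eq .
   qed
   also have "... = A * c powr (- a) * (F m * G l) * (\<Sum>j\<in>?S. (t j / T m l) powr (- a))"
    by (simp add: sum_distrib_left)
   also have "... \<le> A * c powr (- a) * (F m * G l) * C1"
   proof (rule mult_left_mono)
   have "(\<Sum>j\<in>?S. (t j / T m l) powr (- a)) =
     (\<Sum>i\<in>{i\<in>int ` {..<J}. z * (2 powr (- a)) powr (real_of_int i) \<le> 1}. z * (2 powr (- a)) powr (real_of_int i))"
   proof -
    have "{i\<in>int ` {..<J}. z * (2 powr (- a)) powr (real_of_int i) \<le> 1} = int ` ?S"
     using iff by auto
    then show ?thesis by (simp only: zr sum.reindex inj_on_of_nat o_def)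
   qed
   also have "... \<le> C1" unfolding C1_def using r1 z by (intro geometric_sum_le) auto
   finally show "(\<Sum>j\<in>?S. (t j / T m l) powr (- a)) \<le> C1" .
   qed (use A F[OF m] G[OF l] in simp)
   finally show ?thesis by (simp add: mult_ac)
  qed
  \<comment> \<open>Before the cut, the distance of \<open>t j\<close> to it varies geometrically with either height.\<close>
  have geo: "(\<Sum>l\<in>{l\<in>S. t j < T m l}. (t j / T m l) powr b) \<le> C2" if "finite S" for S j m
  proof -
   define z where "z = (t j / c) powr b * 2 powr (\<kappa> * b * m)"
   have z: "z > 0" using t0[of j] c by (simp add: z_def)
   have zr: "z * (2 powr (- (b * \<kappa>))) powr (real_of_int (- l)) = (t j / T m l) powr b" for l
   proof -
    have "t j / T m l = t j / c * 2 powr (\<kappa> * real_of_int (m + l))"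
     unfolding T_def powr_minus_divide by simp
    then have "(t j / T m l) powr b = (t j / c) powr b * 2 powr (\<kappa> * real_of_int (m + l) * b)"
     using t0[of j] c by (simp only: powr_mult powr_powr divide_nonneg_pos less_imp_le powr_ge_zero)
    also have "2 powr (\<kappa> * real_of_int (m + l) * b) = 2 powr (\<kappa> * b * m) * 2 powr (- (b * \<kappa>) * real_of_int (- l))"
     unfolding powr_add[symmetric] by (simp add: algebra_simps)
    finally show ?thesis by (simp add: z_def powr_powr)
   qed
   have sub: "uminus ` {l\<in>S. t j < T m l} \<subseteq> {i\<in>uminus ` S. z * (2 powr (- (b * \<kappa>))) powr (real_of_int i) \<le> 1}"
   proof clarify
    fix l assume l: "l \<in> S" "t j < T m l"
    have "(t j / T m l) powr b \<le> 1"
     using l t0[of j] T0[of m l] b by (intro powr_le1) auto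
    then show "- l \<in> uminus ` S \<and> z * (2 powr (- (b * \<kappa>))) powr (real_of_int (- l)) \<le> 1"
     unfolding zr using l by simp
   qed
   have "(\<Sum>l\<in>{l\<in>S. t j < T m l}. (t j / T m l) powr b) =
    (\<Sum>i\<in>uminus ` {l\<in>S. t j < T m l}. z * (2 powr (- (b * \<kappa>))) powr (real_of_int i))"
   proof -
    have inj: "inj_on uminus B" for B :: "int set" by (simp add: inj_on_def)
    show ?thesis by (simp only: sum.reindex[OF inj] o_def zr)
   qed
   also have "... \<le> (\<Sum>i\<in>{i\<in>uminus ` S. z * (2 powr (- (b * \<kappa>))) powr (real_of_int i) \<le> 1}. z * (2 powr (- (b * \<kappa>))) powr (real_of_int i))"
    using sub that z by (intro sum_mono2) auto
   also have "... \<le> C2" unfolding C2_def using r2 z that by (intro geometric_sum_le) auto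
   finally show ?thesis .
  qed
  define g where "g j m l = (if t j < T m l then (t j / T m l) powr b else 0)" for j m l
  have g0: "g j m l \<ge> 0" for j m l by (simp add: g_def)
  have gsum1: "(\<Sum>l\<in>L. g j m l) \<le> C2" for j m
   using geo[OF fin(2), of j m] fin by (simp add: g_def sum.If_cases Int_def)
  have gsum2: "(\<Sum>m\<in>I. g j m l) \<le> C2" for j l
   using geo[OF fin(1), of j l] fin by (simp add: g_def sum.If_cases Int_def T_sym[of l])
  have small: "(if t j < T m l then D j m l else 0) \<le>
    A * c powr b * (\<rho> * (2 powr (- (2 * b * \<kappa> * m)) * x j m) * g j m l + (2 powr (- (2 * b * \<kappa> * l)) * y j l) / \<rho> * g j m l)"
   if j: "j < J" and m: "m \<in> I" and l: "l \<in> L" for j m l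
  proof (cases "t j < T m l")
   case True
   define s where "s = 2 powr (b * \<kappa> * (l - m))"
   have s: "s > 0" by (simp add: s_def)
   have tb: "t j powr b = T m l powr b * (t j / T m l) powr b"
    using t0[of j] T0[of m l] by (simp add: powr_mult[symmetric])
   have Tb: "T m l powr b = c powr b * 2 powr (- (\<kappa> * real_of_int (m + l)) * b)"
    unfolding T_def using c by (simp only: powr_mult powr_powr less_imp_le powr_ge_zero)
   have Ts: "T m l powr b * s = c powr b * 2 powr (- (2 * b * \<kappa> * m))"
    unfolding Tb s_def mult.assoc powr_add[symmetric] by (simp add: algebra_simps)
   have Ts': "T m l powr b / s = c powr b * 2 powr (- (2 * b * \<kappa> * l))"
    unfolding Tb s_def times_divide_eq_right[symmetric] powr_diff[symmetric] by (simp add: algebra_simps)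
   have "D j m l \<le> A * t j powr b * (\<rho> * s * x j m + y j l / (\<rho> * s))"
    using D2[OF j m l, of "\<rho> * s"] lam s by (simp add: t_def)
   also have "... = A * (t j / T m l) powr b * (\<rho> * (T m l powr b * s) * x j m + (T m l powr b / s) * y j l / \<rho>)"
    unfolding tb by (simp add: algebra_simps)
   also have "... = A * c powr b * (\<rho> * (2 powr (- (2 * b * \<kappa> * m)) * x j m) * g j m l + (2 powr (- (2 * b * \<kappa> * l)) * y j l) / \<rho> * g j m l)"
    unfolding Ts Ts' using True by (simp add: g_def algebra_simps)
   finally show ?thesis using True by simp
  qed (simp add: g_def)
  have split: "(\<Sum>j<J. D j m l) = (\<Sum>j\<in>{j\<in>{..<J}. T m l \<le> t j}. D j m l) + (\<Sum>j<J. if t j < T m l then D j m l else 0)" for m l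
  proof -
   have "(\<Sum>j<J. D j m l) = (\<Sum>j<J. (if T m l \<le> t j then D j m l else 0) + (if t j < T m l then D j m l else 0))"
    by (intro sum.cong) auto
   then show ?thesis by (simp add: sum.distrib sum.If_cases Int_def)
  qed
  have xs: "(\<Sum>j<J. 2 powr (- (2 * b * \<kappa> * m)) * x j m) \<le> F m" if "m \<in> I" for m
  proof -
   have "(\<Sum>j<J. 2 powr (- (2 * b * \<kappa> * m)) * x j m) \<le> 2 powr (- (2 * b * \<kappa> * m)) * (2 powr (real_of_int m * (2 - p)) * F m)"
    unfolding sum_distrib_left[symmetric] using x[OF that] by (intro mult_left_mono) auto
   also have "... = 2 powr (- (2 * b * \<kappa> * m) + real_of_int m * (2 - p)) * F m"
    by (simp only: powr_add mult.assoc)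
   also have "... = F m"
    unfolding p2 by simp
   finally show ?thesis .
  qed
  have ys: "(\<Sum>j<J. 2 powr (- (2 * b * \<kappa> * l)) * y j l) \<le> G l" if "l \<in> L" for l
  proof -
   have "(\<Sum>j<J. 2 powr (- (2 * b * \<kappa> * l)) * y j l) \<le> 2 powr (- (2 * b * \<kappa> * l)) * (2 powr (real_of_int l * (2 - p)) * G l)"
    unfolding sum_distrib_left[symmetric] using y[OF that] by (intro mult_left_mono) auto
   also have "... = 2 powr (- (2 * b * \<kappa> * l) + real_of_int l * (2 - p)) * G l"
    by (simp only: powr_add mult.assoc)
   also have "... = G l"
    unfolding p2 by simp
   finally show ?thesis .
  qed
  have part_x: "(\<Sum>m\<in>I. \<Sum>l\<in>L. \<Sum>j<J. \<rho> * (2 powr (- (2 * b * \<kappa> * m)) * x j m) * g j m l) \<le> \<rho> * C2 * X"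
  proof -
   have "(\<Sum>m\<in>I. \<Sum>l\<in>L. \<Sum>j<J. \<rho> * (2 powr (- (2 * b * \<kappa> * m)) * x j m) * g j m l) =
     (\<Sum>m\<in>I. \<Sum>j<J. \<rho> * (2 powr (- (2 * b * \<kappa> * m)) * x j m) * (\<Sum>l\<in>L. g j m l))"
    by (simp only: sum_distrib_left sum.swap[of _ "{..<J}" L])
   also have "... \<le> (\<Sum>m\<in>I. \<Sum>j<J. \<rho> * (2 powr (- (2 * b * \<kappa> * m)) * x j m) * C2)"
    using lam x0 gsum1 by (intro sum_mono mult_left_mono) auto
   also have "... = \<rho> * C2 * (\<Sum>m\<in>I. \<Sum>j<J. 2 powr (- (2 * b * \<kappa> * m)) * x j m)"
    by (simp add: sum_distrib_left mult_ac)
   also have "... \<le> \<rho> * C2 * X"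
    unfolding X_def using lam C xs by (intro mult_left_mono sum_mono) auto
   finally show ?thesis .
  qed
  have part_y: "(\<Sum>m\<in>I. \<Sum>l\<in>L. \<Sum>j<J. (2 powr (- (2 * b * \<kappa> * l)) * y j l) / \<rho> * g j m l) \<le> C2 * (Y / \<rho>)"
  proof -
   have "(\<Sum>m\<in>I. \<Sum>l\<in>L. \<Sum>j<J. (2 powr (- (2 * b * \<kappa> * l)) * y j l) / \<rho> * g j m l) =
     (\<Sum>l\<in>L. \<Sum>m\<in>I. \<Sum>j<J. (2 powr (- (2 * b * \<kappa> * l)) * y j l) / \<rho> * g j m l)"
    by (rule sum.swap)
   also have "... = (\<Sum>l\<in>L. \<Sum>j<J. (2 powr (- (2 * b * \<kappa> * l)) * y j l) / \<rho> * (\<Sum>m\<in>I. g j m l))"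
    by (simp only: sum_distrib_left sum.swap[of _ "{..<J}" I])
   also have "... \<le> (\<Sum>l\<in>L. \<Sum>j<J. (2 powr (- (2 * b * \<kappa> * l)) * y j l) / \<rho> * C2)"
    using lam y0 gsum2 by (intro sum_mono mult_left_mono) auto
   also have "... = C2 * ((\<Sum>l\<in>L. \<Sum>j<J. 2 powr (- (2 * b * \<kappa> * l)) * y j l) / \<rho>)"
    by (simp add: sum_distrib_left sum_divide_distrib mult_ac)
   also have "... \<le> C2 * (Y / \<rho>)"
    unfolding Y_def using lam C ys by (intro mult_left_mono divide_right_mono sum_mono) auto
   finally show ?thesis .
  qed
  have "(\<Sum>m\<in>I. \<Sum>l\<in>L. \<Sum>j<J. D j m l) =
   (\<Sum>m\<in>I. \<Sum>l\<in>L. \<Sum>j\<in>{j\<in>{..<J}. T m l \<le> t j}. D j m l) + (\<Sum>m\<in>I. \<Sum>l\<in>L. \<Sum>j<J. if t j < T m l then D j m l else 0)"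
   by (simp only: split sum.distrib)
  also have "(\<Sum>m\<in>I. \<Sum>l\<in>L. \<Sum>j\<in>{j\<in>{..<J}. T m l \<le> t j}. D j m l) \<le> (\<Sum>m\<in>I. \<Sum>l\<in>L. A * c powr (- a) * C1 * (F m * G l))"
   by (intro sum_mono large)
  also have "... = A * c powr (- a) * C1 * (X * Y)"
   unfolding X_def Y_def sum_product by (simp only: sum_distrib_left)
  also have "(\<Sum>m\<in>I. \<Sum>l\<in>L. \<Sum>j<J. if t j < T m l then D j m l else 0) \<le>
    (\<Sum>m\<in>I. \<Sum>l\<in>L. \<Sum>j<J. A * c powr b * (\<rho> * (2 powr (- (2 * b * \<kappa> * m)) * x j m) * g j m l + (2 powr (- (2 * b * \<kappa> * l)) * y j l) / \<rho> * g j m l))"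
   by (intro sum_mono small) auto
  also have "... = A * c powr b * ((\<Sum>m\<in>I. \<Sum>l\<in>L. \<Sum>j<J. \<rho> * (2 powr (- (2 * b * \<kappa> * m)) * x j m) * g j m l) +
    (\<Sum>m\<in>I. \<Sum>l\<in>L. \<Sum>j<J. (2 powr (- (2 * b * \<kappa> * l)) * y j l) / \<rho> * g j m l))"
   by (simp only: sum_distrib_left[symmetric] sum.distrib)
  also have "... \<le> A * c powr b * (\<rho> * C2 * X + C2 * (Y / \<rho>))"
   using A by (intro mult_left_mono add_mono part_x part_y) auto
  also have "\<rho> * C2 * X + C2 * (Y / \<rho>) = 2 * C2 * Z"
   using lX by (simp add: mult_ac)
  also have "A * c powr (- a) * C1 * (X * Y) + A * c powr b * (2 * C2 * Z) = A * (C1 + 2 * C2) * (c powr b * Z)"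
  proof -
   have "c powr (- a) * Z = c powr b"
   proof -
    have "Z = c powr (a + b)" using a b Z by (simp add: c_def powr_powr)
    then show ?thesis using c by (simp add: powr_add[symmetric])
   qed
   then have "c powr (- a) * (X * Y) = c powr b * Z"
    by (simp add: ZZ[symmetric] mult.assoc[symmetric])
   then have "A * c powr (- a) * C1 * (X * Y) = A * C1 * (c powr b * Z)"
    by (simp add: mult_ac)
   then show ?thesis by (simp add: algebra_simps)
  qed
  also have "c powr b * Z = (X * Y) powr (1 / p)"
  proof -
   have e: "1 / p = (a + 2 * b) / (2 * (a + b))"
    using a b by (simp add: p field_simps)
   have "c powr b * Z = Z powr (b / (a + b) + 1)"
    using Z by (simp add: c_def powr_powr powr_add)
   also have "... = ((X * Y) powr (1 / 2)) powr (b / (a + b) + 1)"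
    using X Y by (simp add: Z_def powr_half_sqrt)
   also have "... = (X * Y) powr (1 / p)"
    unfolding e powr_powr using a b by (intro arg_cong[where f = "%e. (X * Y) powr e"]) (simp add: field_simps)
   finally show ?thesis .
  qed
  finally show ?thesis
   unfolding C1_def C2_def X_def Y_def kb by simp
 qed
qed

section \<open>Quadratic estimates for the heat semigroup\<close>

lemma conv_commute: "conv a b x = conv b a (x::'a::euclidean_space)"
 if [measurable]: "Borel a" "Borel b"
proof -
 have "conv a b x = (LBINT y. a (x - (x - y)) * b (x - y))"
  unfolding conv_def by (rule integral_lborel_reflect[symmetric]) measurable
 then show ?thesis by (simp add: conv_def mult.commute)
qed

lemma nn_integral_conv_le:
 fixes a b :: "'a::euclidean_space => real"
 assumes a: "bddint a" and b: "bddint b"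
 shows "mass (conv a b) \<le> mass a * mass b"
proof -
 have [measurable]: "Borel a" "Borel b"
  using a b by (auto simp: bddint_def)
 have "mass (conv a b) \<le> (\<integral>\<^sup>+x. \<integral>\<^sup>+y. ennreal \<bar>a (x - y) * b y\<bar> \<partial>lborel \<partial>lborel)"
 proof (rule nn_integral_mono)
  fix x
  show "ennreal \<bar>conv a b x\<bar> \<le> mass (%y. a (x - y) * b y)"
   using integral_norm_bound_ennreal[OF conv_integrand_integrable[OF a bddintD(2)[OF b], of x]]
   by (simp add: conv_def)
 qed
 also have "... = (\<integral>\<^sup>+y. \<integral>\<^sup>+x. ennreal \<bar>a (x - y) * b y\<bar> \<partial>lborel \<partial>lborel)"
  by (rule lborel_pair.Fubini') measurable
 also have "... = (\<integral>\<^sup>+y. mass (%x. a (x - y)) * ennreal \<bar>b y\<bar> \<partial>lborel)"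
  by (intro nn_integral_cong) (simp add: abs_mult ennreal_mult nn_integral_multc)
 also have "... = (\<integral>\<^sup>+y. mass a * ennreal \<bar>b y\<bar> \<partial>lborel)"
  by (subst nn_integral_lborel_translate_minus[where f = "%x. ennreal \<bar>a x\<bar>"]) simp_all
 also have "... = mass a * mass b"
  by (intro nn_integral_cmult) simp
 finally show ?thesis .
qed

lemma nn_integral_square:
 "bddint h ==> (\<integral>\<^sup>+x. ennreal ((h x)\<^sup>2) \<partial>lborel) = ennreal (LBINT x. (h x)\<^sup>2)"
 using bddint_mult_integrable[of h h]
 by (intro nn_integral_eq_integral) (auto simp: power2_eq_square)

text \<open>Schur's test for a convolution kernel, from \<open>2 \<bar>h x h y\<bar> \<le> (h x)\<^sup>2 + (h y)\<^sup>2\<close>.\<close>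

lemma schur_test:
 fixes h s :: "'a::euclidean_space => real"
 assumes h: "bddint h" and s[measurable]: "Borel s" and s0: "\<And>z. s z \<ge> 0"
  and C: "(\<integral>\<^sup>+z. ennreal (s z) \<partial>lborel) \<le> ennreal C" and C0: "C \<ge> 0"
 shows "(\<integral>\<^sup>+x. \<integral>\<^sup>+y. ennreal (\<bar>h x\<bar> * \<bar>h y\<bar> * s (x - y)) \<partial>lborel \<partial>lborel) \<le> ennreal (C * (LBINT x. (h x)\<^sup>2))"
proof -
 have [measurable]: "Borel h" using h by (auto simp: bddint_def)
 let ?S = "\<integral>\<^sup>+z. ennreal (s z) \<partial>lborel"
 let ?a = "%x y. ennreal ((h x)\<^sup>2 / 2) * ennreal (s (x - y))"
 let ?b = "%x y. ennreal ((h y)\<^sup>2 / 2) * ennreal (s (x - y))"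
 have "(\<integral>\<^sup>+x. \<integral>\<^sup>+y. ennreal (\<bar>h x\<bar> * \<bar>h y\<bar> * s (x - y)) \<partial>lborel \<partial>lborel) \<le>
   (\<integral>\<^sup>+x. \<integral>\<^sup>+y. ?a x y + ?b x y \<partial>lborel \<partial>lborel)"
 proof (intro nn_integral_mono)
  fix x y
  have "\<bar>h x\<bar> * \<bar>h y\<bar> \<le> (h x)\<^sup>2 / 2 + (h y)\<^sup>2 / 2"
   using sum_squares_bound[of "\<bar>h x\<bar>" "\<bar>h y\<bar>"] by simp
  then have "\<bar>h x\<bar> * \<bar>h y\<bar> * s (x - y) \<le> ((h x)\<^sup>2 / 2 + (h y)\<^sup>2 / 2) * s (x - y)"
   using s0 by (intro mult_right_mono)
  then have "ennreal (\<bar>h x\<bar> * \<bar>h y\<bar> * s (x - y)) \<le> ennreal (((h x)\<^sup>2 / 2 + (h y)\<^sup>2 / 2) * s (x - y))"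
   by (rule ennreal_leI)
  also have "... = ?a x y + ?b x y"
   using s0[of "x - y"] by (simp add: ennreal_mult''[symmetric] ennreal_plus[symmetric] distrib_right del: ennreal_plus)
  finally show "ennreal (\<bar>h x\<bar> * \<bar>h y\<bar> * s (x - y)) \<le> ?a x y + ?b x y" .
 qed
 also have "... = (\<integral>\<^sup>+x. \<integral>\<^sup>+y. ?a x y \<partial>lborel \<partial>lborel) + (\<integral>\<^sup>+x. \<integral>\<^sup>+y. ?b x y \<partial>lborel \<partial>lborel)"
  by (simp add: nn_integral_add)
 also have "(\<integral>\<^sup>+x. \<integral>\<^sup>+y. ?b x y \<partial>lborel \<partial>lborel) = (\<integral>\<^sup>+y. \<integral>\<^sup>+x. ?b x y \<partial>lborel \<partial>lborel)"
  by (rule lborel_pair.Fubini') measurable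
 also have "... = (\<integral>\<^sup>+y. ennreal ((h y)\<^sup>2 / 2) * ?S \<partial>lborel)"
  by (intro nn_integral_cong, subst nn_integral_cmult)
    (simp_all add: nn_integral_lborel_translate_minus[where f = "%x. ennreal (s x)"])
 also have "(\<integral>\<^sup>+x. \<integral>\<^sup>+y. ?a x y \<partial>lborel \<partial>lborel) = (\<integral>\<^sup>+x. ennreal ((h x)\<^sup>2 / 2) * ?S \<partial>lborel)"
  by (intro nn_integral_cong, subst nn_integral_cmult)
    (simp_all add: nn_integral_lborel_reflect[where f = "%x. ennreal (s x)"])
 also have "(\<integral>\<^sup>+x. ennreal ((h x)\<^sup>2 / 2) * ?S \<partial>lborel) + (\<integral>\<^sup>+x. ennreal ((h x)\<^sup>2 / 2) * ?S \<partial>lborel) =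
   (\<integral>\<^sup>+x. ennreal ((h x)\<^sup>2) \<partial>lborel) * ?S"
 proof -
  have "(\<integral>\<^sup>+x. ennreal ((h x)\<^sup>2 / 2) * ?S \<partial>lborel) + (\<integral>\<^sup>+x. ennreal ((h x)\<^sup>2 / 2) * ?S \<partial>lborel)
    = (\<integral>\<^sup>+x. (ennreal ((h x)\<^sup>2 / 2) + ennreal ((h x)\<^sup>2 / 2)) * ?S \<partial>lborel)"
   by (subst nn_integral_add[symmetric]) (simp_all add: distrib_right)
  also have "... = (\<integral>\<^sup>+x. ennreal ((h x)\<^sup>2) * ?S \<partial>lborel)"
   by (simp add: ennreal_plus[symmetric] del: ennreal_plus)
  finally show ?thesis by (simp add: nn_integral_multc)
 qed
 also have "... \<le> (\<integral>\<^sup>+x. ennreal ((h x)\<^sup>2) \<partial>lborel) * ennreal C"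
  by (intro mult_left_mono C) simp
 also have "... = ennreal (C * (LBINT x. (h x)\<^sup>2))"
  unfolding nn_integral_square[OF h] using C0 by (simp add: ennreal_mult'[symmetric] mult.commute)
 finally show ?thesis .
qed

subsection \<open>The energy of a function under the heat flow\<close>

text \<open>The quadratic form of \<open>exp (s \<Delta>)\<close>. It is the square integral of \<open>f\<close> after the heat flow up to
 time \<open>s / 2\<close>, so it is nonnegative and decreases in \<open>s\<close>.\<close>

definition energy :: "('a::euclidean_space => real) => real => real" where
 "energy f s = (LBINT x. f x * conv (heat s) f x)"

lemma energy_le:
 assumes f: "bddint f" and s: "s > 0"
 shows "energy f s \<le> (LBINT x. (f x)\<^sup>2)"
proof -
 have [measurable]: "Borel f" using f by (auto simp: bddint_def)
 have int: "integrable lborel (%x. f x * conv (heat s) f x)"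
  using f s by (intro bddint_mult_integrable bddint_conv bddint_heat) auto
 have "ennreal \<bar>energy f s\<bar> \<le> mass (%x. f x * conv (heat s) f x)"
  using integral_norm_bound_ennreal[OF int] by (simp add: energy_def)
 also have "... \<le> (\<integral>\<^sup>+x. \<integral>\<^sup>+y. ennreal (\<bar>f x\<bar> * \<bar>f y\<bar> * heat s (x - y)) \<partial>lborel \<partial>lborel)"
 proof (rule nn_integral_mono)
  fix x
  have "ennreal \<bar>conv (heat s) f x\<bar> \<le> mass (%y. heat s (x - y) * f y)"
   using integral_norm_bound_ennreal[OF conv_integrand_integrable[OF bddint_heat bddintD(2)[OF f], of s x]] s
   by (simp add: conv_def)
  then have "ennreal \<bar>f x\<bar> * ennreal \<bar>conv (heat s) f x\<bar> \<le> ennreal \<bar>f x\<bar> * mass (%y. heat s (x - y) * f y)"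
   by (rule mult_left_mono) simp
  also have "... = (\<integral>\<^sup>+y. ennreal (\<bar>f x\<bar> * \<bar>f y\<bar> * heat s (x - y)) \<partial>lborel)"
   by (subst nn_integral_cmult[symmetric]) (simp_all add: ennreal_mult'[symmetric] abs_mult mult_ac)
  finally show "ennreal \<bar>f x * conv (heat s) f x\<bar> \<le> (\<integral>\<^sup>+y. ennreal (\<bar>f x\<bar> * \<bar>f y\<bar> * heat s (x - y)) \<partial>lborel)"
   by (simp add: abs_mult ennreal_mult)
 qed
 also have "... \<le> ennreal (1 * (LBINT x. (f x)\<^sup>2))"
  using s by (intro schur_test f) (simp_all add: nn_integral_heat)
 finally have "\<bar>energy f s\<bar> \<le> (LBINT x. (f x)\<^sup>2)"
  by (subst (asm) ennreal_le_iff) auto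
 then show ?thesis by linarith
qed

lemma energy_add:
 assumes f: "bddint f" and s: "s > 0" and r: "r > 0"
 shows "energy f (2 * s + r) = energy (conv (heat s) f) r"
proof -
 have h: "bddint (heat s :: 'a => real)" "bddint (heat r :: 'a => real)" "bddint (heat (s + r) :: 'a => real)" using s r by (auto intro: bddint_heat)
 have "energy (conv (heat s) f) r = (LBINT x. f x * conv (heat s) (conv (heat r) (conv (heat s) f)) x)"
  unfolding energy_def using f h by (intro conv_adjoint bddint_conv) auto
 also have "conv (heat r) (conv (heat s) f) = conv (heat (r + s)) f"
  using f h s r by (simp add: conv_assoc conv_heat_heat)
 also have "conv (heat s) (conv (heat (r + s)) f) = conv (heat (2 * s + r)) f"
  using f h s r by (subst conv_assoc) (simp_all add: conv_heat_heat add.commute add.left_commute)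
 finally show ?thesis unfolding energy_def ..
qed

lemma energy_double:
 assumes f: "bddint f" and s: "s > 0"
 shows "energy f (2 * s) = (LBINT x. (conv (heat s) f x)\<^sup>2)"
proof -
 have h: "bddint (heat s :: 'a => real)" using s by (auto intro: bddint_heat)
 have "(LBINT x. conv (heat s) f x * conv (heat s) f x) = (LBINT x. f x * conv (heat s) (conv (heat s) f) x)"
  using f h by (intro conv_adjoint bddint_conv) auto
 also have "conv (heat s) (conv (heat s) f) = conv (heat (2 * s)) f"
  using f h s by (subst conv_assoc) (simp_all add: conv_heat_heat)
 finally show ?thesis unfolding energy_def power2_eq_square ..
qed

lemma energy_nonneg: "bddint f ==> s > 0 ==> energy f s \<ge> 0"
 using energy_double[of f "s / 2"] by simp

lemma energy_antimono:
 assumes f: "bddint f" and s: "0 < s" "s < u"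
 shows "energy f u \<le> energy f s"
proof -
 have h: "bddint (heat (s / 2) :: 'a => real)" using s by (auto intro: bddint_heat)
 have "energy f (2 * (s / 2) + (u - s)) = energy (conv (heat (s / 2)) f) (u - s)"
  using f s by (intro energy_add) auto
 also have "... \<le> (LBINT x. (conv (heat (s / 2)) f x)\<^sup>2)"
  using f s h by (intro energy_le bddint_conv) auto
 also have "... = energy f (2 * (s / 2))"
  using f s by (intro energy_double[symmetric]) auto
 finally show ?thesis by simp
qed

text \<open>The polynomial \<open>X (1 - X)\<close>: as an operator, a difference of two heat operators.\<close>

definition dpoly :: "real poly" where "dpoly = [:0, 1, -1:]"

definition square_fun :: "('a::euclidean_space => real) => real => real" where
 "square_fun f t = (LBINT x. (conv (hk dpoly t) f x)\<^sup>2)"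

lemma square_fun_nonneg: "square_fun f t \<ge> 0"
 by (auto simp: square_fun_def)

text \<open>This is \<open>(X - X\<^sup>2)\<^sup>2 = X\<^sup>2 - 2 X\<^sup>3 + X\<^sup>4\<close>.\<close>

lemma square_fun_eq:
 assumes f: "bddint f" and t: "t > 0"
 shows "square_fun f t = energy f (2 * t) - 2 * energy f (3 * t) + energy f (4 * t)"
proof -
 have h: "bddint (hk dpoly t :: 'a => real)" using t by (auto intro: bddint_hk)
 have int: "integrable lborel (%x. f x * conv (heat (real i * t)) f x)" for i
  using f t by (intro bddint_mult_integrable bddint_conv bddint_heat) auto
 have "square_fun f t = (LBINT x. conv (hk dpoly t) f x * conv (hk dpoly t) f x)"
  by (simp add: square_fun_def power2_eq_square)
 also have "... = (LBINT x. f x * conv (hk dpoly t) (conv (hk dpoly t) f) x)"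
  using f h by (intro conv_adjoint bddint_conv) (auto simp: hk_minus)
 also have "conv (hk dpoly t) (conv (hk dpoly t) f) = conv (hk (dpoly * dpoly) t) f"
  using f h t by (subst conv_assoc) (simp_all add: conv_hk_hk dpoly_def)
 also have "(LBINT x. f x * conv (hk (dpoly * dpoly) t) f x) =
   (LBINT x. plin (dpoly * dpoly) (%i. f x * conv (heat (real i * t)) f x))"
 proof -
  have "conv (hk (dpoly * dpoly) t) f x = plin (dpoly * dpoly) (%i. conv (heat (real i * t)) f x)" for x
  proof -
   have "hk (dpoly * dpoly) t = (%x::'a. plin (dpoly * dpoly) (%i. heat (real i * t) x))"
    by (simp add: hk_def fun_eq_iff)
   then show ?thesis
    using t f by (simp only:) (intro conv_plin_left bddint_heat bddintD, auto)
  qed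
  then show ?thesis by (simp only: plin_fun_cmult)
 qed
 also have "... = plin (dpoly * dpoly) (%i. energy f (real i * t))"
  unfolding energy_def by (rule plin_integral[OF int])
 also have "... = energy f (2 * t) - 2 * energy f (3 * t) + energy f (4 * t)"
  by (simp add: dpoly_def plin_pCons mult_pCons_left)
 finally show ?thesis .
qed

text \<open>The energy decreases along the heat flow, so the square functions at dyadic times
 are dominated by a telescoping sum.\<close>

lemma square_fun_sum_le:
 assumes f: "bddint f" and e: "\<epsilon> > 0"
 shows "(\<Sum>j<J. square_fun f (\<epsilon> * 2 ^ j)) \<le> (LBINT x. (f x)\<^sup>2)"
proof -
 have "(\<Sum>j<J. square_fun f (\<epsilon> * 2 ^ j)) \<le> (\<Sum>j<J. energy f (2 * (\<epsilon> * 2 ^ j)) - energy f (2 * (\<epsilon> * 2 ^ Suc j)))"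
 proof (rule sum_mono)
  fix j
  let ?t = "\<epsilon> * 2 ^ j"
  have t: "?t > 0" using e by simp
  have "energy f (4 * ?t) \<le> energy f (3 * ?t)"
   using t by (intro energy_antimono f) auto
  then show "square_fun f ?t \<le> energy f (2 * ?t) - energy f (2 * (\<epsilon> * 2 ^ Suc j))"
   using energy_antimono[OF f, of "3 * ?t" "4 * ?t"] t by (simp add: square_fun_eq[OF f t] mult_ac)
 qed
 also have "... = energy f (2 * (\<epsilon> * 2 ^ 0)) - energy f (2 * (\<epsilon> * 2 ^ J))"
  by (rule sum_lessThan_telescope')
 also have "... \<le> energy f (2 * \<epsilon>)"
  using energy_nonneg[OF f, of "2 * (\<epsilon> * 2 ^ J)"] e by simp
 also have "... \<le> (LBINT x. (f x)\<^sup>2)"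
  using e by (intro energy_le f) simp
 finally show ?thesis .
qed

section \<open>Averaging operators\<close>

text \<open>The operators \<open>Avg th\<close> are convolutions with the images of one finite measure under
 a family of maps; for the rotated surface measures, \<open>\<gamma> th u\<close> is the rotated point with
 parameter \<open>u\<close>.\<close>

locale averaging = H: finite_measure H + M: finite_measure M
 for H :: "'t measure" and M :: "'b measure" +
 fixes \<gamma> :: "'t => 'b => 'a::euclidean_space"
 assumes \<gamma>_measurable: "(%(th, b). \<gamma> th b) \<in> borel_measurable (H \<Otimes>\<^sub>M M)"
begin

sublocale LM: pair_sigma_finite "lborel :: 'a measure" M ..
sublocale MM: pair_sigma_finite M M ..
sublocale HL: pair_sigma_finite H "lborel :: 'a measure" ..

lemma \<gamma>_measurable' [measurable (raw)]:
 "f \<in> measurable N H ==> g \<in> measurable N M ==> (%x. \<gamma> (f x) (g x)) \<in> borel_measurable N"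
 using measurable_compose[OF measurable_Pair \<gamma>_measurable, of f N g] by simp

definition Avg :: "'t => ('a => real) => 'a => real" where
 "Avg th g x = (LINT b|M. g (x - \<gamma> th b))"

lemma Avg_measurable_pair:
 assumes [measurable]: "Borel g"
 shows "(%(th, x). Avg th g x) \<in> borel_measurable (leb H)"
 unfolding Avg_def by measurable

lemma Avg_integrand_integrable:
 fixes g :: "'a => real"
 assumes [measurable]: "Borel g" and "\<And>x. \<bar>g x\<bar> \<le> B" and [measurable]: "th \<in> space H"
 shows "integrable M (%b. g (x - \<gamma> th b))"
 by (rule M.integrable_const_bound[of _ B]) (use assms in auto)

lemma Avg_abs_le:
 assumes "Borel g" and B: "\<And>x. \<bar>g x\<bar> \<le> B" and "th \<in> space H"
 shows "\<bar>Avg th g x\<bar> \<le> B * measure M (space M)"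
proof -
 have "\<bar>Avg th g x\<bar> \<le> (LINT b|M. \<bar>g (x - \<gamma> th b)\<bar>)"
  unfolding Avg_def by (rule integral_abs_bound)
 also have "... \<le> (LINT b|M. B)"
  using assms Avg_integrand_integrable[OF assms] by (intro integral_mono integrable_abs) auto
 finally show ?thesis by (simp add: mult.commute)
qed

lemma nn_integral_Avg_le:
 assumes g: "bddint g" and [measurable]: "th \<in> space H"
 shows "mass (Avg th g) \<le> ennreal (measure M (space M) * (LBINT x. \<bar>g x\<bar>))"
proof -
 have [measurable]: "Borel g" using g by (auto simp: bddint_def)
 obtain B where B: "\<And>x. \<bar>g x\<bar> \<le> B" using g by (auto simp: bddint_def)
 have "mass (Avg th g) \<le> (\<integral>\<^sup>+x. \<integral>\<^sup>+b. ennreal \<bar>g (x - \<gamma> th b)\<bar> \<partial>M \<partial>lborel)"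
 proof (rule nn_integral_mono)
  fix x
  show "ennreal \<bar>Avg th g x\<bar> \<le> (\<integral>\<^sup>+b. ennreal \<bar>g (x - \<gamma> th b)\<bar> \<partial>M)"
   using integral_norm_bound_ennreal[OF Avg_integrand_integrable[of g B th x]] B assms
   by (simp add: Avg_def)
 qed
 also have "... = (\<integral>\<^sup>+b. \<integral>\<^sup>+x. ennreal \<bar>g (x - \<gamma> th b)\<bar> \<partial>lborel \<partial>M)"
  by (rule LM.Fubini'[symmetric]) measurable
 also have "... = (\<integral>\<^sup>+b. mass g \<partial>M)"
  by (simp add: nn_integral_lborel_translate_minus[where f = "%x. ennreal \<bar>g x\<bar>"])
 also have "mass g = ennreal (LBINT x. \<bar>g x\<bar>)"
  using g by (intro nn_integral_eq_integral) (auto simp: bddint_def)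
 also have "(\<integral>\<^sup>+b. ennreal (LBINT x. \<bar>g x\<bar>) \<partial>M) = ennreal (measure M (space M) * (LBINT x. \<bar>g x\<bar>))"
  by (simp add: M.emeasure_eq_measure ennreal_mult'[symmetric] mult.commute)
 finally show ?thesis .
qed

lemma bddint_Avg:
 assumes g: "bddint g" and th[measurable]: "th \<in> space H"
 shows "bddint (Avg th g)"
proof -
 have [measurable]: "Borel g" using g by (auto simp: bddint_def)
 obtain B where B: "\<And>x. \<bar>g x\<bar> \<le> B" using g by (auto simp: bddint_def)
 have m[measurable]: "Borel (Avg th g)"
  unfolding Avg_def[abs_def] by measurable
 have "integrable lborel (Avg th g)"
  using nn_integral_Avg_le[OF g th] by (intro integrableI_bounded) (auto simp: less_top[symmetric] top_unique)
 then show ?thesis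
  using Avg_abs_le[of g B th] B th m \<open>g \<in> borel_measurable borel\<close> unfolding bddint_def by blast
qed

lemma integrable_LM:
 assumes "integrable lborel (f::'a => real)"
 shows "integrable (lborel \<Otimes>\<^sub>M M) (%p. f (fst p))"
proof (rule integrableI_bounded)
 have [measurable]: "Borel f" using assms by auto
 show "(%p. f (fst p)) \<in> borel_measurable (lborel \<Otimes>\<^sub>M M)" by measurable
 have "(\<integral>\<^sup>+p. ennreal (norm (f (fst p))) \<partial>(lborel \<Otimes>\<^sub>M M)) = (\<integral>\<^sup>+x. \<integral>\<^sup>+b. ennreal (norm (f x)) \<partial>M \<partial>lborel)"
  by (subst M.nn_integral_fst[symmetric]) auto
 also have "... = (\<integral>\<^sup>+x. ennreal (norm (f x)) \<partial>lborel) * emeasure M (space M)"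
  by (simp add: nn_integral_multc)
 also have "... < \<infinity>"
  using assms by (simp add: integrable_iff_bounded ennreal_mult_less_top M.emeasure_eq_measure)
 finally show "(\<integral>\<^sup>+p. ennreal (norm (f (fst p))) \<partial>(lborel \<Otimes>\<^sub>M M)) < \<infinity>" .
qed

lemma conv_Avg:
 assumes g: "bddint g" and f: "bddint f" and th[measurable]: "th \<in> space H"
 shows "conv (Avg th g) f = Avg th (conv g f)"
proof
 fix x
 have [measurable]: "Borel g" "Borel f" using g f by (auto simp: bddint_def)
 obtain B where B: "\<And>x. \<bar>g x\<bar> \<le> B" using g by (auto simp: bddint_def)
 have int: "integrable (lborel \<Otimes>\<^sub>M M) (%(y, b). g (x - y - \<gamma> th b) * f y)"
  using integrable_bounded_mult[OF integrable_LM[OF bddintD(2)[OF f]], of "%p. g (x - fst p - \<gamma> th (snd p))" B] B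
  by (simp add: split_beta')
 have "conv (Avg th g) f x = (LBINT y. LINT b|M. g (x - y - \<gamma> th b) * f y)"
  unfolding conv_def Avg_def by simp
 also have "... = (LINT b|M. LINT y|lborel. g (x - y - \<gamma> th b) * f y)"
  using LM.Fubini_integral[OF int] by simp
 also have "... = Avg th (conv g f) x"
  unfolding conv_def Avg_def by (simp add: algebra_simps)
 finally show "conv (Avg th g) f x = Avg th (conv g f) x" .
qed

lemma conv_Avg_right:
 assumes k: "bddint k" and g: "bddint g" and th: "th \<in> space H"
 shows "conv k (Avg th g) = Avg th (conv k g)"
proof -
 have "conv k (Avg th g) = conv (Avg th g) k"
  using bddint_Avg[OF g th] k by (intro ext conv_commute) (auto simp: bddint_def)
 also have "... = Avg th (conv g k)" by (rule conv_Avg[OF g k th])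
 also have "conv g k = conv k g"
  using g k by (intro ext conv_commute) (auto simp: bddint_def)
 finally show ?thesis .
qed

subsection \<open>Families of functions, bounded and integrable uniformly in the parameter\<close>

text \<open>Functions of both variables to which Fubini's theorem and the convolution calculus apply in every
 section. The uniform bounds make the class stable under all the operations used here.\<close>

definition adm :: "('t => 'a => real) => bool" where
 "adm u \<longleftrightarrow> (%(th, x). u th x) \<in> borel_measurable (leb H) \<and>
   (\<exists>B\<ge>0. \<forall>th\<in>space H. (\<forall>x. \<bar>u th x\<bar> \<le> B) \<and> mass (u th) \<le> ennreal B)"

lemma admI:
 assumes "(%(th, x). u th x) \<in> borel_measurable (leb H)"
  and "\<And>th x. th \<in> space H ==> \<bar>u th x\<bar> \<le> B"
  and "\<And>th. th \<in> space H ==> mass (u th) \<le> ennreal C"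
 shows "adm u"
proof -
 let ?B = "max 0 (max B C)"
 have "\<forall>th\<in>space H. (\<forall>x. \<bar>u th x\<bar> \<le> ?B) \<and> mass (u th) \<le> ennreal ?B"
 proof (intro ballI conjI allI)
  fix th assume th: "th \<in> space H"
  show "\<bar>u th x\<bar> \<le> ?B" for x using assms(2)[OF th, of x] by linarith
  show "mass (u th) \<le> ennreal ?B"
   by (rule order_trans[OF assms(3)[OF th]]) (rule ennreal_leI, linarith)
 qed
 then show ?thesis unfolding adm_def using assms(1) by (intro conjI exI[of _ ?B]) auto
qed

lemma adm_measurable: "adm u ==> (%(th, x). u th x) \<in> borel_measurable (leb H)"
 by (simp add: adm_def)

lemma adm_section:
 assumes "adm u" "th \<in> space H" shows "Borel (u th)"
 using measurable_Pair2[OF adm_measurable[OF assms(1)] assms(2)] by simp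

lemma adm_bddint: assumes u: "adm u" and th: "th \<in> space H" shows "bddint (u th)"
proof -
 obtain B where B: "\<forall>x. \<bar>u th x\<bar> \<le> B" "mass (u th) \<le> ennreal B"
  using u th by (auto simp: adm_def)
 have "integrable lborel (u th)"
  using B(2) adm_section[OF u th] by (intro integrableI_bounded) (auto simp: less_top[symmetric] top_unique)
 then show ?thesis using B adm_section[OF u th] by (auto simp: bddint_def)
qed

lemma adm_integrable:
 assumes u: "adm u" shows "integrable (leb H) (%(th, x). u th x)"
proof (rule integrableI_bounded)
 note [measurable] = adm_measurable[OF u]
 show "(%(th, x). u th x) \<in> borel_measurable (leb H)" by measurable
 obtain B where B: "\<And>th. th \<in> space H ==> mass (u th) \<le> ennreal B"
  using u by (auto simp: adm_def)
 have "(\<integral>\<^sup>+p. ennreal (norm (case p of (th, x) => u th x)) \<partial>(leb H)) = (\<integral>\<^sup>+th. \<integral>\<^sup>+x. ennreal \<bar>u th x\<bar> \<partial>lborel \<partial>H)"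
  by (subst lborel.nn_integral_fst[symmetric]) auto
 also have "... \<le> (\<integral>\<^sup>+th. ennreal B \<partial>H)"
  by (intro nn_integral_mono B)
 also have "... < \<infinity>"
  by (simp add: ennreal_mult_less_top H.emeasure_eq_measure)
 finally show "(\<integral>\<^sup>+p. ennreal (norm (case p of (th, x) => u th x)) \<partial>(leb H)) < \<infinity>" .
qed

definition pint :: "('t => 'a => real) => real" where
 "pint u = (LINT p|(leb H). u (fst p) (snd p))"

lemma pint_iterated: "adm u ==> pint u = (LINT th|H. LINT x|lborel. u th x)"
 using HL.integral_fst'[OF adm_integrable[of u]] by (simp add: pint_def split_beta')

lemma adm_integrable': "adm u ==> integrable (leb H) (%p. u (fst p) (snd p))"
 using adm_integrable[of u] by (simp add: split_beta')

lemma adm_integrable_fst: "adm u ==> integrable H (%th. LINT x|lborel. u th x)"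
 using HL.integrable_fst'[OF adm_integrable[of u]] by simp

lemma adm_mult: assumes u: "adm u" and v: "adm v" shows "adm (%th x. u th x * v th x)"
proof -
 note [measurable] = adm_measurable[OF u] adm_measurable[OF v]
 obtain B where B: "B \<ge> 0" "\<And>th x. th \<in> space H ==> \<bar>u th x\<bar> \<le> B" using u by (auto simp: adm_def)
 obtain C where C: "C \<ge> 0" "\<And>th x. th \<in> space H ==> \<bar>v th x\<bar> \<le> C"
  "\<And>th. th \<in> space H ==> mass (v th) \<le> ennreal C" using v by (auto simp: adm_def)
 show ?thesis
 proof (rule admI[of _ "B * C" "B * C"])
  show "(%(th, x). u th x * v th x) \<in> borel_measurable (leb H)"
   using borel_measurable_times[OF adm_measurable[OF u] adm_measurable[OF v]] by (simp add: split_beta')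
  fix th assume th: "th \<in> space H"
  show "\<bar>u th x * v th x\<bar> \<le> B * C" for x
   using B C th by (auto simp: abs_mult intro!: mult_mono)
  have "mass (%x. u th x * v th x) \<le> (\<integral>\<^sup>+x. ennreal B * ennreal \<bar>v th x\<bar> \<partial>lborel)"
   using B th by (intro nn_integral_mono) (auto simp: abs_mult ennreal_mult'[symmetric] intro!: ennreal_leI mult_right_mono)
  also have "... = ennreal B * mass (v th)"
   using adm_section[OF v th] by (intro nn_integral_cmult) auto
  also have "... \<le> ennreal (B * C)"
   using C(3)[OF th] B C by (auto simp: ennreal_mult' intro!: mult_left_mono)
  finally show "mass (%x. u th x * v th x) \<le> ennreal (B * C)" .
 qed
qed

lemma adm_conv: assumes k: "bddint k" and u: "adm u" shows "adm (%th. conv k (u th))"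
proof -
 have [measurable]: "Borel k" using k by (auto simp: bddint_def)
 note um = adm_measurable[OF u]
 obtain D where D: "D \<ge> 0" "\<And>x. \<bar>k x\<bar> \<le> D" using bddintD(3)[OF k] by auto
 obtain B where B: "B \<ge> 0" "\<And>th. th \<in> space H ==> mass (u th) \<le> ennreal B"
  using u by (auto simp: adm_def)
 show ?thesis
 proof (rule admI[of _ "D * B" "(LBINT x. \<bar>k x\<bar>) * B"])
  have [measurable]: "(%x. u (fst (fst x)) (snd x)) \<in> borel_measurable (leb (leb H))"
   using measurable_compose[OF measurable_Pair[of "%x. fst (fst x)" _ H "%x. snd x" "lborel"] um, of "leb (leb H)"]
   by simp
  show "(%(th, x). conv k (u th) x) \<in> borel_measurable (leb H)"
   unfolding conv_def split_beta' by measurable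
  fix th assume th: "th \<in> space H"
  have ub: "bddint (u th)" by (rule adm_bddint[OF u th])
  have e: "mass (u th) = ennreal (LBINT x. \<bar>u th x\<bar>)"
   using ub by (intro nn_integral_eq_integral) (auto simp: bddint_def)
  have le: "(LBINT x. \<bar>u th x\<bar>) \<le> B"
   using B(2)[OF th] B(1) unfolding e by simp
  show "\<bar>conv k (u th) x\<bar> \<le> D * B" for x
   using conv_abs_le[OF k bddintD(2)[OF ub] D(2), of x] mult_left_mono[OF le D(1)] by linarith
  have e2: "mass k = ennreal (LBINT x. \<bar>k x\<bar>)"
   using k by (intro nn_integral_eq_integral) (auto simp: bddint_def)
  have "mass (%x. conv k (u th) x) \<le> ennreal (LBINT x. \<bar>k x\<bar>) * ennreal (LBINT x. \<bar>u th x\<bar>)"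
   using nn_integral_conv_le[OF k ub] unfolding e e2 .
  also have "... \<le> ennreal ((LBINT x. \<bar>k x\<bar>) * B)"
   using le by (auto simp: ennreal_mult'[symmetric] intro!: ennreal_leI mult_left_mono)
  finally show "mass (%x. conv k (u th) x) \<le> ennreal ((LBINT x. \<bar>k x\<bar>) * B)" .
 qed
qed

lemma adm_Avg: assumes g: "bddint g" shows "adm (%th. Avg th g)"
proof -
 obtain B where B: "\<And>x. \<bar>g x\<bar> \<le> B" using g by (auto simp: bddint_def)
 show ?thesis
  using g B by (intro admI[OF Avg_measurable_pair Avg_abs_le nn_integral_Avg_le]) (auto simp: bddint_def)
qed

lemma adm_cmult: assumes u: "adm u" shows "adm (%th x. c * u th x)"
proof -
 obtain B where B: "B \<ge> 0" "\<And>th x. th \<in> space H ==> \<bar>u th x\<bar> \<le> B"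
  "\<And>th. th \<in> space H ==> mass (u th) \<le> ennreal B" using u by (auto simp: adm_def)
 show ?thesis
 proof (rule admI[of _ "\<bar>c\<bar> * B" "\<bar>c\<bar> * B"])
  show "(%(th, x). c * u th x) \<in> borel_measurable (leb H)"
   using borel_measurable_times[OF borel_measurable_const[of c] adm_measurable[OF u]] by (simp add: split_beta')
  fix th assume th: "th \<in> space H"
  show "\<bar>c * u th x\<bar> \<le> \<bar>c\<bar> * B" for x
   using B th by (auto simp: abs_mult intro!: mult_left_mono)
  have "mass (%x. c * u th x) = ennreal \<bar>c\<bar> * mass (u th)"
   using adm_section[OF u th] by (simp add: abs_mult ennreal_mult nn_integral_cmult)
  also have "... \<le> ennreal (\<bar>c\<bar> * B)"
   using B(3)[OF th] B(1) by (auto simp: ennreal_mult' intro!: mult_left_mono)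
  finally show "mass (%x. c * u th x) \<le> ennreal (\<bar>c\<bar> * B)" .
 qed
qed

lemma adm_add: assumes u: "adm u" and v: "adm v" shows "adm (%th x. u th x + v th x)"
proof -
 obtain B where B: "B \<ge> 0" "\<And>th x. th \<in> space H ==> \<bar>u th x\<bar> \<le> B"
  "\<And>th. th \<in> space H ==> mass (u th) \<le> ennreal B" using u by (auto simp: adm_def)
 obtain C where C: "C \<ge> 0" "\<And>th x. th \<in> space H ==> \<bar>v th x\<bar> \<le> C"
  "\<And>th. th \<in> space H ==> mass (v th) \<le> ennreal C" using v by (auto simp: adm_def)
 show ?thesis
 proof (rule admI[of _ "B + C" "B + C"])
  show "(%(th, x). u th x + v th x) \<in> borel_measurable (leb H)"
   using borel_measurable_add[OF adm_measurable[OF u] adm_measurable[OF v]] by (simp add: split_beta')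
  fix th assume th: "th \<in> space H"
  show "\<bar>u th x + v th x\<bar> \<le> B + C" for x
   using B(2)[OF th, of x] C(2)[OF th, of x] by linarith
  have "mass (%x. u th x + v th x) \<le> (\<integral>\<^sup>+x. ennreal \<bar>u th x\<bar> + ennreal \<bar>v th x\<bar> \<partial>lborel)"
   by (intro nn_integral_mono) (auto simp: ennreal_plus[symmetric] simp del: ennreal_plus intro!: ennreal_leI)
  also have "... = mass (u th) + mass (v th)"
   using adm_section[OF v th] adm_section[OF u th] by (intro nn_integral_add) auto
  also have "... \<le> ennreal B + ennreal C"
   by (intro add_mono B C th)
  also have "... = ennreal (B + C)" using B C by simp
  finally show "mass (%x. u th x + v th x) \<le> ennreal (B + C)" .
 qed
qed

lemma adm_sum: "finite A ==> (\<And>i. i \<in> A ==> adm (u i)) ==> adm (%th x. \<Sum>i\<in>A. u i th x)"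
proof (induction A rule: finite_induct)
 case empty
 show ?case by (rule admI[of _ 0 0]) auto
next
 case (insert i A)
 then show ?case using adm_add[of "u i" "%th x. \<Sum>i\<in>A. u i th x"] by simp
qed

subsection \<open>Duality and the size bound\<close>

definition form :: "real poly => real => ('a => real) => ('t => 'a => real) => real" where
 "form P t f g = pint (%th x. g th x * Avg th (conv (hk P t) f) x)"

lemma adm_form: "bddint f ==> adm g ==> t \<ge> 0 ==> adm (%th x. g th x * Avg th (conv (hk P t) f) x)"
 by (intro adm_mult adm_Avg bddint_conv bddint_hk)

text \<open>Operators in \<open>X\<close> are symmetric and commute with the averages, so the two outer factors can be
 distributed, one to each argument of the bilinear form.\<close>

lemma form_factor:
 assumes f: "bddint f" and g: "adm g" and t: "t > 0" and mid: "coeff mid 0 = 0"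
 shows "form (dpoly * mid * dpoly) t f g =
  pint (%th x. conv (hk dpoly t) (g th) x * Avg th (conv (hk mid t) (conv (hk dpoly t) f)) x)"
proof -
 have hd: "bddint (hk dpoly t :: 'a => real)" "bddint (hk mid t :: 'a => real)" "bddint (hk (dpoly * mid) t :: 'a => real)"
  using t by (auto intro: bddint_hk)
 have d0: "coeff dpoly 0 = 0" "coeff (dpoly * mid) 0 = 0" by (auto simp: dpoly_def coeff_mult)
 let ?h = "conv (hk mid t) (conv (hk dpoly t) f)"
 have h: "bddint ?h" using f hd by (intro bddint_conv)
 have eq: "conv (hk (dpoly * mid * dpoly) t) f = conv (hk dpoly t) ?h"
 proof -
  have "conv (hk dpoly t) ?h = conv (conv (hk dpoly t) (conv (hk mid t) (hk dpoly t))) f"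
   using f hd by (simp add: conv_assoc[symmetric] bddint_conv)
  also have "conv (hk dpoly t) (conv (hk mid t) (hk dpoly t)) = hk (dpoly * (mid * dpoly)) t"
   using t mid d0 by (subst conv_hk_hk[OF t mid], simp, subst conv_hk_hk[OF t]) (auto simp: coeff_mult)
  finally show ?thesis by (simp add: mult.assoc)
 qed
 have "form (dpoly * mid * dpoly) t f g = (LINT th|H. LINT x|lborel. g th x * Avg th (conv (hk (dpoly * mid * dpoly) t) f) x)"
  unfolding form_def using f g t by (intro pint_iterated adm_form) auto
 also have "... = (LINT th|H. LINT x|lborel. conv (hk dpoly t) (g th) x * Avg th ?h x)"
 proof (rule Bochner_Integration.integral_cong[OF refl])
  fix th assume th: "th \<in> space H"
  have "(LBINT x. conv (hk dpoly t) (g th) x * Avg th ?h x) = (LBINT x. g th x * conv (hk dpoly t) (Avg th ?h) x)"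
   using hd h adm_bddint[OF g th] bddint_Avg[OF h th] by (intro conv_adjoint) (auto simp: hk_minus)
  also have "conv (hk dpoly t) (Avg th ?h) = Avg th (conv (hk (dpoly * mid * dpoly) t) f)"
   unfolding eq by (rule conv_Avg_right[OF hd(1) h th])
  finally show "(LBINT x. g th x * Avg th (conv (hk (dpoly * mid * dpoly) t) f) x) =
    (LBINT x. conv (hk dpoly t) (g th) x * Avg th ?h x)" ..
 qed
 also have "... = pint (%th x. conv (hk dpoly t) (g th) x * Avg th ?h x)"
  using hd h g by (intro pint_iterated[symmetric] adm_mult adm_conv adm_Avg)
 finally show ?thesis .
qed

lemma Avg_hk_le:
 assumes size: "\<And>s v. s > 0 ==> (LINT b|M. heat s (v - \<gamma> th b)) \<le> A * s powr (- \<alpha>)"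
  and A: "A \<ge> 0" and al: "\<alpha> > 0" and t: "t > 0" and P: "coeff P 0 = 0" and th: "th \<in> space H"
 shows "\<bar>Avg th (hk P t) v\<bar> \<le> coeff_sum P * (A * t powr (- \<alpha>))"
proof -
 have int: "integrable M (%b. heat (real i * t) (v - \<gamma> th b))" for i
 proof -
  obtain B where "\<forall>x::'a. \<bar>heat (real i * t) x\<bar> \<le> B" using bddint_heat[of "real i * t", where ?'a = 'a] t by (auto simp: bddint_def)
  then show ?thesis using th by (intro Avg_integrand_integrable) auto
 qed
 have "Avg th (hk P t) v = plin P (%i. LINT b|M. heat (real i * t) (v - \<gamma> th b))"
  unfolding Avg_def hk_def by (rule plin_integral[OF int])
 also have "\<bar>...\<bar> \<le> coeff_sum P * (A * t powr (- \<alpha>))"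
 proof (rule plin_abs_le)
  fix i assume "coeff P i \<noteq> 0"
  then have i: "i \<ge> 1" using P by (cases i) auto
  have "\<bar>LINT b|M. heat (real i * t) (v - \<gamma> th b)\<bar> = (LINT b|M. heat (real i * t) (v - \<gamma> th b))"
   by (intro abs_of_nonneg integral_nonneg_AE) auto
  also have "... \<le> A * (real i * t) powr (- \<alpha>)"
   using i t by (intro size) auto
  also have "... \<le> A * t powr (- \<alpha>)"
   using i t al A by (intro mult_left_mono powr_mono2') auto
  finally show "\<bar>LINT b|M. heat (real i * t) (v - \<gamma> th b)\<bar> \<le> A * t powr (- \<alpha>)" .
 qed
 finally show ?thesis .
qed

lemma form_size:
 assumes size: "\<And>th s v. th \<in> space H ==> s > 0 ==> (LINT b|M. heat s (v - \<gamma> th b)) \<le> A * s powr (- \<alpha>)"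
  and A: "A \<ge> 0" and al: "\<alpha> > 0" and t: "t > 0" and P: "coeff P 0 = 0"
  and f: "bddint f" and g: "adm g"
 shows "\<bar>form P t f g\<bar> \<le> coeff_sum P * (A * t powr (- \<alpha>)) * (LBINT x. \<bar>f x\<bar>) * pint (%th x. \<bar>g th x\<bar>)"
proof -
 let ?C = "coeff_sum P * (A * t powr (- \<alpha>)) * (LBINT x. \<bar>f x\<bar>)"
 have le: "\<bar>Avg th (conv (hk P t) f) x\<bar> \<le> ?C" if th: "th \<in> space H" for th x
 proof -
  have hb: "bddint (hk P t :: 'a => real)" using t by (auto intro: bddint_hk)
  have "Avg th (conv (hk P t) f) x = conv (Avg th (hk P t)) f x"
   using conv_Avg[OF hb f th] by simp
  then show ?thesis
   using conv_abs_le[OF bddint_Avg[OF hb th] bddintD(2)[OF f] Avg_hk_le[OF size[OF th] A al t P th], of x] by simp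
 qed
 have i1: "integrable (leb H) (%p. g (fst p) (snd p) * Avg (fst p) (conv (hk P t) f) (snd p))"
  using adm_integrable'[OF adm_form[OF f g, of t P]] t by simp
 have i2: "integrable (leb H) (%p. g (fst p) (snd p))" by (rule adm_integrable'[OF g])
 have "\<bar>form P t f g\<bar> \<le> (LINT p|(leb H). \<bar>g (fst p) (snd p) * Avg (fst p) (conv (hk P t) f) (snd p)\<bar>)"
  unfolding form_def pint_def by (rule integral_abs_bound)
 also have "... \<le> (LINT p|(leb H). ?C * \<bar>g (fst p) (snd p)\<bar>)"
 proof (intro integral_mono integrable_abs i1 integrable_mult_right i2)
  fix p :: "'t \<times> 'a" assume p: "p \<in> space (leb H)"
  then have "fst p \<in> space H" by (auto simp: space_pair_measure)
  then show "\<bar>g (fst p) (snd p) * Avg (fst p) (conv (hk P t) f) (snd p)\<bar> \<le> ?C * \<bar>g (fst p) (snd p)\<bar>"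
   using mult_right_mono[OF le, of "fst p" "\<bar>g (fst p) (snd p)\<bar>"] by (simp add: abs_mult mult.commute)
 qed
 also have "... = ?C * pint (%th x. \<bar>g th x\<bar>)"
  unfolding pint_def by simp
 finally show ?thesis .
qed

text \<open>The free parameter \<open>\<rho>\<close> in the arithmetic-geometric mean inequality balances the two square
 functions when the pieces are interpolated.\<close>

lemma form_square_bound:
 assumes f: "bddint f" and g: "adm g" and t: "t > 0" and mid: "coeff mid 0 = 0" and r: "\<rho> > 0"
 shows "2 * \<bar>form (dpoly * mid * dpoly) t f g\<bar> \<le>
   \<rho> * pint (%th x. (Avg th (conv (hk mid t) (conv (hk dpoly t) f)) x)\<^sup>2) + pint (%th x. (conv (hk dpoly t) (g th) x)\<^sup>2) / \<rho>"
proof -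
 let ?U = "%th. Avg th (conv (hk mid t) (conv (hk dpoly t) f))" and ?G = "%th. conv (hk dpoly t) (g th)"
 have U: "adm ?U" using f t by (intro adm_Avg bddint_conv bddint_hk) auto
 have G: "adm ?G" using g t by (intro adm_conv bddint_hk) auto
 have "2 * \<bar>form (dpoly * mid * dpoly) t f g\<bar> = 2 * \<bar>pint (%th x. ?G th x * ?U th x)\<bar>"
  by (simp only: form_factor[OF f g t mid])
 also have "... \<le> 2 * (LINT p|(leb H). \<bar>?G (fst p) (snd p) * ?U (fst p) (snd p)\<bar>)"
  unfolding pint_def by (intro mult_left_mono integral_abs_bound) auto
 also have "... = (LINT p|(leb H). 2 * \<bar>?G (fst p) (snd p) * ?U (fst p) (snd p)\<bar>)"
  by simp
 also have "... \<le> (LINT p|(leb H). \<rho> * (?U (fst p) (snd p) * ?U (fst p) (snd p)) + (?G (fst p) (snd p) * ?G (fst p) (snd p)) / \<rho>)"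
 proof (intro integral_mono integrable_mult_right integrable_abs Bochner_Integration.integrable_add integrable_divide)
  show "integrable (leb H) (%p. ?G (fst p) (snd p) * ?U (fst p) (snd p))"
   using adm_integrable'[OF adm_mult[OF G U]] .
  show "integrable (leb H) (%p. ?U (fst p) (snd p) * ?U (fst p) (snd p))"
   using adm_integrable'[OF adm_mult[OF U U]] .
  show "integrable (leb H) (%p. ?G (fst p) (snd p) * ?G (fst p) (snd p))"
   using adm_integrable'[OF adm_mult[OF G G]] .
  fix p :: "'t \<times> 'a"
  define u v where "u = ?U (fst p) (snd p)" and "v = ?G (fst p) (snd p)"
  have "2 * \<bar>v * u\<bar> = 2 * (sqrt \<rho> * \<bar>u\<bar>) * (\<bar>v\<bar> / sqrt \<rho>)" using r by (simp add: abs_mult)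
  also have "... \<le> (sqrt \<rho> * \<bar>u\<bar>)\<^sup>2 + (\<bar>v\<bar> / sqrt \<rho>)\<^sup>2" by (rule sum_squares_bound)
  also have "... = \<rho> * (u * u) + (v * v) / \<rho>" using r by (simp add: power_mult_distrib power_divide) (simp add: power2_eq_square)
  finally show "2 * \<bar>?G (fst p) (snd p) * ?U (fst p) (snd p)\<bar> \<le>
    \<rho> * (?U (fst p) (snd p) * ?U (fst p) (snd p)) + (?G (fst p) (snd p) * ?G (fst p) (snd p)) / \<rho>"
   unfolding u_def v_def .
 qed
 also have "... = \<rho> * pint (%th x. (?U th x)\<^sup>2) + pint (%th x. (?G th x)\<^sup>2) / \<rho>"
  unfolding pint_def power2_eq_square
  using adm_integrable'[OF adm_mult[OF U U]] adm_integrable'[OF adm_mult[OF G G]] by simp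
 finally show ?thesis .
qed

lemma pint_square_fun_sum:
 assumes g: "adm g" and e: "\<epsilon> > 0"
 shows "(\<Sum>j<J. pint (%th x. (conv (hk dpoly (\<epsilon> * 2 ^ j)) (g th) x)\<^sup>2)) \<le> pint (%th x. (g th x)\<^sup>2)"
proof -
 have a: "adm (%th x. (conv (hk dpoly (\<epsilon> * 2 ^ j)) (g th) x)\<^sup>2)" for j
  unfolding power2_eq_square using e by (intro adm_mult adm_conv g bddint_hk) auto
 have b: "adm (%th x. (g th x)\<^sup>2)" unfolding power2_eq_square by (intro adm_mult g)
 have "(\<Sum>j<J. pint (%th x. (conv (hk dpoly (\<epsilon> * 2 ^ j)) (g th) x)\<^sup>2)) = (\<Sum>j<J. LINT th|H. square_fun (g th) (\<epsilon> * 2 ^ j))"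
  by (simp add: pint_iterated[OF a] square_fun_def)
 also have "... = (LINT th|H. (\<Sum>j<J. square_fun (g th) (\<epsilon> * 2 ^ j)))"
  using adm_integrable_fst[OF a] by (subst Bochner_Integration.integral_sum) (auto simp: square_fun_def)
 also have "... \<le> (LINT th|H. (LBINT x. (g th x)\<^sup>2))"
  using adm_integrable_fst[OF a] adm_integrable_fst[OF b]
  by (intro integral_mono Bochner_Integration.integrable_sum square_fun_sum_le adm_bddint g e) (auto simp: square_fun_def)
 also have "... = pint (%th x. (g th x)\<^sup>2)" by (rule pint_iterated[OF b, symmetric])
 finally show ?thesis .
qed

subsection \<open>The quadratic bound\<close>

text \<open>The differences of two points of the same rotated measure. The heat kernel averaged over
 them is the kernel of \<open>Avg\<^sup>* exp (s \<Delta>) Avg\<close>, integrated over the parameter.\<close>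

definition displacement :: "'t \<times> 'b \<times> 'b => 'a" where
 "displacement n = \<gamma> (fst n) (fst (snd n)) - \<gamma> (fst n) (snd (snd n))"

abbreviation pairs :: "('t \<times> 'b \<times> 'b) measure" where "pairs \<equiv> H \<Otimes>\<^sub>M (M \<Otimes>\<^sub>M M)"

definition autocorr :: "real => 'a => real" where
 "autocorr s z = (LINT n|pairs. heat s (z + displacement n))"

lemma displacement_measurable [measurable]: "displacement \<in> borel_measurable pairs"
 unfolding displacement_def[abs_def] by measurable

lemma finite_measure_MM: "finite_measure (M \<Otimes>\<^sub>M M)"
 by (rule finite_measure_pair_measure) unfold_locales

lemma finite_measure_pairs: "finite_measure pairs"
 by (intro finite_measure_pair_measure finite_measure_MM) unfold_locales

lemma autocorr_measurable [measurable]: "Borel (autocorr s)"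
proof -
 interpret N: finite_measure pairs by (rule finite_measure_pairs)
 show ?thesis unfolding autocorr_def[abs_def] by measurable
qed

lemma integral_shift_square:
 assumes k: "bddint k" and even: "\<And>x. k (- x) = k x" and h: "bddint h"
 shows "(LBINT x. conv k h x * conv k h (x + w)) =
  (LBINT x. LINT y|lborel. h x * h y * conv k k (x - y + w))"
proof -
 define hw where "hw x = h (x + w)" for x
 have [measurable]: "Borel h" "Borel k" using h k by (auto simp: bddint_def)
 have kk: "bddint (conv k k)" using k by (intro bddint_conv)
 have hw: "bddint hw"
  unfolding hw_def using h integrable_lborel_affine[of h 1 w] by (auto simp: bddint_def add.commute)
 have shift: "conv q h (x + w) = conv q hw x" if [measurable]: "Borel q" for q x
 proof -
  have "conv q hw x = (LBINT y. (%y. q (x + w - y) * h y) (w + 1 *\<^sub>R y))"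
   unfolding conv_def hw_def by (simp add: algebra_simps)
  also have "... = (LBINT y. q (x + w - y) * h y)"
   using integral_lborel_affine[of "%y. q (x + w - y) * h y" 1 w] by simp
  finally show ?thesis unfolding conv_def ..
 qed
 have "(LBINT x. conv k h x * conv k h (x + w)) = (LBINT x. conv k h x * conv k hw x)"
  by (simp add: shift)
 also have "... = (LBINT x. h x * conv k (conv k hw) x)"
  using k h hw even by (intro conv_adjoint bddint_conv) auto
 also have "... = (LBINT x. h x * conv (conv k k) h (x + w))"
  using kk by (simp add: conv_assoc[OF k k hw] shift bddint_def)
 also have "... = (LBINT x. LINT y|lborel. h x * h y * conv k k (x - y + w))"
  unfolding conv_def by (simp add: mult_ac algebra_simps)
 finally show ?thesis .
qed

lemma Avg_square:
 assumes G: "bddint G" and th[measurable]: "th \<in> space H"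
 shows "(LBINT x. (Avg th G x)\<^sup>2) =
  (LINT m|(M \<Otimes>\<^sub>M M). (LBINT x. G x * G (x + displacement (th, m))))"
proof -
 interpret N: finite_measure "M \<Otimes>\<^sub>M M" by (rule finite_measure_MM)
 interpret LN: pair_sigma_finite "lborel :: 'a measure" "M \<Otimes>\<^sub>M M" ..
 have Gm[measurable]: "Borel G" using G by (auto simp: bddint_def)
 obtain B where B: "\<And>x. \<bar>G x\<bar> \<le> B" using G by (auto simp: bddint_def)
 have iM: "integrable M (%b. G (x - \<gamma> th b))" for x
  using Avg_integrand_integrable[OF Gm B th] .
 have sq: "(Avg th G x)\<^sup>2 = (LINT m|(M \<Otimes>\<^sub>M M). G (x - \<gamma> th (fst m)) * G (x - \<gamma> th (snd m)))" for x
 proof -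
  have int: "integrable (M \<Otimes>\<^sub>M M) (%m. G (x - \<gamma> th (fst m)) * G (x - \<gamma> th (snd m)))"
   by (rule N.integrable_const_bound[of _ "B * B"])
     (use B in \<open>auto simp: abs_mult intro!: mult_mono order_trans[OF abs_ge_zero B]\<close>)
  show ?thesis
   using MM.integral_fst'[OF int] by (simp add: Avg_def power2_eq_square)
 qed
 have int: "integrable (lborel \<Otimes>\<^sub>M (M \<Otimes>\<^sub>M M)) (%(x, m). G (x - \<gamma> th (fst m)) * G (x - \<gamma> th (snd m)))"
 proof -
  have "integrable (lborel \<Otimes>\<^sub>M (M \<Otimes>\<^sub>M M)) (%p. G (fst p - \<gamma> th (snd (snd p))))"
  proof (rule integrableI_bounded)
   show "(%p. G (fst p - \<gamma> th (snd (snd p)))) \<in> borel_measurable (lborel \<Otimes>\<^sub>M (M \<Otimes>\<^sub>M M))" by measurable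
   have "(\<integral>\<^sup>+p. ennreal (norm (G (fst p - \<gamma> th (snd (snd p))))) \<partial>(lborel \<Otimes>\<^sub>M (M \<Otimes>\<^sub>M M))) =
     (\<integral>\<^sup>+m. \<integral>\<^sup>+x. ennreal (norm (G (x - \<gamma> th (snd m)))) \<partial>lborel \<partial>(M \<Otimes>\<^sub>M M))"
    by (subst LN.nn_integral_snd[symmetric]) auto
   also have "... = (\<integral>\<^sup>+m. (\<integral>\<^sup>+x. ennreal (norm (G x)) \<partial>lborel) \<partial>(M \<Otimes>\<^sub>M M))"
    by (simp add: nn_integral_lborel_translate_minus[where f = "%x. ennreal \<bar>G x\<bar>"])
   also have "... < \<infinity>"
    using bddintD(2)[OF G] by (simp add: integrable_iff_bounded ennreal_mult_less_top N.emeasure_eq_measure)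
   finally show "(\<integral>\<^sup>+p. ennreal (norm (G (fst p - \<gamma> th (snd (snd p))))) \<partial>(lborel \<Otimes>\<^sub>M (M \<Otimes>\<^sub>M M))) < \<infinity>" .
  qed
  then have "integrable (lborel \<Otimes>\<^sub>M (M \<Otimes>\<^sub>M M)) (%p. G (fst p - \<gamma> th (fst (snd p))) * G (fst p - \<gamma> th (snd (snd p))))"
   by (rule integrable_bounded_mult[where B = B]) (use B in auto)
  then show ?thesis by (simp add: split_beta')
 qed
 have "(LBINT x. (Avg th G x)\<^sup>2) = (LBINT x. LINT m|(M \<Otimes>\<^sub>M M). G (x - \<gamma> th (fst m)) * G (x - \<gamma> th (snd m)))"
  by (simp only: sq)
 also have "... = (LINT m|(M \<Otimes>\<^sub>M M). LINT x|lborel. G (x - \<gamma> th (fst m)) * G (x - \<gamma> th (snd m)))"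
  using LN.Fubini_integral[OF int] by simp
 also have "... = (LINT m|(M \<Otimes>\<^sub>M M). (LBINT x. G x * G (x + displacement (th, m))))"
 proof (rule Bochner_Integration.integral_cong[OF refl])
  fix m
  show "(LBINT x. G (x - \<gamma> th (fst m)) * G (x - \<gamma> th (snd m))) = (LBINT x. G x * G (x + displacement (th, m)))"
   using integral_lborel_translate_minus[of "%x. G x * G (x + displacement (th, m))" "\<gamma> th (fst m)"]
   by (simp add: displacement_def algebra_simps)
 qed
 finally show ?thesis .
qed

text \<open>The \<open>T\<^sup>* T\<close> identity: the square integral of the averages of \<open>k * h\<close> is a quadratic form in
 \<open>h\<close> whose kernel is \<open>k * k\<close> averaged over all displacements.\<close>

lemma pint_Avg_square:
 assumes k: "bddint k" and even: "\<And>x. k (- x) = k x" and h: "bddint h"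
 shows "pint (%th x. (Avg th (conv k h) x)\<^sup>2) =
  (LINT p|(leb lborel). h (fst p) * h (snd p) * (LINT n|pairs. conv k k (fst p - snd p + displacement n)))"
proof -
 interpret N: finite_measure "M \<Otimes>\<^sub>M M" by (rule finite_measure_MM)
 interpret P: finite_measure pairs by (rule finite_measure_pairs)
 interpret HN: pair_sigma_finite H "M \<Otimes>\<^sub>M M" ..
 interpret LL: sigma_finite_measure "leb lborel :: ('a \<times> 'a) measure"
  by (simp add: lborel_prod sigma_finite_lborel)
 interpret LP: pair_sigma_finite "leb lborel :: ('a \<times> 'a) measure" pairs ..
 have [measurable]: "Borel h" "Borel k" using h k by (auto simp: bddint_def)
 have kk: "bddint (conv k k)" using k by (intro bddint_conv)
 have [measurable]: "Borel (conv k k)" using kk by (auto simp: bddint_def)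
 obtain B where B: "\<And>x. \<bar>conv k k x\<bar> \<le> B" using kk by (auto simp: bddint_def)
 have G: "bddint (conv k h)" using k h by (intro bddint_conv)
 have a: "adm (%th x. (Avg th (conv k h) x)\<^sup>2)"
  unfolding power2_eq_square by (intro adm_mult adm_Avg G)
 have hh: "integrable (leb lborel) (%p. h (fst p) * h (snd p))"
 proof (rule integrableI_bounded)
  show "(%p. h (fst p) * h (snd p)) \<in> borel_measurable (leb lborel)" by measurable
  have "(\<integral>\<^sup>+p. ennreal (norm (h (fst p) * h (snd p))) \<partial>(leb lborel)) =
    (\<integral>\<^sup>+x. \<integral>\<^sup>+y. ennreal \<bar>h x\<bar> * ennreal \<bar>h y\<bar> \<partial>lborel \<partial>lborel)"
   by (subst lborel.nn_integral_fst[symmetric]) (auto simp: abs_mult ennreal_mult)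
  also have "... = mass h * mass h"
   by (simp add: nn_integral_cmult nn_integral_multc)
  also have "... < \<infinity>"
   using bddintD(2)[OF h] by (simp add: integrable_iff_bounded ennreal_mult_less_top)
  finally show "(\<integral>\<^sup>+p. ennreal (norm (h (fst p) * h (snd p))) \<partial>(leb lborel)) < \<infinity>" .
 qed
 have hhk: "integrable (leb lborel) (%p. h (fst p) * h (snd p) * conv k k (fst p - snd p + w))" for w
  using integrable_bounded_mult[OF hh, of "%p. conv k k (fst p - snd p + w)" B] B by (simp add: mult.commute)
 define Q where "Q w = (LINT p|(leb lborel). h (fst p) * h (snd p) * conv k k (fst p - snd p + w))" for w
 have Qeq: "(LBINT x. conv k h x * conv k h (x + w)) = Q w" for w
  using lborel_pair.integral_fst'[OF hhk[of w]] integral_shift_square[OF k even h, of w] by (simp add: Q_def)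
 have int: "integrable ((leb lborel) \<Otimes>\<^sub>M pairs)
   (%(p, n). h (fst p) * h (snd p) * conv k k (fst p - snd p + displacement n))"
 proof -
  have "integrable ((leb lborel) \<Otimes>\<^sub>M pairs) (%q. h (fst (fst q)) * h (snd (fst q)))"
  proof (rule integrableI_bounded)
   show "(%q. h (fst (fst q)) * h (snd (fst q))) \<in> borel_measurable ((leb lborel) \<Otimes>\<^sub>M pairs)" by measurable
   have "(\<integral>\<^sup>+q. ennreal (norm (h (fst (fst q)) * h (snd (fst q)))) \<partial>((leb lborel) \<Otimes>\<^sub>M pairs)) =
     (\<integral>\<^sup>+p. \<integral>\<^sup>+n. ennreal (norm (h (fst p) * h (snd p))) \<partial>pairs \<partial>(leb lborel))"
    by (subst P.nn_integral_fst[symmetric]) auto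
   also have "... = (\<integral>\<^sup>+p. ennreal (norm (h (fst p) * h (snd p))) \<partial>(leb lborel)) * emeasure pairs (space pairs)"
    by (simp add: nn_integral_multc)
   also have "... < \<infinity>"
    using hh by (simp add: integrable_iff_bounded ennreal_mult_less_top P.emeasure_eq_measure)
   finally show "(\<integral>\<^sup>+q. ennreal (norm (h (fst (fst q)) * h (snd (fst q)))) \<partial>((leb lborel) \<Otimes>\<^sub>M pairs)) < \<infinity>" .
  qed
  then have "integrable ((leb lborel) \<Otimes>\<^sub>M pairs)
   (%q. conv k k (fst (fst q) - snd (fst q) + displacement (snd q)) * (h (fst (fst q)) * h (snd (fst q))))"
   by (rule integrable_bounded_mult[where B = B]) (use B in auto)
  then show ?thesis by (simp add: split_beta' mult_ac)
 qed
 have intQ: "integrable pairs (%n. Q (displacement n))"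
  using LP.integrable_snd[OF int] by (simp add: Q_def)
 have "pint (%th x. (Avg th (conv k h) x)\<^sup>2) = (LINT th|H. LINT x|lborel. (Avg th (conv k h) x)\<^sup>2)"
  by (rule pint_iterated[OF a])
 also have "... = (LINT th|H. LINT m|(M \<Otimes>\<^sub>M M). Q (displacement (th, m)))"
  by (intro Bochner_Integration.integral_cong refl) (simp add: Avg_square[OF G] Qeq)
 also have "... = (LINT n|pairs. Q (displacement n))"
  using HN.integral_fst'[OF intQ] by simp
 also have "... = (LINT p|(leb lborel). LINT n|pairs. h (fst p) * h (snd p) * conv k k (fst p - snd p + displacement n))"
  unfolding Q_def using LP.Fubini_integral[OF int] by simp
 finally show ?thesis by simp
qed

lemma pint_Avg_square_le:
 assumes k: "bddint k" and even: "\<And>x. k (- x) = k x" and h: "bddint h" and C0: "C \<ge> 0"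
  and C: "mass (%z. LINT n|pairs. conv k k (z + displacement n)) \<le> ennreal C"
 shows "pint (%th x. (Avg th (conv k h) x)\<^sup>2) \<le> C * (LBINT x. (h x)\<^sup>2)"
proof -
 interpret P: finite_measure pairs by (rule finite_measure_pairs)
 have [measurable]: "Borel h" "Borel k" using h k by (auto simp: bddint_def)
 define S where "S z = (LINT n|pairs. conv k k (z + displacement n))" for z
 have [measurable]: "Borel S" unfolding S_def[abs_def] by measurable
 let ?F = "%p. h (fst p) * h (snd p) * S (fst p - snd p)"
 have nn: "(\<integral>\<^sup>+p. ennreal \<bar>?F p\<bar> \<partial>(leb lborel)) \<le> ennreal (C * (LBINT x. (h x)\<^sup>2))"
 proof -
  have "(\<integral>\<^sup>+p. ennreal \<bar>?F p\<bar> \<partial>(leb lborel)) =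
    (\<integral>\<^sup>+x. \<integral>\<^sup>+y. ennreal (\<bar>h x\<bar> * \<bar>h y\<bar> * \<bar>S (x - y)\<bar>) \<partial>lborel \<partial>lborel)"
   by (subst lborel.nn_integral_fst[symmetric]) (auto simp: abs_mult)
  also have "... \<le> ennreal (C * (LBINT x. (h x)\<^sup>2))"
   using C by (intro schur_test h C0) (auto simp: S_def)
  finally show ?thesis .
 qed
 have int: "integrable (leb lborel) ?F"
  using nn by (intro integrableI_bounded) (auto simp: less_top[symmetric] top_unique)
 have "ennreal \<bar>LINT p|(leb lborel). ?F p\<bar> \<le> ennreal (C * (LBINT x. (h x)\<^sup>2))"
  using order_trans[OF integral_norm_bound_ennreal[OF int]] nn by simp
 then have "\<bar>LINT p|(leb lborel). ?F p\<bar> \<le> C * (LBINT x. (h x)\<^sup>2)"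
  using C0 by (subst (asm) ennreal_le_iff) (auto intro!: mult_nonneg_nonneg)
 then show ?thesis
  unfolding pint_Avg_square[OF k even h] S_def[symmetric] by linarith
qed

text \<open>Cancellation: vanishing of high order at \<open>X = 1\<close> turns the autocorrelation into a finite
 difference in time.\<close>

lemma integral_hk_displacement:
 assumes t: "t > 0"
 shows "(LINT n|pairs. hk ([:1, -1:] ^ N * R) t (z + displacement n)) =
   plin R (%i. fdiff N (%s. autocorr s z) t (real i * t))"
proof -
 interpret P: finite_measure pairs by (rule finite_measure_pairs)
 have int: "integrable pairs (%n. heat (real i * t) (z + displacement n))" for i
 proof -
  obtain B where "\<forall>x::'a. \<bar>heat (real i * t) x\<bar> \<le> B" using bddint_heat[of "real i * t", where ?'a = 'a] t by (auto simp: bddint_def)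
  then show ?thesis by (intro P.integrable_const_bound[of _ B]) auto
 qed
 show ?thesis
  unfolding hk_def plin_integral[OF int] autocorr_def[symmetric] by (rule plin_fdiff)
qed

lemma nn_integral_plin_le:
 assumes "\<And>i. coeff R i \<noteq> 0 ==> mass (f i) \<le> ennreal (C i)" "\<And>i. C i \<ge> 0"
  and [measurable]: "\<And>i. f i \<in> borel_measurable (borel :: 'a measure)"
 shows "mass (%z. plin R (%i. f i z)) \<le> ennreal (\<Sum>i\<le>degree R. \<bar>coeff R i\<bar> * C i)"
proof -
 have "mass (%z. plin R (%i. f i z)) \<le> (\<integral>\<^sup>+z. (\<Sum>i\<le>degree R. ennreal (\<bar>coeff R i\<bar> * \<bar>f i z\<bar>)) \<partial>lborel)"
 proof (rule nn_integral_mono)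
  fix z
  have "\<bar>plin R (%i. f i z)\<bar> \<le> (\<Sum>i\<le>degree R. \<bar>coeff R i\<bar> * \<bar>f i z\<bar>)"
   unfolding plin_def using sum_abs[of "%i. coeff R i * f i z"] by (simp add: abs_mult)
  then show "ennreal \<bar>plin R (%i. f i z)\<bar> \<le> (\<Sum>i\<le>degree R. ennreal (\<bar>coeff R i\<bar> * \<bar>f i z\<bar>))"
   by (subst sum_ennreal) (auto intro: ennreal_leI)
 qed
 also have "... = (\<Sum>i\<le>degree R. ennreal \<bar>coeff R i\<bar> * mass (f i))"
  by (subst nn_integral_sum) (auto simp: ennreal_mult nn_integral_cmult)
 also have "... \<le> (\<Sum>i\<le>degree R. ennreal (\<bar>coeff R i\<bar> * C i))"
 proof (rule sum_mono)
  fix i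
  show "ennreal \<bar>coeff R i\<bar> * mass (f i) \<le> ennreal (\<bar>coeff R i\<bar> * C i)"
   using assms(1)[of i] by (cases "coeff R i = 0") (auto simp: ennreal_mult' intro!: mult_left_mono)
 qed
 also have "... = ennreal (\<Sum>i\<le>degree R. \<bar>coeff R i\<bar> * C i)"
  using assms(2) by (intro sum_ennreal) auto
 finally show ?thesis .
qed

end

section \<open>Approximation by the heat flow\<close>

lemma heat_scale:
 assumes s: "s > 0"
 shows "sqrt s ^ DIM('a) * heat s (sqrt s *\<^sub>R (x::'a::euclidean_space)) = heat 1 x"
proof -
 have sq: "sqrt s ^ DIM('a) = s powr (DIM('a) / 2)"
  using s by (simp add: powr_half_sqrt[symmetric] powr_power)
 show ?thesis unfolding sq heat_def using s by (simp add: power_mult_distrib)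
qed

lemma conv_heat_tendsto:
 fixes f :: "'a::euclidean_space => real"
 assumes f: "bddint f" and cont: "continuous_on UNIV f"
  and s: "\<And>n. s n > 0" "s \<longlonglongrightarrow> 0"
 shows "(%n. conv (heat (s n)) f y) \<longlonglongrightarrow> f y"
proof -
 have [measurable]: "Borel f" using f by (auto simp: bddint_def)
 obtain B where B: "\<And>x. \<bar>f x\<bar> \<le> B" using f by (auto simp: bddint_def)
 have eq: "conv (heat (s n)) f y = (LBINT x. heat 1 x * f (y - sqrt (s n) *\<^sub>R x))" for n
 proof -
  have "conv (heat (s n)) f y = (LBINT x. f (y - x) * heat (s n) x)"
   by (subst conv_commute) (simp_all add: conv_def)
  also have "... = \<bar>sqrt (s n)\<bar> ^ DIM('a) * (LBINT x. f (y - (0 + sqrt (s n) *\<^sub>R x)) * heat (s n) (0 + sqrt (s n) *\<^sub>R x))"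
   using s(1)[of n] by (intro integral_lborel_affine) auto
  also have "... = (LBINT x. f (y - sqrt (s n) *\<^sub>R x) * (sqrt (s n) ^ DIM('a) * heat (s n) (sqrt (s n) *\<^sub>R x)))"
   using s(1)[of n] by (subst integral_mult_right_zero[symmetric]) (simp add: mult_ac)
  also have "... = (LBINT x. heat 1 x * f (y - sqrt (s n) *\<^sub>R x))"
   by (simp add: heat_scale[OF s(1)] mult.commute)
  finally show ?thesis .
 qed
 have "(%n. LINT x|lborel. heat 1 x * f (y - sqrt (s n) *\<^sub>R x)) \<longlonglongrightarrow> (LBINT (x::'a). heat 1 x * f y)"
 proof (rule integral_dominated_convergence[where w = "%x::'a. B * heat 1 x"])
  show "integrable lborel (%x::'a. B * heat 1 x)" by (intro integrable_mult_right heat_integrable) simp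
  show "AE x in lborel. (%n. heat 1 x * f (y - sqrt (s n) *\<^sub>R x)) \<longlonglongrightarrow> heat 1 x * f y"
  proof (rule AE_I2)
   fix x :: 'a
   have "(%n. y - sqrt (s n) *\<^sub>R x) \<longlonglongrightarrow> y - sqrt 0 *\<^sub>R x"
    using s by (intro tendsto_intros)
   then have "(%n. y - sqrt (s n) *\<^sub>R x) \<longlonglongrightarrow> y" by simp
   then have "(%n. f (y - sqrt (s n) *\<^sub>R x)) \<longlonglongrightarrow> f y"
    using cont by (intro isCont_tendsto_compose[of y f]) (auto simp: continuous_on_eq_continuous_at)
   then show "(%n. heat 1 x * f (y - sqrt (s n) *\<^sub>R x)) \<longlonglongrightarrow> heat 1 x * f y"
    by (rule tendsto_mult_left)
  qed
  show "AE x in lborel. norm (heat 1 x * f (y - sqrt (s n) *\<^sub>R x)) \<le> B * heat 1 x" for n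
  proof (rule AE_I2)
   fix x :: 'a
   show "norm (heat 1 x * f (y - sqrt (s n) *\<^sub>R x)) \<le> B * heat 1 x"
    using mult_right_mono[OF B[of "y - sqrt (s n) *\<^sub>R x"], of "heat 1 x"] by (simp add: abs_mult mult.commute)
  qed
 qed measurable
 then show ?thesis by (simp add: eq integral_heat)
qed

section \<open>A factorization of polynomials\<close>

text \<open>The polynomial \<open>\<chi> = 1 - (1 - X\<^sup>4)\<^sup>N\<close> approximates the identity as \<open>X = exp (t \<Delta>)\<close>
 tends to it, and doubling the time replaces \<open>\<chi>\<close> by \<open>\<chi>(X\<^sup>2)\<close>. The difference vanishes to
 order \<open>N\<close> at \<open>X = 1\<close>, where the low frequencies lie. Two of these zeros are set aside, one
 for each of the two square functions; the others give the cancellation in the middle factor.\<close>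

definition chi_poly :: "nat => real poly" where
 "chi_poly K = 1 - (1 - [:0, 1:] ^ 4) ^ (K + 2)"

lemma poly_chi_poly: "poly (chi_poly K) 1 = 1"
 by (simp add: chi_poly_def poly_power)

lemma coeff_chi_poly: "coeff (chi_poly K) 0 = 0"
 by (simp add: poly_0_coeff_0[symmetric] chi_poly_def poly_power)

text \<open>With \<open>Y = 1 - X\<^sup>4\<close>, the difference is \<open>Y\<^sup>N ((1 + X\<^sup>4)\<^sup>N - 1)\<close>, which is divisible by
 \<open>(1 - X)\<^sup>N\<close> and by \<open>X\<^sup>4\<close>.\<close>

lemma chi_poly_factorization:
 obtains mid R where "coeff mid 0 = 0" "coeff R 0 = 0" "mid * mid = [:1, -1:] ^ (2 * K) * R"
  "chi_poly K - pcompose (chi_poly K) [:0, 0, 1:] = dpoly * mid * dpoly"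
proof -
 define x :: "real poly" where "x = [:0, 1:]"
 define N where "N = K + 2"
 define s where "s = 1 + x + x ^ 2 + x ^ 3"
 define r where "r = (\<Sum>i<N. (1 + x ^ 4) ^ i)"
 define mid where "mid = x ^ 2 * (1 - x) ^ K * s ^ N * r"
 define R where "R = x ^ 4 * (s ^ N * r) ^ 2"
 have sq: "[:0, 0, 1:] = x ^ 2" by (simp add: x_def power2_eq_square)
 have d: "dpoly = x * (1 - x)" by (simp add: dpoly_def x_def one_pCons)
 have om: "[:1, -1:] = 1 - x" by (simp add: x_def one_pCons)
 have x4: "1 - x ^ 4 = (1 - x) * s" unfolding s_def by (simp add: algebra_simps eval_nat_numeral)
 have x8: "1 - (x ^ 2) ^ 4 = (1 - x ^ 4) * (1 + x ^ 4)" by (simp add: algebra_simps flip: power_mult power_add)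
 have rr: "(1 + x ^ 4) ^ N - 1 = x ^ 4 * r" unfolding r_def by (subst power_diff_1_eq) simp
 have pc: "pcompose (chi_poly K) [:0, 0, 1:] = 1 - (1 - (x ^ 2) ^ 4) ^ N"
 proof -
  have hom: "pcompose (P ^ j) Q = pcompose P Q ^ j" for P Q :: "real poly" and j
   by (induction j) (simp_all add: pcompose_mult pcompose_1)
  have "pcompose [:0, 1:] (x ^ 2) = x ^ 2" by (simp add: pcompose_pCons)
  then show ?thesis unfolding sq chi_poly_def N_def
   by (simp only: pcompose_diff hom pcompose_1)
 qed
 have "chi_poly K - pcompose (chi_poly K) [:0, 0, 1:] = ((1 - x ^ 4) * (1 + x ^ 4)) ^ N - (1 - x ^ 4) ^ N"
  unfolding pc x8 by (simp add: chi_poly_def x_def N_def)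
 also have "... = (1 - x ^ 4) ^ N * ((1 + x ^ 4) ^ N - 1)"
  by (simp only: power_mult_distrib right_diff_distrib mult_1_right)
 also have "... = (1 - x) ^ (K + 2) * s ^ N * (x ^ 4 * r)"
  unfolding rr x4 power_mult_distrib by (simp only: N_def)
 also have "... = dpoly * mid * dpoly"
  unfolding d mid_def power_add by (simp add: eval_nat_numeral mult_ac)
 finally have 1: "chi_poly K - pcompose (chi_poly K) [:0, 0, 1:] = dpoly * mid * dpoly" .
 have 2: "mid * mid = [:1, -1:] ^ (2 * K) * R"
 proof -
  have "(1 - x) ^ (2 * K) = (1 - x) ^ K * (1 - x) ^ K" by (simp add: mult_2 power_add)
  moreover have "x ^ 4 = x ^ 2 * x ^ 2" by (simp flip: power_add)
  ultimately show ?thesis unfolding om mid_def R_def power2_eq_square[of "s ^ N * r"]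
   by (simp only: mult_ac)
 qed
 have "poly x 0 = 0" by (simp add: x_def)
 then have 3: "coeff mid 0 = 0" "coeff R 0 = 0"
  by (simp_all add: poly_0_coeff_0[symmetric] mid_def R_def poly_power)
 show ?thesis using that[OF 3 2 1] .
qed

text \<open>The dyadic level of a positive number, in the convention that level \<open>m\<close> is the half-open interval
 from \<open>2\<^sup>m\<close> to \<open>2\<^sup>m\<^sup>+\<^sup>1\<close>, closed above.\<close>

lemma dyadic_level:
 assumes "y > 0"
 shows "2 powr (real_of_int m) < y \<and> y \<le> 2 powr (real_of_int m + 1) \<longleftrightarrow> m = \<lceil>log 2 y\<rceil> - 1"
proof -
 have "2 powr (real_of_int m) < y \<longleftrightarrow> real_of_int m < log 2 y"
  using assms by (simp add: less_log_iff)
 moreover have "y \<le> 2 powr (real_of_int m + 1) \<longleftrightarrow> log 2 y \<le> real_of_int m + 1"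
  using assms by (simp add: log_le_iff)
 ultimately show ?thesis by linarith
qed

section \<open>From size and cancellation to an inequality of strong type\<close>

context averaging
begin

lemma adm_dominated:
 assumes v: "adm v" and m: "(%(th, x). u th x) \<in> borel_measurable (leb H)"
  and le: "\<And>th x. th \<in> space H ==> \<bar>u th x\<bar> \<le> \<bar>v th x\<bar>"
 shows "adm u"
proof -
 obtain B where B: "\<And>th x. th \<in> space H ==> \<bar>v th x\<bar> \<le> B"
  "\<And>th. th \<in> space H ==> mass (v th) \<le> ennreal B" using v by (auto simp: adm_def)
 show ?thesis
 proof (rule admI[OF m, of B B])
  fix th assume th: "th \<in> space H"
  show "\<bar>u th x\<bar> \<le> B" for x using order_trans[OF le[OF th] B(1)[OF th]] .
  have "mass (u th) \<le> mass (v th)"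
   by (intro nn_integral_mono ennreal_leI le th)
  then show "mass (u th) \<le> ennreal B" using B(2)[OF th] by (rule order_trans)
 qed
qed

lemma pint_mono:
 assumes "adm u" "adm v" "\<And>th x. th \<in> space H ==> u th x \<le> v th x"
 shows "pint u \<le> pint v"
 unfolding pint_def using assms(3)
 by (intro integral_mono adm_integrable' assms(1,2)) (auto simp: space_pair_measure)

lemma pint_nonneg: "(\<And>th x. u th x \<ge> 0) ==> pint u \<ge> 0"
 unfolding pint_def by (intro integral_nonneg_AE) auto

lemma pint_cmult: "pint (%th x. c * u th x) = c * pint u"
 unfolding pint_def by simp

lemma pint_sum: "(\<And>i. i \<in> A ==> adm (u i)) ==> pint (%th x. \<Sum>i\<in>A. u i th x) = (\<Sum>i\<in>A. pint (u i))"
 unfolding pint_def by (intro Bochner_Integration.integral_sum adm_integrable')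

lemma nn_integral_pint:
 assumes "adm u" "\<And>th x. u th x \<ge> 0"
 shows "(\<integral>\<^sup>+p. ennreal (u (fst p) (snd p)) \<partial>(leb H)) = ennreal (pint u)"
 unfolding pint_def using assms by (intro nn_integral_eq_integral adm_integrable') auto

definition flow :: "('a => real) => ('t => 'a => real) => real => real" where
 "flow f g s = pint (%th x. g th x * Avg th (conv (heat s) f) x)"

lemma form_eq_plin:
 assumes f: "bddint f" and g: "adm g" and t: "t \<ge> 0"
 shows "form P t f g = plin P (%i. flow f g (real i * t))"
proof -
 have hb: "bddint (conv (heat (real i * t)) f)" for i
  using t f by (intro bddint_conv bddint_heat) auto
 have a: "adm (%th x. g th x * Avg th (conv (heat (real i * t)) f) x)" for i
  by (intro adm_mult g adm_Avg hb)
 have hk: "hk P t = (%x::'a. plin P (%i. heat (real i * t) x))"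
  by (simp add: hk_def fun_eq_iff)
 have 1: "conv (hk P t) f = (%y. plin P (%i. conv (heat (real i * t)) f y))"
  unfolding hk using t f by (intro ext conv_plin_left bddint_heat bddintD) auto
 have 2: "Avg th (conv (hk P t) f) x = plin P (%i. Avg th (conv (heat (real i * t)) f) x)" if th: "th \<in> space H" for th x
  unfolding Avg_def 1
 proof (rule plin_integral)
  fix i
  obtain B where "\<And>x. \<bar>conv (heat (real i * t)) f x\<bar> \<le> B" using hb[of i] by (auto simp: bddint_def)
  then show "integrable M (%b. conv (heat (real i * t)) f (x - \<gamma> th b))"
   using hb[of i] th by (intro Avg_integrand_integrable) (auto simp: bddint_def)
 qed
 have "form P t f g = (LINT p|(leb H). plin P (%i. g (fst p) (snd p) * Avg (fst p) (conv (heat (real i * t)) f) (snd p)))"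
  unfolding form_def pint_def plin_fun_cmult
  by (rule Bochner_Integration.integral_cong) (auto simp: space_pair_measure 2)
 also have "... = plin P (%i. flow f g (real i * t))"
  unfolding flow_def pint_def by (rule plin_integral[OF adm_integrable'[OF a]])
 finally show ?thesis .
qed

text \<open>As the time tends to zero the averages of the heat flow converge boundedly for continuous
 functions; this is where a telescoping sum of the pieces recovers the operator itself.\<close>

lemma flow_tendsto:
 assumes f: "bddint f" and cont: "continuous_on UNIV f" and g: "adm g"
  and s: "\<And>n. s n > 0" "s \<longlonglongrightarrow> 0"
 shows "(%n. flow f g (s n)) \<longlonglongrightarrow> pint (%th x. g th x * Avg th f x)"
proof -
 have fm[measurable]: "Borel f" using f by (auto simp: bddint_def)
 obtain B where B: "\<And>x. \<bar>f x\<bar> \<le> B" using f by (auto simp: bddint_def)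
 have hb: "bddint (conv (heat (s n)) f)" for n
  using s(1)[of n] f by (intro bddint_conv bddint_heat) auto
 have cB: "\<bar>conv (heat (s n)) f x\<bar> \<le> B" for n x
 proof -
  have "conv (heat (s n)) f x = conv f (heat (s n)) x" by (rule conv_commute) auto
  also have "\<bar>...\<bar> \<le> B * (LBINT (y::'a). \<bar>heat (s n) y\<bar>)"
   using s(1)[of n] by (intro conv_abs_le f heat_integrable B) auto
  finally show ?thesis using s(1)[of n] by (simp add: integral_heat)
 qed
 have lim: "(%n. Avg th (conv (heat (s n)) f) x) \<longlonglongrightarrow> Avg th f x" if th[measurable]: "th \<in> space H" for th x
  unfolding Avg_def
 proof (rule integral_dominated_convergence[where w = "%_. B"])
  show "(%b. conv (heat (s n)) f (x - \<gamma> th b)) \<in> borel_measurable M" for n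
   using hb[of n] th by (intro measurable_compose[OF _ bddintD(1)[OF hb]]) measurable
 qed (use th cB in \<open>auto intro!: conv_heat_tendsto f cont s\<close>)
 show ?thesis
  unfolding flow_def pint_def
 proof (rule integral_dominated_convergence[where w = "%p. (B * measure M (space M)) * \<bar>g (fst p) (snd p)\<bar>"])
  show "integrable (leb H) (%p. (B * measure M (space M)) * \<bar>g (fst p) (snd p)\<bar>)"
   by (intro integrable_mult_right integrable_abs adm_integrable' g)
  show "(%p. g (fst p) (snd p) * Avg (fst p) f (snd p)) \<in> borel_measurable (leb H)"
   using adm_integrable'[OF adm_mult[OF g adm_Avg[OF f]]] by auto
  show "(%p. g (fst p) (snd p) * Avg (fst p) (conv (heat (s n)) f) (snd p)) \<in> borel_measurable (leb H)" for n
   using adm_integrable'[OF adm_mult[OF g adm_Avg[OF hb]]] by auto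
  show "AE p in leb H. (%n. g (fst p) (snd p) * Avg (fst p) (conv (heat (s n)) f) (snd p)) \<longlonglongrightarrow> g (fst p) (snd p) * Avg (fst p) f (snd p)"
   by (rule AE_I2) (auto simp: space_pair_measure intro!: tendsto_mult_left lim)
  show "AE p in leb H. norm (g (fst p) (snd p) * Avg (fst p) (conv (heat (s n)) f) (snd p)) \<le> (B * measure M (space M)) * \<bar>g (fst p) (snd p)\<bar>" for n
  proof (rule AE_I2)
   fix p :: "'t \<times> 'a" assume "p \<in> space (leb H)"
   then have th: "fst p \<in> space H" by (auto simp: space_pair_measure)
   show "norm (g (fst p) (snd p) * Avg (fst p) (conv (heat (s n)) f) (snd p)) \<le> (B * measure M (space M)) * \<bar>g (fst p) (snd p)\<bar>"
    using mult_right_mono[OF Avg_abs_le[OF bddintD(1)[OF hb] cB th], of "\<bar>g (fst p) (snd p)\<bar>"]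
    by (simp add: abs_mult mult.commute)
  qed
 qed
qed

text \<open>The step from testing against level sets to the \<open>L\<^sup>q\<close> norm: the inequality is tested on the
 level sets of \<open>F\<^sup>q\<^sup>-\<^sup>1\<close>, which is the extremal function in the duality of \<open>L\<^sup>p\<close> and \<open>L\<^sup>q\<close>, and finitely
 many levels at a time, so that the quantity that is divided out is finite.\<close>

lemma strong_type_from_levels:
 fixes p q C0 X :: real
 assumes F: "adm F" and F0: "\<And>th x. F th x \<ge> 0" and p: "p > 1" and q: "q = p / (p - 1)"
  and C0: "C0 \<ge> 0" and X: "X \<ge> 0"
  and hyp: "\<And>(L::int set) g b. finite L ==> (\<And>l. l \<in> L ==> adm (g l)) ==> (\<And>l th x. l \<in> L ==> 0 \<le> g l th x \<and> g l th x \<le> 1) ==>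
    (\<And>l. l \<in> L ==> pint (g l) \<le> b l) ==>
    (\<Sum>l\<in>L. 2 powr real_of_int l * pint (%th x. g l th x * F th x)) \<le> C0 * (X * (\<Sum>l\<in>L. 2 powr (real_of_int l * p) * b l)) powr (1 / p)"
 shows "(\<integral>\<^sup>+n. ennreal (F (fst n) (snd n) powr q) \<partial>(leb H)) \<le> ennreal ((2 * C0) powr q * X powr (q / p))"
proof -
 have q1: "q - 1 = 1 / (p - 1)" using p by (simp add: q field_simps)
 have q1': "q - 1 > 0" using p unfolding q1 by simp
 have qp: "(q - 1) * p = q" by (simp only: q1) (simp add: q)
 have qq: "q > 1" using q1' by simp
 have dual: "1 / p + 1 / q = 1" using p by (simp add: q field_simps)
 define e where "e l th x = (if 2 powr (real_of_int l) < F th x powr (q - 1) \<and> F th x powr (q - 1) \<le> 2 powr (real_of_int l + 1) then 1 else 0 :: real)" for l th x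
 have e01: "0 \<le> e l th x" "e l th x \<le> 1" for l th x by (auto simp: e_def)
 have Fm[measurable]: "(%(th, x). F th x) \<in> borel_measurable (leb H)" by (rule adm_measurable[OF F])
 have Fm'[measurable]: "(%n. F (fst n) (snd n)) \<in> borel_measurable (leb H)" using Fm by (simp add: split_beta')
 have em[measurable]: "(%n. e l (fst n) (snd n)) \<in> borel_measurable (leb H)" for l
  unfolding e_def by measurable
 have Fpos: "F th x > 0" if "e l th x \<noteq> 0" for l th x
 proof -
  have "F th x powr (q - 1) > 0" using that by (auto simp: e_def split: if_splits intro: less_trans[rotated])
  then show ?thesis using F0[of th x] by (cases "F th x = 0") auto
 qed
 have Fq: "F th x powr q = F th x powr (q - 1) * F th x" for th x
  using F0[of th x] powr_add[of "F th x" "q - 1" 1] by (cases "F th x = 0") auto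
 have e_adm: "adm (e l)" for l
 proof (rule adm_dominated)
  let ?c = "(2 powr (real_of_int l)) powr (1 / (q - 1))"
  show "adm (%th x. (1 / ?c) * F th x)" by (rule adm_cmult[OF F])
  show "(%(th, x). e l th x) \<in> borel_measurable (leb H)" using em by (simp add: split_beta')
  fix th x
  have "?c \<le> F th x" if "e l th x \<noteq> 0"
  proof -
   have "?c \<le> (F th x powr (q - 1)) powr (1 / (q - 1))"
    using that q1' by (intro powr_mono2) (auto simp: e_def split: if_splits)
   then show ?thesis using q1' Fpos[OF that] by (simp add: powr_powr)
  qed
  then show "\<bar>e l th x\<bar> \<le> \<bar>(1 / ?c) * F th x\<bar>"
   using F0[of th x] by (cases "e l th x = 0") (auto simp: e_def field_simps split: if_splits)
 qed
 have eF_adm: "adm (%th x. e l th x * F th x)" for l by (intro adm_mult e_adm F)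
 have le2: "e l th x * F th x powr q \<le> 2 * (2 powr (real_of_int l) * (e l th x * F th x))" for l th x
  using F0[of th x] mult_right_mono[of "F th x powr (q - 1)" "2 powr (real_of_int l + 1)" "F th x"]
  by (auto simp: e_def Fq powr_add mult_ac)
 have eFq_adm: "adm (%th x. e l th x * F th x powr q)" for l
 proof (rule adm_dominated)
  show "adm (%th x. 2 * (2 powr (real_of_int l) * (e l th x * F th x)))" by (intro adm_cmult eF_adm)
  show "(%(th, x). e l th x * F th x powr q) \<in> borel_measurable (leb H)"
   unfolding split_beta' by measurable
  show "\<bar>e l th x * F th x powr q\<bar> \<le> \<bar>2 * (2 powr (real_of_int l) * (e l th x * F th x))\<bar>" for th x
   using le2[of l th x] e01[of l th x] F0[of th x] by (simp add: abs_mult)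
 qed
 have ge: "2 powr (real_of_int l * p) * e l th x \<le> e l th x * F th x powr q" for l th x
 proof (cases "e l th x = 0")
  case False
  then have "(2 powr (real_of_int l)) powr p \<le> (F th x powr (q - 1)) powr p"
   using p by (intro powr_mono2) (auto simp: e_def split: if_splits)
  then show ?thesis using False qp by (auto simp: powr_powr e_def split: if_splits)
 qed simp
 define Y where "Y N = (\<Sum>l\<in>{- int N..int N}. pint (%th x. e l th x * F th x powr q))" for N
 have Y0: "Y N \<ge> 0" for N unfolding Y_def using e01 F0 by (intro sum_nonneg pint_nonneg) auto
 have Y_le: "Y N \<le> (2 * C0) powr q * X powr (q / p)" for N
 proof (cases "Y N = 0")
  case False
  then have Ypos: "Y N > 0" using Y0[of N] by simp
  let ?L = "{- int N..int N}"
  have "Y N \<le> (\<Sum>l\<in>?L. 2 * (2 powr real_of_int l * pint (%th x. e l th x * F th x)))"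
   unfolding Y_def pint_cmult[symmetric] by (intro sum_mono pint_mono eFq_adm adm_cmult eF_adm le2)
  also have "... = 2 * (\<Sum>l\<in>?L. 2 powr real_of_int l * pint (%th x. e l th x * F th x))"
   by (simp add: sum_distrib_left)
  also have "... \<le> 2 * (C0 * (X * (\<Sum>l\<in>?L. 2 powr (real_of_int l * p) * pint (e l))) powr (1 / p))"
   using e01 e_adm by (intro mult_left_mono hyp) auto
  also have "... \<le> 2 * (C0 * (X * Y N) powr (1 / p))"
  proof (intro mult_left_mono powr_mono2)
   show "(\<Sum>l\<in>?L. 2 powr (real_of_int l * p) * pint (e l)) \<le> Y N"
    unfolding Y_def pint_cmult[symmetric] by (intro sum_mono pint_mono eFq_adm adm_cmult e_adm ge)
   show "0 \<le> X * (\<Sum>l\<in>?L. 2 powr (real_of_int l * p) * pint (e l))"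
    using X e01 by (intro mult_nonneg_nonneg sum_nonneg pint_nonneg) auto
  qed (use p C0 X in auto)
  also have "... = (2 * C0) * X powr (1 / p) * Y N powr (1 / p)"
   using X Ypos by (simp add: powr_mult)
  finally have "Y N \<le> (2 * C0) * X powr (1 / p) * Y N powr (1 / p)" .
  moreover have "Y N = Y N powr (1 / q) * Y N powr (1 / p)"
   using dual Ypos by (simp add: powr_add[symmetric] add.commute)
  ultimately have "Y N powr (1 / q) * Y N powr (1 / p) \<le> (2 * C0) * X powr (1 / p) * Y N powr (1 / p)" by simp
  then have "Y N powr (1 / q) \<le> (2 * C0) * X powr (1 / p)"
   using Ypos by simp
  then have "(Y N powr (1 / q)) powr q \<le> ((2 * C0) * X powr (1 / p)) powr q"
   using qq by (intro powr_mono2) auto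
  then show ?thesis using qq Ypos C0 by (simp add: powr_powr powr_mult)
 qed simp
 let ?f = "%N n. ennreal (\<Sum>l\<in>{- int N..int N}. e l (fst n) (snd n) * F (fst n) (snd n) powr q)"
 have "(\<integral>\<^sup>+n. ennreal (F (fst n) (snd n) powr q) \<partial>(leb H)) \<le> (\<integral>\<^sup>+n. (SUP N. ?f N n) \<partial>(leb H))"
 proof (rule nn_integral_mono)
  fix n :: "'t \<times> 'a"
  let ?F = "F (fst n) (snd n)"
  show "ennreal (?F powr q) \<le> (SUP N. ?f N n)"
  proof (cases "?F = 0")
   case False
   then have pos: "?F > 0" using F0[of "fst n" "snd n"] by simp
   then have pos': "?F powr (q - 1) > 0" by simp
   define l0 where "l0 = \<lceil>log 2 (?F powr (q - 1))\<rceil> - 1"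
   have e: "e l0 (fst n) (snd n) = 1"
    using dyadic_level[OF pos', of l0] by (auto simp: e_def l0_def)
   have "?F powr q = e l0 (fst n) (snd n) * ?F powr q" using e by simp
   also have "... \<le> (\<Sum>l\<in>{- int (nat \<bar>l0\<bar>)..int (nat \<bar>l0\<bar>)}. e l (fst n) (snd n) * ?F powr q)"
    using e01 by (intro member_le_sum) auto
   finally show ?thesis by (intro SUP_upper2[of "nat \<bar>l0\<bar>"]) (auto intro: ennreal_leI)
  qed (use qq in simp)
 qed
 also have "... = (SUP N. \<integral>\<^sup>+n. ?f N n \<partial>(leb H))"
 proof (rule nn_integral_monotone_convergence_SUP)
  show "incseq ?f"
   using e01 by (auto simp: incseq_def le_fun_def intro!: ennreal_leI sum_mono2)
 qed measurable
 also have "... \<le> ennreal ((2 * C0) powr q * X powr (q / p))"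
 proof (rule SUP_least)
  fix N
  have "(\<integral>\<^sup>+n. ?f N n \<partial>(leb H)) = ennreal (pint (%th x. \<Sum>l\<in>{- int N..int N}. e l th x * F th x powr q))"
   using e01 by (intro nn_integral_pint adm_sum eFq_adm) (auto intro!: sum_nonneg)
  also have "... = ennreal (Y N)" unfolding Y_def by (subst pint_sum) (auto intro: eFq_adm)
  also have "... \<le> ennreal ((2 * C0) powr q * X powr (q / p))" by (intro ennreal_leI Y_le)
  finally show "(\<integral>\<^sup>+n. ?f N n \<partial>(leb H)) \<le> ennreal ((2 * C0) powr q * X powr (q / p))" .
 qed
 finally show ?thesis .
qed

end

text \<open>The two hypotheses on which the inequality of strong type rests. The exponent \<open>\<alpha>\<close> measures the
 dimension of the measure; \<open>\<beta>\<close> is the gain in \<open>L\<^sup>2\<close>, stated for the kernel of \<open>T\<^sup>* T\<close>, whence the factor two.\<close>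

locale smoothing_averaging = averaging H M \<gamma>
 for H :: "'t measure" and M :: "'b measure" and \<gamma> :: "'t => 'b => 'a::euclidean_space" +
 fixes \<alpha> \<beta> A :: real and K :: nat
 assumes \<alpha>: "\<alpha> > 0" and \<beta>: "\<beta> > 0" and A: "A \<ge> 0"
  and size: "\<And>th s v. th \<in> space H ==> s > 0 ==> (LINT b|M. heat s (v - \<gamma> th b)) \<le> A * s powr (- \<alpha>)"
  and cancellation: "\<And>i::nat. i \<ge> 1 ==> \<exists>C\<ge>0. \<forall>t>0.
    mass (%z. fdiff (2 * K) (%s. autocorr s z) t (real i * t)) \<le> ennreal (C * t powr (2 * \<beta>))"
begin

definition pexp :: real where "pexp = 1 + \<alpha> / (\<alpha> + 2 * \<beta>)"

lemma pexp: "pexp > 1" using \<alpha> \<beta> by (simp add: pexp_def)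

text \<open>By the \<open>T\<^sup>* T\<close> identity and Schur's test; the zeros of \<open>mid\<^sup>2\<close> at \<open>X = 1\<close> become the finite
 difference in the cancellation hypothesis.\<close>

lemma quadratic_bound:
 assumes mid: "coeff mid 0 = 0" and R: "coeff R 0 = 0" "mid * mid = [:1, -1:] ^ (2 * K) * R"
 obtains C where "C \<ge> 0" "\<And>t h. t > 0 ==> bddint h ==>
  pint (%th x. (Avg th (conv (hk mid t) h) x)\<^sup>2) \<le> C * t powr (2 * \<beta>) * (LBINT x. (h x)\<^sup>2)"
proof -
 have "\<forall>i::nat. \<exists>C\<ge>0. i \<ge> 1 --> (\<forall>t>0.
    mass (%z. fdiff (2 * K) (%s. autocorr s z) t (real i * t)) \<le> ennreal (C * t powr (2 * \<beta>)))"
  using cancellation by (metis order_refl)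
 then obtain C where C: "\<And>i::nat. C i \<ge> 0" "\<And>i t. i \<ge> 1 ==> t > 0 ==>
    mass (%z. fdiff (2 * K) (%s. autocorr s z) t (real i * t)) \<le> ennreal (C i * t powr (2 * \<beta>))"
  by metis
 let ?C = "\<Sum>i\<le>degree R. \<bar>coeff R i\<bar> * C i"
 show ?thesis
 proof
  show "?C \<ge> 0" using C by (intro sum_nonneg) auto
  fix t :: real and h :: "'a => real" assume t: "t > 0" and h: "bddint h"
  have fm: "Borel (%z. fdiff N (%s. autocorr s z) t s)" for N s
   by (induction N arbitrary: s) auto
  have "mass (%z. LINT n|pairs. conv (hk mid t) (hk mid t) (z + displacement n))
   = mass (%z. plin R (%i. fdiff (2 * K) (%s. autocorr s z) t (real i * t)))"
   by (simp only: conv_hk_hk[OF t mid mid] R(2) integral_hk_displacement[OF t])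
  also have "... \<le> ennreal (\<Sum>i\<le>degree R. \<bar>coeff R i\<bar> * (C i * t powr (2 * \<beta>)))"
  proof (rule nn_integral_plin_le)
   fix i assume "coeff R i \<noteq> 0"
   then have "i \<ge> 1" using R(1) by (cases i) auto
   then show "mass (%z. fdiff (2 * K) (%s. autocorr s z) t (real i * t)) \<le> ennreal (C i * t powr (2 * \<beta>))"
    using C(2) t by simp
  qed (use C(1) fm in auto)
  also have "(\<Sum>i\<le>degree R. \<bar>coeff R i\<bar> * (C i * t powr (2 * \<beta>))) = ?C * t powr (2 * \<beta>)"
   by (simp add: sum_distrib_right mult.assoc)
  finally have "mass (%z. LINT n|pairs. conv (hk mid t) (hk mid t) (z + displacement n)) \<le> ennreal (?C * t powr (2 * \<beta>))" .
  then show "pint (%th x. (Avg th (conv (hk mid t) h) x)\<^sup>2) \<le> ?C * t powr (2 * \<beta>) * (LBINT x. (h x)\<^sup>2)"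
   using t h C(1) by (intro pint_Avg_square_le bddint_hk hk_minus) (auto intro!: mult_nonneg_nonneg sum_nonneg)
 qed
qed

text \<open>Test functions in place of the indicators of level sets of two functions, at the heights
 \<open>2\<^sup>m\<close> and \<open>2\<^sup>l\<close>, with bounds for their masses.\<close>

definition level_system ::
 "int set => (int => 'a => real) => (int => real) => int set => (int => 't => 'a => real) => (int => real) => bool" where
 "level_system I f a L g b \<longleftrightarrow> finite I \<and> finite L \<and>
   (\<forall>m\<in>I. bddint (f m) \<and> continuous_on UNIV (f m) \<and> (\<forall>x. 0 \<le> f m x \<and> f m x \<le> 1) \<and> (LBINT x. f m x) \<le> a m) \<and>
   (\<forall>l\<in>L. adm (g l) \<and> (\<forall>th x. 0 \<le> g l th x \<and> g l th x \<le> 1) \<and> pint (g l) \<le> b l)"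

text \<open>The hypotheses of the discrete interpolation inequality are the size bound, the factorization with
 the quadratic bound, and the two square function estimates.\<close>

lemma dyadic_pieces_sum:
 assumes mid: "coeff mid 0 = 0" and w: "w = dpoly * mid * dpoly"
  and C0: "C \<ge> 0" and C: "\<And>t h. t > 0 ==> bddint h ==>
   pint (%th x. (Avg th (conv (hk mid t) h) x)\<^sup>2) \<le> C * t powr (2 * \<beta>) * (LBINT x. (h x)\<^sup>2)"
  and sys: "level_system I f am L g bl" and eps: "\<epsilon> > 0"
 shows "(\<Sum>m\<in>I. \<Sum>l\<in>L. \<Sum>j<J. 2 powr real_of_int m * 2 powr real_of_int l * \<bar>form w (\<epsilon> * 2 ^ j) (f m) (g l)\<bar>)
  \<le> (coeff_sum w * A + C + 1) * (1 / (1 - 2 powr (- \<alpha>)) + 2 / (1 - 2 powr (- (\<beta> / (\<alpha> + 2 * \<beta>))))) *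
   ((\<Sum>m\<in>I. 2 powr (real_of_int m * pexp) * am m) * (\<Sum>l\<in>L. 2 powr (real_of_int l * pexp) * bl l)) powr (1 / pexp)"
proof (rule discrete_interpolation)
 let ?x = "%j m. 2 powr (2 * real_of_int m) * square_fun (f m) (\<epsilon> * 2 ^ j)"
 let ?y = "%j l. 2 powr (2 * real_of_int l) * \<bar>pint (%th x. (conv (hk dpoly (\<epsilon> * 2 ^ j)) (g l th) x)\<^sup>2)\<bar>"
 have cs: "coeff_sum w * A \<ge> 0" using A by (intro mult_nonneg_nonneg coeff_sum_nonneg)
 have w0: "coeff w 0 = 0" unfolding w by (simp add: coeff_mult dpoly_def)
 have fI: "bddint (f m)" "0 \<le> f m x" "f m x \<le> 1" "(LBINT x. f m x) \<le> am m" if "m \<in> I" for m x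
  using sys that by (auto simp: level_system_def)
 have gL: "adm (g l)" "0 \<le> g l th x" "g l th x \<le> 1" "pint (g l) \<le> bl l" if "l \<in> L" for l th x
  using sys that by (auto simp: level_system_def)
 have am0: "am m \<ge> 0" if "m \<in> I" for m
  using order_trans[OF integral_nonneg_AE fI(4)[OF that]] fI(2)[OF that] by auto
 have bl0: "bl l \<ge> 0" if "l \<in> L" for l
  using order_trans[OF pint_nonneg gL(4)[OF that]] gL(2)[OF that] by auto
 show "\<alpha> > 0" "\<beta> > 0" "\<epsilon> > 0" by (fact \<alpha> \<beta> eps)+
 show "coeff_sum w * A + C + 1 \<ge> 0" using cs C0 by simp
 show "finite I" "finite L" using sys by (auto simp: level_system_def)
 show "0 \<le> 2 powr (real_of_int m * pexp) * am m" if "m \<in> I" for m using am0[OF that] by simp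
 show "0 \<le> 2 powr (real_of_int l * pexp) * bl l" if "l \<in> L" for l using bl0[OF that] by simp
 show "pexp = 1 + \<alpha> / (\<alpha> + 2 * \<beta>)" by (fact pexp_def)
 show "?x j m \<ge> 0" for j m by (simp add: square_fun_nonneg)
 show "?y j l \<ge> 0" for j l by simp
 fix m l :: int and j :: nat
 {
  assume j: "j < J" and m: "m \<in> I" and l: "l \<in> L"
  let ?t = "\<epsilon> * 2 ^ j"
  have t: "?t > 0" using eps by simp
  have "\<bar>form w ?t (f m) (g l)\<bar> \<le> coeff_sum w * (A * ?t powr (- \<alpha>)) * (LBINT x. \<bar>f m x\<bar>) * pint (%th x. \<bar>g l th x\<bar>)"
   by (rule form_size[OF size A \<alpha> t w0 fI(1)[OF m] gL(1)[OF l]])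
  also have "(LBINT x. \<bar>f m x\<bar>) = (LBINT x. f m x)" using fI(2)[OF m] by simp
  also have "(%th x. \<bar>g l th x\<bar>) = g l" using gL(2)[OF l] by (simp add: fun_eq_iff)
  also have "coeff_sum w * (A * ?t powr (- \<alpha>)) * (LBINT x. f m x) * pint (g l) \<le> coeff_sum w * (A * ?t powr (- \<alpha>)) * am m * bl l"
   using fI(2,4)[OF m] gL(2,4)[OF l] A am0[OF m]
   by (intro mult_mono mult_nonneg_nonneg coeff_sum_nonneg pint_nonneg integral_nonneg_AE order_refl) auto
  also have "... = (coeff_sum w * A) * ?t powr (- \<alpha>) * (am m * bl l)" by (simp add: mult_ac)
  also have "... \<le> (coeff_sum w * A + C + 1) * ?t powr (- \<alpha>) * (am m * bl l)"
   using C0 am0[OF m] bl0[OF l] by (intro mult_right_mono) auto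
  finally have le: "\<bar>form w ?t (f m) (g l)\<bar> \<le> (coeff_sum w * A + C + 1) * ?t powr (- \<alpha>) * (am m * bl l)" .
  have e: "2 powr (real_of_int i * (1 - pexp)) * (2 powr (real_of_int i * pexp) * z) = 2 powr real_of_int i * z" for i z
   by (simp add: mult.assoc[symmetric] powr_add[symmetric] algebra_simps)
  show "2 powr real_of_int m * 2 powr real_of_int l * \<bar>form w ?t (f m) (g l)\<bar> \<le>
   (coeff_sum w * A + C + 1) * ?t powr (- \<alpha>) * (2 powr (real_of_int m * (1 - pexp)) * (2 powr (real_of_int m * pexp) * am m)) *
    (2 powr (real_of_int l * (1 - pexp)) * (2 powr (real_of_int l * pexp) * bl l))"
   unfolding e using mult_left_mono[OF le, of "2 powr real_of_int m * 2 powr real_of_int l"]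
   by (simp add: mult_ac)
 }
 {
  fix \<rho> :: real
  assume j: "j < J" and m: "m \<in> I" and l: "l \<in> L" and r: "\<rho> > 0"
  let ?t = "\<epsilon> * 2 ^ j"
  have t: "?t > 0" using eps by simp
  define G where "G = pint (%th x. (conv (hk dpoly ?t) (g l th) x)\<^sup>2)"
  have G0: "G \<ge> 0" unfolding G_def by (intro pint_nonneg) auto
  define Q where "Q = square_fun (f m) ?t"
  have Q0: "Q \<ge> 0" by (simp add: Q_def square_fun_nonneg)
  define a b T where "a = 2 powr real_of_int m" and "b = 2 powr real_of_int l" and "T = ?t powr \<beta>"
  have pos: "a > 0" "b > 0" "T > 0" using t by (auto simp: a_def b_def T_def)
  have TT: "?t powr (2 * \<beta>) = T * T" by (simp add: T_def powr_add[symmetric])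
  let ?r = "\<rho> * (a / b) / T"
  have "2 * \<bar>form w ?t (f m) (g l)\<bar> \<le> ?r * pint (%th x. (Avg th (conv (hk mid ?t) (conv (hk dpoly ?t) (f m))) x)\<^sup>2) + G / ?r"
   unfolding w G_def using r pos fI(1)[OF m] gL(1)[OF l] t mid by (intro form_square_bound) auto
  also have "... \<le> ?r * (C * ?t powr (2 * \<beta>) * Q) + G / ?r"
   unfolding Q_def square_fun_def using r pos t fI(1)[OF m]
   by (intro add_mono mult_left_mono C bddint_conv bddint_hk) auto
  also have "... = T * (\<rho> * (a / b) * C * Q + G / (\<rho> * (a / b)))"
   unfolding TT using pos r by (simp add: field_simps)
  finally have "\<bar>form w ?t (f m) (g l)\<bar> \<le> T * (\<rho> * (a / b) * C * Q + G / (\<rho> * (a / b)))" by linarith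
  then have "a * b * \<bar>form w ?t (f m) (g l)\<bar> \<le> a * b * (T * (\<rho> * (a / b) * C * Q + G / (\<rho> * (a / b))))"
   using pos by (intro mult_left_mono) auto
  also have "... = T * (C * (\<rho> * (a * a * Q)) + 1 * (b * b * G / \<rho>))"
   using pos r by (simp add: field_simps)
  also have "... \<le> T * ((coeff_sum w * A + C + 1) * (\<rho> * (a * a * Q)) + (coeff_sum w * A + C + 1) * (b * b * G / \<rho>))"
   using pos r Q0 G0 cs C0 by (intro mult_left_mono add_mono mult_right_mono) auto
  also have "... = (coeff_sum w * A + C + 1) * T * (\<rho> * (a * a * Q) + b * b * G / \<rho>)"
   by (simp add: algebra_simps add_divide_distrib)
  also have "a * a = 2 powr (2 * real_of_int m)" by (simp add: a_def powr_add[symmetric])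
  also have "b * b = 2 powr (2 * real_of_int l)" by (simp add: b_def powr_add[symmetric])
  finally show "2 powr real_of_int m * 2 powr real_of_int l * \<bar>form w ?t (f m) (g l)\<bar> \<le>
    (coeff_sum w * A + C + 1) * ?t powr \<beta> * (\<rho> * ?x j m + ?y j l / \<rho>)"
   using G0 by (simp add: a_def b_def T_def Q_def G_def)
 }
 have e: "2 powr (real_of_int i * (2 - pexp)) * (2 powr (real_of_int i * pexp) * z) = 2 powr (2 * real_of_int i) * z" for i z
  by (simp add: mult.assoc[symmetric] powr_add[symmetric] algebra_simps)
 {
  assume m: "m \<in> I"
  have "(\<Sum>j<J. ?x j m) = 2 powr (2 * real_of_int m) * (\<Sum>j<J. square_fun (f m) (\<epsilon> * 2 ^ j))"
   by (simp add: sum_distrib_left)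
  also have "... \<le> 2 powr (2 * real_of_int m) * am m"
  proof (intro mult_left_mono)
   have "(\<Sum>j<J. square_fun (f m) (\<epsilon> * 2 ^ j)) \<le> (LBINT x. (f m x)\<^sup>2)"
    by (rule square_fun_sum_le[OF fI(1)[OF m] eps])
   also have "... \<le> (LBINT x. f m x)"
    using fI(2,3)[OF m] bddint_mult_integrable[OF fI(1)[OF m] fI(1)[OF m]] bddintD(2)[OF fI(1)[OF m]]
    by (intro integral_mono) (auto simp: power2_eq_square mult_left_le)
   finally show "(\<Sum>j<J. square_fun (f m) (\<epsilon> * 2 ^ j)) \<le> am m" using fI(4)[OF m] by simp
  qed simp
  finally show "(\<Sum>j<J. ?x j m) \<le> 2 powr (real_of_int m * (2 - pexp)) * (2 powr (real_of_int m * pexp) * am m)"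
   unfolding e .
 }
 {
  assume l: "l \<in> L"
  have "(\<Sum>j<J. ?y j l) = 2 powr (2 * real_of_int l) * (\<Sum>j<J. pint (%th x. (conv (hk dpoly (\<epsilon> * 2 ^ j)) (g l th) x)\<^sup>2))"
   by (simp add: sum_distrib_left abs_of_nonneg[OF pint_nonneg])
  also have "... \<le> 2 powr (2 * real_of_int l) * bl l"
  proof (intro mult_left_mono)
   have "(\<Sum>j<J. pint (%th x. (conv (hk dpoly (\<epsilon> * 2 ^ j)) (g l th) x)\<^sup>2)) \<le> pint (%th x. (g l th x)\<^sup>2)"
    by (rule pint_square_fun_sum[OF gL(1)[OF l] eps])
   also have "... \<le> pint (g l)"
    using gL(2,3)[OF l] by (intro pint_mono gL(1)[OF l]) (auto simp: power2_eq_square mult_left_le intro!: adm_mult gL(1)[OF l])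
   finally show "(\<Sum>j<J. pint (%th x. (conv (hk dpoly (\<epsilon> * 2 ^ j)) (g l th) x)\<^sup>2)) \<le> bl l" using gL(4)[OF l] by simp
  qed simp
  finally show "(\<Sum>j<J. ?y j l) \<le> 2 powr (real_of_int l * (2 - pexp)) * (2 powr (real_of_int l * pexp) * bl l)"
   unfolding e .
 }
qed

text \<open>The pieces \<open>w = \<chi> - \<chi>(X\<^sup>2)\<close> at the times \<open>\<epsilon> 2\<^sup>j\<close> telescope to the difference of \<open>\<chi>\<close> at the first and
 the last time. The first tends to the identity as \<open>\<epsilon>\<close> tends to zero, and the last tends to zero by
 the size bound as the number of pieces grows.\<close>

lemma level_inequality:
 obtains C where "C \<ge> 0" "\<And>I f a L g b. level_system I f a L g b ==>
  (\<Sum>m\<in>I. \<Sum>l\<in>L. 2 powr real_of_int m * 2 powr real_of_int l * pint (%th x. g l th x * Avg th (f m) x))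
   \<le> C * ((\<Sum>m\<in>I. 2 powr (real_of_int m * pexp) * a m) * (\<Sum>l\<in>L. 2 powr (real_of_int l * pexp) * b l)) powr (1 / pexp)"
proof -
 obtain mid R where mR: "coeff mid 0 = 0" "coeff R 0 = 0" "mid * mid = [:1, -1:] ^ (2 * K) * R"
  "chi_poly K - pcompose (chi_poly K) [:0, 0, 1:] = dpoly * mid * dpoly"
  by (rule chi_poly_factorization)
 obtain C where C0: "C \<ge> 0" and C: "\<And>t h. t > 0 ==> bddint h ==>
  pint (%th x. (Avg th (conv (hk mid t) h) x)\<^sup>2) \<le> C * t powr (2 * \<beta>) * (LBINT x. (h x)\<^sup>2)"
  by (rule quadratic_bound[OF mR(1,2,3)]) blast
 define w where "w = dpoly * mid * dpoly"
 define chi where "chi = chi_poly K"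
 define D where "D = (coeff_sum w * A + C + 1) * (1 / (1 - 2 powr (- \<alpha>)) + 2 / (1 - 2 powr (- (\<beta> / (\<alpha> + 2 * \<beta>)))))"
 have D0: "D \<ge> 0"
 proof -
  have "2 powr (- \<alpha>) < 1" "2 powr (- (\<beta> / (\<alpha> + 2 * \<beta>))) < 1"
   using \<alpha> \<beta> by (auto simp: powr_less_one)
  then show ?thesis unfolding D_def using A C0
   by (intro mult_nonneg_nonneg add_nonneg_nonneg coeff_sum_nonneg) auto
 qed
 show ?thesis
 proof
  show "D \<ge> 0" by (rule D0)
  fix I f a L g b assume sys: "level_system I f a L g b"
  have fin: "finite I" "finite L" using sys by (auto simp: level_system_def)
  have fI: "bddint (f m)" "continuous_on UNIV (f m)" if "m \<in> I" for m
   using sys that by (auto simp: level_system_def)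
  have gL: "adm (g l)" if "l \<in> L" for l
   using sys that by (auto simp: level_system_def)
  define Z where "Z = D * ((\<Sum>m\<in>I. 2 powr (real_of_int m * pexp) * a m) * (\<Sum>l\<in>L. 2 powr (real_of_int l * pexp) * b l)) powr (1 / pexp)"
  let ?c = "%(m::int) (l::int). 2 powr real_of_int m * 2 powr real_of_int l"
  have step: "form chi t (f m) (g l) - form chi (2 * t) (f m) (g l) = form w t (f m) (g l)"
   if "m \<in> I" "l \<in> L" "t > 0" for m l t
  proof -
   have "form chi (2 * t) (f m) (g l) = plin chi (%i. flow (f m) (g l) (real (2 * i) * t))"
    using that fI gL by (subst form_eq_plin) (auto simp: mult_ac)
   also have "... = plin (pcompose chi [:0, 0, 1:]) (%i. flow (f m) (g l) (real i * t))"
    by (rule plin_pcompose_square[symmetric])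
   finally have "form chi t (f m) (g l) - form chi (2 * t) (f m) (g l) =
     plin (chi - pcompose chi [:0, 0, 1:]) (%i. flow (f m) (g l) (real i * t))"
    using that fI gL by (simp add: form_eq_plin plin_diff)
   also have "... = form w t (f m) (g l)"
    unfolding chi_def mR(4) w_def[symmetric] using that fI gL by (subst form_eq_plin) auto
   finally show ?thesis .
  qed
  have tele: "form chi \<epsilon> (f m) (g l) = (\<Sum>j<J. form w (\<epsilon> * 2 ^ j) (f m) (g l)) + form chi (\<epsilon> * 2 ^ J) (f m) (g l)"
   if "m \<in> I" "l \<in> L" "\<epsilon> > 0" for m l \<epsilon> J
  proof -
   have "(\<Sum>j<J. form w (\<epsilon> * 2 ^ j) (f m) (g l)) = (\<Sum>j<J. form chi (\<epsilon> * 2 ^ j) (f m) (g l) - form chi (\<epsilon> * 2 ^ Suc j) (f m) (g l))"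
    using that by (intro sum.cong refl) (subst step[symmetric], auto simp: mult_ac)
   also have "... = form chi \<epsilon> (f m) (g l) - form chi (\<epsilon> * 2 ^ J) (f m) (g l)"
    using sum_lessThan_telescope'[of "%j. form chi (\<epsilon> * 2 ^ j) (f m) (g l)" J] by simp
   finally show ?thesis by simp
  qed
  have tail: "(%J. form chi (\<epsilon> * 2 ^ J) (f m) (g l)) \<longlonglongrightarrow> 0" if "m \<in> I" "l \<in> L" "\<epsilon> > 0" for m l \<epsilon>
  proof (rule Lim_null_comparison)
   let ?B = "coeff_sum chi * A * (LBINT x. \<bar>f m x\<bar>) * pint (%th x. \<bar>g l th x\<bar>)"
   show "\<forall>\<^sub>F J in sequentially. norm (form chi (\<epsilon> * 2 ^ J) (f m) (g l)) \<le> ?B * (\<epsilon> * 2 ^ J) powr (- \<alpha>)"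
   proof (intro always_eventually allI)
    fix J
    have "\<bar>form chi (\<epsilon> * 2 ^ J) (f m) (g l)\<bar> \<le> coeff_sum chi * (A * (\<epsilon> * 2 ^ J) powr (- \<alpha>)) * (LBINT x. \<bar>f m x\<bar>) * pint (%th x. \<bar>g l th x\<bar>)"
     using that by (intro form_size size A \<alpha> fI gL) (auto simp: chi_def coeff_chi_poly)
    then show "norm (form chi (\<epsilon> * 2 ^ J) (f m) (g l)) \<le> ?B * (\<epsilon> * 2 ^ J) powr (- \<alpha>)"
     by (simp add: mult_ac)
   qed
   have "(%J. \<epsilon> powr (- \<alpha>) * (2 powr (- \<alpha>)) ^ J) \<longlonglongrightarrow> \<epsilon> powr (- \<alpha>) * 0"
    using \<alpha> by (intro tendsto_mult_left LIMSEQ_realpow_zero) (auto simp: powr_less_one)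
   moreover have "\<epsilon> powr (- \<alpha>) * (2 powr (- \<alpha>)) ^ J = (\<epsilon> * 2 ^ J) powr (- \<alpha>)" for J
    using that by (simp add: powr_mult powr_realpow[symmetric] powr_powr mult.commute)
   ultimately have "(%J. (\<epsilon> * 2 ^ J) powr (- \<alpha>)) \<longlonglongrightarrow> 0" by simp
   then show "(%J. ?B * (\<epsilon> * 2 ^ J) powr (- \<alpha>)) \<longlonglongrightarrow> 0"
    by (rule tendsto_mult_right_zero)
  qed
  have eps: "(\<Sum>m\<in>I. \<Sum>l\<in>L. ?c m l * form chi \<epsilon> (f m) (g l)) \<le> Z" if e: "\<epsilon> > 0" for \<epsilon>
  proof (rule LIMSEQ_le_const)
   show "(%J. Z + (\<Sum>m\<in>I. \<Sum>l\<in>L. ?c m l * form chi (\<epsilon> * 2 ^ J) (f m) (g l))) \<longlonglongrightarrow> Z"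
   proof -
    have "(%J. Z + (\<Sum>m\<in>I. \<Sum>l\<in>L. ?c m l * form chi (\<epsilon> * 2 ^ J) (f m) (g l))) \<longlonglongrightarrow> Z + (\<Sum>m\<in>I. \<Sum>l\<in>L. ?c m l * 0)"
     by (intro tendsto_add tendsto_const tendsto_sum tendsto_mult_left tail e)
    then show ?thesis by simp
   qed
   show "\<exists>N. \<forall>J\<ge>N. (\<Sum>m\<in>I. \<Sum>l\<in>L. ?c m l * form chi \<epsilon> (f m) (g l)) \<le> Z + (\<Sum>m\<in>I. \<Sum>l\<in>L. ?c m l * form chi (\<epsilon> * 2 ^ J) (f m) (g l))"
   proof (intro exI allI impI)
    fix J
    have "(\<Sum>m\<in>I. \<Sum>l\<in>L. ?c m l * form chi \<epsilon> (f m) (g l)) =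
      (\<Sum>m\<in>I. \<Sum>l\<in>L. (\<Sum>j<J. ?c m l * form w (\<epsilon> * 2 ^ j) (f m) (g l)) + ?c m l * form chi (\<epsilon> * 2 ^ J) (f m) (g l))"
     using e by (intro sum.cong refl) (subst tele[where J = J], auto simp: distrib_left sum_distrib_left)
    also have "... = (\<Sum>m\<in>I. \<Sum>l\<in>L. \<Sum>j<J. ?c m l * form w (\<epsilon> * 2 ^ j) (f m) (g l)) + (\<Sum>m\<in>I. \<Sum>l\<in>L. ?c m l * form chi (\<epsilon> * 2 ^ J) (f m) (g l))"
     by (simp only: sum.distrib)
    also have "(\<Sum>m\<in>I. \<Sum>l\<in>L. \<Sum>j<J. ?c m l * form w (\<epsilon> * 2 ^ j) (f m) (g l)) \<le> (\<Sum>m\<in>I. \<Sum>l\<in>L. \<Sum>j<J. ?c m l * \<bar>form w (\<epsilon> * 2 ^ j) (f m) (g l)\<bar>)"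
     by (intro sum_mono mult_left_mono) auto
    also have "... \<le> Z"
     unfolding Z_def D_def by (rule dyadic_pieces_sum[OF mR(1) w_def C0 C sys e])
    finally show "(\<Sum>m\<in>I. \<Sum>l\<in>L. ?c m l * form chi \<epsilon> (f m) (g l)) \<le> Z + (\<Sum>m\<in>I. \<Sum>l\<in>L. ?c m l * form chi (\<epsilon> * 2 ^ J) (f m) (g l))"
     by simp
   qed
  qed
  have lim: "(%n. form chi (1 / real (Suc n)) (f m) (g l)) \<longlonglongrightarrow> pint (%th x. g l th x * Avg th (f m) x)"
   if "m \<in> I" "l \<in> L" for m l
  proof -
   have "(%n. plin chi (%i. flow (f m) (g l) (real i * (1 / real (Suc n))))) \<longlonglongrightarrow>
    poly chi 1 * pint (%th x. g l th x * Avg th (f m) x)"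
   proof (rule plin_tendsto)
    fix i assume "coeff chi i \<noteq> 0"
    then have i: "i > 0" using coeff_chi_poly[of K] by (cases i) (auto simp: chi_def)
    show "(%n. flow (f m) (g l) (real i * (1 / real (Suc n)))) \<longlonglongrightarrow> pint (%th x. g l th x * Avg th (f m) x)"
    proof (rule flow_tendsto)
     show "(%n. real i * (1 / real (Suc n))) \<longlonglongrightarrow> 0"
      using tendsto_mult_left[OF lim_1_over_n[THEN LIMSEQ_Suc], of "real i"] by simp
    qed (use i that fI gL in auto)
   qed
   then show ?thesis
    using that fI gL by (simp add: form_eq_plin chi_def poly_chi_poly)
  qed
  have "(%n. \<Sum>m\<in>I. \<Sum>l\<in>L. ?c m l * form chi (1 / real (Suc n)) (f m) (g l)) \<longlonglongrightarrow>
    (\<Sum>m\<in>I. \<Sum>l\<in>L. ?c m l * pint (%th x. g l th x * Avg th (f m) x))"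
   by (intro tendsto_sum tendsto_mult_left lim)
  then show "(\<Sum>m\<in>I. \<Sum>l\<in>L. ?c m l * pint (%th x. g l th x * Avg th (f m) x)) \<le>
   D * ((\<Sum>m\<in>I. 2 powr (real_of_int m * pexp) * a m) * (\<Sum>l\<in>L. 2 powr (real_of_int l * pexp) * b l)) powr (1 / pexp)"
   unfolding Z_def[symmetric] by (rule LIMSEQ_le_const2) (auto intro!: eps)
 qed
qed

end

section \<open>The strong type inequality for Borel functions\<close>

text \<open>Continuous functions that increase to the indicator of an open set.\<close>

definition ramp :: "'a::euclidean_space set => nat => 'a => real" where
 "ramp U i x = min 1 (real i * infdist x (- U))"

lemma ramp_bounds: "0 \<le> ramp U i x" "ramp U i x \<le> indicator U x" "ramp U i x \<le> 1"
 by (auto simp: ramp_def infdist_nonneg indicator_def)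

lemma continuous_ramp: "continuous_on UNIV (ramp U i)"
 unfolding ramp_def[abs_def] by (intro continuous_intros)

lemma ramp_tendsto:
 fixes U :: "'a::euclidean_space set"
 assumes U: "open U" "emeasure lborel U < \<infinity>"
 shows "(%i. ramp U i x) \<longlonglongrightarrow> indicator U x"
proof (cases "x \<in> U")
 case False
 then show ?thesis by (simp add: ramp_def)
next
 case True
 have "- U \<noteq> {}"
 proof
  assume "- U = {}"
  then have "U = UNIV" by auto
  then show False using U(2) emeasure_lborel_UNIV[where 'a = 'a] by simp
 qed
 then have d: "infdist x (- U) > 0"
  using True U(1) by (intro infdist_pos_not_in_closed) auto
 obtain N where N: "1 \<le> real N * infdist x (- U)"
  using ex_less_of_nat_mult[OF d, of 1] by (auto intro: less_imp_le)
 have "ramp U i x = 1" if "i \<ge> N" for i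
 proof -
  have "real N * infdist x (- U) \<le> real i * infdist x (- U)"
   using that d by (intro mult_right_mono) auto
  then show ?thesis using N by (simp add: ramp_def)
 qed
 then have "(%i. ramp U i x) \<longlonglongrightarrow> 1"
  by (intro tendsto_eventually) (auto simp: eventually_sequentially)
 then show ?thesis using True by simp
qed

lemma bddint_ramp:
 fixes U :: "'a::euclidean_space set"
 assumes U: "open U" "emeasure lborel U < \<infinity>"
 shows "bddint (ramp U i)" "(LBINT x. ramp U i x) \<le> measure lborel U"
proof -
 have [measurable]: "Borel (ramp U i)"
  by (rule borel_measurable_continuous_onI[OF continuous_ramp])
 have iU: "integrable lborel (indicator U :: 'a => real)"
  using U by (intro integrable_real_indicator) auto
 have iR: "integrable lborel (ramp U i)"
  using iU by (rule Bochner_Integration.integrable_bound) (use ramp_bounds[of U i] in \<open>auto simp: abs_of_nonneg\<close>)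
 show "bddint (ramp U i)"
  using iR ramp_bounds[of U i] by (auto simp: bddint_def abs_of_nonneg intro!: exI[of _ 1])
 have "(LBINT x. ramp U i x) \<le> (LBINT x. indicator U x)"
  using iR iU ramp_bounds(2)[of U i] by (intro integral_mono) auto
 then show "(LBINT x. ramp U i x) \<le> measure lborel U" using U by simp
qed

context smoothing_averaging
begin

definition qexp :: real where "qexp = pexp / (pexp - 1)"

lemma qexp: "qexp > 1"
proof -
 have "qexp - 1 = 1 / (pexp - 1)" using pexp by (simp add: qexp_def field_simps)
 then show ?thesis using pexp by (smt (verit) divide_pos_pos)
qed

text \<open>For open sets the level inequality applies to continuous functions that increase to the
 indicators, and Fatou's lemma gives the limit.\<close>

lemma open_levels_bound:
 assumes C0: "C \<ge> 0" and C: "\<And>I f a L g b. level_system I f a L g b ==>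
  (\<Sum>m\<in>I. \<Sum>l\<in>L. 2 powr real_of_int m * 2 powr real_of_int l * pint (%th x. g l th x * Avg th (f m) x))
   \<le> C * ((\<Sum>m\<in>I. 2 powr (real_of_int m * pexp) * a m) * (\<Sum>l\<in>L. 2 powr (real_of_int l * pexp) * b l)) powr (1 / pexp)"
  and fin: "finite I" and U: "\<And>m. m \<in> I ==> open (U m)" "\<And>m. m \<in> I ==> emeasure lborel (U m) < \<infinity>"
  and X: "(\<Sum>m\<in>I. 2 powr (real_of_int m * pexp) * measure lborel (U m)) \<le> X"
 shows "(\<integral>\<^sup>+n. ennreal ((\<Sum>m\<in>I. 2 powr real_of_int m * Avg (fst n) (indicator (U m)) (snd n)) powr qexp) \<partial>(leb H))
   \<le> ennreal ((2 * C) powr qexp * X powr (qexp / pexp))"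
proof -
 have Um[measurable]: "U m \<in> sets borel" if "m \<in> I" for m using U(1)[OF that] by simp
 define F where "F i th x = (\<Sum>m\<in>I. 2 powr real_of_int m * Avg th (ramp (U m) i) x)" for i th x
 have "0 \<le> (\<Sum>m\<in>I. 2 powr (real_of_int m * pexp) * measure lborel (U m))" by (auto intro!: sum_nonneg)
 then have X0: "X \<ge> 0" using X by linarith
 have adm1: "adm (%th. Avg th (ramp (U m) i))" if "m \<in> I" for m i
  using that U by (intro adm_Avg bddint_ramp)
 have admF: "adm (F i)" for i
  unfolding F_def[abs_def] by (intro adm_sum fin adm_cmult adm1)
 have F0: "F i th x \<ge> 0" for i th x
  unfolding F_def Avg_def by (intro sum_nonneg mult_nonneg_nonneg integral_nonneg_AE) (auto simp: ramp_bounds)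
 have Fi: "(\<integral>\<^sup>+n. ennreal (F i (fst n) (snd n) powr qexp) \<partial>(leb H)) \<le> ennreal ((2 * C) powr qexp * X powr (qexp / pexp))" for i
 proof (rule strong_type_from_levels[OF admF F0 pexp qexp_def C0 X0])
  fix L :: "int set" and g b
  assume L: "finite L" and g: "\<And>l. l \<in> L ==> adm (g l)" "\<And>l th x. l \<in> L ==> 0 \<le> g l th x \<and> g l th x \<le> 1"
   and b: "\<And>l. l \<in> L ==> pint (g l) \<le> b l"
  have sys: "level_system I (%m. ramp (U m) i) (%m. measure lborel (U m)) L g b"
   unfolding level_system_def using fin L g b U by (auto simp: bddint_ramp continuous_ramp ramp_bounds)
  have b0: "b l \<ge> 0" if "l \<in> L" for l
   using order_trans[OF pint_nonneg b[OF that]] g(2)[OF that] by auto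
  have "(\<Sum>l\<in>L. 2 powr real_of_int l * pint (%th x. g l th x * F i th x)) =
   (\<Sum>l\<in>L. \<Sum>m\<in>I. 2 powr real_of_int m * 2 powr real_of_int l * pint (%th x. g l th x * Avg th (ramp (U m) i) x))"
  proof (rule sum.cong[OF refl])
   fix l assume l: "l \<in> L"
   have "(%th x. g l th x * F i th x) = (%th x. \<Sum>m\<in>I. 2 powr real_of_int m * (g l th x * Avg th (ramp (U m) i) x))"
    by (simp add: F_def sum_distrib_left mult_ac)
   then have eq: "pint (%th x. g l th x * F i th x) = (\<Sum>m\<in>I. pint (%th x. 2 powr real_of_int m * (g l th x * Avg th (ramp (U m) i) x)))"
    using g(1)[OF l] by (simp only:) (intro pint_sum adm_cmult adm_mult adm1, auto)
   show "2 powr real_of_int l * pint (%th x. g l th x * F i th x) =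
     (\<Sum>m\<in>I. 2 powr real_of_int m * 2 powr real_of_int l * pint (%th x. g l th x * Avg th (ramp (U m) i) x))"
    unfolding eq pint_cmult sum_distrib_left by (simp only: mult.assoc mult.left_commute)
  qed
  also have "... = (\<Sum>m\<in>I. \<Sum>l\<in>L. 2 powr real_of_int m * 2 powr real_of_int l * pint (%th x. g l th x * Avg th (ramp (U m) i) x))"
   by (rule sum.swap)
  also have "... \<le> C * ((\<Sum>m\<in>I. 2 powr (real_of_int m * pexp) * measure lborel (U m)) * (\<Sum>l\<in>L. 2 powr (real_of_int l * pexp) * b l)) powr (1 / pexp)"
   by (rule C[OF sys])
  also have "... \<le> C * (X * (\<Sum>l\<in>L. 2 powr (real_of_int l * pexp) * b l)) powr (1 / pexp)"
   using C0 X b0 pexp by (intro mult_left_mono powr_mono2 mult_right_mono) (auto intro!: sum_nonneg mult_nonneg_nonneg)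
  finally show "(\<Sum>l\<in>L. 2 powr real_of_int l * pint (%th x. g l th x * F i th x)) \<le>
    C * (X * (\<Sum>l\<in>L. 2 powr (real_of_int l * pexp) * b l)) powr (1 / pexp)" .
 qed
 have lim: "(%i. F i th x) \<longlonglongrightarrow> (\<Sum>m\<in>I. 2 powr real_of_int m * Avg th (indicator (U m)) x)" if th[measurable]: "th \<in> space H" for th x
  unfolding F_def
 proof (intro tendsto_sum tendsto_mult_left)
  fix m assume m: "m \<in> I"
  have [measurable]: "Borel (ramp (U m) i)" for i
   by (rule borel_measurable_continuous_onI[OF continuous_ramp])
  have [measurable]: "(indicator (U m) :: 'a => real) \<in> borel_measurable borel" using Um[OF m] by simp
  show "(%i. Avg th (ramp (U m) i) x) \<longlonglongrightarrow> Avg th (indicator (U m)) x"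
   unfolding Avg_def
   by (rule integral_dominated_convergence[where w = "%_. 1"])
     (use m U in \<open>auto simp: ramp_bounds abs_of_nonneg intro!: ramp_tendsto\<close>)
 qed
 have Fmeas: "(%n. ennreal (F i (fst n) (snd n) powr qexp)) \<in> borel_measurable (leb H)" for i
  using adm_measurable[OF admF[of i]] by (simp add: split_beta')
 have "(\<integral>\<^sup>+n. ennreal ((\<Sum>m\<in>I. 2 powr real_of_int m * Avg (fst n) (indicator (U m)) (snd n)) powr qexp) \<partial>(leb H)) =
   (\<integral>\<^sup>+n. liminf (%i. ennreal (F i (fst n) (snd n) powr qexp)) \<partial>(leb H))"
 proof (rule nn_integral_cong)
  fix n :: "'t \<times> 'a" assume "n \<in> space (leb H)"
  then have th: "fst n \<in> space H" by (auto simp: space_pair_measure)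
  have "(%i. ennreal (F i (fst n) (snd n) powr qexp)) \<longlonglongrightarrow> ennreal ((\<Sum>m\<in>I. 2 powr real_of_int m * Avg (fst n) (indicator (U m)) (snd n)) powr qexp)"
   using lim[OF th, of "snd n"] qexp F0 by (intro tendsto_ennrealI tendsto_powr' tendsto_const) auto
  then show "ennreal ((\<Sum>m\<in>I. 2 powr real_of_int m * Avg (fst n) (indicator (U m)) (snd n)) powr qexp) =
    liminf (%i. ennreal (F i (fst n) (snd n) powr qexp))"
   by (intro lim_imp_Liminf[symmetric]) auto
 qed
 also have "... \<le> liminf (%i. \<integral>\<^sup>+n. ennreal (F i (fst n) (snd n) powr qexp) \<partial>(leb H))"
  by (intro nn_integral_liminf Fmeas)
 also have "... \<le> ennreal ((2 * C) powr qexp * X powr (qexp / pexp))"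
  using Fi by (intro Liminf_le) auto
 finally show ?thesis .
qed

definition level :: "('a => real) => int => 'a set" where
 "level f m = {x. 2 powr (real_of_int m) < f x \<and> f x \<le> 2 powr (real_of_int m + 1)}"

lemma level_measurable: "f \<in> borel_measurable borel ==> level f m \<in> sets borel"
proof -
 assume f: "Borel f"
 have "level f m = f -` {2 powr (real_of_int m)<..2 powr (real_of_int m + 1)} \<inter> space borel"
  by (auto simp: level_def)
 then show ?thesis using measurable_sets[OF f] by simp
qed

lemma level_unique: "x \<in> level f m ==> m = \<lceil>log 2 (f x)\<rceil> - 1"
proof -
 assume x: "x \<in> level f m"
 have "0 < (2::real) powr (real_of_int m)" by simp
 also have "... < f x" using x by (simp add: level_def)
 finally have "f x > 0" .
 then show ?thesis using dyadic_level[of "f x" m] x by (simp add: level_def)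
qed

lemma level_exists: "f x > 0 ==> x \<in> level f (\<lceil>log 2 (f x)\<rceil> - 1)"
 using dyadic_level[of "f x" "\<lceil>log 2 (f x)\<rceil> - 1"] by (simp add: level_def)

lemma level_sum_le:
 fixes f :: "'a => real"
 assumes f[measurable]: "Borel f" and f0: "\<And>x. f x \<ge> 0"
  and int: "integrable lborel (%x. f x powr pexp)" and fin: "finite I"
 shows "m \<in> I ==> emeasure lborel (level f m) < \<infinity>"
  and "(\<Sum>m\<in>I. 2 powr (real_of_int m * pexp) * measure lborel (level f m)) \<le> (LBINT x. f x powr pexp)"
proof -
 have [measurable]: "level f m \<in> sets borel" for m by (rule level_measurable[OF f])
 have le: "2 powr (real_of_int m * pexp) * indicator (level f m) x \<le> f x powr pexp" for m x
 proof (cases "x \<in> level f m")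
  case True
  then have "(2 powr real_of_int m) powr pexp \<le> f x powr pexp"
   using pexp by (intro powr_mono2) (auto simp: level_def)
  then show ?thesis using True by (simp add: powr_powr)
 qed simp
 show fin_level: "emeasure lborel (level f m) < \<infinity>" for m
 proof -
  have "ennreal (2 powr (real_of_int m * pexp)) * emeasure lborel (level f m) =
    (\<integral>\<^sup>+x. ennreal (2 powr (real_of_int m * pexp) * indicator (level f m) x) \<partial>lborel)"
   by (simp add: ennreal_mult' nn_integral_cmult ennreal_indicator)
  also have "... \<le> (\<integral>\<^sup>+x. ennreal (f x powr pexp) \<partial>lborel)"
   by (intro nn_integral_mono ennreal_leI le)
  also have "... < \<infinity>" using int by (simp add: integrable_iff_bounded)
  finally show ?thesis by (auto simp: ennreal_mult_less_top)
 qed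
 have i1: "integrable lborel (%x. 2 powr (real_of_int m * pexp) * indicator (level f m) x)" for m
  using fin_level by (intro integrable_mult_right integrable_real_indicator) auto
 have "(\<Sum>m\<in>I. 2 powr (real_of_int m * pexp) * measure lborel (level f m)) =
   (LBINT x. (\<Sum>m\<in>I. 2 powr (real_of_int m * pexp) * indicator (level f m) x))"
  using i1 fin_level by (subst Bochner_Integration.integral_sum) auto
 also have "... \<le> (LBINT x. f x powr pexp)"
 proof (intro integral_mono Bochner_Integration.integrable_sum i1 int)
  fix x
  let ?m = "\<lceil>log 2 (f x)\<rceil> - 1"
  have "(\<Sum>m\<in>I. 2 powr (real_of_int m * pexp) * indicator (level f m) x) =
    (\<Sum>m\<in>I. if m = ?m then 2 powr (real_of_int m * pexp) * indicator (level f m) x else 0)"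
   by (intro sum.cong refl) (auto dest: level_unique simp: indicator_def)
  also have "... \<le> f x powr pexp"
   using fin le[of ?m x] by (subst sum.delta) auto
  finally show "(\<Sum>m\<in>I. 2 powr (real_of_int m * pexp) * indicator (level f m) x) \<le> f x powr pexp" .
 qed
 finally show "(\<Sum>m\<in>I. 2 powr (real_of_int m * pexp) * measure lborel (level f m)) \<le> (LBINT x. f x powr pexp)" .
qed

text \<open>By outer regularity each level set lies in an open set of almost the same measure.\<close>

lemma Borel_levels_bound:
 fixes f :: "'a => real"
 assumes C0: "C \<ge> 0" and C: "\<And>I f a L g b. level_system I f a L g b ==>
  (\<Sum>m\<in>I. \<Sum>l\<in>L. 2 powr real_of_int m * 2 powr real_of_int l * pint (%th x. g l th x * Avg th (f m) x))
   \<le> C * ((\<Sum>m\<in>I. 2 powr (real_of_int m * pexp) * a m) * (\<Sum>l\<in>L. 2 powr (real_of_int l * pexp) * b l)) powr (1 / pexp)"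
  and f[measurable]: "Borel f" and f0: "\<And>x. f x \<ge> 0"
  and int: "integrable lborel (%x. f x powr pexp)" and fin: "finite I"
 shows "(\<integral>\<^sup>+n. ennreal ((\<Sum>m\<in>I. 2 powr (real_of_int m + 1) * Avg (fst n) (indicator (level f m)) (snd n)) powr qexp) \<partial>(leb H))
   \<le> ennreal (2 powr qexp * ((2 * C) powr qexp * (LBINT x. f x powr pexp) powr (qexp / pexp)))"
  (is "?I \<le> _")
proof -
 let ?X = "LBINT x. f x powr pexp"
 let ?b = "%X. 2 powr qexp * ((2 * C) powr qexp * X powr (qexp / pexp))"
 have X0: "?X \<ge> 0" by (intro integral_nonneg_AE) auto
 have E[measurable]: "level f m \<in> sets borel" for m by (rule level_measurable[OF f])
 have le: "?I \<le> ennreal (?b (?X + \<delta>))" if d: "\<delta> > 0" for \<delta>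
 proof -
  define \<eta> where "\<eta> m = \<delta> / (real (card I) + 1) / 2 powr (real_of_int m * pexp)" for m :: int
  have eta: "\<eta> m > 0" for m using d by (simp add: \<eta>_def)
  have "\<exists>U. open U \<and> level f m \<subseteq> U \<and> emeasure lborel (U - level f m) < ennreal (\<eta> m)" for m
   using outer_regular_lborel[OF E eta] by metis
  then obtain U where U: "\<And>m. open (U m)" "\<And>m. level f m \<subseteq> U m" "\<And>m. emeasure lborel (U m - level f m) < ennreal (\<eta> m)"
   by metis
  have Um[measurable]: "U m \<in> sets borel" for m using U(1) by simp
  have em: "emeasure lborel (U m) \<le> emeasure lborel (level f m) + ennreal (\<eta> m)" for m
  proof -
   have "U m = level f m \<union> (U m - level f m)" using U(2) by auto
   then have "emeasure lborel (U m) \<le> emeasure lborel (level f m) + emeasure lborel (U m - level f m)"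
    using emeasure_subadditive[of "level f m" lborel "U m - level f m"] by simp
   also have "... \<le> emeasure lborel (level f m) + ennreal (\<eta> m)"
    using U(3)[of m] by (intro add_left_mono) auto
   finally show ?thesis .
  qed
  have fl: "emeasure lborel (level f m) < \<infinity>" if "m \<in> I" for m by (rule level_sum_le(1)[OF f f0 int fin that])
  have fU: "emeasure lborel (U m) < \<infinity>" if "m \<in> I" for m
   by (rule le_less_trans[OF em]) (use fl[OF that] in \<open>simp add: less_top[symmetric]\<close>)
  have mU: "measure lborel (U m) \<le> measure lborel (level f m) + \<eta> m" if "m \<in> I" for m
  proof -
   have "ennreal (measure lborel (U m)) \<le> ennreal (measure lborel (level f m) + \<eta> m)"
    using em[of m] fU[OF that] fl[OF that] eta[of m]
    by (simp add: emeasure_eq_ennreal_measure less_top[symmetric] ennreal_plus)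
   then show ?thesis using eta[of m] by (subst (asm) ennreal_le_iff) (auto intro!: add_nonneg_nonneg)
  qed
  have "(\<Sum>m\<in>I. 2 powr (real_of_int m * pexp) * measure lborel (U m)) \<le>
    (\<Sum>m\<in>I. 2 powr (real_of_int m * pexp) * measure lborel (level f m) + \<delta> / (real (card I) + 1))"
  proof (rule sum_mono)
   fix m assume m: "m \<in> I"
   have "2 powr (real_of_int m * pexp) * measure lborel (U m) \<le> 2 powr (real_of_int m * pexp) * (measure lborel (level f m) + \<eta> m)"
    by (intro mult_left_mono mU m) simp
   then show "2 powr (real_of_int m * pexp) * measure lborel (U m) \<le> 2 powr (real_of_int m * pexp) * measure lborel (level f m) + \<delta> / (real (card I) + 1)"
    by (simp add: \<eta>_def distrib_left)
  qed
  also have "... \<le> ?X + \<delta>"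
  proof -
   have "(\<Sum>m\<in>I. \<delta> / (real (card I) + 1)) \<le> \<delta>"
    using d by (simp add: field_simps)
   then show ?thesis
    unfolding sum.distrib using level_sum_le(2)[OF f f0 int fin] by linarith
  qed
  finally have X: "(\<Sum>m\<in>I. 2 powr (real_of_int m * pexp) * measure lborel (U m)) \<le> ?X + \<delta>" .
  have "?I \<le> (\<integral>\<^sup>+n. ennreal (2 powr qexp) * ennreal ((\<Sum>m\<in>I. 2 powr real_of_int m * Avg (fst n) (indicator (U m)) (snd n)) powr qexp) \<partial>(leb H))"
  proof (rule nn_integral_mono)
   fix n :: "'t \<times> 'a" assume "n \<in> space (leb H)"
   then have th: "fst n \<in> space H" by (auto simp: space_pair_measure)
   have A: "0 \<le> Avg (fst n) (indicator (level f m)) (snd n)" "Avg (fst n) (indicator (level f m)) (snd n) \<le> Avg (fst n) (indicator (U m)) (snd n)" for m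
   proof -
    show "0 \<le> Avg (fst n) (indicator (level f m)) (snd n)" unfolding Avg_def by (intro integral_nonneg_AE) auto
    show "Avg (fst n) (indicator (level f m)) (snd n) \<le> Avg (fst n) (indicator (U m)) (snd n)"
     unfolding Avg_def using U(2)[of m] th
     by (intro integral_mono Avg_integrand_integrable[of _ 1]) (auto simp: indicator_def)
   qed
   have "(\<Sum>m\<in>I. 2 powr (real_of_int m + 1) * Avg (fst n) (indicator (level f m)) (snd n)) \<le>
     2 * (\<Sum>m\<in>I. 2 powr real_of_int m * Avg (fst n) (indicator (U m)) (snd n))"
    unfolding sum_distrib_left using A by (intro sum_mono) (auto simp: powr_add)
   then have "(\<Sum>m\<in>I. 2 powr (real_of_int m + 1) * Avg (fst n) (indicator (level f m)) (snd n)) powr qexp \<le>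
     (2 * (\<Sum>m\<in>I. 2 powr real_of_int m * Avg (fst n) (indicator (U m)) (snd n))) powr qexp"
    using A qexp by (intro powr_mono2) (auto intro!: sum_nonneg)
   also have "... = 2 powr qexp * (\<Sum>m\<in>I. 2 powr real_of_int m * Avg (fst n) (indicator (U m)) (snd n)) powr qexp"
    using order_trans[OF A(1) A(2)] by (intro powr_mult)
   finally show "ennreal ((\<Sum>m\<in>I. 2 powr (real_of_int m + 1) * Avg (fst n) (indicator (level f m)) (snd n)) powr qexp) \<le>
     ennreal (2 powr qexp) * ennreal ((\<Sum>m\<in>I. 2 powr real_of_int m * Avg (fst n) (indicator (U m)) (snd n)) powr qexp)"
    by (simp add: ennreal_mult'[symmetric] ennreal_leI)
  qed
  also have "... = ennreal (2 powr qexp) * (\<integral>\<^sup>+n. ennreal ((\<Sum>m\<in>I. 2 powr real_of_int m * Avg (fst n) (indicator (U m)) (snd n)) powr qexp) \<partial>(leb H))"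
  proof (rule nn_integral_cmult)
   have "(%n. Avg (fst n) (indicator (U m)) (snd n)) \<in> borel_measurable (leb H)" for m
    using Avg_measurable_pair[of "indicator (U m)"] by (simp add: split_beta')
   then show "(%n. ennreal ((\<Sum>m\<in>I. 2 powr real_of_int m * Avg (fst n) (indicator (U m)) (snd n)) powr qexp)) \<in> borel_measurable (leb H)"
    by measurable
  qed
  also have "... \<le> ennreal (2 powr qexp) * ennreal ((2 * C) powr qexp * (?X + \<delta>) powr (qexp / pexp))"
   by (intro mult_left_mono open_levels_bound[OF C0 C fin U(1) fU X]) auto
  finally show ?thesis by (simp add: ennreal_mult'[symmetric])
 qed
 have fin_I: "?I < \<infinity>" using le[of 1] by (auto simp: less_top[symmetric] top_unique)
 have "enn2real ?I \<le> ?b ?X"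
 proof (rule LIMSEQ_le_const)
  show "(%n. ?b (?X + 1 / real (Suc n))) \<longlonglongrightarrow> ?b ?X"
  proof -
   have "(%n. ?X + 1 / real (Suc n)) \<longlonglongrightarrow> ?X + 0"
    by (intro tendsto_add tendsto_const lim_1_over_n[THEN LIMSEQ_Suc])
   then show ?thesis using X0 qexp pexp by (intro tendsto_mult_left tendsto_powr') auto
  qed
  show "\<exists>N. \<forall>n\<ge>N. enn2real ?I \<le> ?b (?X + 1 / real (Suc n))"
  proof (intro exI allI impI)
   fix n
   have "enn2real ?I \<le> enn2real (ennreal (?b (?X + 1 / real (Suc n))))"
    by (intro enn2real_mono le) auto
   then show "enn2real ?I \<le> ?b (?X + 1 / real (Suc n))" by simp
  qed
 qed
 then have "ennreal (enn2real ?I) \<le> ennreal (?b ?X)" by (rule ennreal_leI)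
 moreover have "ennreal (enn2real ?I) = ?I" using fin_I by (intro ennreal_enn2real) simp
 ultimately show ?thesis by (simp only:)
qed

text \<open>The conclusion is phrased with a majorant \<open>\<Phi>\<close> of the \<open>q\<close>-th power of the averages of \<open>f\<close>,
 because these averages may be infinite on a null set.\<close>

theorem strong_type:
 obtains C where "C \<ge> 0" "\<And>f. f \<in> borel_measurable borel ==> (\<And>x. f x \<ge> 0) ==> integrable lborel (%x. f x powr pexp) ==>
  \<exists>\<Phi>\<in>borel_measurable (leb H).
   (\<integral>\<^sup>+n. \<Phi> n \<partial>(leb H)) \<le> ennreal (C * (LBINT x. f x powr pexp) powr (qexp / pexp)) \<and>
   (\<forall>th\<in>space H. \<forall>x. \<forall>u\<ge>0. ennreal u \<le> (\<integral>\<^sup>+b. ennreal (f (x - \<gamma> th b)) \<partial>M) --> ennreal (u powr qexp) \<le> \<Phi> (th, x))"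
proof -
 obtain C where C0: "C \<ge> 0" and C: "\<And>I f a L g b. level_system I f a L g b ==>
  (\<Sum>m\<in>I. \<Sum>l\<in>L. 2 powr real_of_int m * 2 powr real_of_int l * pint (%th x. g l th x * Avg th (f m) x))
   \<le> C * ((\<Sum>m\<in>I. 2 powr (real_of_int m * pexp) * a m) * (\<Sum>l\<in>L. 2 powr (real_of_int l * pexp) * b l)) powr (1 / pexp)"
  by (rule level_inequality) blast
 show ?thesis
 proof
  show "2 powr qexp * (2 * C) powr qexp \<ge> 0" by simp
  fix f :: "'a => real"
  assume f[measurable]: "Borel f" and f0: "\<And>x. f x \<ge> 0" and int: "integrable lborel (%x. f x powr pexp)"
  have E[measurable]: "level f m \<in> sets borel" for m by (rule level_measurable[OF f])
  let ?I = "%N::nat. {- int N..int N}"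
  define G where "G N n = (\<Sum>m\<in>?I N. 2 powr (real_of_int m + 1) * Avg (fst n) (indicator (level f m)) (snd n))" for N n
  have Gm[measurable]: "G N \<in> borel_measurable (leb H)" for N
  proof -
   have [measurable]: "(%n. Avg (fst n) (indicator (level f m)) (snd n)) \<in> borel_measurable (leb H)" for m
    using Avg_measurable_pair[of "indicator (level f m)"] by (simp add: split_beta')
   show ?thesis unfolding G_def[abs_def] by measurable
  qed
  have A0: "Avg th (indicator (level f m)) x \<ge> 0" for th m x
   unfolding Avg_def by (intro integral_nonneg_AE) auto
  have G0: "G N n \<ge> 0" for N n unfolding G_def using A0 by (intro sum_nonneg) auto
  have Gmono: "G N n \<le> G N' n" if "N \<le> N'" for N N' n
   unfolding G_def using that A0 by (intro sum_mono2) auto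
  define \<Phi> where "\<Phi> n = (SUP N. ennreal (G N n powr qexp))" for n
  have \<Phi>m: "\<Phi> \<in> borel_measurable (leb H)" unfolding \<Phi>_def[abs_def] by measurable
  show "\<exists>\<Phi>\<in>borel_measurable (leb H).
   (\<integral>\<^sup>+n. \<Phi> n \<partial>(leb H)) \<le> ennreal (2 powr qexp * (2 * C) powr qexp * (LBINT x. f x powr pexp) powr (qexp / pexp)) \<and>
   (\<forall>th\<in>space H. \<forall>x. \<forall>u\<ge>0. ennreal u \<le> (\<integral>\<^sup>+b. ennreal (f (x - \<gamma> th b)) \<partial>M) --> ennreal (u powr qexp) \<le> \<Phi> (th, x))"
  proof (intro bexI[OF _ \<Phi>m] conjI ballI allI impI)
   have "(\<integral>\<^sup>+n. \<Phi> n \<partial>(leb H)) = (SUP N. \<integral>\<^sup>+n. ennreal (G N n powr qexp) \<partial>(leb H))"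
    unfolding \<Phi>_def
   proof (rule nn_integral_monotone_convergence_SUP)
    show "incseq (%N n. ennreal (G N n powr qexp))"
     using Gmono G0 qexp by (auto simp: incseq_def le_fun_def intro!: ennreal_leI powr_mono2)
   qed measurable
   also have "... \<le> ennreal (2 powr qexp * (2 * C) powr qexp * (LBINT x. f x powr pexp) powr (qexp / pexp))"
    unfolding G_def mult.assoc by (intro SUP_least Borel_levels_bound[OF C0 C f f0 int]) auto
   finally show "(\<integral>\<^sup>+n. \<Phi> n \<partial>(leb H)) \<le> ennreal (2 powr qexp * (2 * C) powr qexp * (LBINT x. f x powr pexp) powr (qexp / pexp))" .
  next
   fix th x and u :: real
   assume th[measurable]: "th \<in> space H" and u0: "u \<ge> 0" and u: "ennreal u \<le> (\<integral>\<^sup>+b. ennreal (f (x - \<gamma> th b)) \<partial>M)"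
   define h where "h N y = (\<Sum>m\<in>?I N. 2 powr (real_of_int m + 1) * indicator (level f m) y)" for N y
   have hm[measurable]: "Borel (h N)" for N unfolding h_def[abs_def] by measurable
   have hG: "(\<integral>\<^sup>+b. ennreal (h N (x - \<gamma> th b)) \<partial>M) = ennreal (G N (th, x))" for N
   proof -
    have i: "integrable M (%b. indicator (level f m) (x - \<gamma> th b) :: real)" for m
     using th by (intro Avg_integrand_integrable[of _ 1]) (auto simp: indicator_def)
    have "(\<integral>\<^sup>+b. ennreal (h N (x - \<gamma> th b)) \<partial>M) = ennreal (LINT b|M. h N (x - \<gamma> th b))"
     unfolding h_def using i
     by (intro nn_integral_eq_integral Bochner_Integration.integrable_sum integrable_mult_right) (auto intro!: sum_nonneg)
    also have "(LINT b|M. h N (x - \<gamma> th b)) = G N (th, x)"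
     unfolding h_def G_def Avg_def using i by (subst Bochner_Integration.integral_sum) auto
    finally show ?thesis .
   qed
   have "ennreal u \<le> (\<integral>\<^sup>+b. (SUP N. ennreal (h N (x - \<gamma> th b))) \<partial>M)"
   proof (rule order_trans[OF u nn_integral_mono])
    fix b
    let ?y = "x - \<gamma> th b"
    show "ennreal (f ?y) \<le> (SUP N. ennreal (h N ?y))"
    proof (cases "f ?y = 0")
     case False
     then have pos: "f ?y > 0" using f0[of ?y] by simp
     define m where "m = \<lceil>log 2 (f ?y)\<rceil> - 1"
     have y: "?y \<in> level f m" unfolding m_def using level_exists[where f = f and x = "?y"] pos by simp
     have "f ?y \<le> 2 powr (real_of_int m + 1) * indicator (level f m) ?y" using y by (simp add: level_def)
     also have "... \<le> h (nat \<bar>m\<bar>) ?y"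
      unfolding h_def by (intro member_le_sum) auto
     finally show ?thesis by (intro SUP_upper2[of "nat \<bar>m\<bar>"] ennreal_leI) auto
    qed simp
   qed
   also have "... = (SUP N. \<integral>\<^sup>+b. ennreal (h N (x - \<gamma> th b)) \<partial>M)"
   proof (rule nn_integral_monotone_convergence_SUP)
    show "incseq (%N b. ennreal (h N (x - \<gamma> th b)))"
    proof (unfold incseq_def, intro allI impI le_funI ennreal_leI)
     fix N N' :: nat and b assume "N \<le> N'"
     then show "h N (x - \<gamma> th b) \<le> h N' (x - \<gamma> th b)"
      unfolding h_def by (intro sum_mono2) auto
    qed
   qed measurable
   finally have uG: "ennreal u \<le> (SUP N. ennreal (G N (th, x)))" unfolding hG .
   show "ennreal (u powr qexp) \<le> \<Phi> (th, x)"
   proof (cases "u = 0")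
    case False
    then have pos: "u > 0" using u0 by simp
    have le: "ennreal ((u * (1 - 1 / real (Suc (Suc k)))) powr qexp) \<le> \<Phi> (th, x)" for k
    proof -
     let ?u = "u * (1 - 1 / real (Suc (Suc k)))"
     have u': "0 \<le> ?u" "?u < u" using pos by (auto simp: field_simps)
     have "ennreal ?u < ennreal u" using u' by (intro ennreal_lessI pos)
     also note uG
     finally obtain N where "ennreal ?u < ennreal (G N (th, x))" by (auto simp: less_SUP_iff)
     then have "?u < G N (th, x)" using u' by (simp add: ennreal_less_iff)
     then have "ennreal (?u powr qexp) \<le> ennreal (G N (th, x) powr qexp)"
      using u' qexp by (intro ennreal_leI powr_mono2) auto
     also have "... \<le> \<Phi> (th, x)" unfolding \<Phi>_def by (intro SUP_upper) auto
     finally show ?thesis .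
    qed
    have "(%k. u * (1 - 1 / real (Suc (Suc k)))) \<longlonglongrightarrow> u * (1 - 0)"
     by (intro tendsto_intros lim_1_over_n[THEN LIMSEQ_Suc, THEN LIMSEQ_Suc])
    then have "(%k. ennreal ((u * (1 - 1 / real (Suc (Suc k)))) powr qexp)) \<longlonglongrightarrow> ennreal (u powr qexp)"
     using pos by (intro tendsto_ennrealI tendsto_powr) auto
    then show ?thesis by (rule LIMSEQ_le_const2) (use le in auto)
   qed simp
  qed
 qed
qed

end

section \<open>Differentiation under the integral sign\<close>

text \<open>Dominated convergence, with the mean value theorem for the difference quotients. The
 domination is only required near the point, since the derivatives below are unbounded at time zero.\<close>

lemma has_real_derivative_integral:
 fixes f f' :: "real => 'w => real"
 assumes \<delta>: "\<delta> > 0"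
  and int: "\<And>s. \<bar>s - s0\<bar> < \<delta> ==> integrable M (f s)"
  and der: "\<And>s w. \<bar>s - s0\<bar> < \<delta> ==> w \<in> space M ==> ((%s. f s w) has_real_derivative f' s w) (at s)"
  and bd: "\<And>s w. \<bar>s - s0\<bar> < \<delta> ==> w \<in> space M ==> \<bar>f' s w\<bar> \<le> g w"
  and g: "integrable M g" and [measurable]: "f' s0 \<in> borel_measurable M"
 shows "((%s. LINT w|M. f s w) has_real_derivative (LINT w|M. f' s0 w)) (at s0)"
proof -
 have "(%n. ((LINT w|M. f (s0 + X n) w) - (LINT w|M. f s0 w)) / X n) \<longlonglongrightarrow> (LINT w|M. f' s0 w)"
  if X: "\<And>n. X n \<noteq> 0" "X \<longlonglongrightarrow> 0" for X
 proof -
  define q where "q n w = (if \<bar>X n\<bar> < \<delta> then (f (s0 + X n) w - f s0 w) / X n else f' s0 w)" for n w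
  have ev: "eventually (%n. \<bar>X n\<bar> < \<delta>) sequentially"
   using X(2) \<delta> by (auto simp: tendsto_iff dist_real_def)
  have lim: "(%n. LINT w|M. q n w) \<longlonglongrightarrow> (LINT w|M. f' s0 w)"
  proof (rule integral_dominated_convergence[OF _ _ g])
   show "q n \<in> borel_measurable M" for n
    using int[of "s0 + X n"] int[of s0] \<delta> unfolding q_def[abs_def]
    by (cases "\<bar>X n\<bar> < \<delta>") (auto dest!: borel_measurable_integrable)
   show "AE w in M. (%n. q n w) \<longlonglongrightarrow> f' s0 w"
   proof (rule AE_I2)
    fix w assume w: "w \<in> space M"
    have "((%h. (f (s0 + h) w - f s0 w) / h) \<longlongrightarrow> f' s0 w) (at 0)"
     using der[of s0 w] w \<delta> by (simp add: DERIV_def)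
    then have "(%n. (f (s0 + X n) w - f s0 w) / X n) \<longlonglongrightarrow> f' s0 w"
     using X by (auto simp: tendsto_at_iff_sequentially o_def)
    then show "(%n. q n w) \<longlonglongrightarrow> f' s0 w"
     by (rule Lim_transform_eventually) (use ev in \<open>auto simp: q_def elim: eventually_mono\<close>)
   qed
   show "AE w in M. norm (q n w) \<le> g w" for n
   proof (rule AE_I2)
    fix w assume w: "w \<in> space M"
    show "norm (q n w) \<le> g w"
    proof (cases "\<bar>X n\<bar> < \<delta>")
     case False
     then show ?thesis using bd[of s0 w] w \<delta> by (simp add: q_def)
    next
     case True
     have "\<exists>z. \<bar>z - s0\<bar> < \<delta> \<and> f (s0 + X n) w - f s0 w = X n * f' z w"
     proof (cases "X n > 0")
      case pos: True
      have "\<exists>z>s0. z < s0 + X n \<and> f (s0 + X n) w - f s0 w = (s0 + X n - s0) * f' z w"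
       using pos True w by (intro MVT2 der) auto
      then obtain z where "s0 < z" "z < s0 + X n" "f (s0 + X n) w - f s0 w = X n * f' z w" by auto
      then show ?thesis using True by (intro exI[of _ z]) auto
     next
      case False
      then have neg: "X n < 0" using X(1)[of n] by simp
      have "\<exists>z>s0 + X n. z < s0 \<and> f s0 w - f (s0 + X n) w = (s0 - (s0 + X n)) * f' z w"
       using neg True w by (intro MVT2 der) auto
      then obtain z where "s0 + X n < z" "z < s0" "f s0 w - f (s0 + X n) w = - X n * f' z w" by auto
      then show ?thesis using True by (intro exI[of _ z]) auto
     qed
     then obtain z where "\<bar>z - s0\<bar> < \<delta>" "f (s0 + X n) w - f s0 w = X n * f' z w" by auto
     then show ?thesis using bd[of z w] w X(1)[of n] True by (simp add: q_def)
    qed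
   qed
  qed measurable
  have "eventually (%n. (LINT w|M. q n w) = ((LINT w|M. f (s0 + X n) w) - (LINT w|M. f s0 w)) / X n) sequentially"
   using ev
  proof (rule eventually_mono)
   fix n assume "\<bar>X n\<bar> < \<delta>"
   then show "(LINT w|M. q n w) = ((LINT w|M. f (s0 + X n) w) - (LINT w|M. f s0 w)) / X n"
    using int[of "s0 + X n"] int[of s0] \<delta> by (simp add: q_def Bochner_Integration.integral_diff)
  qed
  then show ?thesis by (rule Lim_transform_eventually[OF lim])
 qed
 then show ?thesis unfolding DERIV_def
  by (auto simp: tendsto_at_iff_sequentially o_def)
qed

section \<open>Averages over the rotation group\<close>

lemma haar_space: "haar_SO H ==> space H = SO"
 using sets_eq_imp_space_eq[of H "restrict_space borel SO"] by (simp add: haar_SO_def space_restrict_space)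

lemma haar_finite: "haar_SO H ==> finite_measure H"
 using haar_space[of H] by (intro finite_measureI) (simp add: haar_SO_def)


lemma haar_id_measurable: "haar_SO H ==> (%\<theta>. \<theta>) \<in> measurable H borel"
 unfolding haar_SO_def by (subst measurable_cong_sets[of H "restrict_space borel SO" borel borel]) (auto intro: measurable_restrict_space1)

lemma haar_measurable: "haar_SO H ==> g \<in> borel_measurable borel ==> g \<in> borel_measurable H"
 using measurable_compose[OF haar_id_measurable] .

lemma continuous_matrix_mult: "continuous_on UNIV (%\<eta>::real^'n^'n. R ** \<eta>)"
 unfolding matrix_matrix_mult_def by (intro continuous_intros continuous_on_vec_lambda)

lemma continuous_matrix_vector_mult: "continuous_on UNIV (%\<eta>::real^'n^'n. \<eta> *v z)"
 unfolding matrix_vector_mult_def by (intro continuous_intros continuous_on_vec_lambda)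

lemma SO_mult: "R \<in> SO ==> \<theta> \<in> SO ==> R ** \<theta> \<in> SO"
 by (auto simp: SO_def rotation_matrix_def orthogonal_matrix_mul det_mul)

lemma SO_transpose: "R \<in> SO ==> transpose R \<in> SO"
 by (auto simp: SO_def rotation_matrix_def)

lemma SO_transpose_mult: "R \<in> SO ==> transpose R ** R = mat 1" "R \<in> SO ==> R ** transpose R = mat 1"
 by (auto simp: SO_def rotation_matrix_def orthogonal_matrix_def)

lemma SO_orthogonal: "\<theta> \<in> SO ==> orthogonal_transformation ((*v) \<theta>)"
 by (simp add: SO_def rotation_matrix_def orthogonal_transformation_matrix)

lemma SO_norm: "\<theta> \<in> SO ==> norm (\<theta> *v z) = norm z"
 by (rule orthogonal_transformation_norm[OF SO_orthogonal])

lemma SO_inner: "\<theta> \<in> SO ==> (\<theta> *v z) \<bullet> (\<theta> *v y) = z \<bullet> y"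
 using SO_orthogonal[of \<theta>] by (simp add: orthogonal_transformation_def)

lemma haar_translate:
 fixes g :: "real^'n^'n::finite => real"
 assumes H: "haar_SO H" and R: "R \<in> SO" and g: "Borel g"
 shows "(LINT \<theta>|H. g (R ** \<theta>)) = (LINT \<theta>|H. g \<theta>)"
proof -
 note sp = haar_space[OF H]
 have m: "(%\<eta>. R ** \<eta>) \<in> measurable H H"
 proof -
  have "(%\<eta>. R ** \<eta>) \<in> measurable H (restrict_space borel SO)"
   using SO_mult[OF R] sp
   by (intro measurable_restrict_space2 haar_measurable[OF H] borel_measurable_continuous_onI continuous_matrix_mult) auto
  then show ?thesis using H by (simp add: haar_SO_def cong: measurable_cong_sets)
 qed
 have "distr H H (%\<eta>. R ** \<eta>) = H"
 proof (rule measure_eqI)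
  fix B assume "B \<in> sets (distr H H (%\<eta>. R ** \<eta>))"
  then have B: "B \<in> sets H" by simp
  let ?B = "(%\<eta>. R ** \<eta>) -` B \<inter> space H"
  have B': "?B \<in> sets H" by (rule measurable_sets[OF m B])
  have "(%\<eta>. R ** \<eta>) ` ?B = B"
  proof
   show "(%\<eta>. R ** \<eta>) ` ?B \<subseteq> B" by auto
   show "B \<subseteq> (%\<eta>. R ** \<eta>) ` ?B"
   proof
    fix b assume b: "b \<in> B"
    then have bS: "b \<in> SO" using sets.sets_into_space[OF B] sp by auto
    have e: "R ** (transpose R ** b) = b"
     using SO_transpose_mult(2)[OF R] by (simp add: matrix_mul_assoc)
    then have "transpose R ** b \<in> ?B"
     using b SO_mult[OF SO_transpose[OF R] bS] sp by simp
    then show "b \<in> (%\<eta>. R ** \<eta>) ` ?B" using e by (metis image_eqI)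
   qed
  qed
  moreover have "emeasure H ((%\<eta>. R ** \<eta>) ` ?B) = emeasure H ?B"
   using H R B' by (simp add: haar_SO_def)
  ultimately show "emeasure (distr H H (%\<eta>. R ** \<eta>)) B = emeasure H B"
   using emeasure_distr[OF m B] by simp
 qed simp
 then have "(LINT \<theta>|H. g \<theta>) = (LINT \<theta>|(distr H H (%\<eta>. R ** \<eta>)). g \<theta>)" by simp
 also have "... = (LINT \<theta>|H. g (R ** \<theta>))"
  using haar_measurable[OF H g] by (intro integral_distr m)
 finally show ?thesis ..
qed

context
 fixes H :: "(real^'n^'n::finite) measure"
 assumes H: "haar_SO H"
begin

interpretation H: finite_measure H by (rule haar_finite[OF H])

lemma exp_family_derivative:
 assumes [measurable]: "x \<in> borel_measurable H" "y \<in> borel_measurable H" "b \<in> borel_measurable H"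
  and X: "\<And>\<theta>. \<theta> \<in> SO ==> \<bar>x \<theta>\<bar> \<le> X" and Y: "\<And>\<theta>. \<theta> \<in> SO ==> \<bar>y \<theta>\<bar> \<le> Y" and B: "\<And>\<theta>. \<theta> \<in> SO ==> \<bar>b \<theta>\<bar> \<le> B"
 shows "((%s. LINT \<theta>|H. b \<theta> * exp (- (s * x \<theta>) - y \<theta>)) has_real_derivative
   (LINT \<theta>|H. - x \<theta> * b \<theta> * exp (- (s0 * x \<theta>) - y \<theta>))) (at s0)"
proof (rule has_real_derivative_integral[where \<delta> = 1 and g = "%_. X * B * exp ((\<bar>s0\<bar> + 1) * X + Y)"])
 have e: "exp (- (s * x \<theta>) - y \<theta>) \<le> exp ((\<bar>s0\<bar> + 1) * X + Y)" if "\<bar>s - s0\<bar> < 1" "\<theta> \<in> SO" for s \<theta>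
 proof -
  have "\<bar>s * x \<theta>\<bar> \<le> (\<bar>s0\<bar> + 1) * X"
   unfolding abs_mult using that X[OF that(2)] by (intro mult_mono) auto
  then show ?thesis using Y[OF that(2)] by auto
 qed
 fix s :: real assume s: "\<bar>s - s0\<bar> < 1"
 show "integrable H (%\<theta>. b \<theta> * exp (- (s * x \<theta>) - y \<theta>))"
 proof (rule H.integrable_const_bound)
  show "AE \<theta> in H. norm (b \<theta> * exp (- (s * x \<theta>) - y \<theta>)) \<le> B * exp ((\<bar>s0\<bar> + 1) * X + Y)"
  proof (rule AE_I2)
   fix \<theta> assume "\<theta> \<in> space H"
   then have th: "\<theta> \<in> SO" by (simp add: haar_space[OF H])
   show "norm (b \<theta> * exp (- (s * x \<theta>) - y \<theta>)) \<le> B * exp ((\<bar>s0\<bar> + 1) * X + Y)"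
    using e[OF s th] B[OF th] order_trans[OF abs_ge_zero B[OF th]] by (auto simp: abs_mult intro!: mult_mono)
  qed
 qed measurable
 fix \<theta> assume "\<theta> \<in> space H"
 then have th: "\<theta> \<in> SO" by (simp add: haar_space[OF H])
 show "((%s. b \<theta> * exp (- (s * x \<theta>) - y \<theta>)) has_real_derivative - x \<theta> * b \<theta> * exp (- (s * x \<theta>) - y \<theta>)) (at s)"
  by (auto intro!: derivative_eq_intros)
 show "\<bar>- x \<theta> * b \<theta> * exp (- (s * x \<theta>) - y \<theta>)\<bar> \<le> X * B * exp ((\<bar>s0\<bar> + 1) * X + Y)"
  using e[OF s th] B[OF th] X[OF th] order_trans[OF abs_ge_zero B[OF th]] order_trans[OF abs_ge_zero X[OF th]]
  by (auto simp: abs_mult intro!: mult_mono mult_nonneg_nonneg)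
qed auto

lemma rot_component_measurable [measurable]: "(%\<theta>. (\<theta> *v z) $ i) \<in> borel_measurable H"
 by (intro haar_measurable[OF H] borel_measurable_continuous_onI continuous_on_component continuous_matrix_vector_mult)

lemma rot_inner_measurable [measurable]: "Borel (%\<theta>::real^'n^'n. w \<bullet> (\<theta> *v z))"
 by (intro borel_measurable_continuous_onI continuous_intros continuous_matrix_vector_mult)

lemma rot_component_le: "\<theta> \<in> SO ==> \<bar>(\<theta> *v z) $ i\<bar> \<le> norm z"
 using component_le_norm_cart[of "\<theta> *v z" i] SO_norm[of \<theta> z] by simp

text \<open>Two vectors of the same length differ by a rotation, which the Haar measure absorbs.\<close>

lemma exp_average_radial:
 assumes n: "CARD('n) \<ge> 2" and eq: "norm w = norm w'"
 shows "(LINT \<theta>|H. exp (- (w \<bullet> (\<theta> *v z)))) = (LINT \<theta>|H. exp (- (w' \<bullet> (\<theta> *v z))))"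
proof -
 obtain f where f: "orthogonal_transformation f" "det (matrix f) = 1" "f w = w'"
  using rotation_exists[OF n eq] .
 have R: "matrix f \<in> SO" using f by (simp add: SO_def rotation_matrix_def orthogonal_transformation_matrix)
 have fR: "matrix f *v x = f x" for x
  using f(1) by (simp add: matrix_works orthogonal_transformation_linear)
 have "(LINT \<theta>|H. exp (- (w' \<bullet> (\<theta> *v z)))) = (LINT \<theta>|H. exp (- (w' \<bullet> ((matrix f ** \<theta>) *v z))))"
  by (rule haar_translate[OF H R, symmetric]) measurable
 also have "... = (LINT \<theta>|H. exp (- (w \<bullet> (\<theta> *v z))))"
  using f(1) by (simp add: matrix_vector_mul_assoc[symmetric] fR f(3)[symmetric] orthogonal_transformation_def)
 finally show ?thesis ..
qed

text \<open>Up to normalization \<open>bessel i z\<close> is a modified Bessel function of \<open>\<rho> \<parallel>z\<parallel>\<close> divided by a power; in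
 dimension at least two it is the same for all coordinates \<open>i\<close>.\<close>

definition bessel :: "'n => real^'n => real => real" where
 "bessel i z \<rho> = (LINT \<theta>|H. exp (- (\<rho> * (\<theta> *v z) $ i)))"

definition bessel' :: "'n => real^'n => real => real" where
 "bessel' i z \<rho> = (LINT \<theta>|H. - (\<theta> *v z) $ i * exp (- (\<rho> * (\<theta> *v z) $ i)))"

definition bessel'' :: "'n => real^'n => real => real" where
 "bessel'' i z \<rho> = (LINT \<theta>|H. ((\<theta> *v z) $ i)\<^sup>2 * exp (- (\<rho> * (\<theta> *v z) $ i)))"

lemma bessel_derivative: "(bessel i z has_real_derivative bessel' i z \<rho>) (at \<rho>)"
 using exp_family_derivative[of "%\<theta>. (\<theta> *v z) $ i" "%_. 0" "%_. 1" "norm z" 0 1 \<rho>]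
 by (simp add: bessel_def[abs_def] bessel'_def rot_component_le)

lemma bessel'_derivative: "(bessel' i z has_real_derivative bessel'' i z \<rho>) (at \<rho>)"
 using exp_family_derivative[of "%\<theta>. (\<theta> *v z) $ i" "%_. 0" "%\<theta>. - (\<theta> *v z) $ i" "norm z" 0 "norm z" \<rho>]
 by (simp add: bessel'_def[abs_def] bessel''_def rot_component_le power2_eq_square)

lemma bessel_continuous: "continuous_on UNIV (bessel i z)"
 using bessel_derivative DERIV_isCont by (blast intro: continuous_at_imp_continuous_on)

lemma bessel'_continuous: "continuous_on UNIV (bessel' i z)"
 using bessel'_derivative DERIV_isCont by (blast intro: continuous_at_imp_continuous_on)

lemmas bessel_continuous_intros =
 continuous_on_compose2[OF bessel_continuous _ subset_UNIV] continuous_on_compose2[OF bessel'_continuous _ subset_UNIV]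

lemma bessel_nonneg: "bessel i z \<rho> \<ge> 0"
 unfolding bessel_def by (intro integral_nonneg_AE) auto

lemma exp_average_eq_bessel:
 assumes n: "CARD('n) \<ge> 2"
 shows "(LINT \<theta>|H. exp (- (w \<bullet> (\<theta> *v z)))) = bessel i z (norm w)"
proof -
 have "norm w = norm (norm w *\<^sub>R axis i (1::real))" by simp
 then have "(LINT \<theta>|H. exp (- (w \<bullet> (\<theta> *v z)))) = (LINT \<theta>|H. exp (- ((norm w *\<^sub>R axis i 1) \<bullet> (\<theta> *v z))))"
  by (rule exp_average_radial[OF n])
 then show ?thesis by (simp add: bessel_def inner_axis' )
qed

text \<open>The second derivative in a direction orthogonal to the axis, computed in two ways: under
 the integral sign, and from radial symmetry.\<close>

lemma bessel_transverse:
 assumes n: "CARD('n) \<ge> 2" and r: "\<rho> > 0" and j: "j \<noteq> i"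
 shows "(LINT \<theta>|H. ((\<theta> *v z) $ j)\<^sup>2 * exp (- (\<rho> * (\<theta> *v z) $ i))) = bessel' i z \<rho> / \<rho>"
proof -
 define g where "g h = sqrt (\<rho>\<^sup>2 + h\<^sup>2)" for h
 have gpos: "g h > 0" for h unfolding g_def using r by (simp add: add_pos_nonneg)
 have g0: "g 0 = \<rho>" using r by (simp add: g_def)
 have gd: "(g has_real_derivative h / g h) (at h)" for h
 proof -
  have "\<rho>\<^sup>2 + h\<^sup>2 > 0" using r by (simp add: add_pos_nonneg)
  then show ?thesis unfolding g_def[abs_def] by (auto intro!: derivative_eq_intros simp: field_simps)
 qed
 have gc: "isCont g h" for h using gd DERIV_isCont by blast
 let ?x = "%\<theta>. (\<theta> *v z) $ j" and ?y = "%\<theta>. \<rho> * (\<theta> *v z) $ i"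
 have Y: "\<bar>?y \<theta>\<bar> \<le> \<rho> * norm z" if "\<theta> \<in> SO" for \<theta>
  using rot_component_le[OF that, of z i] r by (simp add: abs_mult)
 have B: "(LINT \<theta>|H. 1 * exp (- (h * ?x \<theta>) - ?y \<theta>)) = bessel i z (g h)" for h
 proof -
  have "norm (\<rho> *\<^sub>R axis i 1 + h *\<^sub>R axis j (1::real)) = g h"
  proof -
   have "(norm (\<rho> *\<^sub>R axis i 1 + h *\<^sub>R axis j (1::real)))\<^sup>2 = \<rho>\<^sup>2 + h\<^sup>2"
    unfolding power2_norm_eq_inner using j
    by (simp add: inner_add_left inner_add_right inner_axis_axis power2_eq_square)
   then show ?thesis unfolding g_def by (metis norm_ge_zero real_sqrt_unique)
  qed
  moreover have "- (h * ?x \<theta>) - ?y \<theta> = - ((\<rho> *\<^sub>R axis i 1 + h *\<^sub>R axis j 1) \<bullet> (\<theta> *v z))" for \<theta>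
   by (simp add: inner_add_left inner_axis')
  ultimately show ?thesis
   using exp_average_eq_bessel[OF n, of "\<rho> *\<^sub>R axis i 1 + h *\<^sub>R axis j 1" z i] by simp
 qed
 have d1: "((%h. bessel i z (g h)) has_real_derivative (LINT \<theta>|H. - ?x \<theta> * 1 * exp (- (h * ?x \<theta>) - ?y \<theta>))) (at h)" for h
 proof -
  have "((%h. LINT \<theta>|H. 1 * exp (- (h * ?x \<theta>) - ?y \<theta>)) has_real_derivative (LINT \<theta>|H. - ?x \<theta> * 1 * exp (- (h * ?x \<theta>) - ?y \<theta>))) (at h)"
   using Y rot_component_le by (intro exp_family_derivative[where X = "norm z" and Y = "\<rho> * norm z" and B = 1]) auto
  then show ?thesis unfolding B .
 qed
 have d2: "((%h. bessel i z (g h)) has_real_derivative bessel' i z (g h) * (h / g h)) (at h)" for h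
  by (rule DERIV_chain2[OF bessel_derivative gd])
 have C: "(LINT \<theta>|H. - ?x \<theta> * exp (- (h * ?x \<theta>) - ?y \<theta>)) = h * (bessel' i z (g h) / g h)" for h
  using DERIV_unique[OF d1 d2, of h] by (simp add: mult_ac)
 have d3: "((%h. LINT \<theta>|H. - ?x \<theta> * exp (- (h * ?x \<theta>) - ?y \<theta>)) has_real_derivative
   (LINT \<theta>|H. - ?x \<theta> * - ?x \<theta> * exp (- (0 * ?x \<theta>) - ?y \<theta>))) (at 0)"
  using Y rot_component_le by (intro exp_family_derivative[where X = "norm z" and Y = "\<rho> * norm z" and B = "norm z"]) auto
 have d4: "((%h. h * (bessel' i z (g h) / g h)) has_real_derivative bessel' i z \<rho> / \<rho>) (at 0)"
 proof -
  have "isCont (bessel' i z) x" for x using bessel'_derivative DERIV_isCont by blast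
  then have "isCont (%h. bessel' i z (g h) / g h) 0"
   using gpos[of 0] gc by (intro continuous_divide isCont_o2[of 0 g "bessel' i z"]) auto
  then have "((%h. bessel' i z (g h) / g h) \<longlongrightarrow> bessel' i z \<rho> / \<rho>) (at 0)"
   by (simp add: isCont_def g0)
  then show ?thesis unfolding DERIV_def
   by (rule Lim_transform_eventually) (auto simp: eventually_at_filter)
 qed
 have "(LINT \<theta>|H. - ?x \<theta> * - ?x \<theta> * exp (- (0 * ?x \<theta>) - ?y \<theta>)) = bessel' i z \<rho> / \<rho>"
  using d3 d4 unfolding C by (rule DERIV_unique)
 then show ?thesis by (simp add: power2_eq_square)
qed

text \<open>The squares of all coordinates of \<open>\<theta> z\<close> add up to \<open>\<parallel>z\<parallel>\<^sup>2\<close>; the axial coordinate contributes the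
 second derivative and each transverse one the first derivative divided by \<open>\<rho>\<close>.\<close>

lemma bessel_ode:
 assumes n: "CARD('n) \<ge> 2" and r: "\<rho> > 0"
 shows "\<rho> * bessel'' i z \<rho> + (real CARD('n) - 1) * bessel' i z \<rho> = \<rho> * (norm z)\<^sup>2 * bessel i z \<rho>"
proof -
 let ?e = "%\<theta>. exp (- (\<rho> * (\<theta> *v z) $ i))"
 have eb: "?e \<theta> \<le> exp (\<rho> * norm z)" if "\<theta> \<in> SO" for \<theta>
 proof -
  have "\<bar>\<rho> * (\<theta> *v z) $ i\<bar> \<le> \<rho> * norm z"
   using rot_component_le[OF that, of z i] r by (simp add: abs_mult)
  then show ?thesis by simp
 qed
 have int: "integrable H (%\<theta>. ((\<theta> *v z) $ j)\<^sup>2 * ?e \<theta>)" for j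
 proof (rule H.integrable_const_bound)
  show "AE \<theta> in H. norm (((\<theta> *v z) $ j)\<^sup>2 * ?e \<theta>) \<le> (norm z)\<^sup>2 * exp (\<rho> * norm z)"
  proof (rule AE_I2)
   fix \<theta> assume "\<theta> \<in> space H"
   then have th: "\<theta> \<in> SO" by (simp add: haar_space[OF H])
   have "((\<theta> *v z) $ j)\<^sup>2 \<le> (norm z)\<^sup>2"
    using rot_component_le[OF th, of z j] by (simp add: abs_le_square_iff[symmetric])
   then show "norm (((\<theta> *v z) $ j)\<^sup>2 * ?e \<theta>) \<le> (norm z)\<^sup>2 * exp (\<rho> * norm z)"
    using eb[OF th] by (auto simp: abs_mult intro!: mult_mono)
  qed
 qed measurable
 have "(norm z)\<^sup>2 * bessel i z \<rho> = (LINT \<theta>|H. (\<Sum>j\<in>UNIV. ((\<theta> *v z) $ j)\<^sup>2 * ?e \<theta>))"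
 proof -
  have "(\<Sum>j\<in>UNIV. ((\<theta> *v z) $ j)\<^sup>2 * ?e \<theta>) = (norm z)\<^sup>2 * ?e \<theta>" if "\<theta> \<in> space H" for \<theta>
  proof -
   have "(norm (\<theta> *v z))\<^sup>2 = (\<Sum>j\<in>UNIV. ((\<theta> *v z) $ j)\<^sup>2)"
    unfolding power2_norm_eq_inner by (simp add: inner_vec_def power2_eq_square)
   then show ?thesis using SO_norm[of \<theta> z] that by (simp add: haar_space[OF H] sum_distrib_right[symmetric])
  qed
  then show ?thesis unfolding bessel_def
   by (subst Bochner_Integration.integral_cong[OF refl]) auto
 qed
 also have "... = (\<Sum>j\<in>UNIV. LINT \<theta>|H. ((\<theta> *v z) $ j)\<^sup>2 * ?e \<theta>)"
  by (intro Bochner_Integration.integral_sum int)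
 also have "... = bessel'' i z \<rho> + (\<Sum>j\<in>UNIV - {i}. LINT \<theta>|H. ((\<theta> *v z) $ j)\<^sup>2 * ?e \<theta>)"
  unfolding bessel''_def by (subst sum.remove[of _ i]) auto
 also have "(\<Sum>j\<in>UNIV - {i}. LINT \<theta>|H. ((\<theta> *v z) $ j)\<^sup>2 * ?e \<theta>) = (\<Sum>j\<in>UNIV - {i}. bessel' i z \<rho> / \<rho>)"
  by (intro sum.cong refl bessel_transverse[OF n r]) auto
 also have "... = (real CARD('n) - 1) * (bessel' i z \<rho> / \<rho>)"
  by (simp add: card_Diff_singleton of_nat_diff)
 finally have eq: "(norm z)\<^sup>2 * bessel i z \<rho> = bessel'' i z \<rho> + (real CARD('n) - 1) * (bessel' i z \<rho> / \<rho>)" .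
 show ?thesis unfolding mult.assoc eq distrib_left using r by simp
qed

subsection \<open>The heat kernel averaged over rotations\<close>

definition rotheat :: "real^'n => real => real => real" where
 "rotheat z s r = exp (- (r\<^sup>2 + (norm z)\<^sup>2) / (4 * s)) * s powr (- (real CARD('n) / 2)) / gauss_const TYPE(real^'n)
   * bessel undefined z (r / (2 * s))"

text \<open>The functions \<open>r \<partial>\<^sub>r\<close> and \<open>\<partial>\<^sub>s\<close> of the averaged kernel.\<close>

definition rotheat_r :: "real^'n => real => real => real" where
 "rotheat_r z s r = exp (- (r\<^sup>2 + (norm z)\<^sup>2) / (4 * s)) * s powr (- (real CARD('n) / 2)) / gauss_const TYPE(real^'n)
   * (- (r\<^sup>2 / (2 * s)) * bessel undefined z (r / (2 * s)) + r / (2 * s) * bessel' undefined z (r / (2 * s)))"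

definition rotheat_s :: "real^'n => real => real => real" where
 "rotheat_s z s r = exp (- (r\<^sup>2 + (norm z)\<^sup>2) / (4 * s)) * s powr (- (real CARD('n) / 2)) / gauss_const TYPE(real^'n)
   * ((- (real CARD('n) / (2 * s)) + (r\<^sup>2 + (norm z)\<^sup>2) / (4 * s\<^sup>2)) * bessel undefined z (r / (2 * s))
    - r / (2 * s\<^sup>2) * bessel' undefined z (r / (2 * s)))"

text \<open>Expanding the square in the exponent separates the Gaussian in \<open>\<parallel>w\<parallel>\<close> and \<open>\<parallel>z\<parallel>\<close> from the average of the
 exponential of the inner product.\<close>

lemma rotheat_eq:
 assumes n: "CARD('n) \<ge> 2" and s: "s > 0"
 shows "(LINT \<theta>|H. heat s (w + \<theta> *v z)) = rotheat z s (norm w)"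
proof -
 let ?c = "gauss_const TYPE(real^'n)" and ?d = "real CARD('n) / 2"
 let ?p = "exp (- ((norm w)\<^sup>2 + (norm z)\<^sup>2) / (4 * s)) * s powr (- ?d) / ?c"
 have "heat s (w + \<theta> *v z) = ?p * exp (- (((1 / (2 * s)) *\<^sub>R w) \<bullet> (\<theta> *v z)))" if "\<theta> \<in> space H" for \<theta>
 proof -
  have th: "\<theta> \<in> SO" using that by (simp add: haar_space[OF H])
  have n2: "(norm (w + \<theta> *v z))\<^sup>2 = (norm w)\<^sup>2 + (norm z)\<^sup>2 + 2 * (w \<bullet> (\<theta> *v z))"
   unfolding power2_norm_eq_inner inner_add_left inner_add_right SO_inner[OF th] by (simp add: inner_commute)
  have "exp (- (norm (w + \<theta> *v z))\<^sup>2 / (4 * s)) =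
    exp (- ((norm w)\<^sup>2 + (norm z)\<^sup>2) / (4 * s)) * exp (- (((1 / (2 * s)) *\<^sub>R w) \<bullet> (\<theta> *v z)))"
   unfolding n2 exp_add[symmetric] using s by (simp add: field_simps)
  then show ?thesis unfolding heat_def by (simp add: powr_minus_divide)
 qed
 then have "(LINT \<theta>|H. heat s (w + \<theta> *v z)) = (LINT \<theta>|H. ?p * exp (- (((1 / (2 * s)) *\<^sub>R w) \<bullet> (\<theta> *v z))))"
  by (intro Bochner_Integration.integral_cong refl) auto
 also have "... = ?p * bessel undefined z (norm ((1 / (2 * s)) *\<^sub>R w))"
  by (simp add: exp_average_eq_bessel[OF n, of "(1 / (2 * s)) *\<^sub>R w" z undefined, simplified])
 also have "norm ((1 / (2 * s)) *\<^sub>R w) = norm w / (2 * s)" using s by simp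
 finally show ?thesis by (simp add: rotheat_def)
qed

lemma rotheat_nonneg: "rotheat z s r \<ge> 0"
 unfolding rotheat_def using gauss_const_pos[where ?'a = "real^'n"]
 by (intro mult_nonneg_nonneg divide_nonneg_nonneg bessel_nonneg) auto

lemma rotheat_derivative_r:
 assumes s: "s > 0" and r: "r > 0"
 shows "(rotheat z s has_real_derivative rotheat_r z s r / r) (at r)"
proof -
 define c where "c = s powr (- (real CARD('n) / 2)) / gauss_const TYPE(real^'n)"
 have d: "((%r. bessel undefined z (r / (2 * s))) has_real_derivative bessel' undefined z (r / (2 * s)) * (1 / (2 * s))) (at r)"
  using s by (intro DERIV_chain2[OF bessel_derivative]) (auto intro!: derivative_eq_intros)
 have e: "((%r. exp (- (r\<^sup>2 + (norm z)\<^sup>2) / (4 * s))) has_real_derivative exp (- (r\<^sup>2 + (norm z)\<^sup>2) / (4 * s)) * (- (r / (2 * s)))) (at r)"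
  using s by (auto intro!: derivative_eq_intros simp: field_simps)
 have "((%r. (exp (- (r\<^sup>2 + (norm z)\<^sup>2) / (4 * s)) * bessel undefined z (r / (2 * s))) * c) has_real_derivative
  (exp (- (r\<^sup>2 + (norm z)\<^sup>2) / (4 * s)) * (- (r / (2 * s))) * bessel undefined z (r / (2 * s)) +
   bessel' undefined z (r / (2 * s)) * (1 / (2 * s)) * exp (- (r\<^sup>2 + (norm z)\<^sup>2) / (4 * s))) * c) (at r)"
  by (rule DERIV_cmult_right[OF DERIV_mult[OF e d]])
 moreover have "(%r. (exp (- (r\<^sup>2 + (norm z)\<^sup>2) / (4 * s)) * bessel undefined z (r / (2 * s))) * c) = rotheat z s"
  by (simp add: fun_eq_iff rotheat_def c_def mult_ac)
 moreover have "(exp (- (r\<^sup>2 + (norm z)\<^sup>2) / (4 * s)) * (- (r / (2 * s))) * bessel undefined z (r / (2 * s)) +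
   bessel' undefined z (r / (2 * s)) * (1 / (2 * s)) * exp (- (r\<^sup>2 + (norm z)\<^sup>2) / (4 * s))) * c = rotheat_r z s r / r"
 proof -
  have q: "(- (r\<^sup>2 / (2 * s)) * a + r / (2 * s) * b) / r = - (r / (2 * s)) * a + b * (1 / (2 * s))" for a b :: real
   using r by (simp add: add_divide_distrib diff_divide_distrib power2_eq_square)
  have "rotheat_r z s r / r = exp (- (r\<^sup>2 + (norm z)\<^sup>2) / (4 * s)) * c *
    ((- (r\<^sup>2 / (2 * s)) * bessel undefined z (r / (2 * s)) + r / (2 * s) * bessel' undefined z (r / (2 * s))) / r)"
   by (simp add: rotheat_r_def c_def)
  then show ?thesis unfolding q by (simp only: distrib_left distrib_right mult_ac)
 qed
 ultimately show ?thesis by simp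
qed

lemma rotheat_derivative_s:
 assumes s: "s > 0"
 shows "((%s. rotheat z s r) has_real_derivative rotheat_s z s r) (at s)"
proof -
 define c where "c = 1 / gauss_const TYPE(real^'n)"
 define m where "m = (norm z)\<^sup>2"
 define d where "d = real CARD('n) / 2"
 have d1: "((%s. bessel undefined z (r / (2 * s))) has_real_derivative bessel' undefined z (r / (2 * s)) * (- (r / (2 * s\<^sup>2)))) (at s)"
  using s by (intro DERIV_chain2[OF bessel_derivative]) (auto intro!: derivative_eq_intros simp: power2_eq_square)
 have e: "((%s. exp (- (r\<^sup>2 + m) / (4 * s))) has_real_derivative exp (- (r\<^sup>2 + m) / (4 * s)) * ((r\<^sup>2 + m) / (4 * s\<^sup>2))) (at s)"
  using s by (auto intro!: derivative_eq_intros simp: power2_eq_square field_simps)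
 have p: "((%s. s powr (- d)) has_real_derivative s powr (- d) * (- (d / s))) (at s)"
  using has_real_derivative_powr[OF s, of "- d"] s by (simp add: powr_diff field_simps)
 have "((%s. (exp (- (r\<^sup>2 + m) / (4 * s)) * s powr (- d)) * bessel undefined z (r / (2 * s)) * c) has_real_derivative
   ((exp (- (r\<^sup>2 + m) / (4 * s)) * ((r\<^sup>2 + m) / (4 * s\<^sup>2)) * s powr (- d) + s powr (- d) * (- (d / s)) * exp (- (r\<^sup>2 + m) / (4 * s)))
    * bessel undefined z (r / (2 * s)) + bessel' undefined z (r / (2 * s)) * (- (r / (2 * s\<^sup>2))) * (exp (- (r\<^sup>2 + m) / (4 * s)) * s powr (- d))) * c) (at s)"
  by (rule DERIV_cmult_right[OF DERIV_mult[OF DERIV_mult[OF e p] d1]])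
 moreover have "(%s. (exp (- (r\<^sup>2 + m) / (4 * s)) * s powr (- d)) * bessel undefined z (r / (2 * s)) * c) = (%s. rotheat z s r)"
  by (simp add: fun_eq_iff rotheat_def c_def m_def d_def mult_ac)
 moreover have "((exp (- (r\<^sup>2 + m) / (4 * s)) * ((r\<^sup>2 + m) / (4 * s\<^sup>2)) * s powr (- d) + s powr (- d) * (- (d / s)) * exp (- (r\<^sup>2 + m) / (4 * s)))
    * bessel undefined z (r / (2 * s)) + bessel' undefined z (r / (2 * s)) * (- (r / (2 * s\<^sup>2))) * (exp (- (r\<^sup>2 + m) / (4 * s)) * s powr (- d))) * c
   = rotheat_s z s r"
 proof -
  have "real CARD('n) / (2 * s) = d / s" by (simp add: d_def)
  then show ?thesis unfolding rotheat_s_def c_def m_def[symmetric] d_def[symmetric] by (simp add: algebra_simps)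
 qed
 ultimately show ?thesis by simp
qed

text \<open>The heat equation in polar coordinates: with \<open>D = r \<partial>\<^sub>r\<close> the Laplacian of a radial function
 is \<open>r\<^sup>-\<^sup>2 (D\<^sup>2 + (n - 2) D)\<close>.\<close>

lemma rotheat_equation:
 assumes n: "CARD('n) \<ge> 2" and s: "s > 0" and r: "r > 0"
 shows "(rotheat_r z s has_real_derivative (r\<^sup>2 * rotheat_s z s r - (real CARD('n) - 2) * rotheat_r z s r) / r) (at r)"
proof -
 define m where "m = (norm z)\<^sup>2"
 define N where "N = real CARD('n)"
 define L where "L = r / (2 * s)"
 define a b b2 where "a = bessel undefined z L" and "b = bessel' undefined z L" and "b2 = bessel'' undefined z L"
 have L: "L > 0" using r s by (simp add: L_def)
 have rL: "r = 2 * s * L" using s by (simp add: L_def)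
 have ode: "L * b2 = L * m * a - (N - 1) * b"
  using bessel_ode[OF n L, of undefined z] by (simp add: a_def b_def b2_def m_def N_def)
 define c where "c = s powr (- (real CARD('n) / 2)) / gauss_const TYPE(real^'n)"
 define x where "x = exp (- (r\<^sup>2 + m) / (4 * s))"
 have d: "((%r. bessel undefined z (r / (2 * s))) has_real_derivative b * (1 / (2 * s))) (at r)"
  unfolding b_def L_def using s by (intro DERIV_chain2[OF bessel_derivative]) (auto intro!: derivative_eq_intros)
 have d': "((%r. bessel' undefined z (r / (2 * s))) has_real_derivative b2 * (1 / (2 * s))) (at r)"
  unfolding b2_def L_def using s by (intro DERIV_chain2[OF bessel'_derivative]) (auto intro!: derivative_eq_intros)
 have e: "((%r. exp (- (r\<^sup>2 + m) / (4 * s))) has_real_derivative x * (- (r / (2 * s)))) (at r)"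
  unfolding x_def using s by (auto intro!: derivative_eq_intros simp: field_simps)
 have q: "((%r. - (r\<^sup>2 / (2 * s))) has_real_derivative - (r / s)) (at r)"
  using s by (auto intro!: derivative_eq_intros simp: field_simps)
 have l: "((%r. r / (2 * s)) has_real_derivative 1 / (2 * s)) (at r)"
  using s by (auto intro!: derivative_eq_intros)
 have "((%r. (exp (- (r\<^sup>2 + m) / (4 * s)) * (- (r\<^sup>2 / (2 * s)) * bessel undefined z (r / (2 * s)) + r / (2 * s) * bessel' undefined z (r / (2 * s)))) * c)
  has_real_derivative
   (x * (- (r / (2 * s))) * (- (r\<^sup>2 / (2 * s)) * bessel undefined z (r / (2 * s)) + r / (2 * s) * bessel' undefined z (r / (2 * s)))
   + (- (r / s) * bessel undefined z (r / (2 * s)) + b * (1 / (2 * s)) * (- (r\<^sup>2 / (2 * s)))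
     + (1 / (2 * s) * bessel' undefined z (r / (2 * s)) + b2 * (1 / (2 * s)) * (r / (2 * s)))) * exp (- (r\<^sup>2 + m) / (4 * s))) * c) (at r)"
  by (rule DERIV_cmult_right[OF DERIV_mult[OF e DERIV_add[OF DERIV_mult[OF q d] DERIV_mult[OF l d']]]])
 moreover have "(%r. (exp (- (r\<^sup>2 + m) / (4 * s)) * (- (r\<^sup>2 / (2 * s)) * bessel undefined z (r / (2 * s)) + r / (2 * s) * bessel' undefined z (r / (2 * s)))) * c) = rotheat_r z s"
  by (simp add: fun_eq_iff rotheat_r_def c_def m_def mult_ac)
 moreover have "(x * (- (r / (2 * s))) * (- (r\<^sup>2 / (2 * s)) * bessel undefined z (r / (2 * s)) + r / (2 * s) * bessel' undefined z (r / (2 * s)))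
   + (- (r / s) * bessel undefined z (r / (2 * s)) + b * (1 / (2 * s)) * (- (r\<^sup>2 / (2 * s)))
     + (1 / (2 * s) * bessel' undefined z (r / (2 * s)) + b2 * (1 / (2 * s)) * (r / (2 * s)))) * exp (- (r\<^sup>2 + m) / (4 * s))) * c
   = (r\<^sup>2 * rotheat_s z s r - (real CARD('n) - 2) * rotheat_r z s r) / r" (is "?l = ?r")
 proof -
  have E1: "rotheat_r z s r = x * c * (- (r\<^sup>2 / (2 * s)) * a + L * b)"
   unfolding rotheat_r_def x_def c_def a_def b_def L_def m_def by simp
  have Es: "rotheat_s z s r = x * c * ((- (N / (2 * s)) + (r\<^sup>2 + m) / (4 * s\<^sup>2)) * a - r / (2 * s\<^sup>2) * b)"
   unfolding rotheat_s_def x_def c_def a_def b_def L_def m_def N_def by simp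
  have lhs: "?l = x * c * (- L * (- (r\<^sup>2 / (2 * s)) * a + L * b) + (- (r / s) * a - b / (2 * s) * (r\<^sup>2 / (2 * s)) + b / (2 * s) + (L * b2) / (2 * s)))"
   unfolding L_def[symmetric] a_def[symmetric] b_def[symmetric] x_def[symmetric] by (simp add: algebra_simps)
  have s0: "s \<noteq> 0" and L0: "L \<noteq> 0" using s L by auto
  have l2: "?l = x * c * (2 * s * L ^ 3 * a - 2 * L\<^sup>2 * b - 2 * L * a + b / (2 * s) + (L * m * a - (N - 1) * b) / (2 * s))"
   unfolding lhs ode unfolding rL using s0 by (simp add: field_simps power2_eq_square power3_eq_cube)
  have num: "r\<^sup>2 * rotheat_s z s r - (N - 2) * rotheat_r z s r =
    (2 * s * L) * (x * c * (2 * s * L ^ 3 * a - 2 * L\<^sup>2 * b - 2 * L * a + b / (2 * s) + (L * m * a - (N - 1) * b) / (2 * s)))"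
   unfolding E1 Es unfolding rL using s0 by (simp add: field_simps power2_eq_square power3_eq_cube)
  show ?thesis unfolding l2 N_def[symmetric] num using s0 L0 rL r by simp
 qed
 ultimately show ?thesis by simp
qed

lemma rotheat_continuous:
 "continuous_on UNIV (rotheat z s)" "continuous_on UNIV (rotheat_r z s)"
 unfolding rotheat_def[abs_def] rotheat_r_def[abs_def] divide_inverse
 by (intro bessel_continuous_intros continuous_intros)+

lemma rotheat_s_bounded:
 assumes "0 < s1"
 shows "\<exists>B. \<forall>s\<in>{s1..s2}. \<forall>r\<in>{0..R}. \<bar>rotheat_s z s r\<bar> \<le> B"
proof -
 have "continuous_on ({s1..s2} \<times> {0..R}) (%p. rotheat_s z (fst p) (snd p))"
  unfolding rotheat_s_def using assms
  by (intro bessel_continuous_intros continuous_intros) (auto simp: gauss_const_pos less_imp_neq[THEN not_sym])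
 then have "bounded ((%p. rotheat_s z (fst p) (snd p)) ` ({s1..s2} \<times> {0..R}))"
  by (intro compact_imp_bounded compact_continuous_image compact_Times) auto
 then obtain B where "\<forall>x\<in>(%p. rotheat_s z (fst p) (snd p)) ` ({s1..s2} \<times> {0..R}). norm x \<le> B"
  by (auto simp: bounded_iff)
 then show ?thesis by (intro exI[of _ B]) force
qed

end

section \<open>Derivatives along rays\<close>

definition punctured :: "real => 'k::euclidean_space set" where
 "punctured R = {w. w \<noteq> 0 \<and> norm w < R}"

text \<open>The derivative \<open>w \<cdot> \<nabla>\<close>, invariant under dilations, written as a derivative in the logarithm of the
 dilation factor.\<close>

definition ray_deriv :: "real => ('k::euclidean_space => real) => ('k => real) => bool" where
 "ray_deriv R F F' \<longleftrightarrow> (\<forall>w\<in>punctured R. ((%y. F (exp y *\<^sub>R w)) has_real_derivative F' w) (at 0))"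

lemma open_punctured: "open (punctured R :: 'k::euclidean_space set)"
proof -
 have "(punctured R :: 'k set) = ball 0 R - {0}" by (auto simp: punctured_def)
 then show ?thesis by (simp add: open_Diff)
qed

lemma punctured_measurable [measurable]: "(punctured R :: 'k::euclidean_space set) \<in> sets borel"
 by (intro borel_open open_punctured)

lemma ray_eventually_punctured:
 assumes "w \<in> punctured R"
 shows "eventually (%y. exp y *\<^sub>R w \<in> punctured R) (at 0)"
proof -
 have "isCont (%y::real. exp y *\<^sub>R w) 0" by (intro continuous_intros)
 then have "((%y::real. exp y *\<^sub>R w) \<longlongrightarrow> w) (at 0)" by (simp add: isCont_def)
 then show ?thesis using assms open_punctured by - (rule topological_tendstoD)
qed

lemma ray_deriv_mult:
 "ray_deriv R F F' ==> ray_deriv R G G' ==> ray_deriv R (%w. F w * G w) (%w. F' w * G w + G' w * F w)"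
 unfolding ray_deriv_def using DERIV_mult[of "%y. F (exp y *\<^sub>R _)" _ 0 UNIV] by (auto intro!: DERIV_mult[THEN DERIV_cong])

lemma ray_deriv_compose:
 assumes "ray_deriv R F F'" "\<And>w. w \<in> punctured R ==> (g has_real_derivative g' w) (at (F w))"
 shows "ray_deriv R (%w. g (F w)) (%w. g' w * F' w)"
 unfolding ray_deriv_def
proof
 fix w :: 'a assume w: "w \<in> punctured R"
 show "((%y. g (F (exp y *\<^sub>R w))) has_real_derivative g' w * F' w) (at 0)"
  using assms w by (intro DERIV_chain2[of g]) (auto simp: ray_deriv_def)
qed

lemma ray_deriv_cong: "ray_deriv R F F' ==> (\<And>w. w \<in> punctured R ==> F' w = G' w) ==> ray_deriv R F G'"
 by (auto simp: ray_deriv_def)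

lemma ray_deriv_inner: "ray_deriv R (%w. w \<bullet> v) (%w. w \<bullet> v)"
 unfolding ray_deriv_def by (auto intro!: derivative_eq_intros)

text \<open>A function that vanishes outside a ball has a ray derivative that vanishes there, on the
 bounding sphere as well: from outside, the difference quotients are zero.\<close>

lemma ray_deriv_vanish:
 assumes F: "ray_deriv R F F'" and van: "\<And>w. w \<in> punctured R ==> r \<le> norm w ==> F w = 0"
  and w: "w \<in> punctured R" "r \<le> norm w"
 shows "F' w = 0"
proof -
 have "((%h. (F (exp (0 + h) *\<^sub>R w) - F (exp 0 *\<^sub>R w)) / h) \<longlongrightarrow> F' w) (at 0)"
  using F w by (simp add: ray_deriv_def DERIV_def)
 then have "((%h. (F (exp h *\<^sub>R w) - F w) / h) \<longlongrightarrow> F' w) (at 0)" by simp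
 then have 1: "((%h. (F (exp h *\<^sub>R w) - F w) / h) \<longlongrightarrow> F' w) (at_right 0)"
  by (rule tendsto_mono[OF at_le[OF subset_UNIV]])
 have "eventually (%h. exp h *\<^sub>R w \<in> punctured R \<and> h > 0) (at_right 0)"
  using ray_eventually_punctured[OF w(1)] by (intro eventually_conj eventually_at_right_less) (auto simp: eventually_at_split)
 then have "eventually (%h. (F (exp h *\<^sub>R w) - F w) / h = 0) (at_right 0)"
 proof (rule eventually_mono)
  fix h :: real assume h: "exp h *\<^sub>R w \<in> punctured R \<and> h > 0"
  have "norm w \<le> norm (exp h *\<^sub>R w)"
   using h mult_right_mono[of 1 "exp h" "norm w"] by simp
  then have "F (exp h *\<^sub>R w) = 0" using h w van by auto
  then show "(F (exp h *\<^sub>R w) - F w) / h = 0" using van[OF w] by simp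
 qed
 then have 2: "((%h. (F (exp h *\<^sub>R w) - F w) / h) \<longlongrightarrow> 0) (at_right 0)"
  by (rule tendsto_eventually)
 show ?thesis using tendsto_unique[OF _ 1 2] by simp
qed

text \<open>The adjoint of the ray derivative, by comparing integrals over dilates.\<close>

lemma integral_ray_derivative:
 fixes \<Phi> \<Phi>' :: "'k::euclidean_space => real"
 assumes der: "\<And>w. ((%y. \<Phi> (exp y *\<^sub>R w)) has_real_derivative \<Phi>' w) (at 0)"
  and [measurable]: "integrable lborel \<Phi>" "Borel \<Phi>'"
  and C: "\<And>w. \<bar>\<Phi>' w\<bar> \<le> C" and van: "\<And>w. norm w > R ==> \<Phi>' w = 0"
 shows "(LBINT w. \<Phi>' w) = - real DIM('k) * (LBINT w. \<Phi> w)"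
proof -
 have [measurable]: "Borel \<Phi>" using assms(2) by auto
 let ?J = "LBINT w. \<Phi> w"
 have I: "(LBINT w. \<Phi> (exp y *\<^sub>R w)) = exp (- real DIM('k) * y) * ?J" for y
 proof -
  have "?J = \<bar>exp y\<bar> ^ DIM('k) * (LBINT w. \<Phi> (0 + exp y *\<^sub>R w))"
   by (rule integral_lborel_affine) auto
  then show ?thesis by (simp add: exp_of_nat_mult[symmetric] exp_minus field_simps)
 qed
 have d1: "((%y. LINT w|lborel. \<Phi> (exp y *\<^sub>R w)) has_real_derivative (LBINT w. \<Phi>' (exp 0 *\<^sub>R w))) (at 0)"
 proof (rule has_real_derivative_integral[where \<delta> = 1 and g = "%w. C * indicator (cball 0 (R * exp 1)) w"])
  fix s :: real assume s: "\<bar>s - 0\<bar> < 1"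
  show "integrable lborel (%w. \<Phi> (exp s *\<^sub>R w))"
   using integrable_lborel_affine[OF assms(2), of "exp s" 0] by simp
  fix w :: 'k
  have "((%y. \<Phi> (exp y *\<^sub>R (exp s *\<^sub>R w))) has_real_derivative \<Phi>' (exp s *\<^sub>R w)) (at 0)" by (rule der)
  then have "((%y. \<Phi> (exp (y + s) *\<^sub>R w)) has_real_derivative \<Phi>' (exp s *\<^sub>R w)) (at 0)"
   by (simp add: exp_add)
  then show "((%s. \<Phi> (exp s *\<^sub>R w)) has_real_derivative \<Phi>' (exp s *\<^sub>R w)) (at s)"
   using DERIV_shift[of "%s. \<Phi> (exp s *\<^sub>R w)" "\<Phi>' (exp s *\<^sub>R w)" 0 s] by simp
  show "\<bar>\<Phi>' (exp s *\<^sub>R w)\<bar> \<le> C * indicator (cball 0 (R * exp 1)) w"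
  proof (cases "norm w \<le> R * exp 1")
   case True then show ?thesis using C[of "exp s *\<^sub>R w"] by simp
  next
   case False
   have "norm w = exp (- s) * norm (exp s *\<^sub>R w)" by (simp add: exp_minus)
   also have "exp (- s) * norm (exp s *\<^sub>R w) \<le> exp 1 * norm (exp s *\<^sub>R w)"
    using s by (intro mult_right_mono) auto
   finally have "exp 1 * R < exp 1 * norm (exp s *\<^sub>R w)" using False by (simp only: mult.commute[of R] not_le)
   then have "norm (exp s *\<^sub>R w) > R" by (simp only: mult_less_cancel_left_pos exp_gt_zero)
   then show ?thesis using van[of "exp s *\<^sub>R w"] False by simp
  qed
 qed (auto intro!: integrable_mult_right integrable_real_indicator emeasure_lborel_cball_finite)
 have d2: "((%y. exp (- real DIM('k) * y) * ?J) has_real_derivative - real DIM('k) * ?J) (at 0)"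
  by (auto intro!: derivative_eq_intros)
 show ?thesis using DERIV_unique[OF d1[unfolded I] d2] by simp
qed

lemma integrable_punctured:
 fixes h :: "'k::euclidean_space => real"
 assumes c: "continuous_on (punctured R) h" and B: "\<And>w. w \<in> punctured R ==> \<bar>h w\<bar> \<le> B"
 shows "integrable lborel (%w. indicator (punctured R) w * h w)"
proof -
 have m: "Borel (%w. indicator (punctured R) w * h w)"
  using borel_measurable_continuous_on_indicator[OF punctured_measurable c] by (simp add: mult.commute)
 show ?thesis
 proof (rule Bochner_Integration.integrable_bound[of _ "%w. B * indicator (cball 0 R) w"])
  show "integrable lborel (%w::'k. B * indicator (cball 0 R) w)"
   by (intro integrable_mult_right integrable_real_indicator emeasure_lborel_cball_finite) auto
  show "AE w in lborel. norm (indicator (punctured R) w * h w) \<le> norm (B * indicator (cball 0 R) w)"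
  proof (rule AE_I2)
   fix w :: 'k
   show "norm (indicator (punctured R) w * h w) \<le> norm (B * indicator (cball 0 R) w)"
    using order_trans[OF B, of w "\<bar>B\<bar>"] by (cases "w \<in> punctured R") (auto simp: punctured_def)
  qed
 qed (use m in simp)
qed

section \<open>Symbols\<close>

text \<open>A family of functions on a punctured ball is a symbol of order \<open>m\<close> if it is bounded, with
 \<open>m\<close> ray derivatives, uniformly in the parameter. Functions such as \<open>w / \<parallel>w\<parallel>\<close> are not
 differentiable at \<open>0\<close>, but they are symbols; this is the regularity that difference
 quotients of a smooth map inherit.\<close>

definition bounded_family :: "'p set => real => ('p => 'k::euclidean_space => real) => bool" where
 "bounded_family A R F \<longleftrightarrow> (\<forall>p\<in>A. continuous_on (punctured R) (F p)) \<and> (\<exists>C. \<forall>p\<in>A. \<forall>w\<in>punctured R. \<bar>F p w\<bar> \<le> C)"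

primrec symbol :: "'p set => real => nat => ('p => 'k::euclidean_space => real) => bool" where
 "symbol A R 0 F \<longleftrightarrow> bounded_family A R F"
| "symbol A R (Suc m) F \<longleftrightarrow> bounded_family A R F \<and> (\<exists>F'. (\<forall>p\<in>A. ray_deriv R (F p) (F' p)) \<and> symbol A R m F')"

lemma symbol_bounded: "symbol A R m F ==> bounded_family A R F"
 by (cases m) auto

lemma symbol_continuous: "symbol A R m F ==> p \<in> A ==> continuous_on (punctured R) (F p)"
 using symbol_bounded[of A R m F] by (auto simp: bounded_family_def)

lemma symbol_bound:
 fixes F :: "'p => 'k::euclidean_space => real"
 assumes "symbol A R m F"
 obtains C where "C \<ge> 0" "\<And>p w. p \<in> A ==> w \<in> punctured R ==> \<bar>F p w\<bar> \<le> C"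
proof -
 obtain C where C: "\<forall>p\<in>A. \<forall>w\<in>punctured R. \<bar>F p w\<bar> \<le> C"
  using symbol_bounded[OF assms] by (auto simp: bounded_family_def)
 show ?thesis by (rule that[of "max 0 C"]) (use C in \<open>auto simp: le_max_iff_disj\<close>)
qed

lemma symbol_SucI:
 "bounded_family A R F ==> (\<And>p. p \<in> A ==> ray_deriv R (F p) (F' p)) ==> symbol A R m F' ==> symbol A R (Suc m) F"
 by auto

lemma symbol_Suc: "symbol A R (Suc m) F ==> symbol A R m F"
 by (induction m arbitrary: F) (auto simp del: symbol.simps(2) simp: symbol.simps(2)[of A R "Suc _"] symbol.simps(2)[of A R 0] intro: symbol_SucI)


lemma bounded_family_mult:
 fixes F G :: "'p => 'k::euclidean_space => real"
 assumes "bounded_family A R F" "bounded_family A R G" shows "bounded_family A R (%p w. F p w * G p w)"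
proof -
 obtain C D where C: "\<forall>p\<in>A. \<forall>w\<in>punctured R. \<bar>F p w\<bar> \<le> C" "\<forall>p\<in>A. \<forall>w\<in>punctured R. \<bar>G p w\<bar> \<le> D"
  using assms by (auto simp: bounded_family_def)
 have "\<forall>p\<in>A. \<forall>w\<in>punctured R. \<bar>F p w * G p w\<bar> \<le> C * D"
 proof (intro ballI)
  fix p and w :: 'k assume "p \<in> A" "w \<in> punctured R"
  then show "\<bar>F p w * G p w\<bar> \<le> C * D"
   unfolding abs_mult using C by (intro mult_mono) (auto intro: order_trans[OF abs_ge_zero])
 qed
 then show ?thesis using assms by (auto simp: bounded_family_def intro!: continuous_on_mult)
qed

lemma bounded_family_add:
 fixes F G :: "'p => 'k::euclidean_space => real"
 assumes "bounded_family A R F" "bounded_family A R G" shows "bounded_family A R (%p w. F p w + G p w)"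
proof -
 obtain C D where C: "\<forall>p\<in>A. \<forall>w\<in>punctured R. \<bar>F p w\<bar> \<le> C" "\<forall>p\<in>A. \<forall>w\<in>punctured R. \<bar>G p w\<bar> \<le> D"
  using assms by (auto simp: bounded_family_def)
 have "\<forall>p\<in>A. \<forall>w\<in>punctured R. \<bar>F p w + G p w\<bar> \<le> C + D"
  using C by (meson abs_triangle_ineq add_mono order_trans)
 then show ?thesis using assms by (auto simp: bounded_family_def intro!: continuous_on_add)
qed

lemma ray_deriv_const: "ray_deriv R (%w. c) (%w. 0)"
 by (simp add: ray_deriv_def)

lemma ray_deriv_add: "ray_deriv R F F' ==> ray_deriv R G G' ==> ray_deriv R (%w. F w + G w) (%w. F' w + G' w)"
 unfolding ray_deriv_def by (auto intro!: DERIV_add)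

lemma symbol_const: "symbol A R m (%p w. c)"
proof (induction m arbitrary: c)
 case 0
 show ?case by (auto simp: bounded_family_def)
next
 case (Suc m)
 show ?case by (rule symbol_SucI[where F' = "%p w. 0"]) (auto simp: bounded_family_def ray_deriv_const Suc)
qed

lemma symbol_add: "symbol A R m F ==> symbol A R m G ==> symbol A R m (%p w. F p w + G p w)"
proof (induction m arbitrary: F G)
 case 0 then show ?case by (auto intro: bounded_family_add)
next
 case (Suc m)
 then obtain F' G' where *: "\<forall>p\<in>A. ray_deriv R (F p) (F' p)" "symbol A R m F'" "\<forall>p\<in>A. ray_deriv R (G p) (G' p)" "symbol A R m G'"
  by auto
 show ?case
  by (rule symbol_SucI[where F' = "%p w. F' p w + G' p w"]) (use * Suc in \<open>auto intro: bounded_family_add ray_deriv_add\<close>)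
qed

lemma symbol_mult: "symbol A R m F ==> symbol A R m G ==> symbol A R m (%p w. F p w * G p w)"
proof (induction m arbitrary: F G)
 case 0 then show ?case by (auto intro: bounded_family_mult)
next
 case (Suc m)
 then obtain F' G' where *: "\<forall>p\<in>A. ray_deriv R (F p) (F' p)" "symbol A R m F'" "\<forall>p\<in>A. ray_deriv R (G p) (G' p)" "symbol A R m G'"
  by auto
 show ?case
  by (rule symbol_SucI[where F' = "%p w. F' p w * G p w + G' p w * F p w"])
    (use * Suc.IH Suc.prems[THEN symbol_Suc] Suc.prems[THEN symbol_bounded] in \<open>auto intro: bounded_family_mult ray_deriv_mult symbol_add\<close>)
qed

lemma symbol_sum: "finite S ==> (\<And>i. i \<in> S ==> symbol A R m (F i)) ==> symbol A R m (%p w. \<Sum>i\<in>S. F i p w)"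
 by (induction S rule: finite_induct) (auto intro: symbol_const symbol_add)

lemma symbol_cmult: "symbol A R m F ==> symbol A R m (%p w. c * F p w)"
 by (rule symbol_mult[OF symbol_const])

lemma symbol_cong:
 fixes F G :: "'p => 'k::euclidean_space => real"
 assumes "symbol A R m F" "\<And>p w. p \<in> A ==> w \<in> punctured R ==> F p w = G p w"
 shows "symbol A R m G"
proof -
 have b: "bounded_family A R G"
  using symbol_bounded[OF assms(1)] assms(2) by (auto simp: bounded_family_def cong: continuous_on_cong_simp)
 show ?thesis
 proof (cases m)
  case (Suc m')
  then obtain F' where F': "\<forall>p\<in>A. ray_deriv R (F p) (F' p)" "symbol A R m' F'" using assms(1) by auto
  have "ray_deriv R (G p) (F' p)" if p: "p \<in> A" for p
   unfolding ray_deriv_def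
  proof
   fix w :: 'k assume w: "w \<in> punctured R"
   have d: "((%y. F p (exp y *\<^sub>R w)) has_real_derivative F' p w) (at 0)" using F' p w by (auto simp: ray_deriv_def)
   have "eventually (%y. exp y *\<^sub>R w \<in> punctured R) (nhds 0)"
    using ray_eventually_punctured[OF w] w by (auto simp: eventually_at_filter elim!: eventually_mono)
   then have ev: "eventually (%y. F p (exp y *\<^sub>R w) = G p (exp y *\<^sub>R w)) (nhds 0)"
    by (rule eventually_mono) (use assms(2) p in auto)
   show "((%y. G p (exp y *\<^sub>R w)) has_real_derivative F' p w) (at 0)"
    using DERIV_cong_ev[OF refl ev refl] d by simp
  qed
  then show ?thesis unfolding Suc using F' b by (intro symbol_SucI) auto
 qed (use b in simp)
qed

lemma symbol_inverse:
 fixes F :: "'p => 'k::euclidean_space => real"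
 assumes c: "c > 0"
 shows "symbol A R m F ==> (\<And>p w. p \<in> A ==> w \<in> punctured R ==> F p w \<ge> c) ==> symbol A R m (%p w. 1 / F p w)"
proof (induction m arbitrary: F)
 case 0
 have "\<bar>1 / F p w\<bar> \<le> 1 / c" if "p \<in> A" "w \<in> punctured R" for p w
  using 0(2)[OF that] c by (auto simp: field_simps)
 moreover have "continuous_on (punctured R) (%w. 1 / F p w)" if "p \<in> A" for p
  using 0(1) 0(2)[OF that] that c by (intro continuous_on_divide continuous_on_const) (force simp: bounded_family_def)+
 ultimately show ?case by (auto simp: bounded_family_def)
next
 case (Suc m)
 then obtain F' where *: "\<forall>p\<in>A. ray_deriv R (F p) (F' p)" "symbol A R m F'" by auto
 have i: "symbol A R m (%p w. 1 / F p w)" using Suc.IH[OF symbol_Suc[OF Suc.prems(1)] Suc.prems(2)] .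
 show ?case
 proof (rule symbol_SucI[where F' = "%p w. (- 1) * ((1 / F p w) * (1 / F p w)) * F' p w"])
  show "bounded_family A R (%p w. 1 / F p w)" using i by (rule symbol_bounded)
  show "symbol A R m (%p w. (- 1) * ((1 / F p w) * (1 / F p w)) * F' p w)"
   by (intro symbol_mult symbol_cmult i *)
  fix p assume p: "p \<in> A"
  show "ray_deriv R (%w. 1 / F p w) (%w. (- 1) * ((1 / F p w) * (1 / F p w)) * F' p w)"
  proof (rule ray_deriv_compose[of R "F p" "F' p" "%x. 1 / x"])
   show "ray_deriv R (F p) (F' p)" using * p by simp
   fix w :: 'k assume "w \<in> punctured R"
   then have "F p w \<noteq> 0" using Suc.prems(2)[OF p] c by force
   then show "((%x. 1 / x) has_real_derivative (- 1) * ((1 / F p w) * (1 / F p w))) (at (F p w))"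
    by (auto intro!: derivative_eq_intros)
  qed
 qed
qed

lemma DERIV_positive_part_power:
 fixes x :: real
 assumes P: "P \<ge> 2"
 shows "((%x. max 0 x ^ P) has_real_derivative real P * max 0 x ^ (P - 1)) (at x)"
proof -
 consider "x > 0" | "x < 0" | "x = 0" by linarith
 then show ?thesis
 proof cases
  case 1
  have "((%x. x ^ P) has_real_derivative real P * x ^ (P - 1)) (at x)"
   using DERIV_pow[of P x] by simp
  moreover have "eventually (%y. y ^ P = max 0 y ^ P) (nhds x)"
   using eventually_nhds_in_open[of "{0<..}" x] 1 by (auto elim!: eventually_mono)
  ultimately show ?thesis using 1 DERIV_cong_ev[OF refl _ refl] by fastforce
 next
  case 2
  have "eventually (%y. 0 = max 0 y ^ P) (nhds x)"
   using eventually_nhds_in_open[of "{..<0}" x] 2 P by (auto elim!: eventually_mono)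
  moreover have "((%x. 0) has_real_derivative real P * max 0 x ^ (P - 1)) (at x)" using 2 P by (simp add: zero_power)
  ultimately show ?thesis using DERIV_cong_ev[OF refl _ refl] by fastforce
 next
  case 3
  have z0: "(0::real) ^ P = 0" and z1: "(0::real) ^ (P - 1) = 0" using P by (auto intro: zero_power)
  have "((%h. (max 0 (0 + h) ^ P - max 0 0 ^ P) / h) \<longlongrightarrow> 0) (at (0::real))"
  proof (rule Lim_null_comparison)
   show "eventually (%h. norm ((max 0 (0 + h) ^ P - max 0 0 ^ P) / h) \<le> \<bar>h\<bar> ^ (P - 1)) (at (0::real))"
   proof (rule always_eventually, rule allI)
    fix h :: real
    have "\<bar>max 0 h ^ P\<bar> \<le> \<bar>h\<bar> ^ P" by (auto simp: power_abs intro!: power_mono)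
    also have "... = \<bar>h\<bar> ^ (P - 1) * \<bar>h\<bar>" using P by (metis One_nat_def Suc_pred mult.commute not_numeral_le_zero neq0_conv power_Suc)
    finally have "\<bar>max 0 h ^ P\<bar> \<le> \<bar>h\<bar> ^ (P - 1) * \<bar>h\<bar>" .
    then show "norm ((max 0 (0 + h) ^ P - max 0 0 ^ P) / h) \<le> \<bar>h\<bar> ^ (P - 1)"
    proof (cases "h = 0")
     case False
     have z: "max 0 (0::real) ^ P = 0" using P by simp
     show ?thesis
      using \<open>\<bar>max 0 h ^ P\<bar> \<le> \<bar>h\<bar> ^ (P - 1) * \<bar>h\<bar>\<close> False unfolding z by (simp add: abs_divide pos_divide_le_eq)
    qed simp
   qed
   have "((%h::real. \<bar>h\<bar> ^ (P - 1)) \<longlongrightarrow> \<bar>0\<bar> ^ (P - 1)) (at 0)" by (intro tendsto_intros)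
   then show "((%h::real. \<bar>h\<bar> ^ (P - 1)) \<longlongrightarrow> 0) (at 0)" by (simp only: abs_zero z1)
  qed
  then show ?thesis unfolding DERIV_def using 3 by (simp only: max.idem z1 mult_zero_right)
 qed
qed

text \<open>Each derivative lowers the power of the positive part by one, so \<open>m + 1\<close> powers leave \<open>m\<close> bounded
 continuous derivatives.\<close>

lemma symbol_positive_part_power:
 fixes F :: "'p => 'k::euclidean_space => real"
 shows "symbol A R m F ==> P \<ge> m + 1 ==> symbol A R m (%p w. max 0 (F p w) ^ P)"
proof (induction m arbitrary: P)
 have b: "bounded_family A R (%p w. max 0 (F p w) ^ P)" if bF: "bounded_family A R F" for P and F :: "'p => 'k => real"
 proof -
  obtain C where C: "\<forall>p\<in>A. \<forall>w\<in>punctured R. \<bar>F p w\<bar> \<le> C" using bF by (auto simp: bounded_family_def)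
  have "\<forall>p\<in>A. \<forall>w\<in>punctured R. \<bar>max 0 (F p w) ^ P\<bar> \<le> C ^ P"
  proof (intro ballI)
   fix p and w :: 'k assume "p \<in> A" "w \<in> punctured R"
   then have "\<bar>F p w\<bar> \<le> C" using C by auto
   then show "\<bar>max 0 (F p w) ^ P\<bar> \<le> C ^ P" by (auto simp: power_abs intro!: power_mono)
  qed
  then show ?thesis using bF by (auto simp: bounded_family_def intro!: continuous_intros)
 qed
 {
  case 0 then show ?case using b by auto
 next
  case (Suc m)
  obtain F' where *: "\<forall>p\<in>A. ray_deriv R (F p) (F' p)" "symbol A R m F'" using Suc.prems by auto
  show ?case
  proof (rule symbol_SucI[where F' = "%p w. (real P * max 0 (F p w) ^ (P - 1)) * F' p w"])
   show "bounded_family A R (%p w. max 0 (F p w) ^ P)" using b symbol_bounded[OF Suc.prems(1)] .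
   show "symbol A R m (%p w. (real P * max 0 (F p w) ^ (P - 1)) * F' p w)"
    using Suc.prems(2) by (intro symbol_mult symbol_cmult Suc.IH symbol_Suc[OF Suc.prems(1)] *) auto
   fix p assume p: "p \<in> A"
   show "ray_deriv R (%w. max 0 (F p w) ^ P) (%w. (real P * max 0 (F p w) ^ (P - 1)) * F' p w)"
    using * p Suc.prems(2) by (intro ray_deriv_compose[of R "F p" "F' p" "%x. max 0 x ^ P"] DERIV_positive_part_power) auto
  qed
 }
qed


lemma symbol_inner: "symbol A R m (%p w. w \<bullet> v)"
proof (induction m)
 have b: "bounded_family A R (%p w. w \<bullet> v)"
 proof -
  have "\<bar>w \<bullet> v\<bar> \<le> R * norm v" if "w \<in> punctured R" for w
   using Cauchy_Schwarz_ineq2[of w v] that mult_right_mono[of "norm w" R "norm v"] by (auto simp: punctured_def)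
  then show ?thesis by (auto simp: bounded_family_def intro!: continuous_intros)
 qed
 { case 0 show ?case using b by simp next
  case (Suc m) then show ?case using b ray_deriv_inner by (intro symbol_SucI) auto }
qed

lemma ray_deriv_angle: "ray_deriv R (%w. (w \<bullet> v) / norm w) (%w. 0)"
 unfolding ray_deriv_def by simp

lemma symbol_angle: "symbol A R m (%p w. (w \<bullet> v) / norm w)"
proof -
 have b: "bounded_family A R (%p w. (w \<bullet> v) / norm w)"
 proof -
  have "\<bar>(w \<bullet> v) / norm w\<bar> \<le> norm v" if "w \<in> punctured R" for w
   using Cauchy_Schwarz_ineq2[of w v] that by (auto simp: punctured_def divide_le_eq mult.commute)
  then show ?thesis by (auto simp: bounded_family_def punctured_def intro!: continuous_intros)
 qed
 show ?thesis
  by (cases m) (auto intro!: b ray_deriv_angle symbol_const[where c = 0] exI[of _ "%p w. 0"])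
qed

text \<open>The cutoff \<open>\<zeta> = \<parallel>w\<parallel>\<^sup>2\<^sup>M / (\<parallel>w\<parallel>\<^sup>2\<^sup>M + t\<^sup>M)\<close> separates \<open>\<parallel>w\<parallel> > \<surd>t\<close> from \<open>\<parallel>w\<parallel> < \<surd>t\<close>. Its ray derivative
 is \<open>2 M \<zeta> (1 - \<zeta>)\<close>, so it is a symbol uniformly in \<open>t\<close>.\<close>

definition weight :: "nat => nat => real => 'k::euclidean_space => real" where
 "weight M i t w = (w \<bullet> w) ^ (M - i) / ((w \<bullet> w) ^ M + t ^ M)"

lemma weight_nonneg: "t > 0 ==> weight M i t w \<ge> 0"
 by (simp add: weight_def)

lemma weight_denominator: "t > 0 ==> (w \<bullet> w) ^ M + t ^ M > (0::real)"
 by (simp add: add_nonneg_pos)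

lemma weight_continuous: "t > 0 ==> continuous_on S (weight M i t)"
 unfolding weight_def[abs_def]
 by (intro continuous_intros ballI) (metis weight_denominator less_irrefl)

lemma weight_ray_deriv:
 assumes t: "t > 0"
 shows "ray_deriv R (weight M i t) (%w. weight M i t w * (2 * real (M - i) - 2 * real M * weight M 0 t w))"
 unfolding ray_deriv_def
proof
 fix w :: 'a
 let ?N = "w \<bullet> w" and ?e = "%y::real. exp (2 * y) * (w \<bullet> w)"
 have N: "(exp y *\<^sub>R w) \<bullet> (exp y *\<^sub>R w) = ?e y" for y
  by (simp add: exp_add[symmetric] mult.assoc[symmetric])
 have D: "?N ^ M + t ^ M > 0" by (rule weight_denominator[OF t])
 have pw: "((%y. ?e y ^ j) has_real_derivative 2 * real j * ?N ^ j) (at 0)" for j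
 proof -
  have "((%y. exp (2 * real j * y) * ?N ^ j) has_real_derivative 2 * real j * ?N ^ j) (at 0)"
   by (auto intro!: derivative_eq_intros)
  moreover have "exp (2 * real j * y) * ?N ^ j = ?e y ^ j" for y
   by (simp add: power_mult_distrib exp_of_nat_mult[symmetric] mult_ac)
  ultimately show ?thesis by simp
 qed
 have "((%y. ?e y ^ (M - i) / (?e y ^ M + t ^ M)) has_real_derivative
   (2 * real (M - i) * ?N ^ (M - i) * (?e 0 ^ M + t ^ M) - ?e 0 ^ (M - i) * (2 * real M * ?N ^ M + 0)) / ((?e 0 ^ M + t ^ M) * (?e 0 ^ M + t ^ M))) (at 0)"
  using D by (intro DERIV_divide pw DERIV_add DERIV_const) auto
 also have "(2 * real (M - i) * ?N ^ (M - i) * (?e 0 ^ M + t ^ M) - ?e 0 ^ (M - i) * (2 * real M * ?N ^ M + 0)) / ((?e 0 ^ M + t ^ M) * (?e 0 ^ M + t ^ M))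
   = weight M i t w * (2 * real (M - i) - 2 * real M * weight M 0 t w)"
  using D by (simp add: weight_def field_simps)
 finally show "((%y. weight M i t (exp y *\<^sub>R w)) has_real_derivative weight M i t w * (2 * real (M - i) - 2 * real M * weight M 0 t w)) (at 0)"
  unfolding weight_def[of M i t "exp _ *\<^sub>R w"] N .
qed

lemma weight_zero_bounds: "t > 0 ==> 0 \<le> weight M 0 t w" "t > 0 ==> weight M 0 t w \<le> 1"
 using weight_denominator[of t w M] by (auto simp: weight_def)

lemma symbol_cutoff:
 fixes A :: "'p set"
 assumes T: "\<And>p. p \<in> A ==> T p > 0"
 shows "symbol A R m (%p (w::'k::euclidean_space). weight M 0 (T p) w)"
proof (induction m)
 have b: "bounded_family A R (%p (w::'k). weight M 0 (T p) w)"
  unfolding bounded_family_def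
 proof (intro conjI ballI exI[of _ 1])
  show "continuous_on (punctured R :: 'k set) (weight M 0 (T p))" if "p \<in> A" for p using T[OF that] by (rule weight_continuous)
  show "\<bar>weight M 0 (T p) w\<bar> \<le> 1" if "p \<in> A" for p and w :: 'k using weight_zero_bounds[OF T[OF that], of M w] by (simp add: abs_of_nonneg)
 qed
 { case 0 show ?case using b by simp next
  case (Suc m)
  show ?case
  proof (rule symbol_SucI[where F' = "%p w. weight M 0 (T p) w * (2 * real M + (- (2 * real M)) * weight M 0 (T p) w)"])
   show "symbol A R m (%p (w::'k). weight M 0 (T p) w * (2 * real M + (- (2 * real M)) * weight M 0 (T p) w))"
    by (intro symbol_mult symbol_add symbol_cmult symbol_const Suc.IH)
   show "ray_deriv R (weight M 0 (T p)) (%w::'k. weight M 0 (T p) w * (2 * real M + (- (2 * real M)) * weight M 0 (T p) w))" if "p \<in> A" for p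
    using weight_ray_deriv[OF T[OF that], of R M 0] by simp
  qed (rule b) }
qed

definition vanishing :: "'p set => real => real => ('p => 'k::euclidean_space => real) => bool" where
 "vanishing A R r F \<longleftrightarrow> (\<forall>p\<in>A. \<forall>w\<in>punctured R. r \<le> norm w --> F p w = 0)"

section \<open>Integration by parts against functions of a distance\<close>

text \<open>Besides a base point, the parameter \<open>p\<close> includes the time \<open>T p\<close>, so that the bounds for symbols are
 uniform in both. The condition on \<open>slope\<close> says that the distance is comparable to its own ray
 derivative.\<close>

locale distance_family =
 fixes A :: "'p set" and R r :: real and T :: "'p => real" and M :: nat
  and dst :: "'p => 'k::euclidean_space => real" and e slope :: "'p => 'k => real" and c Rd :: real
 assumes T: "\<And>p. p \<in> A ==> T p > 0" and rR: "0 < r" "r < R" and c: "c > 0"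
  and dst_bounds: "\<And>p w. p \<in> A ==> w \<in> punctured R ==> 0 < dst p w \<and> dst p w \<le> Rd"
  and dst_cont: "\<And>p. p \<in> A ==> continuous_on (punctured R) (dst p)"
  and dst_deriv: "\<And>p. p \<in> A ==> ray_deriv R (dst p) (%w. dst p w * slope p w)"
  and dst_sq: "\<And>p w. p \<in> A ==> w \<in> punctured R ==> (dst p w)\<^sup>2 = (w \<bullet> w) * e p w"
  and e: "\<And>m. symbol A R m e" "\<And>p w. p \<in> A ==> w \<in> punctured R ==> e p w \<ge> c"
  and slope: "\<And>m. symbol A R m slope" "\<And>p w. p \<in> A ==> w \<in> punctured R ==> slope p w \<ge> c"
begin

definition pairing :: "nat => ('p => 'k => real) => 'p => (real => real) => real" where
 "pairing i b p F = (LBINT w. indicator (punctured R) w * (weight M i (T p) w * b p w * F (dst p w)))"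

lemma weight_bounded: "p \<in> A ==> \<exists>B\<ge>0. \<forall>w\<in>punctured R. \<bar>weight M i (T p) (w::'k)\<bar> \<le> B"
proof -
 assume p: "p \<in> A"
 have "compact (weight M i (T p) ` cball (0::'k) R)"
  using T[OF p] by (intro compact_continuous_image weight_continuous) auto
 from compact_imp_bounded[OF this] obtain B where "\<forall>x\<in>weight M i (T p) ` cball (0::'k) R. norm x \<le> B"
  by (auto simp: bounded_iff)
 then show ?thesis by (intro exI[of _ "max 0 B"]) (force simp: punctured_def le_max_iff_disj)
qed

lemma pairing_integrand:
 assumes b: "symbol A R m b" and p: "p \<in> A" and F: "continuous_on UNIV F"
 shows "continuous_on (punctured R) (%w. weight M i (T p) w * b p w * F (dst p w))"
  and "\<exists>B. \<forall>w\<in>punctured R. \<bar>weight M i (T p) w * b p w * F (dst p w)\<bar> \<le> B"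
proof -
 show "continuous_on (punctured R) (%w. weight M i (T p) w * b p w * F (dst p w))"
  by (intro continuous_on_mult weight_continuous T p symbol_continuous[OF b] continuous_on_compose2[OF F dst_cont] subset_UNIV)
 obtain B1 where B1: "B1 \<ge> 0" "\<forall>w\<in>punctured R. \<bar>weight M i (T p) (w::'k)\<bar> \<le> B1" using weight_bounded[OF p] by auto
 obtain B2 where B2: "B2 \<ge> 0" "\<And>w. w \<in> punctured R ==> \<bar>b p w\<bar> \<le> B2" using symbol_bound[OF b] p by metis
 have "compact (F ` {0..Rd})" using F by (intro compact_continuous_image) (auto intro: continuous_on_subset)
 from compact_imp_bounded[OF this] obtain B3 where B3: "\<forall>x\<in>F ` {0..Rd}. norm x \<le> B3" by (auto simp: bounded_iff)
 have "\<bar>weight M i (T p) w * b p w * F (dst p w)\<bar> \<le> B1 * B2 * B3" if w: "w \<in> punctured R" for w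
 proof -
  have "\<bar>F (dst p w)\<bar> \<le> B3" using B3 dst_bounds[OF p w] by auto
  then show ?thesis unfolding abs_mult using B1 B2 w by (intro mult_mono mult_nonneg_nonneg) auto
 qed
 then show "\<exists>B. \<forall>w\<in>punctured R. \<bar>weight M i (T p) w * b p w * F (dst p w)\<bar> \<le> B" by blast
qed

lemma pairing_integrable:
 assumes "symbol A R m b" "p \<in> A" "continuous_on UNIV F"
 shows "integrable lborel (%w. indicator (punctured R) w * (weight M i (T p) w * b p w * F (dst p w)))"
proof -
 obtain B where "\<forall>w\<in>punctured R. \<bar>weight M i (T p) w * b p w * F (dst p w)\<bar> \<le> B"
  using pairing_integrand(2)[OF assms] by blast
 then show ?thesis by (intro integrable_punctured[where B = B] pairing_integrand(1)[OF assms]) auto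
qed

text \<open>The derivative \<open>s F'(s)\<close>, evaluated at the distance, equals the ray derivative of \<open>F (dst w)\<close>
 divided by the slope; integration by parts along rays moves it to the symbol.\<close>

lemma pairing_by_parts:
 assumes b: "symbol A R (Suc m) b" and van: "vanishing A R r b"
 obtains b' where "symbol A R m b'" "vanishing A R r b'"
  "\<And>p F F1. p \<in> A ==> continuous_on UNIV F ==> continuous_on UNIV F1 ==>
   (\<And>s. s > 0 ==> (F has_real_derivative F1 s / s) (at s)) ==> pairing i b p F1 = pairing i b' p F"
proof -
 define k where "k p w = 1 / slope p w" for p w
 have k: "symbol A R m' k" for m'
  unfolding k_def[abs_def] by (rule symbol_inverse[OF c slope])
 have kb: "symbol A R (Suc m) (%p w. k p w * b p w)" by (intro symbol_mult k b)
 then obtain D where D: "\<And>p. p \<in> A ==> ray_deriv R (%w. k p w * b p w) (D p)" "symbol A R m D" by auto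
 have vanD: "D p w = 0" if "p \<in> A" "w \<in> punctured R" "r \<le> norm w" for p w
  using ray_deriv_vanish[OF D(1)[OF that(1)] _ that(2,3)] van that by (auto simp: vanishing_def)
 let ?dim = "real DIM('k)"
 define b' where "b' p w = (- 1) * (((?dim + 2 * real (M - i)) + (- (2 * real M)) * weight M 0 (T p) w) * (k p w * b p w) + D p w)" for p w
 show ?thesis
 proof
  show "symbol A R m b'"
   unfolding b'_def[abs_def]
   by (intro symbol_cmult symbol_add symbol_mult symbol_const symbol_cutoff[where T = T] T D k symbol_Suc[OF b])
  show "vanishing A R r b'"
   using van vanD by (auto simp: vanishing_def b'_def)
  fix p F F1
  assume p: "p \<in> A" and F: "continuous_on UNIV F" and F1: "continuous_on UNIV F1"
   and dF: "\<And>s. s > 0 ==> (F has_real_derivative F1 s / s) (at s)"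
  define \<Phi> where "\<Phi> w = indicator (punctured R) w * (weight M i (T p) w * (k p w * b p w) * F (dst p w))" for w
  define g where "g w = weight M i (T p) w * ((2 * real (M - i) + (- (2 * real M)) * weight M 0 (T p) w) * (k p w * b p w) + D p w) * F (dst p w)
    + weight M i (T p) w * b p w * F1 (dst p w)" for w
  define \<Phi>' where "\<Phi>' w = indicator (punctured R) w * g w" for w
  have kslope: "k p w * slope p w = 1" if "w \<in> punctured R" for w
   using slope(2)[OF p that] c by (simp add: k_def)
  have Fd: "ray_deriv R (%w. F (dst p w)) (%w. F1 (dst p w) * slope p w)"
  proof (rule ray_deriv_cong[OF ray_deriv_compose[OF dst_deriv[OF p], of F "%w. F1 (dst p w) / dst p w"]])
   fix w :: 'k assume w: "w \<in> punctured R"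
   show "(F has_real_derivative F1 (dst p w) / dst p w) (at (dst p w))" using dF dst_bounds[OF p w] by simp
   show "F1 (dst p w) / dst p w * (dst p w * slope p w) = F1 (dst p w) * slope p w" using dst_bounds[OF p w] by simp
  qed
  have ray: "ray_deriv R (%w. weight M i (T p) w * (k p w * b p w) * F (dst p w)) g"
  proof (rule ray_deriv_cong[OF ray_deriv_mult[OF ray_deriv_mult[OF weight_ray_deriv[OF T[OF p]] D(1)[OF p]] Fd]])
   fix w :: 'k assume w: "w \<in> punctured R"
   have "F1 (dst p w) * slope p w * (weight M i (T p) w * (k p w * b p w)) = (k p w * slope p w) * (weight M i (T p) w * b p w * F1 (dst p w))"
    by (simp only: mult_ac)
   then show "(weight M i (T p) w * (2 * real (M - i) - 2 * real M * weight M 0 (T p) w) * (k p w * b p w) + D p w * weight M i (T p) w) * F (dst p w)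
     + F1 (dst p w) * slope p w * (weight M i (T p) w * (k p w * b p w)) = g w"
    unfolding kslope[OF w] g_def by (simp add: algebra_simps)
  qed
  have s1: "symbol A R m (%p w. (2 * real (M - i) + (- (2 * real M)) * weight M 0 (T p) w) * (k p w * b p w) + D p w)"
   by (intro symbol_cmult symbol_add symbol_mult symbol_const symbol_cutoff[where T = T] T D k symbol_Suc[OF b])
  note i1 = pairing_integrand[OF s1 p F, of i] and i2 = pairing_integrand[OF b p F1, of i]
  have gc: "continuous_on (punctured R) g"
   unfolding g_def[abs_def] by (intro continuous_on_add i1 i2)
  obtain B where B: "\<And>w. w \<in> punctured R ==> \<bar>g w\<bar> \<le> B"
  proof -
   obtain B1 B2 where "\<forall>w\<in>punctured R. \<bar>weight M i (T p) w * ((2 * real (M - i) + (- (2 * real M)) * weight M 0 (T p) w) * (k p w * b p w) + D p w) * F (dst p w)\<bar> \<le> B1"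
    "\<forall>w\<in>punctured R. \<bar>weight M i (T p) w * b p w * F1 (dst p w)\<bar> \<le> B2" using i1(2) i2(2) by blast
   then have "\<bar>g w\<bar> \<le> B1 + B2" if "w \<in> punctured R" for w
    unfolding g_def using that by (meson abs_triangle_ineq add_mono order_trans)
   then show ?thesis using that by blast
  qed
  have van0: "b p w = 0" "D p w = 0" if "w \<in> punctured R" "r \<le> norm w" for w
   using van vanD that p by (auto simp: vanishing_def)
  have "(LBINT w. \<Phi>' w) = - ?dim * (LBINT w. \<Phi> w)"
  proof (rule integral_ray_derivative[where C = "\<bar>B\<bar>" and R = R])
   show "integrable lborel \<Phi>"
    unfolding \<Phi>_def[abs_def] by (rule pairing_integrable[OF kb p F])
   show "Borel \<Phi>'"
    using borel_measurable_continuous_on_indicator[OF punctured_measurable gc] unfolding \<Phi>'_def[abs_def] by simp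
   show "\<bar>\<Phi>' w\<bar> \<le> \<bar>B\<bar>" for w
    using order_trans[OF B abs_ge_self] by (auto simp: \<Phi>'_def indicator_def)
   show "\<Phi>' w = 0" if "norm w > R" for w using that by (simp add: \<Phi>'_def punctured_def)
   fix w :: 'k
   show "((%y. \<Phi> (exp y *\<^sub>R w)) has_real_derivative \<Phi>' w) (at 0)"
   proof (cases "w \<in> punctured R")
    case True
    have "eventually (%y. exp y *\<^sub>R w \<in> punctured R) (nhds 0)"
     using ray_eventually_punctured[OF True] True by (auto simp: eventually_at_filter elim!: eventually_mono)
    then have ev: "eventually (%y. \<Phi> (exp y *\<^sub>R w) = weight M i (T p) (exp y *\<^sub>R w) * (k p (exp y *\<^sub>R w) * b p (exp y *\<^sub>R w)) * F (dst p (exp y *\<^sub>R w))) (nhds 0)"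
     by (rule eventually_mono) (simp add: \<Phi>_def)
    show ?thesis using DERIV_cong_ev[OF refl ev refl] ray True by (simp add: ray_deriv_def \<Phi>'_def)
   next
    case False
    then consider "w = 0" | "norm w \<ge> R" by (auto simp: punctured_def)
    then show ?thesis
    proof cases
     case 1
     then show ?thesis by (simp add: \<Phi>_def \<Phi>'_def punctured_def)
    next
     case 2
     have "isCont (%y::real. norm (exp y *\<^sub>R w)) 0" by (intro continuous_intros)
     then have "((%y::real. norm (exp y *\<^sub>R w)) \<longlongrightarrow> norm (exp 0 *\<^sub>R w)) (nhds 0)"
      unfolding isCont_def by (rule tendsto_at_iff_tendsto_nhds[THEN iffD1])
     then have "eventually (%y. norm (exp y *\<^sub>R w) > r) (nhds 0)"
      by (rule order_tendstoD(1)) (use 2 rR in simp)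
     then have ev: "eventually (%y. \<Phi> (exp y *\<^sub>R w) = 0) (nhds 0)"
      by (rule eventually_mono) (auto simp: \<Phi>_def indicator_def van0)
     show ?thesis using DERIV_cong_ev[OF refl ev refl] 2 by (simp add: \<Phi>'_def punctured_def)
    qed
   qed
  qed
  moreover have "(LBINT w. \<Phi>' w) = pairing i (%p w. (2 * real (M - i) + (- (2 * real M)) * weight M 0 (T p) w) * (k p w * b p w) + D p w) p F + pairing i b p F1"
   unfolding \<Phi>'_def g_def pairing_def distrib_left
   by (subst Bochner_Integration.integral_add[symmetric])
     (use pairing_integrable[OF s1 p F, of i] pairing_integrable[OF b p F1, of i] in \<open>auto simp: distrib_left mult_ac\<close>)
  moreover have "pairing i b' p F = - ?dim * (LBINT w. \<Phi> w) - pairing i (%p w. (2 * real (M - i) + (- (2 * real M)) * weight M 0 (T p) w) * (k p w * b p w) + D p w) p F"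
  proof -
   have "pairing i b' p F = (LBINT w. - ?dim * \<Phi> w - indicator (punctured R) w * (weight M i (T p) w * ((2 * real (M - i) + (- (2 * real M)) * weight M 0 (T p) w) * (k p w * b p w) + D p w) * F (dst p w)))"
    unfolding pairing_def \<Phi>_def b'_def by (intro Bochner_Integration.integral_cong refl) (simp add: algebra_simps)
   also have "... = - ?dim * (LBINT w. \<Phi> w) - pairing i (%p w. (2 * real (M - i) + (- (2 * real M)) * weight M 0 (T p) w) * (k p w * b p w) + D p w) p F"
    using pairing_integrable[OF s1 p F, of i] pairing_integrable[OF kb p F, of i]
    unfolding pairing_def \<Phi>_def by (subst Bochner_Integration.integral_diff) auto
   finally show ?thesis .
  qed
  ultimately show "pairing i b p F1 = pairing i b' p F" by linarith
 qed
qed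

end

section \<open>Cancellation in the averaged heat kernel\<close>

lemma fdiff_add: "fdiff M (%s. f s + g s) t s = fdiff M f t s + fdiff M g t s"
 by (induction M arbitrary: s) simp_all

lemma fdiff_cmult: "fdiff M (%s. c * f s) t s = c * fdiff M f t s"
 by (induction M arbitrary: s) (simp_all add: right_diff_distrib)

lemma fdiff_cong: "t > 0 ==> s0 > 0 ==> (\<And>s. s > 0 ==> f s = g s) ==> fdiff M f t s0 = fdiff M g t s0"
 by (induction M arbitrary: s0) simp_all

lemma fdiff_abs_le_sup:
 assumes "\<And>s. s0 \<le> s ==> s \<le> s0 + real M * t ==> \<bar>f s\<bar> \<le> B" and t: "t > 0"
 shows "\<bar>fdiff M f t s0\<bar> \<le> 2 ^ M * B"
 using assms(1)
proof (induction M arbitrary: s0)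
 case 0 then show ?case by simp
next
 case (Suc M)
 have "\<bar>fdiff M f t s0\<bar> \<le> 2 ^ M * B" using t by (intro Suc.IH Suc.prems) (auto simp: algebra_simps)
 moreover have "\<bar>fdiff M f t (s0 + t)\<bar> \<le> 2 ^ M * B" using t by (intro Suc.IH Suc.prems) (auto simp: algebra_simps)
 ultimately show ?case by simp
qed

lemma rotheat_s_continuous: "continuous_on UNIV (rotheat_s H z s)" if "haar_SO H"
 unfolding rotheat_s_def[OF that, abs_def] divide_inverse
 by (intro bessel_continuous_intros[OF that] continuous_intros)

lemma rotheat_le:
 fixes z :: "real^'n::finite"
 assumes H: "haar_SO H" and n: "CARD('n) \<ge> 2" and t: "0 < t" "t \<le> s" "s \<le> L * t" and r: "r \<ge> 0"
 shows "rotheat H z s r \<le> L powr (real CARD('n) / 2) * rotheat H z (L * t) r"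
proof -
 interpret H: finite_measure H by (rule haar_finite[OF H])
 have L: "L > 0" using t by (smt (verit) zero_less_mult_pos2)
 define w :: "real^'n" where "w = r *\<^sub>R axis undefined 1"
 have w: "norm w = r" using r by (simp add: w_def)
 have [measurable]: "(%\<theta>. heat s' (w + \<theta> *v z)) \<in> borel_measurable H" for s'
 proof -
  have "Borel (%\<theta>::real^'n^'n. w + \<theta> *v z)"
   by (intro borel_measurable_continuous_onI continuous_on_add continuous_on_const continuous_matrix_vector_mult)
  then show ?thesis by (intro haar_measurable[OF H] measurable_compose[OF _ heat_measurable])
 qed
 have int: "integrable H (%\<theta>. heat s' (w + \<theta> *v z))" if "s' > 0" for s'
 proof -
  obtain B where B: "\<forall>x::real^'n. \<bar>heat s' x\<bar> \<le> B" using bddint_heat[of s', where ?'a = "real^'n"] \<open>s' > 0\<close>[THEN less_imp_le] unfolding bddint_def by blast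
  show ?thesis by (rule H.integrable_const_bound[of _ B]) (use B in auto)
 qed
 have "rotheat H z s r = (LINT \<theta>|H. heat s (w + \<theta> *v z))"
  using t by (simp add: rotheat_eq[OF H n] w)
 also have "... \<le> (LINT \<theta>|H. L powr (real CARD('n) / 2) * heat (L * t) (w + \<theta> *v z))"
  using t L heat_le_heat[OF t, where ?'a = "real^'n"] by (intro integral_mono integrable_mult_right int) auto
 also have "... = L powr (real CARD('n) / 2) * rotheat H z (L * t) r"
  using t L by (simp add: rotheat_eq[OF H n] w)
 finally show ?thesis .
qed

context distance_family
begin

lemma pairing_add:
 assumes "symbol A R m b" "symbol A R m b'" "p \<in> A" "continuous_on UNIV F"
 shows "pairing i (%p w. b p w + b' p w) p F = pairing i b p F + pairing i b' p F"
 using pairing_integrable[OF assms(1,3,4), of i] pairing_integrable[OF assms(2,3,4), of i]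
 unfolding pairing_def by (subst Bochner_Integration.integral_add[symmetric]) (auto simp: algebra_simps)

lemma pairing_cmult: "pairing i (%p w. a * b p w) p F = a * pairing i b p F"
 unfolding pairing_def by (subst integral_mult_right_zero[symmetric]) (simp add: mult_ac)

lemma pairing_fun_add:
 assumes "symbol A R m b" "p \<in> A" "continuous_on UNIV F" "continuous_on UNIV G"
 shows "pairing i b p (%s. F s + a * G s) = pairing i b p F + a * pairing i b p G"
 using pairing_integrable[OF assms(1-3), of i] pairing_integrable[OF assms(1,2,4), of i]
 unfolding pairing_def by (subst integral_mult_right_zero[symmetric], subst Bochner_Integration.integral_add[symmetric])
   (auto simp: algebra_simps)

lemma pairing_bound:
 assumes b: "symbol A R m b"
 obtains C where "C \<ge> 0" "\<And>p F. p \<in> A ==> continuous_on UNIV F ==> (\<And>s. F s \<ge> 0) ==>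
  \<bar>pairing M b p F\<bar> \<le> C * pairing M (%_ _. 1) p F"
proof -
 obtain C where C: "C \<ge> 0" "\<And>p w. p \<in> A ==> w \<in> punctured R ==> \<bar>b p w\<bar> \<le> C" using symbol_bound[OF b] by metis
 show ?thesis
 proof
  show "C \<ge> 0" by fact
  fix p and F :: "real => real" assume p: "p \<in> A" and F: "continuous_on UNIV F" "\<And>s. F s \<ge> 0"
  have "\<bar>pairing M b p F\<bar> \<le> (LBINT w. \<bar>indicator (punctured R) w * (weight M M (T p) w * b p w * F (dst p w))\<bar>)"
   unfolding pairing_def by (rule integral_abs_bound)
  also have "... \<le> (LBINT w. C * (indicator (punctured R) w * (weight M M (T p) w * 1 * F (dst p w))))"
  proof (intro integral_mono integrable_abs integrable_mult_right)
   show "integrable lborel (%w. indicator (punctured R) w * (weight M M (T p) w * b p w * F (dst p w)))"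
    by (rule pairing_integrable[OF b p F(1)])
   show "integrable lborel (%w. indicator (punctured R) w * (weight M M (T p) w * 1 * F (dst p w)))"
    by (rule pairing_integrable[OF symbol_const[where m = 0] p F(1)])
   fix w :: 'k
   show "\<bar>indicator (punctured R) w * (weight M M (T p) w * b p w * F (dst p w))\<bar> \<le>
     C * (indicator (punctured R) w * (weight M M (T p) w * 1 * F (dst p w)))"
   proof (cases "w \<in> punctured R")
    case True
    have "\<bar>b p w\<bar> * (weight M M (T p) w * F (dst p w)) \<le> C * (weight M M (T p) w * F (dst p w))"
     using C(2)[OF p True] F(2) weight_nonneg[OF T[OF p]] by (intro mult_right_mono mult_nonneg_nonneg)
    then show ?thesis using True F(2) by (simp add: abs_mult abs_of_nonneg[OF weight_nonneg[OF T[OF p]]] mult_ac)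
   qed simp
  qed
  also have "... = C * pairing M (%_ _. 1) p F" unfolding pairing_def by simp
  finally show "\<bar>pairing M b p F\<bar> \<le> C * pairing M (%_ _. 1) p F" .
 qed
qed

context
 fixes H :: "(real^'n^'n::finite) measure"
 assumes H: "haar_SO H" and n: "CARD('n) \<ge> 2"
begin

text \<open>By the heat equation in polar coordinates a time derivative costs two integrations by parts
 and a factor \<open>\<parallel>w\<parallel>\<^sup>-\<^sup>2\<close>, which lowers the power of \<open>\<parallel>w\<parallel>\<close> in the weight by two.\<close>

lemma pairing_heat_step:
 assumes b: "symbol A R (Suc (Suc m)) b" and van: "vanishing A R r b" and i: "i < M"
 obtains b' where "symbol A R m b'" "vanishing A R r b'"
  "\<And>p z s. p \<in> A ==> s > 0 ==> pairing i b p (rotheat_s H z s) = pairing (Suc i) b' p (rotheat H z s)"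
proof -
 define b0 where "b0 p w = b p w * (1 / e p w)" for p w
 have b0: "symbol A R (Suc (Suc m)) b0"
  unfolding b0_def[abs_def] by (intro symbol_mult b symbol_inverse[OF c e])
 have van0: "vanishing A R r b0" using van by (auto simp: vanishing_def b0_def)
 obtain b1 where b1: "symbol A R (Suc m) b1" "vanishing A R r b1"
  "\<And>p F F1. p \<in> A ==> continuous_on UNIV F ==> continuous_on UNIV F1 ==>
   (\<And>s. s > 0 ==> (F has_real_derivative F1 s / s) (at s)) ==> pairing (Suc i) b0 p F1 = pairing (Suc i) b1 p F"
  using pairing_by_parts[OF b0 van0, of "Suc i"] by metis
 define b2 where "b2 p w = b1 p w + (real CARD('n) - 2) * b0 p w" for p w
 have b2: "symbol A R (Suc m) b2" unfolding b2_def[abs_def] by (intro symbol_add symbol_cmult b1 symbol_Suc[OF b0])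
 have van2: "vanishing A R r b2" using b1(2) van0 by (auto simp: vanishing_def b2_def)
 obtain b' where b': "symbol A R m b'" "vanishing A R r b'"
  "\<And>p F F1. p \<in> A ==> continuous_on UNIV F ==> continuous_on UNIV F1 ==>
   (\<And>s. s > 0 ==> (F has_real_derivative F1 s / s) (at s)) ==> pairing (Suc i) b2 p F1 = pairing (Suc i) b' p F"
  using pairing_by_parts[OF b2 van2, of "Suc i"] by metis
 show ?thesis
 proof (rule that[OF b'(1,2)])
  fix p z and s :: real assume p: "p \<in> A" and s: "s > 0"
  let ?F = "rotheat H z s" and ?F1 = "rotheat_r H z s" and ?n = "real CARD('n) - 2"
  let ?F2 = "%x. x\<^sup>2 * rotheat_s H z s x - ?n * ?F1 x"
  have cF: "continuous_on UNIV ?F" "continuous_on UNIV ?F1" by (rule rotheat_continuous[OF H])+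
  have cF2: "continuous_on UNIV ?F2"
   by (intro continuous_intros cF rotheat_s_continuous[OF H])
  have "pairing i b p (rotheat_s H z s) = pairing (Suc i) b0 p (%x. ?F2 x + ?n * ?F1 x)"
   unfolding pairing_def
  proof (rule Bochner_Integration.integral_cong[OF refl])
   fix w :: 'k
   show "indicator (punctured R) w * (weight M i (T p) w * b p w * rotheat_s H z s (dst p w)) =
    indicator (punctured R) w * (weight M (Suc i) (T p) w * b0 p w * (?F2 (dst p w) + ?n * ?F1 (dst p w)))"
   proof (cases "w \<in> punctured R")
    case True
    have e0: "e p w > 0" using e(2)[OF p True] c by linarith
    have "weight M i (T p) w = weight M (Suc i) (T p) w * (w \<bullet> w)"
     using i by (simp add: weight_def Suc_diff_Suc[symmetric])
    then have "weight M (Suc i) (T p) w * ((dst p w)\<^sup>2 * (1 / e p w)) = weight M i (T p) w"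
     using dst_sq[OF p True] e0 by simp
    from arg_cong[OF this, of "%a. a * b p w * rotheat_s H z s (dst p w)"] have "weight M i (T p) w * b p w * rotheat_s H z s (dst p w) =
      weight M (Suc i) (T p) w * b0 p w * ((dst p w)\<^sup>2 * rotheat_s H z s (dst p w))"
     unfolding b0_def by (simp only: mult_ac)
    then show ?thesis by simp
   qed simp
  qed
  also have "... = pairing (Suc i) b0 p ?F2 + ?n * pairing (Suc i) b0 p ?F1"
   by (rule pairing_fun_add[OF b0 p cF2 cF(2)])
  also have "pairing (Suc i) b0 p ?F2 = pairing (Suc i) b1 p ?F1"
   by (rule b1(3)[OF p cF(2) cF2 rotheat_equation[OF H n s]])
  also have "pairing (Suc i) b1 p ?F1 + ?n * pairing (Suc i) b0 p ?F1 = pairing (Suc i) b2 p ?F1"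
   unfolding b2_def pairing_cmult[symmetric]
   by (rule pairing_add[OF b1(1) symbol_cmult[OF symbol_Suc[OF b0]] p cF(2), symmetric])
  also have "... = pairing (Suc i) b' p ?F"
   by (rule b'(3)[OF p cF rotheat_derivative_r[OF H s]])
  finally show "pairing i b p (rotheat_s H z s) = pairing (Suc i) b' p (rotheat H z s)" .
 qed
qed

lemma pairing_heat_derivative:
 assumes b: "symbol A R m b" and p: "p \<in> A" and s: "s > 0"
 shows "((%s. pairing i b p (rotheat H z s)) has_real_derivative pairing i b p (rotheat_s H z s)) (at s)"
 unfolding pairing_def
proof -
 obtain B where B: "\<forall>w\<in>punctured R. \<bar>weight M i (T p) w * b p w * 1\<bar> \<le> B"
  using pairing_integrand(2)[OF b p, of "%_. 1" i] by auto
 obtain B' where B': "\<forall>s\<in>{s / 2..2 * s}. \<forall>r\<in>{0..Rd}. \<bar>rotheat_s H z s r\<bar> \<le> B'"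
  using rotheat_s_bounded[OF H, of "s / 2" "2 * s" Rd z] s by auto
 show "((%s. LINT w|lborel. indicator (punctured R) w * (weight M i (T p) w * b p w * rotheat H z s (dst p w))) has_real_derivative
   (LBINT w. indicator (punctured R) w * (weight M i (T p) w * b p w * rotheat_s H z s (dst p w)))) (at s)"
 proof (rule has_real_derivative_integral[where \<delta> = "s / 2" and g = "%w. indicator (punctured R) w * (B * B')"])
  show "s / 2 > 0" using s by simp
  show "integrable lborel (%w::'k. indicator (punctured R) w * (B * B'))"
   by (intro integrable_punctured) auto
  show "(%w. indicator (punctured R) w * (weight M i (T p) w * b p w * rotheat_s H z s (dst p w))) \<in> borel_measurable lborel"
   using pairing_integrable[OF b p rotheat_s_continuous[OF H]] by (rule borel_measurable_integrable)
  fix s' :: real assume s': "\<bar>s' - s\<bar> < s / 2"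
  show "integrable lborel (%w. indicator (punctured R) w * (weight M i (T p) w * b p w * rotheat H z s' (dst p w)))"
   by (rule pairing_integrable[OF b p rotheat_continuous(1)[OF H]])
  fix w :: 'k
  have s'0: "s' > 0" using s' by linarith
  show "((%s. indicator (punctured R) w * (weight M i (T p) w * b p w * rotheat H z s (dst p w))) has_real_derivative
    indicator (punctured R) w * (weight M i (T p) w * b p w * rotheat_s H z s' (dst p w))) (at s')"
   by (intro DERIV_cmult rotheat_derivative_s[OF H s'0])
  show "\<bar>indicator (punctured R) w * (weight M i (T p) w * b p w * rotheat_s H z s' (dst p w))\<bar> \<le> indicator (punctured R) w * (B * B')"
  proof (cases "w \<in> punctured R")
   case True
   have "\<bar>rotheat_s H z s' (dst p w)\<bar> \<le> B'"
   proof -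
    have "s' \<in> {s / 2..2 * s}" "dst p w \<in> {0..Rd}" using s' dst_bounds[OF p True] by (auto simp: abs_if split: if_splits)
    then show ?thesis using B' by blast
   qed
   moreover have "\<bar>weight M i (T p) w * b p w\<bar> \<le> B" using B True by simp
   ultimately have "\<bar>weight M i (T p) w * b p w\<bar> * \<bar>rotheat_s H z s' (dst p w)\<bar> \<le> B * B'"
    by (intro mult_mono) (auto intro: order_trans[OF abs_ge_zero])
   then show ?thesis using True by (simp add: abs_mult)
  qed simp
 qed
qed

text \<open>Starting from the weight of index \<open>i\<close>, after \<open>j\<close> time derivatives the index is \<open>M\<close>, where the weight
 is \<open>1 / (\<parallel>w\<parallel>\<^sup>2\<^sup>M + t\<^sup>M)\<close>.\<close>

lemma pairing_heat_chain:
 assumes "i + j = M" "symbol A R (2 * j) b" "vanishing A R r b"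
 shows "\<exists>f C. C \<ge> 0 \<and> f 0 = (%p z s. pairing i b p (rotheat H z s)) \<and>
  (\<forall>l<j. \<forall>p\<in>A. \<forall>z. \<forall>s>0. (f l p z has_real_derivative f (Suc l) p z s) (at s)) \<and>
  (\<forall>p\<in>A. \<forall>z. \<forall>s>0. \<bar>f j p z s\<bar> \<le> C * pairing M (%_ _. 1) p (rotheat H z s))"
 using assms
proof (induction j arbitrary: i b)
 case 0
 obtain C where C: "C \<ge> 0" "\<And>p F. p \<in> A ==> continuous_on UNIV F ==> (\<And>s. F s \<ge> 0) ==>
  \<bar>pairing M b p F\<bar> \<le> C * pairing M (%_ _. 1) p F" using pairing_bound[OF 0(2)] by metis
 show ?case
  by (rule exI[of _ "%_ p z s. pairing i b p (rotheat H z s)"], rule exI[of _ C])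
    (use C 0 rotheat_continuous(1)[OF H] rotheat_nonneg[OF H] in auto)
next
 case (Suc j)
 have i: "i < M" and i': "Suc i + j = M" using Suc.prems(1) by auto
 have b: "symbol A R (Suc (Suc (2 * j))) b" using Suc.prems(2) by simp
 obtain b' where b': "symbol A R (2 * j) b'" "vanishing A R r b'"
  "\<And>p z s. p \<in> A ==> s > 0 ==> pairing i b p (rotheat_s H z s) = pairing (Suc i) b' p (rotheat H z s)"
  using pairing_heat_step[OF b Suc.prems(3) i] by metis
 obtain f C where f: "C \<ge> 0" "f 0 = (%p z s. pairing (Suc i) b' p (rotheat H z s))"
  "\<forall>l<j. \<forall>p\<in>A. \<forall>z. \<forall>s>0. (f l p z has_real_derivative f (Suc l) p z s) (at s)"
  "\<forall>p\<in>A. \<forall>z. \<forall>s>0. \<bar>f j p z s\<bar> \<le> C * pairing M (%_ _. 1) p (rotheat H z s)"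
  using Suc.IH[OF i' b'(1,2)] by blast
 define g where "g l = (case l of 0 => (%p z s. pairing i b p (rotheat H z s)) | Suc l => f l)" for l
 have "(g l p z has_real_derivative g (Suc l) p z s) (at s)" if "l < Suc j" "p \<in> A" "s > 0" for l p z s
 proof (cases l)
  case 0
  then show ?thesis
   using pairing_heat_derivative[OF Suc.prems(2) that(2,3), of i z] b'(3)[OF that(2,3), of z] f(2) by (simp add: g_def)
 next
  case (Suc l')
  then show ?thesis using that f(3) by (simp add: g_def)
 qed
 then show ?case
  by (intro exI[of _ g] exI[of _ C]) (use f in \<open>auto simp: g_def\<close>)
qed

text \<open>The cutoff splits the integral. For \<open>\<parallel>w\<parallel> > \<surd>t\<close> the chain of derivatives bounds the finite difference;
 the remaining part is itself \<open>t\<^sup>M\<close> times a pairing with the last weight, and its finite difference is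
 bounded term by term. The common bound is stated at the time \<open>(M + 1) i t\<close>, to which all the times
 that occur are comparable.\<close>

lemma cancellation_pointwise:
 assumes b: "symbol A R (2 * M) b" and van: "vanishing A R r b"
 obtains C where "C \<ge> 0" "\<And>p z i. p \<in> A ==> i \<ge> (1::nat) ==>
  \<bar>fdiff M (%s. LINT w|lborel. indicator (punctured R) w * (b p w * rotheat H z s (dst p w))) (T p) (real i * T p)\<bar>
   \<le> C * (T p ^ M * pairing M (%_ _. 1) p (rotheat H z (real (M + 1) * (real i * T p))))"
proof -
 obtain f C where f: "C \<ge> 0" "f 0 = (%p z s. pairing 0 b p (rotheat H z s))"
  "\<forall>l<M. \<forall>p\<in>A. \<forall>z. \<forall>s>0. (f l p z has_real_derivative f (Suc l) p z s) (at s)"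
  "\<forall>p\<in>A. \<forall>z. \<forall>s>0. \<bar>f M p z s\<bar> \<le> C * pairing M (%_ _. 1) p (rotheat H z s)"
  using pairing_heat_chain[of 0 M b] b van by auto
 obtain C' where C': "C' \<ge> 0" "\<And>p F. p \<in> A ==> continuous_on UNIV F ==> (\<And>s. F s \<ge> 0) ==>
  \<bar>pairing M b p F\<bar> \<le> C' * pairing M (%_ _. 1) p F" using pairing_bound[OF b] by metis
 define Q where "Q = real (M + 1) powr (real CARD('n) / 2)"
 have Q0: "Q \<ge> 0" by (simp add: Q_def)
 show ?thesis
 proof (rule that[of "(C + 2 ^ M * C') * Q"])
  show "(C + 2 ^ M * C') * Q \<ge> 0" using f(1) C'(1) Q0 by (intro mult_nonneg_nonneg add_nonneg_nonneg) auto
  fix p z and i :: nat assume p: "p \<in> A" and i: "i \<ge> 1"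
  let ?t = "T p" and ?s0 = "real i * T p"
  have t: "?t > 0" by (rule T[OF p])
  have s0: "?s0 > 0" "?t \<le> ?s0" using t i by (auto intro: mult_right_mono[of 1 "real i" ?t, simplified])
  let ?P = "pairing M (%_ _. 1) p (rotheat H z (real (M + 1) * ?s0))"
  have P: "pairing M (%_ _. 1) p (rotheat H z s) \<le> Q * ?P" if s: "?s0 \<le> s" "s \<le> ?s0 + real M * ?t" for s
  proof -
   have "s \<le> real (M + 1) * ?s0" using s mult_left_mono[OF s0(2), of "real M"] by (simp add: algebra_simps)
   note le = rotheat_le[OF H n s0(1) s(1) this]
   have int: "integrable lborel (%w. indicator (punctured R) w * (weight M M ?t w * 1 * rotheat H z s (dst p w)))" for s
    by (rule pairing_integrable[OF symbol_const[where m = 0] p rotheat_continuous(1)[OF H]])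
   have "pairing M (%_ _. 1) p (rotheat H z s) \<le> (LBINT w. Q * (indicator (punctured R) w * (weight M M ?t w * 1 * rotheat H z (real (M + 1) * ?s0) (dst p w))))"
    unfolding pairing_def
   proof (intro integral_mono integrable_mult_right int)
    fix w :: 'k
    show "indicator (punctured R) w * (weight M M ?t w * 1 * rotheat H z s (dst p w)) \<le>
      Q * (indicator (punctured R) w * (weight M M ?t w * 1 * rotheat H z (real (M + 1) * ?s0) (dst p w)))"
    proof (cases "w \<in> punctured R")
     case True
     have "weight M M ?t w * rotheat H z s (dst p w) \<le> weight M M ?t w * (Q * rotheat H z (real (M + 1) * ?s0) (dst p w))"
      unfolding Q_def using dst_bounds[OF p True] by (intro mult_left_mono le weight_nonneg t) auto
     then show ?thesis using True by (simp add: mult_ac)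
    qed simp
   qed
   then show ?thesis unfolding pairing_def by simp
  qed
  have split: "(LBINT w. indicator (punctured R) w * (b p w * rotheat H z s (dst p w))) =
    f 0 p z s + ?t ^ M * pairing M b p (rotheat H z s)" for s
  proof -
   have one: "weight M 0 ?t w + ?t ^ M * weight M M ?t w = 1" for w :: 'k
    using weight_denominator[OF t, of w M] by (simp add: weight_def add_divide_distrib[symmetric])
   have "(LBINT w. indicator (punctured R) w * (b p w * rotheat H z s (dst p w))) =
     (LBINT w. indicator (punctured R) w * (weight M 0 ?t w * b p w * rotheat H z s (dst p w)) +
      ?t ^ M * (indicator (punctured R) w * (weight M M ?t w * b p w * rotheat H z s (dst p w))))"
   proof (rule Bochner_Integration.integral_cong[OF refl])
    fix w :: 'k
    have "indicator (punctured R) w * (b p w * rotheat H z s (dst p w)) =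
      (weight M 0 ?t w + ?t ^ M * weight M M ?t w) * (indicator (punctured R) w * (b p w * rotheat H z s (dst p w)))"
     unfolding one by simp
    then show "indicator (punctured R) w * (b p w * rotheat H z s (dst p w)) =
     indicator (punctured R) w * (weight M 0 ?t w * b p w * rotheat H z s (dst p w)) +
      ?t ^ M * (indicator (punctured R) w * (weight M M ?t w * b p w * rotheat H z s (dst p w)))"
     by (simp add: algebra_simps)
   qed
   then show ?thesis
    unfolding f(2) pairing_def
    using pairing_integrable[OF b p rotheat_continuous(1)[OF H], of 0 z s] pairing_integrable[OF b p rotheat_continuous(1)[OF H], of M z s]
    by simp
  qed
  have "\<bar>fdiff M (f 0 p z) ?t ?s0\<bar> \<le> ?t ^ M * (C * (Q * ?P))"
  proof (rule fdiff_abs_le[of ?t M "%l. f l p z"])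
   show "((f l p z) has_real_derivative f (Suc l) p z s) (at s)" if "l < M" "s > 0" for l s using f(3) that p by auto
   show "\<bar>f M p z s\<bar> \<le> C * (Q * ?P)" if "?s0 \<le> s" "s \<le> ?s0 + real M * ?t" for s
   proof -
    have "s > 0" using that s0 by linarith
    then have "\<bar>f M p z s\<bar> \<le> C * pairing M (%_ _. 1) p (rotheat H z s)" using f(4) p by auto
    also have "... \<le> C * (Q * ?P)" using f(1) by (intro mult_left_mono P that)
    finally show ?thesis .
   qed
  qed (use t s0 in auto)
  moreover have "\<bar>fdiff M (%s. pairing M b p (rotheat H z s)) ?t ?s0\<bar> \<le> 2 ^ M * (C' * (Q * ?P))"
  proof (rule fdiff_abs_le_sup[OF _ t])
   fix s assume s: "?s0 \<le> s" "s \<le> ?s0 + real M * ?t"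
   have "\<bar>pairing M b p (rotheat H z s)\<bar> \<le> C' * pairing M (%_ _. 1) p (rotheat H z s)"
    by (intro C'(2) p rotheat_continuous(1)[OF H] rotheat_nonneg[OF H])
   also have "... \<le> C' * (Q * ?P)" using C'(1) by (intro mult_left_mono P s)
   finally show "\<bar>pairing M b p (rotheat H z s)\<bar> \<le> C' * (Q * ?P)" .
  qed
  ultimately have "\<bar>fdiff M (f 0 p z) ?t ?s0\<bar> + ?t ^ M * \<bar>fdiff M (%s. pairing M b p (rotheat H z s)) ?t ?s0\<bar> \<le>
    ?t ^ M * (C * (Q * ?P)) + ?t ^ M * (2 ^ M * (C' * (Q * ?P)))"
   using t by (intro add_mono mult_left_mono) auto
  moreover have "fdiff M (%s. LINT w|lborel. indicator (punctured R) w * (b p w * rotheat H z s (dst p w))) ?t ?s0 =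
    fdiff M (f 0 p z) ?t ?s0 + ?t ^ M * fdiff M (%s. pairing M b p (rotheat H z s)) ?t ?s0"
   unfolding split fdiff_add fdiff_cmult ..
  moreover have "\<bar>fdiff M (f 0 p z) ?t ?s0 + ?t ^ M * fdiff M (%s. pairing M b p (rotheat H z s)) ?t ?s0\<bar> \<le>
    \<bar>fdiff M (f 0 p z) ?t ?s0\<bar> + ?t ^ M * \<bar>fdiff M (%s. pairing M b p (rotheat H z s)) ?t ?s0\<bar>"
   using t abs_triangle_ineq[of "fdiff M (f 0 p z) ?t ?s0" "?t ^ M * fdiff M (%s. pairing M b p (rotheat H z s)) ?t ?s0"]
   by (simp add: abs_mult)
  ultimately show "\<bar>fdiff M (%s. LINT w|lborel. indicator (punctured R) w * (b p w * rotheat H z s (dst p w))) ?t ?s0\<bar>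
    \<le> (C + 2 ^ M * C') * Q * (?t ^ M * ?P)"
   by (simp add: algebra_simps)
 qed
qed

end

end

section \<open>Smooth maps\<close>

lemma Cm_on_cong:
 assumes U: "open U"
 shows "Cm_on m f U ==> (\<And>x. x \<in> U ==> f x = g x) ==> Cm_on m g U"
proof (induction m arbitrary: f g)
 case 0 then show ?case by (simp cong: continuous_on_cong)
next
 case (Suc m)
 have d: "(g has_derivative frechet_derivative f (at x)) (at x)" if x: "x \<in> U" for x
 proof (rule has_derivative_transform_within_open[OF _ U x])
  show "(f has_derivative frechet_derivative f (at x)) (at x)"
   using Suc.prems(1) x by (auto simp: frechet_derivative_works[symmetric])
 qed (use Suc.prems(2) in auto)
 have eq: "frechet_derivative f (at x) = frechet_derivative g (at x)" if "x \<in> U" for x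
  using frechet_derivative_at[OF d[OF that]] .
 show ?case
 proof (simp, intro conjI ballI allI)
  show "g differentiable at x" if "x \<in> U" for x using d[OF that] by (auto simp: differentiable_def)
  show "Cm_on m (%x. frechet_derivative g (at x) v) U" for v
   by (rule Suc.IH[of "%x. frechet_derivative f (at x) v"]) (use Suc.prems(1) eq in auto)
 qed
qed

lemma Cm_on_continuous: "Cm_on m f U ==> continuous_on U f"
 by (cases m) (simp_all add: differentiable_imp_continuous_on differentiable_at_imp_differentiable_on)

lemma Cm_on_component:
 fixes f :: "'a::euclidean_space => real^'n::finite"
 assumes U: "open U"
 shows "Cm_on m f U ==> Cm_on m (%x. f x $ i) U"
proof (induction m arbitrary: f)
 case 0 then show ?case by (auto intro: continuous_on_component)
next
 case (Suc m)
 have d: "((%x. f x $ i) has_derivative (%v. frechet_derivative f (at x) v $ i)) (at x)" if "x \<in> U" for x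
  using Suc.prems that by (intro bounded_linear.has_derivative[OF bounded_linear_vec_nth]) (auto simp: frechet_derivative_works[symmetric])
 have eq: "(%v. frechet_derivative f (at x) v $ i) = frechet_derivative (%x. f x $ i) (at x)" if "x \<in> U" for x
  using frechet_derivative_at[OF d[OF that]] .
 show ?case
 proof (simp, intro conjI ballI allI)
  show "(%x. f x $ i) differentiable at x" if "x \<in> U" for x using d[OF that] by (auto simp: differentiable_def)
  fix v
  have "Cm_on m (%x. frechet_derivative f (at x) v $ i) U"
   using Suc.prems by (intro Suc.IH) auto
  then show "Cm_on m (%x. frechet_derivative (%x. f x $ i) (at x) v) U"
   by (rule Cm_on_cong[OF U]) (use eq in \<open>auto simp: fun_eq_iff\<close>)
 qed
qed

text \<open>Base points near the center of a patch, with a positive time. For steps \<open>w\<close> shorter than \<open>3 r\<close> the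
 end point stays within the ball of radius \<open>4 r\<close>.\<close>

definition params :: "'k::euclidean_space => real => ('k \<times> real) set" where
 "params u0 r = {p. fst p \<in> ball u0 r \<and> snd p > 0}"

lemma params_shift:
 "p \<in> params u0 r ==> w \<in> punctured (3 * r) ==> fst p + w \<in> ball u0 (4 * r)"
 "p \<in> params u0 r ==> fst p \<in> ball u0 (4 * r)"
proof -
 assume p: "p \<in> params u0 r"
 then have u: "norm (u0 - fst p) < r" by (auto simp: params_def dist_norm)
 then have "r > 0" using norm_ge_zero[of "u0 - fst p"] by linarith
 then show "fst p \<in> ball u0 (4 * r)" using u by (simp add: dist_norm)
 assume w: "w \<in> punctured (3 * r)"
 have "norm (u0 - (fst p + w)) \<le> norm (u0 - fst p) + norm w"
  using norm_triangle_ineq4[of "u0 - fst p" w] by (simp add: algebra_simps)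
 then show "fst p + w \<in> ball u0 (4 * r)" using u w by (auto simp: dist_norm punctured_def)
qed

context
 fixes U :: "'k::euclidean_space set" and u0 :: 'k and r :: real
 assumes U: "open U" "cball u0 (4 * r) \<subseteq> U"
begin

lemma shift_in: "p \<in> params u0 r ==> w \<in> punctured (3 * r) ==> fst p + w \<in> U"
 using params_shift(1)[of p u0 r w] U(2) ball_subset_cball[of u0 "4 * r"] by blast


lemma shift_ray_deriv:
 fixes f :: "'k => real"
 assumes f: "\<forall>x\<in>U. f differentiable at x" and p: "p \<in> params u0 r"
 shows "ray_deriv (3 * r) (%w. f (fst p + w)) (%w. \<Sum>b\<in>Basis. (w \<bullet> b) * frechet_derivative f (at (fst p + w)) b)"
 unfolding ray_deriv_def
proof
 fix w :: 'k assume w: "w \<in> punctured (3 * r)"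
 let ?D = "frechet_derivative f (at (fst p + w))"
 have fd: "(f has_derivative ?D) (at (fst p + exp 0 *\<^sub>R w))"
  using f shift_in[OF p w] by (simp add: frechet_derivative_works[symmetric])
 have gd: "((%y::real. fst p + exp y *\<^sub>R w) has_derivative (%h. h *\<^sub>R w)) (at 0)"
  by (auto intro!: derivative_eq_intros)
 have comp: "((%y. f (fst p + exp y *\<^sub>R w)) has_derivative (%h. ?D (h *\<^sub>R w))) (at 0)"
  by (rule has_derivative_compose[OF gd fd])
 have lin: "linear ?D" using has_derivative_linear[OF fd] .
 moreover have "?D w = (\<Sum>b\<in>Basis. (w \<bullet> b) * ?D b)"
 proof -
  have "?D w = ?D (\<Sum>b\<in>Basis. (w \<bullet> b) *\<^sub>R b)" by (simp add: euclidean_representation)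
  also have "... = (\<Sum>b\<in>Basis. (w \<bullet> b) * ?D b)" by (simp add: linear_sum[OF lin] linear_scale[OF lin])
  finally show ?thesis .
 qed
 ultimately have "(%h. ?D (h *\<^sub>R w)) = (*) (\<Sum>b\<in>Basis. (w \<bullet> b) * ?D b)" by (simp add: fun_eq_iff linear_scale)
 then show "((%y. f (fst p + exp y *\<^sub>R w)) has_real_derivative (\<Sum>b\<in>Basis. (w \<bullet> b) * ?D b)) (at 0)"
  using comp by (simp add: has_field_derivative_def)
qed

lemma bounded_on_cball:
 fixes f :: "'k => real"
 assumes "continuous_on U f"
 obtains B where "B \<ge> 0" "\<And>x. x \<in> cball u0 (4 * r) ==> \<bar>f x\<bar> \<le> B"
proof -
 have "compact (f ` cball u0 (4 * r))"
  using assms U(2) by (intro compact_continuous_image) (auto intro: continuous_on_subset)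
 from compact_imp_bounded[OF this] obtain B where "\<forall>x\<in>f ` cball u0 (4 * r). norm x \<le> B" by (auto simp: bounded_iff)
 then show ?thesis by (intro that[of "max 0 B"]) (auto simp: le_max_iff_disj)
qed

lemma symbol_shift:
 fixes f :: "'k => real"
 shows "Cm_on m f U ==> symbol (params u0 r) (3 * r) m (%p w. f (fst p + w))"
proof (induction m arbitrary: f)
 have b: "bounded_family (params u0 r) (3 * r) (%p w. f (fst p + w))" if cf: "continuous_on U f" for f :: "'k => real"
 proof -
  obtain B where B: "\<And>x. x \<in> cball u0 (4 * r) ==> \<bar>f x\<bar> \<le> B" using bounded_on_cball[OF cf] by metis
  show ?thesis unfolding bounded_family_def
  proof (intro conjI ballI exI[of _ B])
   fix p assume p: "p \<in> params u0 r"
   show "continuous_on (punctured (3 * r)) (%w. f (fst p + w))"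
    by (rule continuous_on_compose2[OF cf]) (auto intro!: continuous_intros shift_in[OF p])
   show "\<bar>f (fst p + w)\<bar> \<le> B" if "w \<in> punctured (3 * r)" for w
    using B params_shift(1)[OF p that] by (auto dest: subsetD[OF ball_subset_cball])
  qed
 qed
 {
  case 0 then show ?case using b by simp
 next
  case (Suc m)
  show ?case
  proof (rule symbol_SucI)
   show "bounded_family (params u0 r) (3 * r) (%p w. f (fst p + w))" using b Cm_on_continuous[OF Suc.prems] .
   show "ray_deriv (3 * r) (%w. f (fst p + w)) (%w. \<Sum>b\<in>Basis. (w \<bullet> b) * frechet_derivative f (at (fst p + w)) b)" if "p \<in> params u0 r" for p
    using Suc.prems that by (intro shift_ray_deriv) auto
   show "symbol (params u0 r) (3 * r) m (%p w. \<Sum>b\<in>Basis. (w \<bullet> b) * frechet_derivative f (at (fst p + w)) b)"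
    using Suc.prems by (intro symbol_sum symbol_mult symbol_inner Suc.IH) auto
  qed
 }
qed

lemma shift_lipschitz:
 fixes f :: "'k => real"
 assumes f: "Cm_on (Suc 0) f U"
 obtains B where "B \<ge> 0" "\<And>x y. x \<in> cball u0 (4 * r) ==> y \<in> cball u0 (4 * r) ==> \<bar>f x - f y\<bar> \<le> B * norm (x - y)"
proof -
 have "\<forall>b. \<exists>B\<ge>0. \<forall>x\<in>cball u0 (4 * r). \<bar>frechet_derivative f (at x) b\<bar> \<le> B"
  using f bounded_on_cball by (metis Cm_on.simps(1) Cm_on.simps(2))
 then obtain B where B: "\<And>b. B b \<ge> 0" "\<And>b x. x \<in> cball u0 (4 * r) ==> \<bar>frechet_derivative f (at x) b\<bar> \<le> B b" by metis
 let ?B = "\<Sum>b\<in>Basis. B b"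
 show ?thesis
 proof (rule that[of ?B])
  show "?B \<ge> 0" using B by (intro sum_nonneg) auto
  fix x y assume xy: "x \<in> cball u0 (4 * r)" "y \<in> cball u0 (4 * r)"
  have "norm (f x - f y) \<le> ?B * norm (x - y)"
  proof (rule differentiable_bound[of "cball u0 (4 * r)" f "%x. frechet_derivative f (at x)"])
   show "convex (cball u0 (4 * r))" by (rule convex_cball)
   fix z assume z: "z \<in> cball u0 (4 * r)"
   have d: "(f has_derivative frechet_derivative f (at z)) (at z)"
    using f z U(2) by (auto simp: frechet_derivative_works[symmetric])
   then show "(f has_derivative frechet_derivative f (at z)) (at z within cball u0 (4 * r))" by (rule has_derivative_at_withinI)
   have lin: "linear (frechet_derivative f (at z))" using has_derivative_linear[OF d] .
   show "onorm (frechet_derivative f (at z)) \<le> ?B"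
   proof (rule onorm_le)
    fix v
    have "frechet_derivative f (at z) v = frechet_derivative f (at z) (\<Sum>b\<in>Basis. (v \<bullet> b) *\<^sub>R b)" by (simp add: euclidean_representation)
    also have "... = (\<Sum>b\<in>Basis. (v \<bullet> b) * frechet_derivative f (at z) b)" by (simp add: linear_sum[OF lin] linear_scale[OF lin])
    also have "norm ... \<le> (\<Sum>b\<in>Basis. norm v * B b)"
    proof (rule sum_norm_le)
     fix b :: 'k assume b: "b \<in> Basis"
     show "norm ((v \<bullet> b) * frechet_derivative f (at z) b) \<le> norm v * B b"
      using Basis_le_norm[OF b, of v] B(2)[OF z, of b] by (auto simp: abs_mult intro!: mult_mono)
    qed
    finally show "norm (frechet_derivative f (at z) v) \<le> ?B * norm v" by (simp add: sum_distrib_left mult.commute)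
   qed
  qed (use xy in auto)
  then show "\<bar>f x - f y\<bar> \<le> ?B * norm (x - y)" by simp
 qed
qed

lemma quotient_ray_deriv:
 fixes f :: "'k => real"
 assumes f: "\<forall>x\<in>U. f differentiable at x" and p: "p \<in> params u0 r"
 shows "ray_deriv (3 * r) (%w. (f (fst p + w) - f (fst p)) / norm w)
   (%w. (- 1) * ((f (fst p + w) - f (fst p)) / norm w) + (\<Sum>b\<in>Basis. ((w \<bullet> b) / norm w) * frechet_derivative f (at (fst p + w)) b))"
 unfolding ray_deriv_def
proof
 fix w :: 'k assume w: "w \<in> punctured (3 * r)"
 then have w0: "norm w \<noteq> 0" by (simp add: punctured_def)
 let ?S = "\<Sum>b\<in>Basis. (w \<bullet> b) * frechet_derivative f (at (fst p + w)) b"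
 have d: "((%y. f (fst p + exp y *\<^sub>R w)) has_real_derivative ?S) (at 0)"
  using shift_ray_deriv[OF f p] w by (simp add: ray_deriv_def)
 have "((%y. (f (fst p + exp y *\<^sub>R w) - f (fst p)) / (exp y * norm w)) has_real_derivative
   ((?S - 0) * (exp 0 * norm w) - (f (fst p + exp 0 *\<^sub>R w) - f (fst p)) * (exp 0 * norm w)) / ((exp 0 * norm w) * (exp 0 * norm w))) (at 0)"
  using w0 by (intro DERIV_divide DERIV_diff d DERIV_const DERIV_cmult_right DERIV_exp) auto
 moreover have "((?S - 0) * (exp 0 * norm w) - (f (fst p + exp 0 *\<^sub>R w) - f (fst p)) * (exp 0 * norm w)) / ((exp 0 * norm w) * (exp 0 * norm w)) =
   (- 1) * ((f (fst p + w) - f (fst p)) / norm w) + ?S / norm w"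
  using w0 by (simp add: field_simps)
 moreover have "?S / norm w = (\<Sum>b\<in>Basis. ((w \<bullet> b) / norm w) * frechet_derivative f (at (fst p + w)) b)"
  by (simp add: sum_divide_distrib)
 ultimately show "((%y. (f (fst p + exp y *\<^sub>R w) - f (fst p)) / norm (exp y *\<^sub>R w)) has_real_derivative
   (- 1) * ((f (fst p + w) - f (fst p)) / norm w) + (\<Sum>b\<in>Basis. ((w \<bullet> b) / norm w) * frechet_derivative f (at (fst p + w)) b)) (at 0)"
  by simp
qed

text \<open>A difference quotient loses no regularity as a symbol: its ray derivative is a
 combination of itself and of first derivatives.\<close>

lemma symbol_quotient:
 fixes f :: "'k => real"
 shows "Cm_on (Suc m) f U ==> symbol (params u0 r) (3 * r) (Suc m) (%p w. (f (fst p + w) - f (fst p)) / norm w)"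
proof (induction m)
 have b: "bounded_family (params u0 r) (3 * r) (%p w. (f (fst p + w) - f (fst p)) / norm w)" if c1: "Cm_on (Suc 0) f U"
 proof -
  obtain B where B: "\<And>x y. x \<in> cball u0 (4 * r) ==> y \<in> cball u0 (4 * r) ==> \<bar>f x - f y\<bar> \<le> B * norm (x - y)"
   using shift_lipschitz[OF c1] by metis
  show ?thesis unfolding bounded_family_def
  proof (intro conjI ballI exI[of _ B])
   fix p assume p: "p \<in> params u0 r"
   show "continuous_on (punctured (3 * r)) (%w. (f (fst p + w) - f (fst p)) / norm w)"
    by (intro continuous_on_divide continuous_on_diff continuous_on_const continuous_on_norm continuous_on_id
       continuous_on_compose2[OF Cm_on_continuous[OF c1]] continuous_on_add)
      (auto intro!: shift_in[OF p] simp: punctured_def)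
   show "\<bar>(f (fst p + w) - f (fst p)) / norm w\<bar> \<le> B" if w: "w \<in> punctured (3 * r)" for w
   proof -
    have "\<bar>f (fst p + w) - f (fst p)\<bar> \<le> B * norm (fst p + w - fst p)"
     using params_shift(1)[OF p w] params_shift(2)[OF p] by (intro B) (auto dest: subsetD[OF ball_subset_cball])
    then show ?thesis using w by (auto simp: punctured_def abs_divide divide_le_eq)
   qed
  qed
 qed
 have step: "symbol (params u0 r) (3 * r) (Suc m) (%p w. (f (fst p + w) - f (fst p)) / norm w)"
  if c: "Cm_on (Suc m) f U" and bb: "bounded_family (params u0 r) (3 * r) (%p w. (f (fst p + w) - f (fst p)) / norm w)"
   and IH: "symbol (params u0 r) (3 * r) m (%p w. (f (fst p + w) - f (fst p)) / norm w)" for m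
 proof (rule symbol_SucI[OF bb])
  show "ray_deriv (3 * r) (%w. (f (fst p + w) - f (fst p)) / norm w)
   (%w. (- 1) * ((f (fst p + w) - f (fst p)) / norm w) + (\<Sum>b\<in>Basis. ((w \<bullet> b) / norm w) * frechet_derivative f (at (fst p + w)) b))"
   if "p \<in> params u0 r" for p using c that by (intro quotient_ray_deriv) auto
  show "symbol (params u0 r) (3 * r) m (%p w. (- 1) * ((f (fst p + w) - f (fst p)) / norm w) + (\<Sum>b\<in>Basis. ((w \<bullet> b) / norm w) * frechet_derivative f (at (fst p + w)) b))"
   using c by (intro symbol_add symbol_cmult IH symbol_sum symbol_mult symbol_angle symbol_shift[where f = "%x. frechet_derivative f (at x) _"]) auto
 qed
 {
  case 0
  then show ?case using step[of 0] b by simp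
 next
  case (Suc m)
  have c1: "Cm_on (Suc m) f U"
  proof -
   have "Cm_on (Suc m) g U" if "Cm_on (Suc (Suc m)) g U" for m and g :: "'k => real"
    using that by (induction m arbitrary: g) (simp_all add: differentiable_imp_continuous_on differentiable_at_imp_differentiable_on)
   then show ?thesis using Suc.prems .
  qed
  show ?case using step[OF Suc.prems symbol_bounded[OF Suc.IH[OF c1]] Suc.IH[OF c1]] .
 }
qed

end

section \<open>Coordinate patches\<close>

lemma Cm_on_const: "Cm_on m (%x. c) U"
 by (induction m arbitrary: c) (auto intro: continuous_on_const simp: frechet_derivative_const)

lemma Cm_on_coordinate: "Cm_on m (%x. (x - u0) \<bullet> b) U"
proof (cases m)
 case 0 then show ?thesis by (auto intro!: continuous_intros)
next
 case (Suc m')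
 have d: "((%x. (x - u0) \<bullet> b) has_derivative (%v. v \<bullet> b)) (at x)" for x
  by (auto intro!: derivative_eq_intros)
 have "(%x. (x - u0) \<bullet> b) differentiable at x" for x using d by (auto simp: differentiable_def)
 moreover have "frechet_derivative (%x. (x - u0) \<bullet> b) (at x) v = v \<bullet> b" for x v
  by (rule fun_cong[OF frechet_derivative_at[OF d, symmetric]])
 ultimately show ?thesis using Suc by (simp add: Cm_on_const)
qed

lemma symbol_inner_vec:
 fixes F G :: "'p => 'k::euclidean_space => real^'n::finite"
 assumes "\<And>i. symbol A R m (%p w. F p w $ i)" "\<And>i. symbol A R m (%p w. G p w $ i)"
 shows "symbol A R m (%p w. F p w \<bullet> G p w)"
 unfolding inner_vec_def inner_real_def by (intro symbol_sum symbol_mult assms) auto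

text \<open>On a small enough ball a parametrization is a perturbation of an injective linear map. This
 makes it bi-Lipschitz, and makes the distance \<open>\<parallel>\<phi> (u + w) - \<phi> u\<parallel>\<close> grow along each ray at a rate
 comparable to its own size.\<close>

locale patch =
 fixes \<phi> :: "real^'k::finite => real^'n::finite" and U :: "(real^'k) set" and u0 :: "real^'k"
  and r c :: real and L :: "real^'k => real^'n"
 assumes U: "open U" "cball u0 (4 * r) \<subseteq> U" and r: "r > 0" and c: "c > 0" and smooth: "smooth_on \<phi> U"
  and L: "linear L" "\<And>v. norm (L v) \<ge> c * norm v"
  and near: "\<And>x v. x \<in> cball u0 (4 * r) ==> norm (frechet_derivative \<phi> (at x) v - L v) \<le> c / 8 * norm v"
begin

lemma \<phi>_derivative: "x \<in> U ==> (\<phi> has_derivative frechet_derivative \<phi> (at x)) (at x)"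
 using smooth[unfolded smooth_on_def, rule_format, of "Suc 0"] by (simp add: frechet_derivative_works)

lemma \<phi>_continuous: "continuous_on U \<phi>"
 using smooth[unfolded smooth_on_def, rule_format, of 0] by simp

lemma secant:
 assumes x: "x \<in> cball u0 (4 * r)" and y: "y \<in> cball u0 (4 * r)"
 shows "norm (\<phi> x - \<phi> y - L (x - y)) \<le> c / 8 * norm (x - y)"
proof -
 have "norm ((\<phi> x - L x) - (\<phi> y - L y)) \<le> c / 8 * norm (x - y)"
 proof (rule differentiable_bound[of "cball u0 (4 * r)" "%x. \<phi> x - L x" "%x v. frechet_derivative \<phi> (at x) v - L v"])
  fix z assume z: "z \<in> cball u0 (4 * r)"
  show "((%x. \<phi> x - L x) has_derivative (%v. frechet_derivative \<phi> (at z) v - L v)) (at z within cball u0 (4 * r))"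
   using z U(2) L(1) by (intro has_derivative_at_withinI[OF has_derivative_diff] \<phi>_derivative linear_imp_has_derivative) auto
  show "onorm (%v. frechet_derivative \<phi> (at z) v - L v) \<le> c / 8"
   using near[OF z] by (intro onorm_le) auto
 qed (use x y in auto)
 moreover have "(\<phi> x - L x) - (\<phi> y - L y) = \<phi> x - \<phi> y - L (x - y)" by (simp add: linear_diff[OF L(1)])
 ultimately show ?thesis by simp
qed

lemma chord_ge:
 assumes x: "x \<in> cball u0 (4 * r)" and y: "y \<in> cball u0 (4 * r)"
 shows "norm (\<phi> x - \<phi> y) \<ge> 7 * c / 8 * norm (x - y)"
proof -
 have "norm (L (x - y)) \<le> norm (\<phi> x - \<phi> y) + norm (\<phi> x - \<phi> y - L (x - y))"
  using norm_triangle_ineq4[of "\<phi> x - \<phi> y" "\<phi> x - \<phi> y - L (x - y)"] by simp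
 then show ?thesis using secant[OF assms] L(2)[of "x - y"] by (simp add: algebra_simps)
qed

lemma chord_le:
 obtains B where "B \<ge> 0" "\<And>x y. x \<in> cball u0 (4 * r) ==> y \<in> cball u0 (4 * r) ==> norm (\<phi> x - \<phi> y) \<le> B * norm (x - y)"
proof -
 obtain B where B: "B > 0" "\<And>v. norm (L v) \<le> B * norm v" using linear_bounded_pos[OF L(1)] by blast
 show ?thesis
 proof (rule that[of "B + c / 8"])
  show "B + c / 8 \<ge> 0" using B c by simp
  fix x y assume xy: "x \<in> cball u0 (4 * r)" "y \<in> cball u0 (4 * r)"
  have "norm (\<phi> x - \<phi> y) \<le> norm (\<phi> x - \<phi> y - L (x - y)) + norm (L (x - y))"
   using norm_triangle_ineq[of "\<phi> x - \<phi> y - L (x - y)" "L (x - y)"] by simp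
  then show "norm (\<phi> x - \<phi> y) \<le> (B + c / 8) * norm (x - y)"
   using secant[OF xy] B(2)[of "x - y"] by (simp add: algebra_simps)
 qed
qed

abbreviation P :: "((real^'k) \<times> real) set" where "P \<equiv> params u0 r"

definition dst :: "(real^'k) \<times> real => real^'k => real" where
 "dst p w = norm (\<phi> (fst p + w) - \<phi> (fst p))"

definition chord :: "(real^'k) \<times> real => real^'k => real^'n" where
 "chord p w = inverse (norm w) *\<^sub>R (\<phi> (fst p + w) - \<phi> (fst p))"

definition velocity :: "(real^'k) \<times> real => real^'k => real^'n" where
 "velocity p w = inverse (norm w) *\<^sub>R frechet_derivative \<phi> (at (fst p + w)) w"

definition slope :: "(real^'k) \<times> real => real^'k => real" where
 "slope p w = (chord p w \<bullet> velocity p w) * (1 / (chord p w \<bullet> chord p w))"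

lemma in_cball:
 assumes "p \<in> P" shows "w \<in> punctured (3 * r) ==> fst p + w \<in> cball u0 (4 * r)" "fst p \<in> cball u0 (4 * r)"
 using params_shift[OF assms] ball_subset_cball by blast+

lemma dst_eq: "w \<in> punctured (3 * r) ==> dst p w = norm w * norm (chord p w)"
 by (simp add: dst_def chord_def punctured_def)

lemma norm_chord_ge:
 assumes p: "p \<in> P" and w: "w \<in> punctured (3 * r)"
 shows "norm (chord p w) \<ge> 7 * c / 8"
proof -
 have "7 * c / 8 * norm w \<le> norm w * norm (chord p w)"
  using chord_ge[OF in_cball(1)[OF p w] in_cball(2)[OF p]] unfolding dst_eq[OF w, symmetric] dst_def by simp
 then show ?thesis using w by (simp add: punctured_def mult.commute[of "norm w"])
qed

lemma symbol_chord: "symbol P (3 * r) m (%p w. chord p w $ i)"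
proof (rule symbol_Suc)
 have "Cm_on (Suc m) (%x. \<phi> x $ i) U"
  using smooth Cm_on_component[OF U(1)] by (auto simp: smooth_on_def simp del: Cm_on.simps)
 from symbol_quotient[OF U this] show "symbol P (3 * r) (Suc m) (%p w. chord p w $ i)"
  by (simp add: chord_def divide_inverse mult.commute del: symbol.simps)
qed

lemma symbol_velocity: "symbol P (3 * r) m (%p w. velocity p w $ i)"
proof (rule symbol_cong)
 have "Cm_on m (%x. frechet_derivative \<phi> (at x) b $ i) U" for b
  using smooth[unfolded smooth_on_def, rule_format, of "Suc m"] by (intro Cm_on_component[OF U(1)]) simp
 then show "symbol P (3 * r) m (%p w. \<Sum>b\<in>Basis. ((w \<bullet> b) / norm w) * (frechet_derivative \<phi> (at (fst p + w)) b $ i))"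
  by (intro symbol_sum symbol_mult symbol_angle symbol_shift[OF U, where f = "%x. frechet_derivative \<phi> (at x) _ $ i"]) auto
 fix p and w :: "real^'k" assume p: "p \<in> P" and w: "w \<in> punctured (3 * r)"
 let ?D = "frechet_derivative \<phi> (at (fst p + w))"
 have lin: "linear ?D" using has_derivative_linear[OF \<phi>_derivative] in_cball(1)[OF p w] U(2) by blast
 have "?D w = ?D (\<Sum>b\<in>Basis. (w \<bullet> b) *\<^sub>R b)" by (simp add: euclidean_representation)
 also have "... = (\<Sum>b\<in>Basis. (w \<bullet> b) *\<^sub>R ?D b)" by (simp add: linear_sum[OF lin] linear_scale[OF lin])
 finally show "(\<Sum>b\<in>Basis. ((w \<bullet> b) / norm w) * (?D b $ i)) = velocity p w $ i"
  by (simp add: velocity_def sum_distrib_left divide_inverse mult_ac)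
qed

lemma chord_inner_ge: "p \<in> P ==> w \<in> punctured (3 * r) ==> chord p w \<bullet> chord p w \<ge> (7 * c / 8)\<^sup>2"
 using power_mono[OF norm_chord_ge, of p w 2] c by (simp add: power2_norm_eq_inner)

text \<open>The chord and the velocity along the ray differ by at most \<open>c / 4\<close>, while the chord has length at
 least \<open>7 c / 8\<close>.\<close>

lemma slope_ge:
 assumes p: "p \<in> P" and w: "w \<in> punctured (3 * r)"
 shows "slope p w \<ge> 1 / 2"
proof -
 have w0: "norm w > 0" using w by (simp add: punctured_def)
 let ?q = "chord p w" and ?g = "velocity p w"
 have q: "norm ?q \<ge> 7 * c / 8" by (rule norm_chord_ge[OF p w])
 have q0: "norm ?q > 0" using q c by linarith
 have "norm (?g - ?q) = norm ((frechet_derivative \<phi> (at (fst p + w)) w - L w) - (\<phi> (fst p + w) - \<phi> (fst p) - L w)) / norm w"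
 proof -
  have "?g - ?q = inverse (norm w) *\<^sub>R ((frechet_derivative \<phi> (at (fst p + w)) w - L w) - (\<phi> (fst p + w) - \<phi> (fst p) - L w))"
   unfolding velocity_def chord_def scaleR_diff_right[symmetric] by simp
  then show ?thesis by (simp only: norm_scaleR) (simp add: divide_inverse mult.commute)
 qed
 also have "... \<le> (c / 8 * norm w + c / 8 * norm w) / norm w"
  using secant[OF in_cball(1)[OF p w] in_cball(2)[OF p]] near[OF in_cball(1)[OF p w], of w]
  by (intro divide_right_mono order_trans[OF norm_triangle_ineq4 add_mono]) auto
 also have "... = c / 4" using w0 by simp
 finally have gq: "norm (?g - ?q) \<le> c / 4" .
 have "?q \<bullet> ?g = (norm ?q)\<^sup>2 + ?q \<bullet> (?g - ?q)" by (simp add: inner_diff_right power2_norm_eq_inner)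
 moreover have "?q \<bullet> (?g - ?q) \<ge> - (norm ?q * (c / 4))"
  using Cauchy_Schwarz_ineq2[of ?q "?g - ?q"] mult_left_mono[OF gq, of "norm ?q"] by auto
 ultimately have "?q \<bullet> ?g \<ge> (norm ?q)\<^sup>2 - norm ?q * (c / 4)" by linarith
 moreover have "norm ?q * (c / 4) \<le> (norm ?q)\<^sup>2 / 2"
  using mult_left_mono[of "c / 2" "norm ?q" "norm ?q"] q c by (simp add: power2_eq_square mult.commute)
 ultimately have "?q \<bullet> ?g \<ge> (?q \<bullet> ?q) / 2" unfolding power2_norm_eq_inner by linarith
 moreover have "?q \<bullet> ?q > 0" using q0 by auto
 ultimately show ?thesis by (simp add: slope_def pos_le_divide_eq)
qed

lemma dst_ray_deriv: assumes p: "p \<in> P" shows "ray_deriv (3 * r) (dst p) (%w. dst p w * slope p w)"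
 unfolding ray_deriv_def
proof
 fix w :: "real^'k" assume w: "w \<in> punctured (3 * r)"
 then have w0: "norm w > 0" by (simp add: punctured_def)
 let ?D = "frechet_derivative \<phi> (at (fst p + w))" and ?v = "\<phi> (fst p + w) - \<phi> (fst p)"
 have inU: "fst p + w \<in> U" using in_cball(1)[OF p w] U(2) by blast
 have lin: "linear ?D" by (rule has_derivative_linear[OF \<phi>_derivative[OF inU]])
 have q0: "norm (chord p w) > 0" using norm_chord_ge[OF p w] c by linarith
 have v0: "?v \<bullet> ?v > 0" using q0 by (auto simp: chord_def)
 have gd: "((%y::real. fst p + exp y *\<^sub>R w) has_derivative (%h. h *\<^sub>R w)) (at 0)"
  by (auto intro!: derivative_eq_intros)
 have "((%y. \<phi> (fst p + exp y *\<^sub>R w)) has_derivative (%h. ?D (h *\<^sub>R w))) (at 0)"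
  by (rule has_derivative_compose[OF gd]) (use \<phi>_derivative[OF inU] in simp)
 then have fd: "((%y. \<phi> (fst p + exp y *\<^sub>R w) - \<phi> (fst p)) has_derivative (%h. h *\<^sub>R ?D w)) (at 0)"
  by (auto simp: linear_scale[OF lin] intro!: derivative_eq_intros)
 have "((%y. (\<phi> (fst p + exp y *\<^sub>R w) - \<phi> (fst p)) \<bullet> (\<phi> (fst p + exp y *\<^sub>R w) - \<phi> (fst p))) has_derivative
   (%h. (\<phi> (fst p + exp 0 *\<^sub>R w) - \<phi> (fst p)) \<bullet> (h *\<^sub>R ?D w) + (h *\<^sub>R ?D w) \<bullet> (\<phi> (fst p + exp 0 *\<^sub>R w) - \<phi> (fst p)))) (at 0)"
  by (rule has_derivative_inner[OF fd fd])
 then have "((%y. (\<phi> (fst p + exp y *\<^sub>R w) - \<phi> (fst p)) \<bullet> (\<phi> (fst p + exp y *\<^sub>R w) - \<phi> (fst p))) has_real_derivative 2 * (?v \<bullet> ?D w)) (at 0)"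
  unfolding has_field_derivative_def by (rule has_derivative_eq_rhs) (auto simp: fun_eq_iff inner_commute)
 from DERIV_chain2[OF DERIV_real_sqrt this] v0
 have "((%y. sqrt ((\<phi> (fst p + exp y *\<^sub>R w) - \<phi> (fst p)) \<bullet> (\<phi> (fst p + exp y *\<^sub>R w) - \<phi> (fst p)))) has_real_derivative
   inverse (sqrt (?v \<bullet> ?v)) / 2 * (2 * (?v \<bullet> ?D w))) (at 0)" by simp
 moreover have "inverse (sqrt (?v \<bullet> ?v)) / 2 * (2 * (?v \<bullet> ?D w)) = dst p w * slope p w"
 proof -
  have v: "?v = norm w *\<^sub>R chord p w" and d: "?D w = norm w *\<^sub>R velocity p w"
   using w0 by (simp_all add: chord_def velocity_def)
  have "inverse (sqrt (?v \<bullet> ?v)) / 2 * (2 * (?v \<bullet> ?D w)) = inverse (norm ?v) * (?v \<bullet> ?D w)" by (simp add: norm_eq_sqrt_inner)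
  also have "... = inverse (norm w * norm (chord p w)) * (norm w * norm w * (chord p w \<bullet> velocity p w))"
   unfolding v d by simp
  also have "... = norm w * norm (chord p w) * slope p w"
   using w0 q0 by (simp add: slope_def dot_square_norm power2_eq_square field_simps)
  finally show ?thesis using dst_eq[OF w] by simp
 qed
 ultimately show "((%y. dst p (exp y *\<^sub>R w)) has_real_derivative dst p w * slope p w) (at 0)"
  by (simp add: dst_def norm_eq_sqrt_inner)
qed

lemma distance_family:
 obtains B where "distance_family P (3 * r) (2 * r) snd dst (%p w. chord p w \<bullet> chord p w) slope (min ((7 * c / 8)\<^sup>2) (1 / 2)) B"
proof -
 obtain B where B: "B \<ge> 0" "\<And>x y. x \<in> cball u0 (4 * r) ==> y \<in> cball u0 (4 * r) ==> norm (\<phi> x - \<phi> y) \<le> B * norm (x - y)"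
  using chord_le by metis
 have sq: "symbol P (3 * r) m (%p w. chord p w \<bullet> chord p w)" for m
  by (intro symbol_inner_vec symbol_chord)
 show ?thesis
 proof (rule that[of "B * (3 * r)"], unfold_locales)
  show "0 < snd p" if "p \<in> P" for p using that by (simp add: params_def)
  show "0 < 2 * r" "2 * r < 3 * r" using r by auto
  show "0 < min ((7 * c / 8)\<^sup>2) (1 / 2)" using c by simp
  show "0 < dst p w \<and> dst p w \<le> B * (3 * r)" if p: "p \<in> P" and w: "w \<in> punctured (3 * r)" for p w
  proof
   have "0 < 7 * c / 8 * norm w" using c w by (simp add: punctured_def)
   then show "0 < dst p w" unfolding dst_def by (rule less_le_trans) (use chord_ge[OF in_cball(1)[OF p w] in_cball(2)[OF p]] in simp)
   show "dst p w \<le> B * (3 * r)"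
    using order_trans[OF B(2)[OF in_cball(1)[OF p w] in_cball(2)[OF p]] mult_left_mono[of _ "3 * r"]] w B(1)
    by (auto simp: dst_def punctured_def)
  qed
  show "continuous_on (punctured (3 * r)) (dst p)" if p: "p \<in> P" for p
  proof -
   have "continuous_on (punctured (3 * r)) (%w. \<phi> (fst p + w))"
    by (rule continuous_on_compose2[OF \<phi>_continuous]) (use in_cball(1)[OF p] U(2) in \<open>auto intro!: continuous_intros\<close>)
   then show ?thesis unfolding dst_def[abs_def] by (intro continuous_intros)
  qed
  show "ray_deriv (3 * r) (dst p) (%w. dst p w * slope p w)" if "p \<in> P" for p by (rule dst_ray_deriv[OF that])
  show "(dst p w)\<^sup>2 = w \<bullet> w * (chord p w \<bullet> chord p w)" if "w \<in> punctured (3 * r)" for p w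
   using dst_eq[OF that, of p] by (simp add: power_mult_distrib power2_norm_eq_inner)
  show "symbol P (3 * r) m (%p w. chord p w \<bullet> chord p w)" for m by (rule sq)
  show "min ((7 * c / 8)\<^sup>2) (1 / 2) \<le> chord p w \<bullet> chord p w" if "p \<in> P" "w \<in> punctured (3 * r)" for p w
   using chord_inner_ge[OF that] by simp
  show "symbol P (3 * r) m slope" for m
   unfolding slope_def[abs_def]
   by (intro symbol_mult symbol_inner_vec symbol_chord symbol_velocity symbol_inverse[of "(7 * c / 8)\<^sup>2"] sq chord_inner_ge) (use c in auto)
  show "min ((7 * c / 8)\<^sup>2) (1 / 2) \<le> slope p w" if "p \<in> P" "w \<in> punctured (3 * r)" for p w
   using slope_ge[OF that] by simp
 qed
qed

section \<open>Averages over rotations of a patch\<close>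

text \<open>A density that is positive on the open ball and has \<open>m\<close> bounded derivatives along rays. A power is
 enough: only finitely many derivatives are taken.\<close>

definition bump :: "nat => real^'k => real" where
 "bump m u = max 0 (r\<^sup>2 - (norm (u - u0))\<^sup>2) ^ Suc m"

lemma bump_nonneg: "bump m u \<ge> 0" by (simp add: bump_def)

lemma bump_zero: "norm (u - u0) \<ge> r ==> bump m u = 0"
 using power_mono[of r "norm (u - u0)" 2] r by (simp add: bump_def)

lemma bump_le: "bump m u \<le> (r\<^sup>2) ^ Suc m"
 unfolding bump_def by (intro power_mono) auto

lemma bump_measurable [measurable]: "Borel (bump m)"
 unfolding bump_def[abs_def] by measurable

lemma symbol_bump: "symbol P (3 * r) m (%p w. bump m (fst p + w))"
proof -
 have "symbol P (3 * r) m (%p w. r\<^sup>2 + (- 1) * (\<Sum>b\<in>Basis. ((fst p + w - u0) \<bullet> b) * ((fst p + w - u0) \<bullet> b)))"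
  by (intro symbol_add symbol_const symbol_cmult symbol_sum symbol_mult symbol_shift[OF U, where f = "%x. (x - u0) \<bullet> _"] Cm_on_coordinate) auto
 from symbol_positive_part_power[OF this, of "Suc m"] show ?thesis
  by (simp add: bump_def power2_norm_eq_inner euclidean_inner[of "_ - u0" "_ - u0"])
qed

lemma vanishing_bump: "vanishing P (3 * r) (2 * r) (%p w. bump m (fst p + w))"
 unfolding vanishing_def
proof (intro ballI impI bump_zero)
 fix p and w :: "real^'k" assume p: "p \<in> P" and w: "2 * r \<le> norm w"
 have "norm (u0 - fst p) < r" using p by (auto simp: params_def dist_norm)
 moreover have "norm w \<le> norm (fst p + w - u0) + norm (u0 - fst p)"
  using norm_triangle_ineq[of "fst p + w - u0" "u0 - fst p"] by simp
 ultimately show "r \<le> norm (fst p + w - u0)" using w by linarith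
qed

text \<open>The exponent corresponds to finite differences of order \<open>2 k\<close>, each of which costs two
 derivatives of the density.\<close>

definition patch_measure :: "(real^'k) measure" where
 "patch_measure = density lborel (%u. ennreal (bump (4 * CARD('k)) u))"

definition \<phi>0 :: "real^'k => real^'n" where
 "\<phi>0 u = (if u \<in> ball u0 (4 * r) then \<phi> u else 0)"

definition orbit :: "real^'n^'n => real^'k => real^'n" where
 "orbit \<theta> u = transpose \<theta> *v \<phi>0 u"

lemma \<phi>0_measurable [measurable]: "Borel \<phi>0"
proof -
 have "continuous_on (ball u0 (4 * r)) \<phi>"
  by (rule continuous_on_subset[OF \<phi>_continuous]) (use U(2) ball_subset_cball in blast)
 from borel_measurable_continuous_on_if[OF _ this continuous_on_const[of _ 0]] show ?thesis
  by (simp add: \<phi>0_def[abs_def])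
qed

lemma sets_patch_measure [simp, measurable_cong]: "sets patch_measure = sets borel"
 by (simp add: patch_measure_def)

lemma finite_patch_measure: "finite_measure patch_measure"
proof
 have "emeasure patch_measure (space patch_measure) = (\<integral>\<^sup>+u. ennreal (bump (4 * CARD('k)) u) \<partial>lborel)"
  by (simp add: patch_measure_def emeasure_density)
 also have "... \<le> (\<integral>\<^sup>+u. ennreal ((r\<^sup>2) ^ Suc (4 * CARD('k))) * indicator (cball u0 r) u \<partial>lborel)"
  using bump_le bump_zero by (intro nn_integral_mono) (auto simp: indicator_def dist_norm norm_minus_commute intro!: ennreal_leI)
 also have "... < \<infinity>"
  using emeasure_lborel_cball_finite[of u0 r] by (subst nn_integral_cmult) (auto simp: ennreal_mult_less_top borel_measurable_indicator)
 finally show "emeasure patch_measure (space patch_measure) \<noteq> \<infinity>" by simp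
qed

end

lemma fdiff_integral:
 assumes "\<And>s. s > 0 ==> integrable N (%u. g u s)" and t: "t > 0" and s0: "s0 > 0"
 shows "integrable N (%u. fdiff m (g u) t s0) \<and> fdiff m (%s. LINT u|N. g u s) t s0 = (LINT u|N. fdiff m (g u) t s0)"
 using s0
proof (induction m arbitrary: s0)
 case 0 then show ?case using assms(1) by simp
next
 case (Suc m)
 have "s0 + t > 0" using Suc.prems t by simp
 from Suc.IH[OF this] Suc.IH[OF Suc.prems] show ?case by simp
qed

text \<open>Heat kernels on spaces of different dimension have the same exponential factor, and their
 normalizations differ by a power of the time.\<close>

lemma heat_compare:
 fixes x :: "'a::euclidean_space" and y :: "'b::euclidean_space"
 assumes s: "s > 0" and le: "norm y \<le> norm x"
 shows "heat s x \<le> gauss_const TYPE('b) / gauss_const TYPE('a) * s powr (real DIM('b) / 2 - real DIM('a) / 2) * heat s y"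
proof -
 have "(norm y)\<^sup>2 \<le> (norm x)\<^sup>2" using le by (intro power_mono) auto
 then have "exp (- (norm x)\<^sup>2 / (4 * s)) \<le> exp (- (norm y)\<^sup>2 / (4 * s))" using s by (simp add: divide_right_mono)
 then have "heat s x \<le> exp (- (norm y)\<^sup>2 / (4 * s)) / (gauss_const TYPE('a) * s powr (real DIM('a) / 2))"
  unfolding heat_def using gauss_const_pos[where ?'a = 'a] by (intro divide_right_mono) auto
 also have "... = gauss_const TYPE('b) / gauss_const TYPE('a) * s powr (real DIM('b) / 2 - real DIM('a) / 2) * heat s y"
  using gauss_const_pos[where ?'a = 'b] s by (simp add: heat_def powr_diff)
 finally show ?thesis .
qed

lemma SO_mult_measurable:
 assumes H: "haar_SO H" and f: "f \<in> measurable N H" and g[measurable]: "g \<in> borel_measurable N"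
 shows "(%x. f x *v (g x :: real^'n::finite)) \<in> borel_measurable N"
  and "(%x. transpose (f x) *v (g x :: real^'n)) \<in> borel_measurable N"
proof -
 have [measurable]: "f \<in> borel_measurable N" using measurable_compose[OF f haar_id_measurable[OF H]] .
 show "(%x. f x *v (g x :: real^'n::finite)) \<in> borel_measurable N"
  by (rule borel_measurable_continuous_Pair) (auto simp: matrix_vector_mult_def intro!: continuous_intros continuous_on_vec_lambda)
 show "(%x. transpose (f x) *v (g x :: real^'n)) \<in> borel_measurable N"
  by (rule borel_measurable_continuous_Pair) (auto simp: matrix_vector_mult_def transpose_def intro!: continuous_intros continuous_on_vec_lambda)
qed

lemma heat_rotate:
 "\<theta> \<in> SO ==> heat s (z + transpose \<theta> *v x) = heat s (x + \<theta> *v z)"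
proof -
 assume th: "\<theta> \<in> SO"
 have "norm (z + transpose \<theta> *v x) = norm (\<theta> *v (z + transpose \<theta> *v x))" using SO_norm[OF th] by simp
 also have "\<theta> *v (z + transpose \<theta> *v x) = x + \<theta> *v z"
  by (simp add: matrix_vector_right_distrib matrix_vector_mul_assoc SO_transpose_mult[OF th] del: transpose_matrix_vector)
 finally show ?thesis by (simp add: heat_def)
qed

context
 fixes H :: "(real^'n^'n::finite) measure"
 assumes H: "haar_SO H" and n: "CARD('n) \<ge> 2"
begin

lemma rotheat_nn_integral:
 fixes x :: "real^'n"
 assumes s: "s > 0"
 shows "(\<integral>\<^sup>+\<theta>. ennreal (heat s (x + \<theta> *v z)) \<partial>H) = ennreal (rotheat H z s (norm x))"
proof -
 interpret H: finite_measure H by (rule haar_finite[OF H])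
 have "Borel (%\<theta>::real^'n^'n. x + \<theta> *v z)"
  by (intro borel_measurable_continuous_onI continuous_on_add continuous_on_const continuous_matrix_vector_mult)
 then have [measurable]: "(%\<theta>. heat s (x + \<theta> *v z)) \<in> borel_measurable H"
  by (intro haar_measurable[OF H] measurable_compose[OF _ heat_measurable])
 obtain B where "\<forall>x::real^'n. \<bar>heat s x\<bar> \<le> B" using bddint_heat[of s, where ?'a = "real^'n"] s[THEN less_imp_le] unfolding bddint_def by blast
 then have "integrable H (%\<theta>. heat s (x + \<theta> *v z))" by (intro H.integrable_const_bound[of _ B]) auto
 then show ?thesis by (simp add: nn_integral_eq_integral rotheat_eq[OF H n s])
qed

lemma rotheat_measurable_pair:
 fixes f g :: "'x => real^'n"
 assumes s: "s > 0" and [measurable]: "f \<in> borel_measurable N" "g \<in> borel_measurable N"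
 shows "(%x. ennreal (rotheat H (f x) s (norm (g x)))) \<in> borel_measurable N"
proof -
 interpret H: finite_measure H by (rule haar_finite[OF H])
 have [measurable]: "(%(x, \<theta>). \<theta> *v f x) \<in> borel_measurable (N \<Otimes>\<^sub>M H)"
  unfolding case_prod_unfold by (rule SO_mult_measurable(1)[OF H]) measurable
 have "(%x. \<integral>\<^sup>+\<theta>. ennreal (heat s (g x + \<theta> *v f x)) \<partial>H) \<in> borel_measurable N" by measurable
 then show ?thesis by (simp add: rotheat_nn_integral[OF s])
qed

lemma nn_integral_rotheat:
 fixes x :: "real^'n"
 assumes s: "s > 0"
 shows "(\<integral>\<^sup>+z. ennreal (rotheat H z s (norm x)) \<partial>lborel) = 1"
proof -
 interpret H: finite_measure H by (rule haar_finite[OF H])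
 interpret LH: pair_sigma_finite "lborel :: (real^'n) measure" H ..
 have [measurable]: "(%(z, \<theta>). \<theta> *v z) \<in> borel_measurable (lborel \<Otimes>\<^sub>M H)"
  unfolding case_prod_unfold by (rule SO_mult_measurable(1)[OF H]) measurable
 have "(\<integral>\<^sup>+z. ennreal (rotheat H z s (norm x)) \<partial>lborel) = (\<integral>\<^sup>+z. \<integral>\<^sup>+\<theta>. ennreal (heat s (x + \<theta> *v z)) \<partial>H \<partial>lborel)"
  by (simp add: rotheat_nn_integral[OF s])
 also have "... = (\<integral>\<^sup>+\<theta>. \<integral>\<^sup>+z. ennreal (heat s (x + \<theta> *v z)) \<partial>lborel \<partial>H)"
  by (rule LH.Fubini'[symmetric]) measurable
 also have "... = (\<integral>\<^sup>+\<theta>. 1 \<partial>H)"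
 proof (rule nn_integral_cong)
  fix \<theta> assume "\<theta> \<in> space H"
  then have th: "\<theta> \<in> SO" using haar_space[OF H] by simp
  have "(\<integral>\<^sup>+z. ennreal (heat s (x + \<theta> *v z)) \<partial>lborel) = (\<integral>\<^sup>+z. ennreal (heat s (transpose \<theta> *v x + z)) \<partial>lborel)"
   by (simp add: heat_rotate[OF th, symmetric] add.commute)
  also have "... = 1" using nn_integral_lborel_translate[of "%z. ennreal (heat s z)" "transpose \<theta> *v x"] nn_integral_heat[OF s, where ?'a = "real^'n"] by simp
  finally show "(\<integral>\<^sup>+z. ennreal (heat s (x + \<theta> *v z)) \<partial>lborel) = 1" .
 qed
 also have "... = 1" using haar_space[OF H] H by (simp add: haar_SO_def)
 finally show ?thesis .
qed

end

context patch
begin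

lemma orbit_measurable:
 assumes "haar_SO H" and "f \<in> measurable N H" and [measurable]: "g \<in> borel_measurable N"
 shows "(%x. orbit (f x) (g x)) \<in> borel_measurable N"
 unfolding orbit_def using assms(1,2) by (rule SO_mult_measurable(2)) measurable

lemma \<phi>0_eq: "u \<in> ball u0 (4 * r) ==> \<phi>0 u = \<phi> u"
 by (simp add: \<phi>0_def)

lemma integral_patch_measure:
 fixes f :: "real^'k => real"
 assumes "Borel f"
 shows "(LINT u|patch_measure. f u) = (LBINT u. bump (4 * CARD('k)) u * f u)"
 unfolding patch_measure_def using assms bump_nonneg by (subst integral_density) auto

lemma AE_patch_measure: "AE u in patch_measure. u \<in> ball u0 r"
proof -
 have "0 < bump (4 * CARD('k)) u ==> u \<in> ball u0 r" for u
  using bump_zero[of u "4 * CARD('k)"] by (force simp: dist_norm norm_minus_commute)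
 then show ?thesis unfolding patch_measure_def by (subst AE_density) auto
qed

text \<open>If \<open>u'\<close> minimizes the distance from \<open>\<theta> v\<close> to the patch, then \<open>\<parallel>\<theta> v - \<phi> u\<parallel>\<close> dominates a
 multiple of \<open>\<parallel>u - u'\<parallel>\<close>; the \<open>n\<close>-dimensional kernel is thus compared with a \<open>k\<close>-dimensional
 one.\<close>

lemma patch_size:
 assumes th: "\<theta> \<in> SO" and s: "s > 0"
 shows "(LINT u|patch_measure. heat s (v - orbit \<theta> u)) \<le>
  (r\<^sup>2) ^ Suc (4 * CARD('k)) * (gauss_const TYPE(real^'k) / gauss_const TYPE(real^'n) * (4 / c) ^ CARD('k))
   * s powr - ((real CARD('n) - real CARD('k)) / 2)"
proof -
 let ?m = "4 * CARD('k)" and ?v = "\<theta> *v v"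
 define Q where "Q = gauss_const TYPE(real^'k) / gauss_const TYPE(real^'n) * s powr (real CARD('k) / 2 - real CARD('n) / 2)"
 have Q0: "Q \<ge> 0" using gauss_const_pos[where ?'a = "real^'k"] gauss_const_pos[where ?'a = "real^'n"] by (simp add: Q_def)
 have sub: "cball u0 r \<subseteq> ball u0 (4 * r)" "cball u0 r \<subseteq> cball u0 (4 * r)" using r by auto
 have "continuous_on (cball u0 r) (%u. norm (?v - \<phi> u))"
  using sub(2) U(2) by (intro continuous_intros continuous_on_subset[OF \<phi>_continuous]) auto
 from continuous_attains_inf[OF compact_cball _ this]
 obtain u' where u': "u' \<in> cball u0 r" "\<And>u. u \<in> cball u0 r ==> norm (?v - \<phi> u') \<le> norm (?v - \<phi> u)" using r by auto
 have orbit_meas: "Borel (orbit \<theta>)"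
 proof -
  have "Borel (%x. transpose \<theta> *v x)"
   by (intro borel_measurable_continuous_onI linear_continuous_on matrix_vector_mul_bounded_linear)
  then show ?thesis unfolding orbit_def[abs_def] by (intro measurable_compose[OF \<phi>0_measurable])
 qed
 note [measurable] = orbit_meas
 have le: "bump ?m u * heat s (v - orbit \<theta> u) \<le> (r\<^sup>2) ^ Suc ?m * (Q * heat s (- (c / 4) *\<^sub>R u' + (c / 4) *\<^sub>R u))" for u
 proof (cases "u \<in> cball u0 r")
  case True
  have "norm (\<phi> u - \<phi> u') \<le> norm (?v - \<phi> u) + norm (?v - \<phi> u')"
   using norm_triangle_ineq4[of "?v - \<phi> u'" "?v - \<phi> u"] by simp
  then have "7 * c / 8 * norm (u - u') \<le> 2 * norm (?v - \<phi> u)"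
   using chord_ge[of u u'] u'(2)[OF True] u'(1) True sub(2) by fastforce
  moreover have "c / 4 * norm (u - u') \<le> 7 * c / 16 * norm (u - u')" using c by (intro mult_right_mono) auto
  moreover have "norm ((c / 4) *\<^sub>R (u - u')) = c / 4 * norm (u - u')" using c by simp
  ultimately have "norm ((c / 4) *\<^sub>R (u - u')) \<le> norm (?v - \<phi> u)" by linarith
  moreover have "norm (?v - \<phi> u) = norm (v - orbit \<theta> u)"
  proof -
   have "norm (v - orbit \<theta> u) = norm (\<theta> *v (v - orbit \<theta> u))" using SO_norm[OF th] by simp
   also have "\<theta> *v (v - orbit \<theta> u) = ?v - \<phi> u"
    using True sub(1) by (simp add: orbit_def \<phi>0_eq subset_iff matrix_vector_mult_diff_distrib matrix_vector_mul_assoc SO_transpose_mult[OF th] del: transpose_matrix_vector)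
   finally show ?thesis by simp
  qed
  ultimately have "heat s (v - orbit \<theta> u) \<le> Q * heat s ((c / 4) *\<^sub>R (u - u'))"
   using heat_compare[OF s, of "(c / 4) *\<^sub>R (u - u')" "v - orbit \<theta> u"] by (simp add: Q_def)
  moreover have "(c / 4) *\<^sub>R (u - u') = - (c / 4) *\<^sub>R u' + (c / 4) *\<^sub>R u" by (simp add: scaleR_diff_right)
  ultimately show ?thesis by (intro mult_mono bump_le) auto
 next
  case False
  then have "bump ?m u = 0" by (intro bump_zero) (simp add: dist_norm norm_minus_commute)
  then show ?thesis using Q0 by simp
 qed
 have I: "(LBINT u. heat s (- (c / 4) *\<^sub>R u' + (c / 4) *\<^sub>R u)) = (4 / c) ^ CARD('k)"
  using integral_lborel_affine[of "heat s" "c / 4" "- (c / 4) *\<^sub>R u'"] integral_heat[OF s, where ?'a = "real^'k"] c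
  by (simp add: power_divide field_simps)
 have "integrable lborel (%u. heat s (- (c / 4) *\<^sub>R u' + (c / 4) *\<^sub>R u))"
  using c s by (intro integrable_lborel_affine heat_integrable) auto
 then have int: "integrable lborel (%u. (r\<^sup>2) ^ Suc ?m * (Q * heat s (- (c / 4) *\<^sub>R u' + (c / 4) *\<^sub>R u)))" by (intro integrable_mult_right)
 have "(LINT u|patch_measure. heat s (v - orbit \<theta> u)) = (LBINT u. bump ?m u * heat s (v - orbit \<theta> u))"
  by (rule integral_patch_measure) measurable
 also have "... \<le> (LBINT u. (r\<^sup>2) ^ Suc ?m * (Q * heat s (- (c / 4) *\<^sub>R u' + (c / 4) *\<^sub>R u)))"
  by (rule integral_mono'[OF int le]) (use Q0 in auto)
 also have "... = (r\<^sup>2) ^ Suc ?m * (Q * (4 / c) ^ CARD('k))" by (simp only: integral_mult_right_zero I)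
 also have "... = (r\<^sup>2) ^ Suc (4 * CARD('k)) * (gauss_const TYPE(real^'k) / gauss_const TYPE(real^'n) * (4 / c) ^ CARD('k))
   * s powr - ((real CARD('n) - real CARD('k)) / 2)"
  unfolding Q_def by (simp add: minus_divide_left[symmetric] diff_divide_distrib)
 finally show ?thesis .
qed

text \<open>The average of the heat kernel over all rotations and over one of the two points of the patch,
 the other being \<open>\<phi> u\<close>.\<close>

definition kernel :: "(real^'n^'n) measure => real^'n => real^'k => real => real" where
 "kernel H z u s = (LBINT w. bump (4 * CARD('k)) (u + w) * rotheat H z s (norm (\<phi>0 (u + w) - \<phi>0 u)))"

context
 fixes H :: "(real^'n^'n) measure"
 assumes H: "haar_SO H" and n: "CARD('n) \<ge> 2"
begin

lemma averaging_patch: "averaging H patch_measure orbit"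
proof -
 interpret H: finite_measure H by (rule haar_finite[OF H])
 interpret M: finite_measure patch_measure by (rule finite_patch_measure)
 show ?thesis
 proof
  show "(%(\<theta>, b). orbit \<theta> b) \<in> borel_measurable (H \<Otimes>\<^sub>M patch_measure)"
   unfolding case_prod_unfold by (rule orbit_measurable[OF H]) measurable
 qed
qed

lemma autocorr_eq:
 assumes s: "s > 0"
 shows "integrable patch_measure (%u. kernel H z u s)"
  and "averaging.autocorr H patch_measure orbit s z = (LINT u|patch_measure. kernel H z u s)"
proof -
 interpret A: averaging H patch_measure orbit by (rule averaging_patch)
 have MMp: "pair_sigma_finite patch_measure patch_measure" ..
 interpret MM: finite_measure "patch_measure \<Otimes>\<^sub>M patch_measure" by (rule A.finite_measure_MM)
 interpret HMM: pair_sigma_finite H "patch_measure \<Otimes>\<^sub>M patch_measure" ..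
 interpret P: finite_measure A.pairs by (rule A.finite_measure_pairs)
 have [measurable]: "Borel (rotheat H z s)" by (intro borel_measurable_continuous_onI rotheat_continuous(1)[OF H])
 have [measurable]: "(%n. A.displacement n) \<in> borel_measurable A.pairs" by (rule A.displacement_measurable)
 obtain B where B: "\<forall>x::real^'n. \<bar>heat s x\<bar> \<le> B" using bddint_heat[of s, where ?'a = "real^'n"] s[THEN less_imp_le] unfolding bddint_def by blast
 have intP: "integrable A.pairs (%n. heat s (z + A.displacement n))"
  by (rule P.integrable_const_bound[of _ B]) (use B in auto)
 let ?G = "%b b'. rotheat H z s (norm (\<phi>0 b - \<phi>0 b'))"
 have inner: "(LINT \<theta>|H. heat s (z + (orbit \<theta> (fst q) - orbit \<theta> (snd q)))) = ?G (fst q) (snd q)" for q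
 proof -
  have "(LINT \<theta>|H. heat s (z + (orbit \<theta> (fst q) - orbit \<theta> (snd q)))) = (LINT \<theta>|H. heat s ((\<phi>0 (fst q) - \<phi>0 (snd q)) + \<theta> *v z))"
  proof (rule Bochner_Integration.integral_cong[OF refl])
   fix \<theta> assume "\<theta> \<in> space H"
   then have th: "\<theta> \<in> SO" using haar_space[OF H] by simp
   show "heat s (z + (orbit \<theta> (fst q) - orbit \<theta> (snd q))) = heat s ((\<phi>0 (fst q) - \<phi>0 (snd q)) + \<theta> *v z)"
    using heat_rotate[OF th, of s z "\<phi>0 (fst q) - \<phi>0 (snd q)"] by (simp add: orbit_def matrix_vector_mult_diff_distrib del: transpose_matrix_vector)
  qed
  then show ?thesis by (simp add: rotheat_eq[OF H n s])
 qed
 have intP': "integrable (H \<Otimes>\<^sub>M (patch_measure \<Otimes>\<^sub>M patch_measure)) (%(\<theta>, q). heat s (z + (orbit \<theta> (fst q) - orbit \<theta> (snd q))))"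
  using intP by (simp add: A.displacement_def case_prod_unfold)
 have "A.autocorr s z = (LINT q|(patch_measure \<Otimes>\<^sub>M patch_measure). (LINT \<theta>|H. heat s (z + (orbit \<theta> (fst q) - orbit \<theta> (snd q)))))"
  using HMM.integral_snd[OF intP'] by (simp add: A.autocorr_def A.displacement_def case_prod_unfold)
 then have 1: "A.autocorr s z = (LINT (b, b')|(patch_measure \<Otimes>\<^sub>M patch_measure). ?G b b')"
  by (simp add: inner case_prod_unfold)
 have int2: "integrable (patch_measure \<Otimes>\<^sub>M patch_measure) (%(b, b'). ?G b b')"
  using HMM.integrable_snd[OF intP'] by (simp add: inner case_prod_unfold)
 have k: "(LINT b|patch_measure. ?G b u) = kernel H z u s" for u
 proof -
  have "(LINT b|patch_measure. ?G b u) = (LBINT b. bump (4 * CARD('k)) b * ?G b u)"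
   by (rule integral_patch_measure) measurable
  also have "... = (LBINT w. bump (4 * CARD('k)) (u + w) * ?G (u + w) u)"
   using integral_lborel_affine[of "%b. bump (4 * CARD('k)) b * ?G b u" 1 u] by simp
  finally show ?thesis unfolding kernel_def .
 qed
 show "A.autocorr s z = (LINT u|patch_measure. kernel H z u s)"
  unfolding 1 using pair_sigma_finite.integral_snd[OF MMp int2] by (simp add: k)
 show "integrable patch_measure (%u. kernel H z u s)"
  using pair_sigma_finite.integrable_snd[OF MMp int2] by (simp add: k)
qed

lemma kernel_eq:
 assumes u: "u \<in> ball u0 r"
 shows "kernel H z u s = (LBINT w. indicator (punctured (3 * r)) w * (bump (4 * CARD('k)) (u + w) * rotheat H z s (dst (u, t) w)))"
proof -
 have [measurable]: "Borel (rotheat H z s)" by (intro borel_measurable_continuous_onI rotheat_continuous(1)[OF H])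
 have p: "(u, 1) \<in> P" using u by (simp add: params_def)
 let ?h = "%w. bump (4 * CARD('k)) (u + w) * rotheat H z s (norm (\<phi>0 (u + w) - \<phi>0 u))"
 have "kernel H z u s = (LBINT w. indicator (punctured (3 * r)) w * ?h w)"
  unfolding kernel_def
 proof (rule integral_cong_AE)
  have "AE w in lborel. w \<noteq> (0::real^'k)" by (rule AE_lborel_singleton)
  then show "AE w in lborel. ?h w = indicator (punctured (3 * r)) w * ?h w"
  proof (rule AE_mp, intro AE_I2 impI)
   fix w :: "real^'k" assume w: "w \<noteq> 0"
   show "?h w = indicator (punctured (3 * r)) w * ?h w"
   proof (cases "w \<in> punctured (3 * r)")
    case False
    then have "norm w \<ge> 3 * r" using w by (auto simp: punctured_def)
    moreover have "norm w \<le> norm (u + w - u0) + norm (u0 - u)"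
     using norm_triangle_ineq[of "u + w - u0" "u0 - u"] by simp
    moreover have "norm (u0 - u) < r" using u by (simp add: dist_norm)
    ultimately have "bump (4 * CARD('k)) (u + w) = 0" using r by (intro bump_zero) linarith
    then show ?thesis by simp
   qed simp
  qed
 qed measurable
 also have "... = (LBINT w. indicator (punctured (3 * r)) w * (bump (4 * CARD('k)) (u + w) * rotheat H z s (dst (u, t) w)))"
 proof (rule Bochner_Integration.integral_cong[OF refl])
  fix w :: "real^'k"
  show "indicator (punctured (3 * r)) w * ?h w = indicator (punctured (3 * r)) w * (bump (4 * CARD('k)) (u + w) * rotheat H z s (dst (u, t) w))"
   using params_shift(1)[OF p, of w] params_shift(2)[OF p] by (cases "w \<in> punctured (3 * r)") (auto simp: \<phi>0_def dst_def)
 qed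
 finally show ?thesis .
qed

text \<open>Integrating the pointwise bound in \<open>z\<close> removes the heat kernel, which has integral one. What remains is
 the integral of \<open>t\<^sup>M / (\<parallel>w\<parallel>\<^sup>2\<^sup>M + t\<^sup>M)\<close> over the \<open>k\<close>-dimensional \<open>w\<close>, a multiple of \<open>t\<close> to the power \<open>k / 2\<close> by scaling.\<close>

lemma patch_cancellation:
 assumes i: "i \<ge> (1::nat)"
 shows "\<exists>C\<ge>0. \<forall>t>0. mass (%z. fdiff (2 * CARD('k)) (%s. averaging.autocorr H patch_measure orbit s z) t (real i * t))
   \<le> ennreal (C * t powr (2 * (real CARD('k) / 4)))"
proof -
 interpret A: averaging H patch_measure orbit by (rule averaging_patch)
 have LL: "pair_sigma_finite (lborel :: (real^'n) measure) (lborel :: (real^'k) measure)" ..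
 let ?K = "CARD('k)" let ?M = "2 * CARD('k)"
 obtain B where "distance_family P (3 * r) (2 * r) snd dst (%p w. chord p w \<bullet> chord p w) slope (min ((7 * c / 8)\<^sup>2) (1 / 2)) B"
  by (rule distance_family)
 then interpret F: distance_family P "3 * r" "2 * r" snd ?M dst "%p w. chord p w \<bullet> chord p w" slope "min ((7 * c / 8)\<^sup>2) (1 / 2)" B .
 have sb: "symbol P (3 * r) (2 * ?M) (%p w. bump (4 * ?K) (fst p + w))" using symbol_bump[of "4 * ?K"] by simp
 obtain C where C: "C \<ge> 0" "\<And>p z i. p \<in> P ==> i \<ge> (1::nat) ==>
  \<bar>fdiff ?M (%s. LINT w|lborel. indicator (punctured (3 * r)) w * (bump (4 * ?K) (fst p + w) * rotheat H z s (dst p w))) (snd p) (real i * snd p)\<bar>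
   \<le> C * (snd p ^ ?M * F.pairing ?M (%_ _. 1) p (rotheat H z (real (?M + 1) * (real i * snd p))))"
  by (rule F.cancellation_pointwise[OF H n sb vanishing_bump]) (rule that)
 define J where "J = (\<integral>\<^sup>+(x::real^'k). ennreal (1 / (1 + norm x ^ (2 * ?M))) \<partial>lborel)"
 have J: "J < \<infinity>" unfolding J_def by (rule nn_integral_inverse_power_finite) simp
 define C' where "C' = C * enn2real J * measure patch_measure (space patch_measure)"
 show ?thesis
 proof (intro exI[of _ C'] conjI allI impI)
  show "C' \<ge> 0" using C by (simp add: C'_def)
  fix t :: real assume t: "t > 0"
  define s' where "s' = real (?M + 1) * (real i * t)"
  have s': "s' > 0" using t i by (simp add: s'_def)
  have it: "real i * t > 0" using t i by simp
  let ?W = "%w::real^'k. ennreal (t ^ ?M / (norm w ^ (2 * ?M) + t ^ ?M))"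
  let ?R = "%z u w. ennreal (rotheat H z s' (norm (\<phi>0 (u + w) - \<phi>0 u)))"
  note Rm = rotheat_measurable_pair[OF H n s']
  have pt: "ennreal \<bar>fdiff ?M (kernel H z u) t (real i * t)\<bar> \<le> ennreal C * (\<integral>\<^sup>+w. ?W w * ?R z u w \<partial>lborel)"
   if u: "u \<in> ball u0 r" for z u
  proof -
   have p: "(u, t) \<in> P" using u t by (simp add: params_def)
   let ?g = "%w. indicator (punctured (3 * r)) w * (weight ?M ?M t w * 1 * rotheat H z s' (dst (u, t) w))"
   have int: "integrable lborel ?g"
    using F.pairing_integrable[OF symbol_const[where m = 0] p rotheat_continuous(1)[OF H], of ?M 1 z s'] by simp
   have g0: "?g w \<ge> 0" for w
    by (intro mult_nonneg_nonneg weight_nonneg t rotheat_nonneg[OF H]) auto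
   have kz: "kernel H z u = (%s. LINT w|lborel. indicator (punctured (3 * r)) w * (bump (4 * ?K) (u + w) * rotheat H z s (dst (u, t) w)))"
    by (rule ext) (rule kernel_eq[OF u])
   have "\<bar>fdiff ?M (kernel H z u) t (real i * t)\<bar> \<le> C * (t ^ ?M * (LBINT w. ?g w))"
    using C(2)[OF p i, of z] unfolding kz F.pairing_def s'_def by simp
   then have "ennreal \<bar>fdiff ?M (kernel H z u) t (real i * t)\<bar> \<le> ennreal (C * (t ^ ?M * (LBINT w. ?g w)))" by (rule ennreal_leI)
   also have "... = ennreal C * ennreal (LBINT w. t ^ ?M * ?g w)"
    using C(1) t by (simp add: ennreal_mult')
   also have "ennreal (LBINT w. t ^ ?M * ?g w) = (\<integral>\<^sup>+w. ennreal (t ^ ?M * ?g w) \<partial>lborel)"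
    using t g0 by (intro nn_integral_eq_integral[symmetric] integrable_mult_right int) auto
   also have "ennreal C * ... \<le> ennreal C * (\<integral>\<^sup>+w. ?W w * ?R z u w \<partial>lborel)"
   proof (intro mult_left_mono nn_integral_mono)
    fix w :: "real^'k"
    show "ennreal (t ^ ?M * ?g w) \<le> ?W w * ?R z u w"
    proof (cases "w \<in> punctured (3 * r)")
     case True
     have "t ^ ?M * ?g w = t ^ ?M / (norm w ^ (2 * ?M) + t ^ ?M) * rotheat H z s' (norm (\<phi>0 (u + w) - \<phi>0 u))"
      using True params_shift(1)[OF p, of w] params_shift(2)[OF p] by (simp add: weight_def \<phi>0_def dst_def power2_norm_eq_inner[symmetric] power_mult)
     moreover have "t ^ ?M / (norm w ^ (2 * ?M) + t ^ ?M) \<ge> 0" using t by simp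
     ultimately show ?thesis by (simp only: ennreal_mult' order_refl)
    qed simp
   qed simp
   finally show ?thesis .
  qed
  have "mass (%z. fdiff ?M (%s. A.autocorr s z) t (real i * t)) \<le>
    (\<integral>\<^sup>+z. \<integral>\<^sup>+u. ennreal C * (\<integral>\<^sup>+w. ?W w * ?R z u w \<partial>lborel) \<partial>patch_measure \<partial>lborel)"
  proof (rule nn_integral_mono)
   fix z :: "real^'n"
   have "fdiff ?M (%s. A.autocorr s z) t (real i * t) = fdiff ?M (%s. LINT u|patch_measure. kernel H z u s) t (real i * t)"
    by (rule fdiff_cong[OF t it]) (rule autocorr_eq(2))
   also have "... = (LINT u|patch_measure. fdiff ?M (kernel H z u) t (real i * t))"
    using fdiff_integral[of patch_measure "kernel H z", OF autocorr_eq(1) t it] by simp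
   finally have "ennreal \<bar>fdiff ?M (%s. A.autocorr s z) t (real i * t)\<bar> \<le> (\<integral>\<^sup>+u. ennreal \<bar>fdiff ?M (kernel H z u) t (real i * t)\<bar> \<partial>patch_measure)"
    using integral_norm_bound_ennreal[of patch_measure "%u. fdiff ?M (kernel H z u) t (real i * t)"]
     fdiff_integral[of patch_measure "kernel H z", OF autocorr_eq(1) t it] by simp
   also have "... \<le> (\<integral>\<^sup>+u. ennreal C * (\<integral>\<^sup>+w. ?W w * ?R z u w \<partial>lborel) \<partial>patch_measure)"
    by (rule nn_integral_mono_AE, rule AE_mp[OF AE_patch_measure], intro AE_I2 impI pt)
   finally show "ennreal \<bar>fdiff ?M (%s. A.autocorr s z) t (real i * t)\<bar> \<le> (\<integral>\<^sup>+u. ennreal C * (\<integral>\<^sup>+w. ?W w * ?R z u w \<partial>lborel) \<partial>patch_measure)" .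
  qed
  also have "... = (\<integral>\<^sup>+u. \<integral>\<^sup>+z. ennreal C * (\<integral>\<^sup>+w. ?W w * ?R z u w \<partial>lborel) \<partial>lborel \<partial>patch_measure)"
  proof (rule A.LM.Fubini'[symmetric])
   have [measurable]: "(%x. ?R (fst (fst x)) (snd (fst x)) (snd x)) \<in> borel_measurable ((lborel \<Otimes>\<^sub>M patch_measure) \<Otimes>\<^sub>M lborel)"
    by (rule Rm) measurable
   show "(%(z, u). ennreal C * (\<integral>\<^sup>+w. ?W w * ?R z u w \<partial>lborel)) \<in> borel_measurable (lborel \<Otimes>\<^sub>M patch_measure)"
    unfolding case_prod_unfold
    by (intro borel_measurable_times_ennreal borel_measurable_const sigma_finite_measure.borel_measurable_nn_integral[OF sigma_finite_lborel])
      (simp add: case_prod_unfold)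
  qed
  also have "... = (\<integral>\<^sup>+u. ennreal (C * enn2real J * t powr (real ?K / 2)) \<partial>patch_measure)"
  proof (rule nn_integral_cong)
   fix u :: "real^'k"
   have m1[measurable]: "(%x. ?R (fst x) u (snd x)) \<in> borel_measurable (leb lborel)"
    by (rule Rm) measurable
   have m2[measurable]: "(%z. ?R z u w) \<in> borel_measurable lborel" for w
    by (rule Rm) measurable
   have "(\<integral>\<^sup>+z. ennreal C * (\<integral>\<^sup>+w. ?W w * ?R z u w \<partial>lborel) \<partial>lborel) = ennreal C * (\<integral>\<^sup>+z. (\<integral>\<^sup>+w. ?W w * ?R z u w \<partial>lborel) \<partial>lborel)"
    by (intro nn_integral_cmult sigma_finite_measure.borel_measurable_nn_integral[OF sigma_finite_lborel]) (simp add: case_prod_unfold)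
   also have "(\<integral>\<^sup>+z. (\<integral>\<^sup>+w. ?W w * ?R z u w \<partial>lborel) \<partial>lborel) = (\<integral>\<^sup>+w. (\<integral>\<^sup>+z. ?W w * ?R z u w \<partial>lborel) \<partial>lborel)"
    by (rule pair_sigma_finite.Fubini'[OF LL, symmetric]) (simp add: case_prod_unfold)
   also have "... = (\<integral>\<^sup>+w. ?W w \<partial>lborel)"
    using nn_integral_rotheat[OF H n s'] by (simp add: nn_integral_cmult[OF m2])
   also have "... = ennreal (t powr (real ?K / 2)) * J"
    unfolding J_def using t by (subst nn_integral_scaled_inverse_power) auto
   also have "J = ennreal (enn2real J)" using J by simp
   finally show "(\<integral>\<^sup>+z. ennreal C * (\<integral>\<^sup>+w. ?W w * ?R z u w \<partial>lborel) \<partial>lborel) = ennreal (C * enn2real J * t powr (real ?K / 2))"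
    using C(1) by (simp add: ennreal_mult'[symmetric] mult_ac)
  qed
  also have "... = ennreal (C * enn2real J * t powr (real ?K / 2)) * ennreal (measure patch_measure (space patch_measure))"
   by (simp add: A.M.emeasure_eq_measure)
  also have "... = ennreal (C' * t powr (2 * (real ?K / 4)))"
   using C(1) by (simp add: C'_def ennreal_mult'[symmetric] mult_ac)
  finally show "mass (%z. fdiff ?M (%s. A.autocorr s z) t (real i * t)) \<le> ennreal (C' * t powr (2 * (real ?K / 4)))" .
 qed
qed

lemma smoothing_averaging_patch:
 assumes k: "CARD('k) < CARD('n)"
 shows "smoothing_averaging H patch_measure orbit ((real CARD('n) - real CARD('k)) / 2) (real CARD('k) / 4)
  ((r\<^sup>2) ^ Suc (4 * CARD('k)) * (gauss_const TYPE(real^'k) / gauss_const TYPE(real^'n) * (4 / c) ^ CARD('k))) CARD('k)"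
proof -
 interpret A: averaging H patch_measure orbit by (rule averaging_patch)
 show ?thesis
 proof
  show "0 < (real CARD('n) - real CARD('k)) / 2" "0 < real CARD('k) / 4" using k by auto
  show "0 \<le> (r\<^sup>2) ^ Suc (4 * CARD('k)) * (gauss_const TYPE(real^'k) / gauss_const TYPE(real^'n) * (4 / c) ^ CARD('k))"
   using c gauss_const_pos[where ?'a = "real^'k"] gauss_const_pos[where ?'a = "real^'n"] by simp
 qed (use patch_size patch_cancellation haar_space[OF H] in auto)
qed

end

end

section \<open>From patches to compact pieces of a surface\<close>

text \<open>The derivative at one point is injective, hence bounded below, and nearby derivatives are close to it.\<close>

lemma patch_exists:
 fixes \<phi> :: "real^'k::finite => real^'n::finite"
 assumes U: "open U" and smooth: "smooth_on \<phi> U" and u: "u \<in> U" and inj: "inj (frechet_derivative \<phi> (at u))"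
 obtains r c L where "patch \<phi> U u r c L"
proof -
 have der: "(\<phi> has_derivative frechet_derivative \<phi> (at x)) (at x)" if "x \<in> U" for x
  using smooth[unfolded smooth_on_def, rule_format, of "Suc 0"] that by (simp add: frechet_derivative_works)
 have lin: "linear (frechet_derivative \<phi> (at x))" if "x \<in> U" for x by (rule has_derivative_linear[OF der[OF that]])
 let ?L = "frechet_derivative \<phi> (at u)"
 obtain c where c: "c > 0" "\<And>v. c * norm v \<le> norm (?L v)"
  by (rule linear_inj_bounded_below_pos[OF lin[OF u] inj]) (rule that)
 define h where "h x = (\<Sum>b\<in>Basis. norm (frechet_derivative \<phi> (at x) b - ?L b))" for x
 have "continuous_on U (%x. frechet_derivative \<phi> (at x) b)" for b
  using smooth[unfolded smooth_on_def, rule_format, of "Suc 0"] by simp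
 then have "continuous_on U h" unfolding h_def[abs_def] by (intro continuous_intros)
 then have "isCont h u" using U u by (simp add: continuous_on_eq_continuous_at)
 then have "(h \<longlongrightarrow> h u) (nhds u)" unfolding isCont_def by (rule tendsto_at_iff_tendsto_nhds[THEN iffD1])
 moreover have "h u < c / 8" using c by (simp add: h_def)
 ultimately have "eventually (%x. h x < c / 8) (nhds u)" by (rule order_tendstoD(2))
 with eventually_nhds_in_open[OF U u] have "eventually (%x. x \<in> U \<and> h x < c / 8) (nhds u)" by (rule eventually_conj)
 then obtain d where d: "d > 0" "\<And>x. dist x u < d ==> x \<in> U \<and> h x < c / 8" by (auto simp: eventually_nhds_metric)
 have in_d: "x \<in> U \<and> h x < c / 8" if "x \<in> cball u (4 * (d / 8))" for x
  using d that by (intro d(2)) (auto simp: dist_commute)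
 show ?thesis
 proof (rule that[of "d / 8" c ?L], rule patch.intro)
  show "cball u (4 * (d / 8)) \<subseteq> U" using in_d by blast
  fix x v assume x: "x \<in> cball u (4 * (d / 8))"
  let ?D = "frechet_derivative \<phi> (at x)"
  have l: "linear (%v. ?D v - ?L v)" using lin u in_d[OF x] by (intro linear_compose_sub) auto
  have "?D v - ?L v = ?D (\<Sum>b\<in>Basis. (v \<bullet> b) *\<^sub>R b) - ?L (\<Sum>b\<in>Basis. (v \<bullet> b) *\<^sub>R b)" by (simp add: euclidean_representation)
  also have "... = (\<Sum>b\<in>Basis. (v \<bullet> b) *\<^sub>R (?D b - ?L b))" by (simp add: linear_sum[OF l] linear_scale[OF l])
  also have "norm ... \<le> (\<Sum>b\<in>Basis. norm v * norm (?D b - ?L b))"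
  proof (rule sum_norm_le)
   fix b :: "real^'k" assume b: "b \<in> Basis"
   show "norm ((v \<bullet> b) *\<^sub>R (?D b - ?L b)) \<le> norm v * norm (?D b - ?L b)"
    using Basis_le_norm[OF b, of v] by (simp add: mult_right_mono)
  qed
  also have "... = h x * norm v" by (simp add: h_def sum_distrib_left mult.commute)
  also have "... \<le> c / 8 * norm v" using in_d[OF x] by (intro mult_right_mono) auto
  finally show "norm (?D v - ?L v) \<le> c / 8 * norm v" .
 qed (use U smooth c d lin[OF u] in auto)
qed

lemma continuous_area_element:
 fixes \<phi> :: "real^'k::finite => real^'n::finite"
 assumes smooth: "smooth_on \<phi> U"
 shows "continuous_on U (area_element \<phi>)"
proof -
 have "continuous_on U (%x. frechet_derivative \<phi> (at x) b)" for b
  using smooth[unfolded smooth_on_def, rule_format, of "Suc 0"] by simp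
 then have *: "continuous_on U (%x. frechet_derivative \<phi> (at x) b $ i)" for b i by (rule continuous_on_component)
 show ?thesis
  unfolding area_element_def[abs_def] Let_def jacobian_def det_def matrix_matrix_mult_def transpose_def matrix_def
  by (simp, intro continuous_intros *)
qed

abbreviation (input) convolution_energy ::
 "(real^'n::finite^'n) measure => (real^'n) measure => (real^'n => complex) => real => (real^'n => complex) => ennreal" where
 "convolution_energy H \<sigma> \<psi> q f \<equiv>
  \<integral>\<^sup>+\<theta>. (\<integral>\<^sup>+x. ennreal (norm (convolve f (rotated_measure \<theta> (weighted_measure \<sigma> \<psi>)) x) powr q) \<partial>lborel) \<partial>H"

text \<open>The strong type inequality for the part of the surface in \<open>E\<close>. The majorant \<open>\<Phi>\<close> takes
 the place of the \<open>q\<close>-th power of an integral that may be infinite at some points.\<close>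

definition rotation_bound ::
 "(real^'n::finite^'n) measure => (real^'n) measure => real => real => (real^'n) set => real => bool" where
 "rotation_bound H \<sigma> p q E C \<longleftrightarrow> (\<forall>F\<in>borel_measurable borel. (\<forall>x. F x \<ge> (0::real)) --> integrable lborel (%x. F x powr p) -->
   (\<exists>\<Phi>\<in>borel_measurable (leb H).
    (\<integral>\<^sup>+n. \<Phi> n \<partial>(leb H)) \<le> ennreal (C * (LBINT x. F x powr p) powr (q / p)) \<and>
    (\<forall>\<theta>\<in>SO. \<forall>x. \<forall>u\<ge>0. ennreal u \<le> (\<integral>\<^sup>+y. ennreal (F (x - transpose \<theta> *v y)) * indicator E y \<partial>\<sigma>)
     --> ennreal (u powr q) \<le> \<Phi> (\<theta>, x))))"

context patch
begin

definition piece :: "(real^'n) set" where "piece = \<phi> ` cball u0 (r / 2)"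

lemma piece_ball: "cball u0 (r / 2) \<subseteq> ball u0 (4 * r)" "cball u0 (r / 2) \<subseteq> U"
 using r U(2) by (auto intro: subsetD[OF U(2)])

lemma compact_piece: "compact piece"
 unfolding piece_def using piece_ball(2) by (intro compact_continuous_image continuous_on_subset[OF \<phi>_continuous]) auto

lemma piece_borel [measurable]: "piece \<in> sets borel"
 by (intro borel_closed compact_imp_closed compact_piece)

text \<open>On the piece the area element is bounded above and the bump function is bounded below.\<close>

lemma surface_measure_le:
 assumes \<sigma>: "induced_surface_measure TYPE('k) S \<sigma>" and lp: "local_param S U \<phi>"
 obtains C where "C > 0" "\<And>g :: real^'n => ennreal. g \<in> borel_measurable borel ==>
  (\<integral>\<^sup>+y. g y * indicator piece y \<partial>\<sigma>) \<le> ennreal C * (\<integral>\<^sup>+u. g (\<phi>0 u) \<partial>patch_measure)"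
proof -
 let ?B = "cball u0 (r / 2)" and ?m = "4 * CARD('k)"
 have sets_\<sigma> [simp, measurable_cong]: "sets \<sigma> = sets borel" using \<sigma> by (simp add: induced_surface_measure_def)
 have "continuous_on ?B (area_element \<phi>)"
  using continuous_area_element[OF smooth] piece_ball(2) by (rule continuous_on_subset)
 from compact_imp_bounded[OF compact_continuous_image[OF this compact_cball]]
 obtain a0 where a0: "\<forall>x\<in>area_element \<phi> ` ?B. norm x \<le> a0" by (auto simp: bounded_iff)
 define a where "a = max 1 a0"
 have a: "a > 0" "\<And>u. u \<in> ?B ==> area_element \<phi> u \<le> a" using a0 by (auto simp: a_def le_max_iff_disj intro: order_trans[OF abs_ge_self])
 define \<epsilon> where "\<epsilon> = (3 / 4 * r\<^sup>2) ^ Suc ?m"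
 have \<epsilon>: "\<epsilon> > 0" using r unfolding \<epsilon>_def by (intro zero_less_power) simp
 have bump_ge: "bump ?m u \<ge> \<epsilon>" if "u \<in> ?B" for u
 proof -
  have "(norm (u - u0))\<^sup>2 \<le> (r / 2)\<^sup>2" using that by (intro power_mono) (auto simp: dist_norm norm_minus_commute)
  then have "3 / 4 * r\<^sup>2 \<le> max 0 (r\<^sup>2 - (norm (u - u0))\<^sup>2)"
   by (intro order_trans[OF _ max.cobounded2]) (simp add: power_divide)
  then show ?thesis unfolding \<epsilon>_def bump_def by (intro power_mono) auto
 qed
 have inj: "inj_on \<phi> U" using lp unfolding local_param_def by (metis homeomorphism_def inj_on_inverseI)
 have \<sigma>_eq: "emeasure \<sigma> A = (\<integral>\<^sup>+u\<in>{u\<in>U. \<phi> u \<in> A}. ennreal (area_element \<phi> u) \<partial>lborel)"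
  if "A \<in> sets borel" "A \<subseteq> \<phi> ` U" for A
  using \<sigma> lp that unfolding induced_surface_measure_def by blast
 have [measurable]: "(%u. ennreal a * indicator ?B u) \<in> borel_measurable lborel"
  by (auto intro!: borel_measurable_times_ennreal borel_measurable_indicator)
 define N where "N = distr (density lborel (%u. ennreal a * indicator ?B u)) borel \<phi>0"
 have dom: "density \<sigma> (indicator piece) \<le> N"
 proof (rule le_measure[THEN iffD2])
  show "sets (density \<sigma> (indicator piece)) = sets N" by (simp add: N_def)
  show "\<forall>A\<in>sets (density \<sigma> (indicator piece)). emeasure (density \<sigma> (indicator piece)) A \<le> emeasure N A"
  proof
   fix A assume "A \<in> sets (density \<sigma> (indicator piece))"
   then have A[measurable]: "A \<in> sets borel" by simp
   have "emeasure (density \<sigma> (indicator piece)) A = emeasure \<sigma> (piece \<inter> A)"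
    by (rule emeasure_restricted) simp_all
   also have "... = (\<integral>\<^sup>+u\<in>{u\<in>U. \<phi> u \<in> piece \<inter> A}. ennreal (area_element \<phi> u) \<partial>lborel)"
    by (rule \<sigma>_eq) (use piece_ball(2) in \<open>auto simp: piece_def[symmetric], auto simp: piece_def\<close>)
   also have "... \<le> (\<integral>\<^sup>+u. (ennreal a * indicator ?B u) * indicator (\<phi>0 -` A \<inter> space lborel) u \<partial>lborel)"
   proof (rule nn_integral_mono)
    fix u
    show "ennreal (area_element \<phi> u) * indicator {u\<in>U. \<phi> u \<in> piece \<inter> A} u \<le>
      (ennreal a * indicator ?B u) * indicator (\<phi>0 -` A \<inter> space lborel) u"
    proof (cases "u \<in> {u\<in>U. \<phi> u \<in> piece \<inter> A}")
     case True
     then obtain u' where u': "u' \<in> ?B" "\<phi> u = \<phi> u'" by (auto simp: piece_def)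
     then have "u = u'" using inj True piece_ball(2) by (auto dest: inj_onD)
     then have u: "u \<in> ?B" using u' by simp
     then have "\<phi>0 u = \<phi> u" using piece_ball(1) by (intro \<phi>0_eq) auto
     then show ?thesis using True u a(2)[OF u] by (simp add: ennreal_leI)
    qed simp
   qed
   also have "... = emeasure N A"
   proof -
    have "\<phi>0 -` A \<in> sets borel" using measurable_sets[OF \<phi>0_measurable A] by simp
    then show ?thesis unfolding N_def by (subst emeasure_distr) (simp_all add: emeasure_density)
   qed
   finally show "emeasure (density \<sigma> (indicator piece)) A \<le> emeasure N A" .
  qed
 qed
 show ?thesis
 proof (rule that[of "a / \<epsilon>"])
  show "a / \<epsilon> > 0" using a \<epsilon> by simp
  fix g :: "real^'n => ennreal" assume g[measurable]: "Borel g"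
  have "(\<integral>\<^sup>+y. g y * indicator piece y \<partial>\<sigma>) = (\<integral>\<^sup>+y. g y \<partial>density \<sigma> (indicator piece))"
   by (subst nn_integral_density) (auto simp: mult.commute)
  also have "... \<le> (\<integral>\<^sup>+y. g y \<partial>N)" by (rule nn_integral_mono_measure) (simp_all add: dom, simp add: N_def)
  also have "... = (\<integral>\<^sup>+u. ennreal a * indicator ?B u * g (\<phi>0 u) \<partial>lborel)"
   unfolding N_def by (subst nn_integral_distr, simp, simp, subst nn_integral_density, measurable)
  also have "... \<le> (\<integral>\<^sup>+u. ennreal (a / \<epsilon>) * (ennreal (bump ?m u) * g (\<phi>0 u)) \<partial>lborel)"
  proof (rule nn_integral_mono)
   fix u
   show "ennreal a * indicator ?B u * g (\<phi>0 u) \<le> ennreal (a / \<epsilon>) * (ennreal (bump ?m u) * g (\<phi>0 u))"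
   proof (cases "u \<in> ?B")
    case True
    have "a \<le> a / \<epsilon> * bump ?m u" using mult_left_mono[OF bump_ge[OF True], of "a / \<epsilon>"] a(1) \<epsilon> by simp
    then have "ennreal a \<le> ennreal (a / \<epsilon>) * ennreal (bump ?m u)"
     using a(1) \<epsilon> bump_nonneg by (subst ennreal_mult[symmetric]) (auto intro: ennreal_leI)
    from mult_right_mono[OF this, of "g (\<phi>0 u)"] show ?thesis using True by (simp add: mult.assoc)
   qed simp
  qed
  also have "... = ennreal (a / \<epsilon>) * (\<integral>\<^sup>+u. g (\<phi>0 u) \<partial>patch_measure)"
   unfolding patch_measure_def by (subst nn_integral_cmult) (simp_all add: nn_integral_density)
  finally show "(\<integral>\<^sup>+y. g y * indicator piece y \<partial>\<sigma>) \<le> ennreal (a / \<epsilon>) * (\<integral>\<^sup>+u. g (\<phi>0 u) \<partial>patch_measure)" .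
 qed
qed

lemma rotation_bounded_piece:
 assumes H: "haar_SO H" and n: "CARD('n) \<ge> 2" and k: "CARD('k) < CARD('n)"
  and \<sigma>: "induced_surface_measure TYPE('k) S \<sigma>" and lp: "local_param S U \<phi>"
  and p: "p = (2 * real CARD('n) - real CARD('k)) / real CARD('n)"
  and q: "q = (2 * real CARD('n) - real CARD('k)) / (real CARD('n) - real CARD('k))"
 obtains C where "C \<ge> 0" "rotation_bound H \<sigma> p q piece C"
proof -
 interpret A: smoothing_averaging H patch_measure orbit "(real CARD('n) - real CARD('k)) / 2" "real CARD('k) / 4"
  "(r\<^sup>2) ^ Suc (4 * CARD('k)) * (gauss_const TYPE(real^'k) / gauss_const TYPE(real^'n) * (4 / c) ^ CARD('k))" "CARD('k)"
  by (rule smoothing_averaging_patch[OF H n k])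
 have pe: "A.pexp = p"
  using k unfolding A.pexp_def p by (simp add: field_simps)
 have p1: "p - 1 = (real CARD('n) - real CARD('k)) / real CARD('n)" using k unfolding p by (simp add: field_simps)
 have qe: "A.qexp = q"
  using k unfolding A.qexp_def pe p1 unfolding p q by simp
 have q0: "q > 0" using k unfolding q by simp
 obtain C1 where C1: "C1 > 0" "\<And>g :: real^'n => ennreal. g \<in> borel_measurable borel ==>
  (\<integral>\<^sup>+y. g y * indicator piece y \<partial>\<sigma>) \<le> ennreal C1 * (\<integral>\<^sup>+u. g (\<phi>0 u) \<partial>patch_measure)"
  by (rule surface_measure_le[OF \<sigma> lp]) (rule that)
 obtain C where C: "C \<ge> 0" "\<And>f. f \<in> borel_measurable borel ==> (\<And>x. f x \<ge> 0) ==> integrable lborel (%x. f x powr p) ==>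
  \<exists>\<Phi>\<in>borel_measurable (leb H).
   (\<integral>\<^sup>+n. \<Phi> n \<partial>(leb H)) \<le> ennreal (C * (LBINT x. f x powr p) powr (q / p)) \<and>
   (\<forall>\<theta>\<in>space H. \<forall>x. \<forall>u\<ge>0. ennreal u \<le> (\<integral>\<^sup>+b. ennreal (f (x - orbit \<theta> b)) \<partial>patch_measure) --> ennreal (u powr q) \<le> \<Phi> (\<theta>, x))"
  by (rule A.strong_type[unfolded pe qe]) blast
 show ?thesis
 proof (rule that[of "C1 powr q * C"], unfold rotation_bound_def, goal_cases)
  case 1 show ?case using C(1) by simp
 next
  case 2 show ?case
 proof (intro ballI impI)
  fix F :: "real^'n => real" assume F[measurable]: "Borel F" and F0: "\<forall>x. F x \<ge> 0" and Fi: "integrable lborel (%x. F x powr p)"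
  obtain \<Phi> where \<Phi>[measurable]: "\<Phi> \<in> borel_measurable (leb H)"
   "(\<integral>\<^sup>+n. \<Phi> n \<partial>(leb H)) \<le> ennreal (C * (LBINT x. F x powr p) powr (q / p))"
   "\<forall>\<theta>\<in>space H. \<forall>x. \<forall>u\<ge>0. ennreal u \<le> (\<integral>\<^sup>+b. ennreal (F (x - orbit \<theta> b)) \<partial>patch_measure) --> ennreal (u powr q) \<le> \<Phi> (\<theta>, x)"
   using C(2)[OF F _ Fi] F0 by blast
  let ?\<Phi> = "%n. ennreal (C1 powr q) * \<Phi> n"
  show "\<exists>\<Phi>\<in>borel_measurable (leb H).
    (\<integral>\<^sup>+n. \<Phi> n \<partial>(leb H)) \<le> ennreal (C1 powr q * C * (LBINT x. F x powr p) powr (q / p)) \<and>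
    (\<forall>\<theta>\<in>SO. \<forall>x. \<forall>u\<ge>0. ennreal u \<le> (\<integral>\<^sup>+y. ennreal (F (x - transpose \<theta> *v y)) * indicator piece y \<partial>\<sigma>)
     --> ennreal (u powr q) \<le> \<Phi> (\<theta>, x))"
  proof (intro bexI[of _ ?\<Phi>] conjI ballI allI impI)
   show "?\<Phi> \<in> borel_measurable (leb H)" by measurable
   have "(\<integral>\<^sup>+n. ?\<Phi> n \<partial>(leb H)) = ennreal (C1 powr q) * (\<integral>\<^sup>+n. \<Phi> n \<partial>(leb H))"
    by (rule nn_integral_cmult) measurable
   also have "... \<le> ennreal (C1 powr q) * ennreal (C * (LBINT x. F x powr p) powr (q / p))"
    by (intro mult_left_mono \<Phi>(2)) simp
   also have "... = ennreal (C1 powr q * C * (LBINT x. F x powr p) powr (q / p))"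
    using C(1) by (simp add: ennreal_mult'[symmetric] mult.assoc)
   finally show "(\<integral>\<^sup>+n. ?\<Phi> n \<partial>(leb H)) \<le> ennreal (C1 powr q * C * (LBINT x. F x powr p) powr (q / p))" .
   fix \<theta> :: "real^'n^'n" and x and u :: real
   assume th: "\<theta> \<in> SO" and u: "u \<ge> 0" and le: "ennreal u \<le> (\<integral>\<^sup>+y. ennreal (F (x - transpose \<theta> *v y)) * indicator piece y \<partial>\<sigma>)"
   have [measurable]: "Borel (%y. transpose \<theta> *v y)"
    by (intro borel_measurable_continuous_onI linear_continuous_on matrix_vector_mul_bounded_linear)
   have "ennreal u \<le> ennreal C1 * (\<integral>\<^sup>+b. ennreal (F (x - orbit \<theta> b)) \<partial>patch_measure)"
    unfolding orbit_def by (rule order_trans[OF le C1(2)]) measurable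
   also have "ennreal u = ennreal C1 * ennreal (u / C1)" using C1(1) u by (simp add: ennreal_mult'[symmetric])
   finally have "ennreal (u / C1) \<le> (\<integral>\<^sup>+b. ennreal (F (x - orbit \<theta> b)) \<partial>patch_measure)"
    using C1(1) by (simp add: ennreal_mult_le_mult_iff)
   then have "ennreal ((u / C1) powr q) \<le> \<Phi> (\<theta>, x)" using \<Phi>(3) th haar_space[OF H] u C1(1) by simp
   from mult_left_mono[OF this, of "ennreal (C1 powr q)"]
   show "ennreal (u powr q) \<le> ?\<Phi> (\<theta>, x)"
    using u C1(1) by (simp add: ennreal_mult'[symmetric] powr_divide)
  qed
 qed
 qed
qed

end

section \<open>The sum over the pieces\<close>

lemma matrix_inv_SO: "\<theta> \<in> SO ==> matrix_inv \<theta> = transpose \<theta>"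
proof -
 assume th: "\<theta> \<in> SO"
 have inv: "\<theta> ** matrix_inv \<theta> = mat 1 \<and> matrix_inv \<theta> ** \<theta> = mat 1"
  unfolding matrix_inv_def by (rule someI[of _ "transpose \<theta>"]) (simp add: SO_transpose_mult[OF th])
 have "matrix_inv \<theta> = matrix_inv \<theta> ** (\<theta> ** transpose \<theta>)" using SO_transpose_mult[OF th] by simp
 also have "... = transpose \<theta>" using inv by (simp add: matrix_mul_assoc)
 finally show ?thesis .
qed

lemma norm_integral_le_nn_integral:
 fixes f :: "'x => 'y::{banach, second_countable_topology}"
 shows "ennreal (norm (LINT x|N. f x)) \<le> (\<integral>\<^sup>+x. ennreal (norm (f x)) \<partial>N)"
 by (cases "integrable N f") (auto simp: not_integrable_integral_eq intro: integral_norm_bound_ennreal)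

text \<open>The density is nonzero only on a compact subset of the surface, each point of which is interior,
 relative to the surface, to a piece.\<close>

lemma finite_cover_pieces:
 fixes S :: "(real^'n::finite) set" and \<psi> :: "real^'n => complex"
 assumes S: "smooth_surface TYPE('k::finite) S" and \<sigma>: "induced_surface_measure TYPE('k) S \<sigma>"
  and \<psi>: "smooth_density TYPE('k) S \<psi>" and H: "haar_SO H" and n: "CARD('n) \<ge> 2" and k: "CARD('k) < CARD('n)"
  and p: "p = (2 * real CARD('n) - real CARD('k)) / real CARD('n)"
  and q: "q = (2 * real CARD('n) - real CARD('k)) / (real CARD('n) - real CARD('k))"
 obtains \<E> where "finite \<E>" "\<And>E. E \<in> \<E> ==> E \<in> sets borel \<and> bounded (\<psi> ` E) \<and> (\<exists>C\<ge>0. rotation_bound H \<sigma> p q E C)"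
  "\<And>y. \<psi> y \<noteq> 0 ==> y \<in> \<Union>\<E>"
proof -
 obtain K where K: "compact K" "K \<subseteq> S" "\<And>x. x \<notin> K ==> \<psi> x = 0" using \<psi> by (auto simp: smooth_density_def)
 have "\<forall>y\<in>K. \<exists>E T. open T \<and> y \<in> T \<and> S \<inter> T \<subseteq> E \<and> E \<in> sets borel \<and> bounded (\<psi> ` E) \<and> (\<exists>C\<ge>0. rotation_bound H \<sigma> p q E C)"
 proof
  fix y assume "y \<in> K"
  then obtain U and \<phi> :: "real^'k => real^'n" where lp: "local_param S U \<phi>" and y: "y \<in> \<phi> ` U"
   using S K(2) unfolding smooth_surface_def by blast
  then obtain u where u: "u \<in> U" "y = \<phi> u" by auto
  have U: "open U" "smooth_on \<phi> U" "inj (frechet_derivative \<phi> (at u))" using lp u by (auto simp: local_param_def)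
  obtain r c L where "patch \<phi> U u r c L" by (rule patch_exists[OF U(1,2) u(1) U(3)])
  then interpret patch \<phi> U u r c L .
  obtain g where g: "homeomorphism U (\<phi> ` U) \<phi> g" using lp by (auto simp: local_param_def)
  have sub: "ball u (r / 2) \<subseteq> U" using piece_ball(2) ball_subset_cball by blast
  have "openin (top_of_set U) (ball u (r / 2))" using sub by (intro open_subset) auto
  from homeomorphism_imp_open_map[OF g this] have "openin (top_of_set (\<phi> ` U)) (\<phi> ` ball u (r / 2))" .
  moreover have "openin (top_of_set S) (\<phi> ` U)" using lp by (simp add: local_param_def)
  ultimately have "openin (top_of_set S) (\<phi> ` ball u (r / 2))" by (rule openin_trans)
  then obtain T where T: "open T" "\<phi> ` ball u (r / 2) = S \<inter> T" by (auto simp: openin_open)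
  have "S \<inter> T \<subseteq> piece" unfolding T(2)[symmetric] piece_def using ball_subset_cball by blast
  moreover have "y \<in> T" using T(2) u r by (metis IntD2 centre_in_ball half_gt_zero imageI)
  moreover have "bounded (\<psi> ` piece)"
  proof -
   have "smooth_on (\<psi> \<circ> \<phi>) U" using \<psi> lp by (simp add: smooth_density_def)
   then have "continuous_on U (\<psi> \<circ> \<phi>)" unfolding smooth_on_def using Cm_on.simps(1) by blast
   then have "compact ((\<psi> \<circ> \<phi>) ` cball u (r / 2))"
    using piece_ball(2) by (intro compact_continuous_image) (auto intro: continuous_on_subset)
   then show ?thesis by (simp add: piece_def image_comp compact_imp_bounded)
  qed
  ultimately show "\<exists>E T. open T \<and> y \<in> T \<and> S \<inter> T \<subseteq> E \<and> E \<in> sets borel \<and> bounded (\<psi> ` E) \<and> (\<exists>C\<ge>0. rotation_bound H \<sigma> p q E C)"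
   using T(1) piece_borel rotation_bounded_piece[OF H n k \<sigma> lp p q] by metis
 qed
 then obtain E T where ET: "\<And>y. y \<in> K ==> open (T y)" "\<And>y. y \<in> K ==> y \<in> T y" "\<And>y. y \<in> K ==> S \<inter> T y \<subseteq> E y"
  "\<And>y. y \<in> K ==> E y \<in> sets borel \<and> bounded (\<psi> ` E y) \<and> (\<exists>C\<ge>0. rotation_bound H \<sigma> p q (E y) C)"
  by metis
 obtain D where D: "D \<subseteq> K" "finite D" "K \<subseteq> (\<Union>y\<in>D. T y)"
  by (rule compactE_image[OF K(1), of K T]) (use ET(1,2) in auto)
 show ?thesis
 proof (rule that[of "E ` D"])
  show "finite (E ` D)" using D by simp
  show "E' \<in> sets borel \<and> bounded (\<psi> ` E') \<and> (\<exists>C\<ge>0. rotation_bound H \<sigma> p q E' C)" if "E' \<in> E ` D" for E' using that ET(4) D(1) by auto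
  show "y \<in> \<Union>(E ` D)" if "\<psi> y \<noteq> 0" for y
  proof -
   have y: "y \<in> K" using that K(3) by blast
   then obtain z where z: "z \<in> D" "y \<in> T z" using D(3) by blast
   moreover have "y \<in> S \<inter> T z" "z \<in> K" using y z K(2) D(1) by auto
   ultimately show ?thesis using ET(3)[of z] by (intro UnionI[of "E z"]) auto
  qed
 qed
qed

text \<open>A sum of \<open>N\<close> terms is at most \<open>N\<close> times its largest term, so at each \<open>(\<theta>, x)\<close> the bound for a
 single piece applies.\<close>

lemma convolution_bound:
 fixes \<psi> :: "real^'n::finite => complex"
 assumes H: "haar_SO H" and sets_\<sigma>: "sets \<sigma> = sets borel" and q0: "q > 0"
  and fin: "finite \<E>" and \<E>: "\<And>E. E \<in> \<E> ==> E \<in> sets borel \<and> bounded (\<psi> ` E) \<and> (\<exists>C\<ge>0. rotation_bound H \<sigma> p q E C)"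
  and cover: "\<And>y. \<psi> y \<noteq> 0 ==> y \<in> \<Union>\<E>"
 obtains C where "C \<ge> 0" "\<And>f :: real^'n => complex. f \<in> borel_measurable borel ==> integrable lborel (%y. norm (f y) powr p) ==>
  convolution_energy H \<sigma> \<psi> q f
   \<le> ennreal (C * (LBINT y. norm (f y) powr p) powr (q / p))"
proof -
 interpret H: finite_measure H by (rule haar_finite[OF H])
 note [simp, measurable_cong] = sets_\<sigma>
 have "bounded (\<Union>E\<in>\<E>. \<psi> ` E)" using fin \<E> by (intro bounded_UN) auto
 then obtain B0 where B0: "\<forall>z\<in>(\<Union>E\<in>\<E>. \<psi> ` E). norm z \<le> B0" by (auto simp: bounded_iff)
 define B where "B = max 1 B0 * (real (card \<E>) + 1)"
 have B: "B > 0" by (simp add: B_def)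
 have "\<forall>E\<in>\<E>. \<exists>C\<ge>0. rotation_bound H \<sigma> p q E C" using \<E> by blast
 then obtain C where C: "\<And>E. E \<in> \<E> ==> C E \<ge> 0" "\<And>E. E \<in> \<E> ==> rotation_bound H \<sigma> p q E (C E)"
  by metis
 show ?thesis
 proof (rule that[of "B powr q * (\<Sum>E\<in>\<E>. C E)"])
  show "B powr q * (\<Sum>E\<in>\<E>. C E) \<ge> 0" using C(1) by (intro mult_nonneg_nonneg sum_nonneg) auto
  fix f :: "real^'n => complex" assume f[measurable]: "Borel f" and fi: "integrable lborel (%y. norm (f y) powr p)"
  let ?I = "(LBINT y. norm (f y) powr p) powr (q / p)"
  let ?X = "%\<theta> x E. \<integral>\<^sup>+y. ennreal (norm (f (x - transpose \<theta> *v y))) * indicator E y \<partial>\<sigma>"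
  have "\<exists>\<Phi>\<in>borel_measurable (leb H). (\<integral>\<^sup>+n. \<Phi> n \<partial>(leb H)) \<le> ennreal (C E * ?I) \<and>
    (\<forall>\<theta>\<in>SO. \<forall>x. \<forall>u\<ge>0. ennreal u \<le> ?X \<theta> x E --> ennreal (u powr q) \<le> \<Phi> (\<theta>, x))" if "E \<in> \<E>" for E
   using C(2)[OF that, unfolded rotation_bound_def, rule_format, of "%x. norm (f x)"] fi by simp
  then obtain \<Phi> where \<Phi>: "\<And>E. E \<in> \<E> ==> \<Phi> E \<in> borel_measurable (leb H)" "\<And>E. E \<in> \<E> ==> (\<integral>\<^sup>+n. \<Phi> E n \<partial>(leb H)) \<le> ennreal (C E * ?I)"
   "\<And>E \<theta> x u. E \<in> \<E> ==> \<theta> \<in> SO ==> u \<ge> 0 ==> ennreal u \<le> ?X \<theta> x E ==> ennreal (u powr q) \<le> \<Phi> E (\<theta>, x)"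
   using bchoice[of \<E> "%E \<Phi>. \<Phi> \<in> borel_measurable (leb H) \<and> (\<integral>\<^sup>+n. \<Phi> n \<partial>(leb H)) \<le> ennreal (C E * ?I) \<and>
    (\<forall>\<theta>\<in>SO. \<forall>x. \<forall>u\<ge>0. ennreal u \<le> ?X \<theta> x E --> ennreal (u powr q) \<le> \<Phi> (\<theta>, x))"] by blast
  have main: "ennreal (norm (convolve f (rotated_measure \<theta> (weighted_measure \<sigma> \<psi>)) x) powr q) \<le> ennreal (B powr q) * (\<Sum>E\<in>\<E>. \<Phi> E (\<theta>, x))"
   if th: "\<theta> \<in> SO" for \<theta> x
  proof -
   define u where "u = norm (convolve f (rotated_measure \<theta> (weighted_measure \<sigma> \<psi>)) x)"
   have u0: "u \<ge> 0" by (simp add: u_def)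
   have [measurable]: "Borel (%y. transpose \<theta> *v y)"
    by (intro borel_measurable_continuous_onI linear_continuous_on matrix_vector_mul_bounded_linear)
   have \<psi>: "ennreal (norm (\<psi> y)) \<le> ennreal (max 1 B0) * (\<Sum>E\<in>\<E>. indicator E y)" for y
   proof (cases "\<psi> y = 0")
    case False
    then obtain E where E: "E \<in> \<E>" "y \<in> E" using cover by auto
    have "ennreal (norm (\<psi> y)) \<le> ennreal (max 1 B0)" using B0 E by (intro ennreal_leI) (auto simp: le_max_iff_disj)
    moreover have "(1::ennreal) \<le> (\<Sum>E\<in>\<E>. indicator E y)"
     using member_le_sum[OF E(1), of "%E. indicator E y :: ennreal"] fin E by simp
    ultimately show ?thesis using mult_mono[of "ennreal (norm (\<psi> y))" "ennreal (max 1 B0)" 1 "\<Sum>E\<in>\<E>. indicator E y"] by simp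
   qed simp
   have "ennreal u \<le> (\<integral>\<^sup>+y. ennreal (norm (f (x - transpose \<theta> *v y) * \<psi> y)) \<partial>\<sigma>)"
    unfolding u_def convolve_def rotated_measure_def weighted_measure_def matrix_inv_SO[OF th]
    by (rule norm_integral_le_nn_integral)
   also have "... \<le> (\<integral>\<^sup>+y. ennreal (max 1 B0) * (\<Sum>E\<in>\<E>. ennreal (norm (f (x - transpose \<theta> *v y))) * indicator E y) \<partial>\<sigma>)"
   proof (rule nn_integral_mono)
    fix y
    from mult_left_mono[OF \<psi>, of "ennreal (norm (f (x - transpose \<theta> *v y)))" y]
    show "ennreal (norm (f (x - transpose \<theta> *v y) * \<psi> y)) \<le> ennreal (max 1 B0) * (\<Sum>E\<in>\<E>. ennreal (norm (f (x - transpose \<theta> *v y))) * indicator E y)"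
     by (simp add: norm_mult ennreal_mult' sum_distrib_left sum_distrib_right mult_ac)
   qed
   also have "... = ennreal (max 1 B0) * (\<Sum>E\<in>\<E>. ?X \<theta> x E)"
   proof -
    have [measurable]: "E \<in> sets \<sigma>" if "E \<in> \<E>" for E using \<E>[OF that] by simp
    have "(%y. ennreal (norm (f (x - transpose \<theta> *v y))) * indicator E y) \<in> borel_measurable \<sigma>" if "E \<in> \<E>" for E
     using that by measurable
    then show ?thesis by (subst nn_integral_cmult) (auto simp: nn_integral_sum)
   qed
   finally have le: "ennreal u \<le> ennreal (max 1 B0) * (\<Sum>E\<in>\<E>. ?X \<theta> x E)" .
   show ?thesis
   proof (cases "\<E> = {}")
    case True
    then have "u = 0" using le u0 by simp
    then show ?thesis unfolding u_def[symmetric] by simp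
   next
    case False
    then have "Max (?X \<theta> x ` \<E>) \<in> ?X \<theta> x ` \<E>" using fin by (intro Max_in) auto
    then obtain E where E: "E \<in> \<E>" "?X \<theta> x E = Max (?X \<theta> x ` \<E>)" by auto
    have "(\<Sum>E\<in>\<E>. ?X \<theta> x E) \<le> of_nat (card \<E>) * ?X \<theta> x E"
     unfolding E(2) using fin by (intro sum_bounded_above Max_ge) auto
    also have "... \<le> ennreal (real (card \<E>) + 1) * ?X \<theta> x E"
     by (intro mult_right_mono) (auto simp: ennreal_of_nat_eq_real_of_nat intro!: ennreal_leI)
    finally have "ennreal u \<le> ennreal (max 1 B0) * (ennreal (real (card \<E>) + 1) * ?X \<theta> x E)"
     by (intro order_trans[OF le] mult_left_mono) auto
    then have "ennreal u \<le> ennreal B * ?X \<theta> x E"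
     unfolding B_def by (simp add: ennreal_mult mult.assoc)
    moreover have "ennreal u = ennreal B * ennreal (u / B)" using B u0 by (simp add: ennreal_mult'[symmetric])
    ultimately have "ennreal (u / B) \<le> ?X \<theta> x E" using B by (simp add: ennreal_mult_le_mult_iff)
    then have "ennreal ((u / B) powr q) \<le> \<Phi> E (\<theta>, x)" using \<Phi>(3)[OF E(1) th] u0 B by simp
    also have "... \<le> (\<Sum>E\<in>\<E>. \<Phi> E (\<theta>, x))" using member_le_sum[OF E(1), of "%E. \<Phi> E (\<theta>, x)"] fin by simp
    finally have "ennreal (B powr q) * ennreal ((u / B) powr q) \<le> ennreal (B powr q) * (\<Sum>E\<in>\<E>. \<Phi> E (\<theta>, x))"
     by (intro mult_left_mono) auto
    then show ?thesis unfolding u_def[symmetric] using u0 B by (simp add: ennreal_mult'[symmetric] powr_divide)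
   qed
  qed
  note [measurable] = \<Phi>(1)
  have ms: "(%n. \<Sum>E\<in>\<E>. \<Phi> E n) \<in> borel_measurable (leb H)" by (intro borel_measurable_sum \<Phi>(1))
  have "convolution_energy H \<sigma> \<psi> q f
   \<le> (\<integral>\<^sup>+\<theta>. (\<integral>\<^sup>+x. ennreal (B powr q) * (\<Sum>E\<in>\<E>. \<Phi> E (\<theta>, x)) \<partial>lborel) \<partial>H)"
   using haar_space[OF H] by (intro nn_integral_mono main) auto
  also have "... = (\<integral>\<^sup>+n. ennreal (B powr q) * (\<Sum>E\<in>\<E>. \<Phi> E n) \<partial>(leb H))"
   using ms by (subst lborel.nn_integral_fst[symmetric]) auto
  also have "... = ennreal (B powr q) * (\<Sum>E\<in>\<E>. \<integral>\<^sup>+n. \<Phi> E n \<partial>(leb H))"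
   using ms \<Phi>(1) by (simp add: nn_integral_cmult nn_integral_sum)
  also have "... \<le> ennreal (B powr q) * (\<Sum>E\<in>\<E>. ennreal (C E * ?I))"
   by (intro mult_left_mono sum_mono \<Phi>(2)) auto
  also have "... = ennreal (B powr q * (\<Sum>E\<in>\<E>. C E) * ?I)"
   using C(1) by (subst sum_ennreal) (auto simp: ennreal_mult'[symmetric] sum_distrib_right[symmetric] mult.assoc)
  finally show "convolution_energy H \<sigma> \<psi> q f
   \<le> ennreal (B powr q * (\<Sum>E\<in>\<E>. C E) * ?I)" .
 qed
qed

theorem theorem3:
  fixes n k :: nat
    and S :: "(real^'n::finite) set"
    and \<sigma> :: "(real^'n) measure"
    and \<psi> :: "real^'n \<Rightarrow> complex"
    and \<mu> :: "'n cmeasure"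
    and H :: "(real^'n^'n) measure"
  assumes "n = CARD('n)" and "k = CARD('k::finite)"
    and "n \<ge> 2" and "1 \<le> k" and "k \<le> n - 1"
    and "smooth_surface TYPE('k) S"
    and "induced_surface_measure TYPE('k) S \<sigma>"
    and "smooth_density TYPE('k) S \<psi>"
    and "\<mu> = weighted_measure \<sigma> \<psi>"
    and "haar_SO H"
  shows "\<exists>c::real. \<forall>f :: real^'n \<Rightarrow> complex.
    f \<in> borel_measurable borel \<and>
    integrable lborel (\<lambda>y. norm (f y) powr ((2 * real n - real k) / real n)) \<longrightarrow>
    (\<integral>\<^sup>+\<theta>. (\<integral>\<^sup>+x. ennreal (norm (convolve f (rotated_measure \<theta> \<mu>) x)
        powr ((2 * real n - real k) / (real n - real k))) \<partial>lborel) \<partial>H) < \<infinity> \<and>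
    enn2real (\<integral>\<^sup>+\<theta>. (\<integral>\<^sup>+x. ennreal (norm (convolve f (rotated_measure \<theta> \<mu>) x)
        powr ((2 * real n - real k) / (real n - real k))) \<partial>lborel) \<partial>H)
      powr ((real n - real k) / (2 * real n - real k))
    \<le> c * (LINT y|lborel. norm (f y) powr ((2 * real n - real k) / real n))
      powr (real n / (2 * real n - real k))"
proof -
 define p where "p = (2 * real n - real k) / real n"
 define q where "q = (2 * real n - real k) / (real n - real k)"
 have kn: "real k < real n" using assms(3,5) by simp
 have q0: "q > 0" and p0: "p > 0" using kn by (simp_all add: q_def p_def)
 have iq: "(real n - real k) / (2 * real n - real k) = 1 / q" "real n / (2 * real n - real k) = 1 / p" using kn by (simp_all add: q_def p_def)
 obtain \<E> where \<E>: "finite \<E>" "\<And>E. E \<in> \<E> ==> E \<in> sets borel \<and> bounded (\<psi> ` E) \<and> (\<exists>C\<ge>0. rotation_bound H \<sigma> p q E C)"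
  "\<And>y. \<psi> y \<noteq> 0 ==> y \<in> \<Union>\<E>"
 proof (rule finite_cover_pieces[OF assms(6-8,10)])
  show "CARD('n) \<ge> 2" "CARD('k) < CARD('n)" using assms(1-5) by auto
  show "p = (2 * real CARD('n) - real CARD('k)) / real CARD('n)"
   "q = (2 * real CARD('n) - real CARD('k)) / (real CARD('n) - real CARD('k))" using assms(1,2) by (simp_all add: p_def q_def)
 qed (rule that)
 have sets: "sets \<sigma> = sets borel" using assms(7) by (simp add: induced_surface_measure_def)
 obtain C where C: "C \<ge> 0" "\<And>f :: real^'n => complex. f \<in> borel_measurable borel ==> integrable lborel (%y. norm (f y) powr p) ==>
  convolution_energy H \<sigma> \<psi> q f
   \<le> ennreal (C * (LBINT y. norm (f y) powr p) powr (q / p))"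
  by (rule convolution_bound[OF assms(10) sets q0 \<E>(1)], erule \<E>(2), erule \<E>(3), rule that)
 show ?thesis
  unfolding iq assms(9) p_def[symmetric] q_def[symmetric]
 proof (intro exI[of _ "C powr (1 / q)"] allI impI)
  fix f :: "real^'n => complex"
  assume "f \<in> borel_measurable borel \<and> integrable lborel (%y. norm (f y) powr p)"
  then have le: "convolution_energy H \<sigma> \<psi> q f
   \<le> ennreal (C * (LBINT y. norm (f y) powr p) powr (q / p))" (is "?N \<le> ennreal (C * ?I powr _)") using C(2) by blast
  have "?N < \<infinity>" using le by (rule le_less_trans) simp
  moreover have "enn2real ?N powr (1 / q) \<le> (C * ?I powr (q / p)) powr (1 / q)"
   using le C(1) q0 by (intro powr_mono2 enn2real_leI) auto
  moreover have "(C * ?I powr (q / p)) powr (1 / q) = C powr (1 / q) * ?I powr (1 / p)"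
   using C(1) q0 by (simp add: powr_mult powr_powr)
  ultimately show "?N < \<infinity> \<and> enn2real ?N powr (1 / q) \<le> C powr (1 / q) * ?I powr (1 / p)" by simp
 qed
qed

end
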